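(* Let $n\ge2$, let $\Omega\subset\mathbb{R}^n$ be a bounded Lipschitz domain and $\frac12<s<1$. Then the operator $$S_s:H^{-s+\frac12}(\partial\Omega)\to H^{s-\frac12}(\partial\Omega),\qquad S_s\phi=(\mathcal{S}_s\phi)|_{\partial\Omega},$$ is a bounded operator, where $(\mathcal{S}_s\phi)|_{\partial\Omega}$ is the restriction of $\mathcal{S}_s\phi$ to $\partial\Omega$.
   Context: $\partial\Omega$ carries surface measure $dQ$. $\Gamma_{2s}(x)=c(n,s)|x|^{-(n-2s)}$ is the Riesz kernel of order $2s$, with $c(n,s)>0$ chosen so that its Fourier transform is $|\xi|^{-2s}$. For $0<\alpha<1$, $H^\alpha(\partial\Omega)$ is the space of $\phi\in L^2(\partial\Omega)$ with $\int_{\partial\Omega}\int_{\partial\Omega}\frac{|\phi(P)-\phi(Q)|^2}{|P-Q|^{n-1+2\alpha}}dPdQ<\infty$, and $H^{-\alpha}(\partial\Omega)=(H^\alpha(\partial\Omega))^*$ with pairing $\langle\cdot,\cdot\rangle$. $\mathcal{S}_s\phi(x)=\langle\phi,\Gamma_{2s}(x-\cdot)\rangle$ for $x\in\mathbb{R}^n\setminus\partial\Omega$. The restriction to $\partial\Omega$ is understood in the trace sense: $\mathcal{S}_s\phi$ lies in $H^s$ of a ball containing $\overline\Omega$, and the trace operator maps $H^{\sigma+\frac12}$ of a bounded Lipschitz neighborhood of $\partial\Omega$ into $H^\sigma(\partial\Omega)$ for $0<\sigma<1$. *)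

theory Defs
  imports "HOL-Analysis.Analysis"
begin

definition lipschitz_domain :: "'a::euclidean_space set \<Rightarrow> bool" where
  "lipschitz_domain \<Omega> \<longleftrightarrow> open \<Omega> \<and> connected \<Omega> \<and> bounded \<Omega> \<and> \<Omega> \<noteq> {} \<and>
     (\<forall>p \<in> frontier \<Omega>. \<exists>r>0. \<exists>(e::'a) (h::'a \<Rightarrow> real) L.
        norm e = 1 \<and> L-lipschitz_on {y. y \<bullet> e = 0} h \<and>
        (\<forall>x \<in> ball p r. x \<in> \<Omega> \<longleftrightarrow> x \<bullet> e > h (x - (x \<bullet> e) *\<^sub>R e)))"

definition hausdorff_content :: "real \<Rightarrow> real \<Rightarrow> 'a::euclidean_space set \<Rightarrow> ennreal" where
  "hausdorff_content d \<delta> A =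
     (INF C \<in> {C :: nat \<Rightarrow> 'a set. A \<subseteq> (\<Union>i. C i) \<and> (\<forall>i. bounded (C i) \<and> diameter (C i) < \<delta>)}.
        (\<Sum>i. ennreal (unit_ball_vol d / 2 powr d * diameter (C i) powr d)))"

definition hausdorff_outer :: "real \<Rightarrow> 'a::euclidean_space set \<Rightarrow> ennreal" where
  "hausdorff_outer d A = (SUP \<delta> \<in> {0<..}. hausdorff_content d \<delta> A)"

definition surface_measure :: "'a::euclidean_space set \<Rightarrow> 'a measure" where
  "surface_measure \<Omega> = measure_of (frontier \<Omega>) (sets (restrict_space lborel (frontier \<Omega>)))
      (hausdorff_outer (real DIM('a) - 1))"

definition bdry_L2sq :: "'a::euclidean_space set \<Rightarrow> ('a \<Rightarrow> real) \<Rightarrow> ennreal" where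
  "bdry_L2sq \<Omega> f = (\<integral>\<^sup>+ P. ennreal ((f P)\<^sup>2) \<partial>surface_measure \<Omega>)"

definition bdry_semi :: "'a::euclidean_space set \<Rightarrow> real \<Rightarrow> ('a \<Rightarrow> real) \<Rightarrow> ennreal" where
  "bdry_semi \<Omega> \<alpha> f = (\<integral>\<^sup>+ P. \<integral>\<^sup>+ Q. ennreal ((f P - f Q)\<^sup>2 /
        dist P Q powr (real DIM('a) - 1 + 2 * \<alpha>)) \<partial>surface_measure \<Omega> \<partial>surface_measure \<Omega>)"

definition bdry_H :: "'a::euclidean_space set \<Rightarrow> real \<Rightarrow> ('a \<Rightarrow> real) set" where
  "bdry_H \<Omega> \<alpha> = {f. f \<in> borel_measurable (surface_measure \<Omega>) \<and>
        bdry_L2sq \<Omega> f < \<infinity> \<and> bdry_semi \<Omega> \<alpha> f < \<infinity>}"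

definition bdry_H_norm :: "'a::euclidean_space set \<Rightarrow> real \<Rightarrow> ('a \<Rightarrow> real) \<Rightarrow> real" where
  "bdry_H_norm \<Omega> \<alpha> f = sqrt (enn2real (bdry_L2sq \<Omega> f) + enn2real (bdry_semi \<Omega> \<alpha> f))"

definition bdry_Hneg :: "'a::euclidean_space set \<Rightarrow> real \<Rightarrow> (('a \<Rightarrow> real) \<Rightarrow> real) set" where
  "bdry_Hneg \<Omega> \<alpha> = {T. (\<forall>f \<in> bdry_H \<Omega> \<alpha>. \<forall>g \<in> bdry_H \<Omega> \<alpha>. \<forall>a b.
          T (\<lambda>x. a * f x + b * g x) = a * T f + b * T g) \<and>
        (\<exists>C. \<forall>f \<in> bdry_H \<Omega> \<alpha>. \<bar>T f\<bar> \<le> C * bdry_H_norm \<Omega> \<alpha> f)}"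

definition bdry_Hneg_norm :: "'a::euclidean_space set \<Rightarrow> real \<Rightarrow> (('a \<Rightarrow> real) \<Rightarrow> real) \<Rightarrow> real" where
  "bdry_Hneg_norm \<Omega> \<alpha> T = Inf {C. 0 \<le> C \<and> (\<forall>f \<in> bdry_H \<Omega> \<alpha>. \<bar>T f\<bar> \<le> C * bdry_H_norm \<Omega> \<alpha> f)}"

text \<open>c(n,s) with Fourier convention hat f(xi) = integral f(x) e^{-i x.xi} dx, so that the
  Fourier transform of the kernel is |xi|^{-2s}.\<close>
definition riesz_const :: "nat \<Rightarrow> real \<Rightarrow> real" where
  "riesz_const n s = Gamma ((real n - 2 * s) / 2) / (2 powr (2 * s) * pi powr (real n / 2) * Gamma s)"

definition riesz_kernel :: "real \<Rightarrow> 'a::euclidean_space \<Rightarrow> real" where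
  "riesz_kernel s x = riesz_const DIM('a) s * norm x powr (- (real DIM('a) - 2 * s))"

text \<open>S_s phi (x) = < phi, Gamma_{2s}(x - .) > (meaningful for x off the boundary).\<close>
definition single_layer :: "real \<Rightarrow> (('a::euclidean_space \<Rightarrow> real) \<Rightarrow> real) \<Rightarrow> 'a \<Rightarrow> real" where
  "single_layer s T x = T (\<lambda>Q. riesz_kernel s (x - Q))"

definition dom_L2sq :: "'a::euclidean_space set \<Rightarrow> ('a \<Rightarrow> real) \<Rightarrow> ennreal" where
  "dom_L2sq U u = (\<integral>\<^sup>+ x \<in> U. ennreal ((u x)\<^sup>2) \<partial>lebesgue)"

definition dom_semi :: "'a::euclidean_space set \<Rightarrow> real \<Rightarrow> ('a \<Rightarrow> real) \<Rightarrow> ennreal" where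
  "dom_semi U \<sigma> u = (\<integral>\<^sup>+ x \<in> U. \<integral>\<^sup>+ y \<in> U. ennreal ((u x - u y)\<^sup>2 /
        dist x y powr (real DIM('a) + 2 * \<sigma>)) \<partial>lebesgue \<partial>lebesgue)"

definition dom_H :: "'a::euclidean_space set \<Rightarrow> real \<Rightarrow> ('a \<Rightarrow> real) set" where
  "dom_H U \<sigma> = {u. u \<in> borel_measurable (restrict_space lebesgue U) \<and>
        dom_L2sq U u < \<infinity> \<and> dom_semi U \<sigma> u < \<infinity>}"

definition dom_H_norm :: "'a::euclidean_space set \<Rightarrow> real \<Rightarrow> ('a \<Rightarrow> real) \<Rightarrow> real" where
  "dom_H_norm U \<sigma> u = sqrt (enn2real (dom_L2sq U u) + enn2real (dom_semi U \<sigma> u))"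

text \<open>g is the trace on the boundary of Omega of u in H^sigma(U): g is the L^2(boundary) limit of
  the restrictions of continuous functions u_k on U converging to u in H^sigma(U)
  (i.e. the continuous extension of the restriction map).\<close>
definition is_trace_on :: "'a::euclidean_space set \<Rightarrow> 'a set \<Rightarrow> real \<Rightarrow> ('a \<Rightarrow> real) \<Rightarrow> ('a \<Rightarrow> real) \<Rightarrow> bool" where
  "is_trace_on \<Omega> U \<sigma> u g \<longleftrightarrow> g \<in> borel_measurable (surface_measure \<Omega>) \<and>
     (\<exists>v :: nat \<Rightarrow> 'a \<Rightarrow> real. (\<forall>k. continuous_on U (v k) \<and> (\<lambda>x. v k x - u x) \<in> dom_H U \<sigma>) \<and>
        (\<lambda>k. dom_H_norm U \<sigma> (\<lambda>x. v k x - u x)) \<longlonglongrightarrow> 0 \<and>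
        (\<lambda>k. \<integral>\<^sup>+ P. ennreal ((v k P - g P)\<^sup>2) \<partial>surface_measure \<Omega>) \<longlonglongrightarrow> 0)"

definition is_bdry_trace :: "'a::euclidean_space set \<Rightarrow> real \<Rightarrow> ('a \<Rightarrow> real) \<Rightarrow> ('a \<Rightarrow> real) \<Rightarrow> bool" where
  "is_bdry_trace \<Omega> \<sigma> u g \<longleftrightarrow> (\<exists>c r. closure \<Omega> \<subseteq> ball c r \<and> is_trace_on \<Omega> (ball c r) \<sigma> u g)"

end

theory Submission
  imports Defs
begin

text \<open>The functional \<open>T\<close> is represented, in the Hilbert space \<open>H\<^sup>s\<^sup>-\<^sup>1\<^sup>/\<^sup>2\<close> of the boundary, by some
  \<open>\<tau>\<close>; the potential at \<open>x\<close> is then the inner product of \<open>\<tau>\<close> with the kernel \<open>|x - P|\<close> to the power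
  \<open>-p\<close>, where \<open>p = n - 2s\<close>. Differences of the potential pair \<open>\<tau>\<close> with first and second differences
  of the kernel, and Schur's test with power weights, which only needs that the surface measure of a ball
  of radius \<open>r\<close> is at most a multiple of \<open>r\<close> to the power \<open>n - 1\<close>, bounds the \<open>H\<^sup>s\<close> norm of the potential
  by the norm of \<open>T\<close>. Evaluating the kernel at a small height above the space in one more dimension gives
  continuous functions obeying the same bounds, so they approximate the potential in \<open>H\<^sup>s\<close> by dominated
  convergence.

  The traces are controlled from inside \<open>\<Omega>\<close> alone. For a function continuous on the closure of \<open>\<Omega>\<close>, the
  value at a boundary point is the limit of its means over corkscrew regions at dyadic scales; telescoping
  these means and comparing them at neighbouring boundary points bounds the boundary norm by the \<open>H\<^sup>s(\<Omega>)\<close>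
  norm. Hence the approximations converge on the boundary, and by Fatou's lemma every trace obeys the
  bound, with a constant independent of the ball in which the trace is taken.\<close>

text \<open>\<open>T\<close> is known only through its norm: there is no density to integrate, so a
  representer \<open>\<tau>\<close> has to be found before any kernel estimate can start. Its
  pairing with the kernel has a value part and a difference-quotient part. In the second part a
  difference of potentials is measured in two increments at once, one in space and one along the
  boundary; this is what forces second differences and the product of the two minima in
  \<open>kap2\<close>. First differences in space suffice because s < 1, which makes t^(-n-s) min(1,
  t/r) integrable at t = 0. The condition s > 1/2 enters as 2s - 1 > 0, in two ways: it makes |x -
  P|^(2s-n) integrable over a boundary of dimension n - 1, and it makes the increments of means over
  consecutive corkscrew regions decay geometrically.

  The potential is given only off the boundary, while a trace is a limit of restrictions of
  continuous functions. The approximants must therefore be continuous across the boundary and obey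
  bounds that do not degenerate. Raising the evaluation point does both, since it only increases
  distances to the singularities. As \<open>is_bdry_trace\<close> is a relation, existence of a
  trace and the bound for each trace are separate tasks.\<close>

section \<open>Differences of the Riesz kernel\<close>

text \<open>Sizes of the first and second differences of \<open>|z|\<close> to the power \<open>-p\<close> at distance \<open>r\<close> from the
  singularity, under displacements of lengths \<open>t\<close> and \<open>h\<close>. Both vanish at \<open>r = 0\<close>, since
  \<open>0 powr a = 0\<close>.\<close>
definition kap1 :: "real \<Rightarrow> real \<Rightarrow> real \<Rightarrow> real" where
  "kap1 p t r = r powr -p * min 1 (t / r)"

definition kap2 :: "real \<Rightarrow> real \<Rightarrow> real \<Rightarrow> real \<Rightarrow> real" where
  "kap2 p t h r = r powr -p * min 1 (t / r) * min 1 (h / r)"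

lemma min_1_divide_antimono:
  fixes t r r' :: real
  assumes "0 < r" "r \<le> r'" "0 \<le> t"
  shows "min 1 (t / r') \<le> min 1 (t / r)"
  using divide_left_mono[of r r' t] assms by (simp add: min_def)

lemma kap1_nonneg: "0 \<le> t \<Longrightarrow> 0 \<le> r \<Longrightarrow> 0 \<le> kap1 p t r"
  by (simp add: kap1_def)

lemma kap2_nonneg: "0 \<le> t \<Longrightarrow> 0 \<le> h \<Longrightarrow> 0 \<le> r \<Longrightarrow> 0 \<le> kap2 p t h r"
  by (simp add: kap2_def)

text \<open>This and \<open>kap2_antimono\<close> serve later to discard the height: a raised point
  is farther from the boundary, so its bounds are dominated by those at height 0. Strict positivity
  of the smaller radius matters, since at radius 0 the value collapses to 0.\<close>

lemma kap1_antimono: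
  assumes "0 < r" "r \<le> r'" "0 \<le> t" "0 \<le> p"
  shows "kap1 p t r' \<le> kap1 p t r"
proof -
  have "r' powr -p \<le> r powr -p"
    using assms by (intro powr_mono2') auto
  moreover have "min 1 (t / r') \<le> min 1 (t / r)"
    using assms by (intro min_1_divide_antimono) auto
  ultimately show ?thesis
    unfolding kap1_def using assms by (intro mult_mono) auto
qed

lemma kap2_antimono:
  assumes "0 < r" "r \<le> r'" "0 \<le> t" "0 \<le> h" "0 \<le> p"
  shows "kap2 p t h r' \<le> kap2 p t h r"
proof -
  have "min 1 (h / r') \<le> min 1 (h / r)"
    using assms by (intro min_1_divide_antimono) auto
  with kap1_antimono[of r r' t p] kap1_nonneg[of t r p] show ?thesis
    unfolding kap2_def kap1_def[symmetric] using assms by (intro mult_mono) auto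
qed

lemma powr_neg_diff_le:
  fixes a b p :: real
  assumes "0 < a" "a \<le> b" "0 < p"
  shows "a powr -p - b powr -p \<le> p * a powr (-p-1) * (b - a)"
proof (cases "a = b")
  case False
  with assms have ab: "a < b" by simp
  have "\<exists>z>a. z < b \<and> b powr -p - a powr -p = (b - a) * (-p * z powr (-p-1))"
    using assms ab
    by (intro MVT2) (auto intro!: derivative_eq_intros simp: powr_diff)
  then obtain z where z: "a < z" "z < b" "b powr -p - a powr -p = (b - a) * (-p * z powr (-p-1))"
    by blast
  have "z powr (-p-1) \<le> a powr (-p-1)"
    using assms z by (intro powr_mono2') auto
  then have "(b - a) * (p * z powr (-p-1)) \<le> (b - a) * (p * a powr (-p-1))"
    using assms ab by (intro mult_left_mono) auto
  then show ?thesis using z(3) by (simp add: algebra_simps)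
qed simp

lemma kernel_diff1_aux:
  fixes a b :: "'b::real_normed_vector"
  assumes "a \<noteq> 0" "b \<noteq> 0" "0 < p" "norm a \<le> norm b"
  shows "\<bar>norm a powr -p - norm b powr -p\<bar> \<le> (1 + p) * kap1 p (norm (a - b)) (norm a)"
proof -
  have le: "norm b powr -p \<le> norm a powr -p"
    using assms by (intro powr_mono2') auto
  have "norm a powr -p - norm b powr -p \<le> p * norm a powr (-p-1) * (norm b - norm a)"
    using assms by (intro powr_neg_diff_le) auto
  also have "\<dots> \<le> p * norm a powr (-p-1) * norm (a - b)"
    using assms norm_triangle_ineq2[of b a]
    by (intro mult_left_mono) (auto simp: norm_minus_commute)
  also have "\<dots> = p * (norm a powr -p * (norm (a - b) / norm a))"
    using assms by (simp add: powr_diff)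
  also have "\<dots> \<le> (1 + p) * (norm a powr -p * (norm (a - b) / norm a))"
    using assms by (intro mult_right_mono) auto
  finally have 1: "norm a powr -p - norm b powr -p \<le> (1 + p) * (norm a powr -p * (norm (a - b) / norm a))" .
  have "norm a powr -p - norm b powr -p \<le> 1 * (norm a powr -p * 1)"
    by simp
  also have "\<dots> \<le> (1 + p) * (norm a powr -p * 1)"
    using assms by (intro mult_right_mono) auto
  finally show ?thesis
    using 1 le unfolding kap1_def min_def by auto
qed

text \<open>The natural bound sits at the nearer of the two points. Adding the term of the other
  point makes the estimate symmetric, so no integral has to be split according to which point is
  nearer, and each summand becomes a kernel of its own in Schur's test.\<close>

lemma kernel_diff1:
  fixes a b :: "'b::real_normed_vector"
  assumes "a \<noteq> 0" "b \<noteq> 0" "0 < p"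
  shows "\<bar>norm a powr -p - norm b powr -p\<bar>
      \<le> (1 + p) * (kap1 p (norm (a - b)) (norm a) + kap1 p (norm (a - b)) (norm b))"
proof (cases "norm a \<le> norm b")
  case True
  have "(1 + p) * kap1 p (norm (a - b)) (norm b) \<ge> 0"
    using assms kap1_nonneg[of "norm (a-b)" "norm b" p] by simp
  with kernel_diff1_aux[OF assms True] show ?thesis by (simp add: algebra_simps)
next
  case False
  have "(1 + p) * kap1 p (norm (a - b)) (norm a) \<ge> 0"
    using assms kap1_nonneg[of "norm (a-b)" "norm a" p] by simp
  with kernel_diff1_aux[of b a p] assms False show ?thesis
    by (simp add: algebra_simps norm_minus_commute)
qed

lemma norm_powr_line_derivative:
  fixes a k :: "'b::real_inner"
  assumes "a + x *\<^sub>R k \<noteq> 0"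
  shows "((\<lambda>x. norm (a + x *\<^sub>R k) powr -p) has_real_derivative
    - p * norm (a + x *\<^sub>R k) powr (-p-2) * ((a + x *\<^sub>R k) \<bullet> k)) (at x)"
proof -
  have pos: "0 < (a + x *\<^sub>R k) \<bullet> (a + x *\<^sub>R k)"
    using assms by simp
  have eq: "norm z powr q = (z \<bullet> z) powr (q/2)" for z :: 'b and q
    by (simp add: norm_eq_sqrt_inner powr_half_sqrt[symmetric] powr_powr)
  have inner_d: "((\<lambda>x. (a + x *\<^sub>R k) \<bullet> (a + x *\<^sub>R k)) has_real_derivative 2 * ((a + x *\<^sub>R k) \<bullet> k)) (at x)"
  proof -
    have "(\<lambda>x. (a + x *\<^sub>R k) \<bullet> (a + x *\<^sub>R k)) = (\<lambda>x. a \<bullet> a + 2 * x * (a \<bullet> k) + x\<^sup>2 * (k \<bullet> k))"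
      by (auto simp: inner_add_left inner_add_right inner_commute power2_eq_square)
    moreover have "((\<lambda>x. a \<bullet> a + 2 * x * (a \<bullet> k) + x\<^sup>2 * (k \<bullet> k)) has_real_derivative 2 * (a \<bullet> k) + 2 * x * (k \<bullet> k)) (at x)"
      by (auto intro!: derivative_eq_intros)
    ultimately show ?thesis by (simp add: inner_add_left algebra_simps)
  qed
  have "((\<lambda>x. ((a + x *\<^sub>R k) \<bullet> (a + x *\<^sub>R k)) powr (-p/2)) has_real_derivative
     (-p/2) * ((a + x *\<^sub>R k) \<bullet> (a + x *\<^sub>R k)) powr (-p/2 - 1) * (2 * ((a + x *\<^sub>R k) \<bullet> k))) (at x)"
    using DERIV_fun_powr[OF inner_d pos, of "-p/2"] by simp
  moreover have e: "-p/2 - 1 = (-p-2)/2" by (simp add: field_simps)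
  ultimately show ?thesis unfolding eq e by (simp add: mult_ac)
qed

text \<open>The mean value theorem along \<open>k\<close>, applied to the difference of the kernel
  at two points that are \<open>l\<close> apart, reduces the second difference to a difference of
  gradients at b and b + l. With both displacements at most a quarter of |a|, every point met on the
  way stays at distance at least |a|/2 from the singularity.\<close>

lemma kernel_diff2_far:
  fixes a k l :: "'b::real_inner"
  assumes "a \<noteq> 0" "0 < p" "norm k \<le> norm a / 4" "norm l \<le> norm a / 4"
  shows "\<bar>norm a powr -p - norm (a + k) powr -p - norm (a + l) powr -p + norm (a + k + l) powr -p\<bar>
    \<le> p * (3 * p + 7) * 2 powr (p + 2) * kap2 p (norm k) (norm l) (norm a)"
proof -
  define F where "F x = norm (a + x *\<^sub>R k) powr -p - norm (a + l + x *\<^sub>R k) powr -p" for x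
  define F' where "F' x = - p * norm (a + x *\<^sub>R k) powr (-p-2) * ((a + x *\<^sub>R k) \<bullet> k)
      - (- p * norm (a + l + x *\<^sub>R k) powr (-p-2) * ((a + l + x *\<^sub>R k) \<bullet> k))" for x
  have big: "norm (a + x *\<^sub>R k) \<ge> norm a / 2" "norm (a + l + x *\<^sub>R k) \<ge> norm a / 2" if "0 \<le> x" "x \<le> 1" for x
  proof -
    have 1: "norm (x *\<^sub>R k) \<le> norm a / 4"
      using that assms(3) mult_left_le_one_le[of "norm k" x] by auto
    have "norm a \<le> norm (a + x *\<^sub>R k) + norm (x *\<^sub>R k)"
      using norm_triangle_ineq4[of "a + x *\<^sub>R k" "x *\<^sub>R k"] by simp
    then show "norm (a + x *\<^sub>R k) \<ge> norm a / 2" using 1 norm_ge_zero[of a] by linarith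
    have "norm a \<le> norm (a + l + x *\<^sub>R k) + norm (l + x *\<^sub>R k)"
      using norm_triangle_ineq4[of "a + l + x *\<^sub>R k" "l + x *\<^sub>R k"] by (simp add: algebra_simps)
    moreover have "norm (l + x *\<^sub>R k) \<le> norm l + norm (x *\<^sub>R k)" by (rule norm_triangle_ineq)
    ultimately show "norm (a + l + x *\<^sub>R k) \<ge> norm a / 2" using 1 assms(4) norm_ge_zero[of a] by linarith
  qed
  have "\<exists>z>0. z < 1 \<and> F 1 - F 0 = (1 - 0) * F' z"
  proof (rule MVT2)
    fix x :: real assume x: "0 \<le> x" "x \<le> 1"
    have "a + x *\<^sub>R k \<noteq> 0" "a + l + x *\<^sub>R k \<noteq> 0" using big[OF x] assms(1) by auto
    then show "(F has_real_derivative F' x) (at x)"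
      unfolding F_def F'_def by (intro DERIV_diff norm_powr_line_derivative)
  qed simp
  then obtain z where z: "0 < z" "z < 1" "F 1 - F 0 = F' z" by auto
  define b where "b = a + z *\<^sub>R k"
  have b: "norm b \<ge> norm a / 2" "norm (b + l) \<ge> norm a / 2"
    using big[of z] z by (auto simp: b_def algebra_simps)
  define r where "r = norm a / 2"
  have r: "r > 0" using assms by (simp add: r_def)
  have bn: "b \<noteq> 0" "b + l \<noteq> 0" using b r by (auto simp: r_def)
  \<comment> \<open>The gradient of |z|^(-p) is -p |z|^(-q) z. Its increment from b to b + l splits
    into a change of the scalar factor, with b kept, and the term |b + l|^(-q) l. The two bounds are
    \<open>e1\<close> and \<open>e2\<close>; together they give 3q + 1 = 3p + 7.\<close>
  define q where "q = p + 2"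
  have F'z: "F' z = - p * ((norm b powr -q - norm (b+l) powr -q) * (b \<bullet> k) - norm (b+l) powr -q * (l \<bullet> k))"
    unfolding F'_def b_def q_def by (simp add: algebra_simps inner_add_left)
  have bup: "norm b \<le> 3 * r"
  proof -
    have "norm (z *\<^sub>R k) \<le> norm k" using z mult_left_le_one_le[of "norm k" z] by auto
    then show ?thesis using assms(3) norm_triangle_ineq[of a "z *\<^sub>R k"] norm_ge_zero[of a]
      unfolding b_def r_def by linarith
  qed
  \<comment> \<open>The mean value bound puts the power q + 1 on the shorter of the two vectors. If
    that is b, the extra factor |b| cancels one power directly; otherwise the upper bound |b| <= 3r
    is what absorbs it.\<close>
  have d1: "\<bar>norm b powr -q - norm (b+l) powr -q\<bar> * norm b \<le> 3 * (q * norm l * r powr -q)"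
  proof (cases "norm b \<le> norm (b+l)")
    case True
    have "norm b powr -q - norm (b+l) powr -q \<le> q * norm b powr (-q-1) * (norm (b+l) - norm b)"
      using bn True assms by (intro powr_neg_diff_le) (auto simp: q_def)
    also have "\<dots> \<le> q * norm b powr (-q-1) * norm l"
      using norm_triangle_ineq[of b l] assms by (intro mult_left_mono) (auto simp: q_def)
    finally have "(norm b powr -q - norm (b+l) powr -q) * norm b \<le> q * norm b powr (-q-1) * norm l * norm b"
      by (intro mult_right_mono) auto
    also have "\<dots> = q * norm l * norm b powr -q" using bn by (simp add: powr_diff)
    also have "\<dots> \<le> q * norm l * r powr -q"
      using b r assms by (intro mult_left_mono powr_mono2') (auto simp: q_def r_def)
    finally have 1: "(norm b powr -q - norm (b+l) powr -q) * norm b \<le> q * norm l * r powr -q" .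
    have 2: "norm (b+l) powr -q \<le> norm b powr -q"
      using True bn assms by (intro powr_mono2') (auto simp: q_def)
    have "0 \<le> q * norm l * r powr -q" using assms by (simp add: q_def)
    with 1 2 show ?thesis by simp
  next
    case False
    have "norm (b+l) powr -q - norm b powr -q \<le> q * norm (b+l) powr (-q-1) * (norm b - norm (b+l))"
      using bn False assms by (intro powr_neg_diff_le) (auto simp: q_def)
    also have "\<dots> \<le> q * norm (b+l) powr (-q-1) * norm l"
      using norm_triangle_ineq4[of "b+l" l] assms by (intro mult_left_mono) (auto simp: q_def)
    also have "\<dots> \<le> q * r powr (-q-1) * norm l"
      using b r assms by (intro mult_left_mono mult_right_mono powr_mono2') (auto simp: q_def r_def)
    finally have 1: "norm (b+l) powr -q - norm b powr -q \<le> q * r powr (-q-1) * norm l" .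
    have "(norm (b+l) powr -q - norm b powr -q) * norm b \<le> q * r powr (-q-1) * norm l * (3 * r)"
      using 1 bup r assms by (intro mult_mono) (auto simp: q_def)
    also have "\<dots> = 3 * (q * norm l * r powr -q)" using r by (simp add: powr_diff)
    finally have 2: "(norm (b+l) powr -q - norm b powr -q) * norm b \<le> 3 * (q * norm l * r powr -q)" .
    have 3: "norm b powr -q \<le> norm (b+l) powr -q"
      using False bn assms by (intro powr_mono2') (auto simp: q_def)
    have "0 \<le> q * norm l * r powr -q" using assms by (simp add: q_def)
    with 2 3 show ?thesis by (simp add: abs_if mult_ac)
  qed
  have e1: "\<bar>(norm b powr -q - norm (b+l) powr -q) * (b \<bullet> k)\<bar> \<le> 3 * (q * norm l * r powr -q) * norm k"
  proof -
    have "\<bar>(norm b powr -q - norm (b+l) powr -q) * (b \<bullet> k)\<bar>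
        \<le> \<bar>norm b powr -q - norm (b+l) powr -q\<bar> * (norm b * norm k)"
      unfolding abs_mult by (intro mult_left_mono Cauchy_Schwarz_ineq2) auto
    also have "\<dots> \<le> 3 * (q * norm l * r powr -q) * norm k"
      using mult_right_mono[OF d1, of "norm k"] by (simp add: mult_ac)
    finally show ?thesis .
  qed
  have e2: "\<bar>norm (b+l) powr -q * (l \<bullet> k)\<bar> \<le> r powr -q * (norm l * norm k)"
    unfolding abs_mult using b r assms
    by (intro mult_mono Cauchy_Schwarz_ineq2) (auto intro!: powr_mono2' simp: q_def r_def)
  have "\<bar>F' z\<bar> \<le> p * (3 * (q * norm l * r powr -q) * norm k + r powr -q * (norm l * norm k))"
    unfolding F'z abs_mult using e1 e2 assms by (intro mult_mono) auto
  also have "\<dots> = p * (3 * p + 7) * (r powr -q * norm l * norm k)"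
    by (simp add: q_def algebra_simps)
  also have "r powr -q = 2 powr q * norm a powr -q"
    using assms by (simp add: r_def powr_divide powr_minus field_simps)
  also have "norm a powr -q = norm a powr -p / (norm a * norm a)"
    using assms by (simp add: q_def powr_diff power2_eq_square)
  also have "p * (3 * p + 7) * (2 powr q * (norm a powr -p / (norm a * norm a)) * norm l * norm k)
     = p * (3 * p + 7) * 2 powr (p + 2) * kap2 p (norm k) (norm l) (norm a)"
  proof -
    have "norm k / norm a \<le> 1" "norm l / norm a \<le> 1"
    proof -
      have "norm k \<le> norm a" "norm l \<le> norm a"
        using assms(3,4) norm_ge_zero[of a] by linarith+
      then show "norm k / norm a \<le> 1" "norm l / norm a \<le> 1" using assms(1) by simp_all
    qed
    then show ?thesis unfolding kap2_def q_def by (simp add: min_def)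
  qed
  finally have "\<bar>F 1 - F 0\<bar> \<le> p * (3 * p + 7) * 2 powr (p + 2) * kap2 p (norm k) (norm l) (norm a)"
    using z by simp
  moreover have "\<bar>F 1 - F 0\<bar> = \<bar>norm a powr -p - norm (a + k) powr -p - norm (a + l) powr -p + norm (a + k + l) powr -p\<bar>"
    by (simp add: F_def algebra_simps)
  ultimately show ?thesis by simp
qed

text \<open>When the radius is at most six times a displacement, the minimum belonging to that
  displacement is at least 1/6, so inserting it costs only a constant. Six is the bound for the four
  corner distances in \<open>kernel_diff2_near\<close>: 4 from a, and 1 from each
  displacement.\<close>

lemma kap1_le_kap2:
  assumes "0 \<le> t" "0 < r" "r \<le> 6 * h"
  shows "kap1 p t r \<le> 6 * kap2 p t h r" "kap1 p t r \<le> 6 * kap2 p h t r"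
proof -
  have "1 / 6 \<le> min 1 (h / r)" using assms by (auto simp: divide_simps)
  then have "kap1 p t r * (1/6) \<le> kap1 p t r * min 1 (h / r)"
    using assms kap1_nonneg[of t r p] by (intro mult_left_mono) auto
  then show "kap1 p t r \<le> 6 * kap2 p t h r" "kap1 p t r \<le> 6 * kap2 p h t r"
    by (auto simp: kap1_def kap2_def mult_ac)
qed

text \<open>The longer displacement \<open>l\<close> is comparable to or exceeds all four distances,
  so nothing is to be gained from cancellation in that direction. The second difference is treated
  as two first differences in the shorter displacement \<open>k\<close>, and the missing minimum is
  inserted by \<open>kap1_le_kap2\<close>.\<close>

lemma kernel_diff2_near:
  fixes a k l :: "'b::real_normed_vector"
  assumes nz: "a \<noteq> 0" "a + k \<noteq> 0" "a + l \<noteq> 0" "a + k + l \<noteq> 0" and "0 < p"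
    and h: "norm k \<le> norm l" "norm a < 4 * norm l"
  shows "\<bar>norm a powr -p - norm (a + k) powr -p - norm (a + l) powr -p + norm (a + k + l) powr -p\<bar>
    \<le> 6 * (1 + p) * (kap2 p (norm k) (norm l) (norm a) + kap2 p (norm k) (norm l) (norm (a + k))
       + kap2 p (norm k) (norm l) (norm (a + l)) + kap2 p (norm k) (norm l) (norm (a + k + l)))"
    (is "?L \<le> _ * (?A + ?B + ?C + ?D)")
proof -
  let ?k = "\<lambda>z. kap1 p (norm k) (norm z)"
  have 1: "\<bar>norm a powr -p - norm (a + k) powr -p\<bar> \<le> (1 + p) * (?k a + ?k (a + k))"
    using kernel_diff1[of a "a + k" p] assms by (simp add: norm_minus_commute)
  have 2: "\<bar>norm (a + l) powr -p - norm (a + l + k) powr -p\<bar> \<le> (1 + p) * (?k (a + l) + ?k (a + l + k))"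
    using kernel_diff1[of "a + l" "a + l + k" p] assms by (simp add: add_ac)
  have "norm (a + k) \<le> 6 * norm l" "norm (a + l) \<le> 6 * norm l" "norm (a + k + l) \<le> 6 * norm l"
    using h norm_triangle_ineq[of a k] norm_triangle_ineq[of a l] norm_triangle_ineq[of "a + k" l]
    norm_ge_zero[of l] by linarith+
  then have 3: "?k a \<le> 6 * ?A" "?k (a + k) \<le> 6 * ?B" "?k (a + l) \<le> 6 * ?C" "?k (a + k + l) \<le> 6 * ?D"
    using nz h norm_ge_zero[of k] norm_ge_zero[of l] by (intro kap1_le_kap2; auto; linarith?)+
  have "?L \<le> \<bar>norm a powr -p - norm (a + k) powr -p\<bar> + \<bar>norm (a + l) powr -p - norm (a + l + k) powr -p\<bar>"
    by (simp add: add_ac)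
  also have "\<dots> \<le> (1 + p) * (?k a + ?k (a + k) + ?k (a + l) + ?k (a + k + l))"
    using 1 2 by (simp add: algebra_simps)
  also have "\<dots> \<le> (1 + p) * (6 * ?A + 6 * ?B + 6 * ?C + 6 * ?D)"
    using 3 assms by (intro mult_left_mono add_mono) auto
  finally show ?thesis by (simp add: algebra_simps)
qed

lemma kernel_diff2:
  fixes p :: real
  assumes p: "0 < p"
  obtains C where "0 < C" and "\<And>a k l :: 'b::real_inner. a \<noteq> 0 \<Longrightarrow> a + k \<noteq> 0 \<Longrightarrow> a + l \<noteq> 0 \<Longrightarrow> a + k + l \<noteq> 0 \<Longrightarrow>
     \<bar>norm a powr -p - norm (a + k) powr -p - norm (a + l) powr -p + norm (a + k + l) powr -p\<bar>
    \<le> C * (kap2 p (norm k) (norm l) (norm a) + kap2 p (norm k) (norm l) (norm (a + k))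
       + kap2 p (norm k) (norm l) (norm (a + l)) + kap2 p (norm k) (norm l) (norm (a + k + l)))"
proof
  define C1 where "C1 = p * (3 * p + 7) * 2 powr (p + 2)"
  define C where "C = C1 + 6 * (1 + p)"
  have C1: "0 < C1" using p by (simp add: C1_def)
  then show "0 < C" using p by (simp add: C_def)
  fix a k l :: 'b
  assume nz: "a \<noteq> 0" "a + k \<noteq> 0" "a + l \<noteq> 0" "a + k + l \<noteq> 0"
  let ?S = "kap2 p (norm k) (norm l) (norm a) + kap2 p (norm k) (norm l) (norm (a + k))
       + kap2 p (norm k) (norm l) (norm (a + l)) + kap2 p (norm k) (norm l) (norm (a + k + l))"
  let ?L = "\<bar>norm a powr -p - norm (a + k) powr -p - norm (a + l) powr -p + norm (a + k + l) powr -p\<bar>"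
  have S: "kap2 p (norm k) (norm l) (norm a) \<le> ?S" "0 \<le> ?S"
    by (simp_all add: kap2_nonneg)
  have "?L \<le> C1 * ?S \<or> ?L \<le> 6 * (1 + p) * ?S"
  proof (cases "norm k \<le> norm a / 4 \<and> norm l \<le> norm a / 4")
    case True
    then have "?L \<le> C1 * kap2 p (norm k) (norm l) (norm a)"
      unfolding C1_def using kernel_diff2_far[of a p k l] nz p by blast
    also have "\<dots> \<le> C1 * ?S" using S C1 by (intro mult_left_mono) auto
    finally show ?thesis ..
  next
    case False
    \<comment> \<open>Outside the far regime one displacement exceeds |a|/4, hence so does the
      longer one. The expression is symmetric in \<open>k\<close> and \<open>l\<close>, so the
      longer one may be taken as \<open>l\<close>.\<close>
    show ?thesis
    proof (cases "norm k \<le> norm l")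
      case True
      then show ?thesis using kernel_diff2_near[of a k l p] nz p False by auto
    next
      case 2: False
      have "kap2 p (norm l) (norm k) r = kap2 p (norm k) (norm l) r" for r
        by (simp add: kap2_def)
      then show ?thesis using kernel_diff2_near[of a l k p] nz p False 2
        by (auto simp: add_ac algebra_simps)
    qed
  qed
  then show "?L \<le> C * ?S"
  proof
    assume "?L \<le> C1 * ?S"
    also have "\<dots> \<le> C * ?S" using S p by (intro mult_right_mono) (auto simp: C_def)
    finally show ?thesis .
  next
    assume "?L \<le> 6 * (1 + p) * ?S"
    also have "\<dots> \<le> C * ?S" using S C1 by (intro mult_right_mono) (auto simp: C_def)
    finally show ?thesis .
  qed
qed

section \<open>Potential estimates and Schur's test\<close>

lemma dyadic_interval:
  fixes y :: real
  assumes "1 \<le> y"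
  obtains k :: nat where "2 ^ k \<le> y" "y < 2 ^ (Suc k)"
proof -
  define n where "n = (LEAST n::nat. y < 2 ^ n)"
  obtain m :: nat where "y < 2 ^ m" using real_arch_pow[of 2 y] by auto
  then have n: "y < 2 ^ n" unfolding n_def by (rule LeastI)
  with assms have "n \<noteq> 0" by (cases n) auto
  then obtain k where k: "n = Suc k" by (cases n) auto
  then have "\<not> y < 2 ^ k" unfolding n_def by (intro not_less_Least) (simp add: n_def[symmetric])
  with n k show ?thesis by (intro that[of k]) auto
qed

lemma suminf_ennreal_geometric:
  assumes "0 \<le> c" "0 \<le> q" "q < 1"
  shows "(\<Sum>k. ennreal (c * q ^ k)) = ennreal (c / (1 - q))"
proof -
  have "(\<lambda>k. c * q ^ k) sums (c * (1 / (1 - q)))"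
    using assms by (intro sums_mult geometric_sums) auto
  then show ?thesis using assms by (intro suminf_ennreal_eq) auto
qed

lemma power_powr_swap: "((2::real) ^ k) powr x = (2 powr x) ^ k"
  by (simp add: powr_realpow[symmetric] powr_powr mult.commute)

text \<open>Dyadic shells around \<open>z\<close>. Inside radius \<rho> the shell sums behave like
  2^(-\<beta>k), outside like 2^((\<beta>-1)k), where the minimum provides the additional decay;
  both series converge because 0 < \<beta> < 1. The condition \<beta> <= d makes the power
  decreasing, so on each shell it is bounded by its value at the inner radius.\<close>

lemma potential_bound:
  fixes M :: "'a::euclidean_space measure" and A d \<beta> :: real
  assumes sets[measurable_cong]: "sets M = sets borel"
    and bound: "\<And>z r. 0 < r \<Longrightarrow> emeasure M (ball z r) \<le> ennreal (A * r powr d)"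
    and \<beta>: "0 < \<beta>" "\<beta> < 1" "\<beta> \<le> d" and A: "0 \<le> A"
  obtains C where "0 < C" and "\<And>z \<rho>. 0 < \<rho> \<Longrightarrow>
    (\<integral>\<^sup>+x. ennreal (dist x z powr (\<beta> - d) * min 1 (\<rho> / dist x z)) \<partial>M) \<le> ennreal (C * \<rho> powr \<beta>)"
proof
  define C1 where "C1 = A * 2 powr (2 * d - \<beta>) / (1 - 2 powr (-\<beta>))"
  define C2 where "C2 = A * 2 powr d / (1 - 2 powr (\<beta> - 1))"
  have q1: "2 powr (-\<beta>) < (1::real)" using \<beta> powr_less_mono[of "-\<beta>" 0 2] by simp
  have q2: "2 powr (\<beta> - 1) < (1::real)" using \<beta> powr_less_mono[of "\<beta> - 1" 0 2] by simp
  have C12: "0 \<le> C1" "0 \<le> C2" using A q1 q2 by (auto simp: C1_def C2_def)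
  \<comment> \<open>The summand 1 keeps the constant positive when A = 0.\<close>
  then show "0 < C1 + C2 + 1" by simp
  fix z :: 'a and \<rho> :: real assume \<rho>: "0 < \<rho>"
  have [measurable]: "ball x r \<in> sets M" for x r by (simp add: sets)
  \<comment> \<open>The value of the power at the inner radius of the k-th shell inside \<rho>;
    \<open>b\<close> is its analogue outside. Whole balls replace the shells, since only an upper
    bound is sought, and the inner ones have doubled radius because the shell contains its outer
    sphere while balls are open.\<close>
  define a where "a k = (\<rho> / 2 ^ Suc k) powr (\<beta> - d)" for k
  define b where "b k = (2 ^ k * \<rho>) powr (\<beta> - 1 - d) * \<rho>" for k
  define f where "f x = dist x z powr (\<beta> - d) * min 1 (\<rho> / dist x z)" for x
  have ab: "0 \<le> a k" "0 \<le> b k" for k using \<rho> by (auto simp: a_def b_def)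
  have pointwise: "ennreal (f x) \<le> (\<Sum>k. ennreal (a k) * indicator (ball z (2 * \<rho> / 2 ^ k)) x
      + ennreal (b k) * indicator (ball z (2 ^ Suc k * \<rho>)) x)" (is "_ \<le> (\<Sum>k. ?t k)") for x
  proof -
    define D where "D = dist x z"
    have D0: "D \<ge> 0" by (simp add: D_def)
    consider "D = 0" | "0 < D" "D \<le> \<rho>" | "\<rho> < D" using D0 by linarith
    then show ?thesis
    proof cases
      \<comment> \<open>At x = z the integrand is 0 because \<open>0 powr a = 0\<close>, so even an
        atom of the measure at z would do no harm.\<close>
      case 1
      then show ?thesis by (simp add: f_def D_def)
    next
      case 2
      obtain k where k: "2 ^ k \<le> \<rho> / D" "\<rho> / D < 2 ^ Suc k"
        using dyadic_interval[of "\<rho> / D"] 2 by auto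
      have Dk: "\<rho> / 2 ^ Suc k \<le> D" "D < 2 * \<rho> / 2 ^ k"
      proof -
        show "\<rho> / 2 ^ Suc k \<le> D" using k(2) 2 by (simp add: field_simps)
        have "D \<le> \<rho> / 2 ^ k" using k(1) 2 by (simp add: field_simps)
        also have "\<dots> < 2 * \<rho> / 2 ^ k" using \<rho> by (simp add: divide_strict_right_mono)
        finally show "D < 2 * \<rho> / 2 ^ k" .
      qed
      have "f x \<le> D powr (\<beta> - d)" unfolding f_def D_def[symmetric]
        by (rule mult_left_le) auto
      also have "\<dots> \<le> a k" unfolding a_def using Dk \<rho> \<beta> by (intro powr_mono2') auto
      finally have "ennreal (f x) \<le> ennreal (a k)" using ab by (intro ennreal_leI)
      also have "\<dots> \<le> ?t k" using Dk by (auto simp: D_def dist_commute indicator_def)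
      also have "\<dots> \<le> (\<Sum>k. ?t k)" using sum_le_suminf[of ?t "{k}"] by simp
      finally show ?thesis .
    next
      case 3
      obtain k where k: "2 ^ k \<le> D / \<rho>" "D / \<rho> < 2 ^ Suc k"
        using dyadic_interval[of "D / \<rho>"] 3 \<rho> by auto
      have Dk: "2 ^ k * \<rho> \<le> D" "D < 2 ^ Suc k * \<rho>"
        using k \<rho> by (simp_all add: field_simps)
      have "f x \<le> D powr (\<beta> - d) * (\<rho> / D)"
        unfolding f_def D_def[symmetric] by (intro mult_left_mono) auto
      also have "\<dots> = D powr (\<beta> - 1 - d) * \<rho>"
        using 3 \<rho> powr_diff[of D "\<beta> - d" 1] by (simp add: algebra_simps)
      also have "\<dots> \<le> b k" unfolding b_def using Dk \<rho> \<beta> by (intro mult_right_mono powr_mono2') auto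
      finally have "ennreal (f x) \<le> ennreal (b k)" using ab by (intro ennreal_leI)
      also have "\<dots> \<le> ?t k" using Dk by (auto simp: D_def dist_commute indicator_def)
      also have "\<dots> \<le> (\<Sum>k. ?t k)" using sum_le_suminf[of ?t "{k}"] by simp
      finally show ?thesis .
    qed
  qed
  have "(\<integral>\<^sup>+x. ennreal (f x) \<partial>M) \<le> (\<integral>\<^sup>+x. (\<Sum>k. ennreal (a k) * indicator (ball z (2 * \<rho> / 2 ^ k)) x
      + ennreal (b k) * indicator (ball z (2 ^ Suc k * \<rho>)) x) \<partial>M)"
    by (intro nn_integral_mono pointwise)
  also have "\<dots> = (\<Sum>k. (\<integral>\<^sup>+x. ennreal (a k) * indicator (ball z (2 * \<rho> / 2 ^ k)) x
      + ennreal (b k) * indicator (ball z (2 ^ Suc k * \<rho>)) x \<partial>M))"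
    by (intro nn_integral_suminf) measurable
  also have "\<dots> = (\<Sum>k. ennreal (a k) * emeasure M (ball z (2 * \<rho> / 2 ^ k))
      + ennreal (b k) * emeasure M (ball z (2 ^ Suc k * \<rho>)))"
    by (intro suminf_cong, subst nn_integral_add) (auto simp: sets nn_integral_cmult_indicator)
  also have "\<dots> \<le> (\<Sum>k. ennreal (a k) * ennreal (A * (2 * \<rho> / 2 ^ k) powr d)
      + ennreal (b k) * ennreal (A * (2 ^ Suc k * \<rho>) powr d))"
    using \<rho> by (intro suminf_le add_mono mult_left_mono bound) auto
  also have "\<dots> = (\<Sum>k. ennreal (a k * (A * (2 * \<rho> / 2 ^ k) powr d)))
      + (\<Sum>k. ennreal (b k * (A * (2 ^ Suc k * \<rho>) powr d)))"
    using ab A by (subst suminf_add) (auto simp: ennreal_mult)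
  also have "(\<lambda>k. a k * (A * (2 * \<rho> / 2 ^ k) powr d)) = (\<lambda>k. A * 2 powr (2 * d - \<beta>) * \<rho> powr \<beta> * (2 powr (-\<beta>)) ^ k)"
  proof
    fix k
    have e1: "a k = \<rho> powr (\<beta> - d) * 2 powr (d - \<beta>) * (2 powr (d - \<beta>)) ^ k"
    proof -
      have "a k = \<rho> powr (\<beta> - d) * (2 ^ Suc k) powr (-(\<beta> - d))"
        unfolding a_def using \<rho> by (simp only: powr_divide powr_minus) (simp add: divide_inverse)
      also have "(2 ^ Suc k) powr (-(\<beta> - d)) = (2 powr (d - \<beta>)) ^ Suc k"
        unfolding power_powr_swap by simp
      finally show ?thesis by simp
    qed
    have e2: "(2 * \<rho> / 2 ^ k) powr d = 2 powr d * \<rho> powr d * (2 powr (-d)) ^ k"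
    proof -
      have "(2 * \<rho> / 2 ^ k) powr d = 2 powr d * \<rho> powr d * (2 ^ k) powr (-d)"
        using \<rho> by (simp only: powr_divide powr_mult powr_minus) (simp add: divide_inverse)
      then show ?thesis unfolding power_powr_swap .
    qed
    have e3: "(2 powr (d - \<beta>)) ^ k * (2 powr (-d)) ^ k = ((2::real) powr (-\<beta>)) ^ k"
      by (simp add: power_mult_distrib[symmetric] powr_add[symmetric])
    have e4: "\<rho> powr (\<beta> - d) * \<rho> powr d = \<rho> powr \<beta>" using \<rho> by (simp add: powr_add[symmetric])
    have e5: "(2::real) powr (d - \<beta>) * 2 powr d = 2 powr (2 * d - \<beta>)" by (simp add: powr_add[symmetric])
    have "a k * (A * (2 * \<rho> / 2 ^ k) powr d) = A * (2 powr (d - \<beta>) * 2 powr d) * (\<rho> powr (\<beta> - d) * \<rho> powr d)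
        * ((2 powr (d - \<beta>)) ^ k * (2 powr (-d)) ^ k)"
      unfolding e1 e2 by (simp only: mult_ac)
    then show "a k * (A * (2 * \<rho> / 2 ^ k) powr d) = A * 2 powr (2 * d - \<beta>) * \<rho> powr \<beta> * (2 powr (-\<beta>)) ^ k"
      unfolding e3 e4 e5 .
  qed
  also have "(\<lambda>k. b k * (A * (2 ^ Suc k * \<rho>) powr d)) = (\<lambda>k. A * 2 powr d * \<rho> powr \<beta> * (2 powr (\<beta> - 1)) ^ k)"
  proof
    fix k
    have e1: "b k = (2 powr (\<beta> - 1 - d)) ^ k * (\<rho> powr (\<beta> - 1 - d) * \<rho>)"
      using \<rho> unfolding b_def by (simp only: powr_mult power_powr_swap mult.assoc)
    have e2: "(2 ^ Suc k * \<rho>) powr d = 2 powr d * (2 powr d) ^ k * \<rho> powr d"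
      using \<rho> by (simp only: powr_mult power_powr_swap power_Suc)
    have e3: "(2 powr (\<beta> - 1 - d)) ^ k * (2 powr d) ^ k = ((2::real) powr (\<beta> - 1)) ^ k"
      by (simp add: power_mult_distrib[symmetric] powr_add[symmetric])
    have e4: "\<rho> powr (\<beta> - 1 - d) * \<rho> * \<rho> powr d = \<rho> powr \<beta>"
      using \<rho> by (simp add: powr_diff)
    have "b k * (A * (2 ^ Suc k * \<rho>) powr d) = A * 2 powr d * (\<rho> powr (\<beta> - 1 - d) * \<rho> * \<rho> powr d)
        * ((2 powr (\<beta> - 1 - d)) ^ k * (2 powr d) ^ k)"
      unfolding e1 e2 by (simp only: mult_ac)
    then show "b k * (A * (2 ^ Suc k * \<rho>) powr d) = A * 2 powr d * \<rho> powr \<beta> * (2 powr (\<beta> - 1)) ^ k"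
      unfolding e3 e4 .
  qed
  also have "(\<Sum>k. ennreal (A * 2 powr (2 * d - \<beta>) * \<rho> powr \<beta> * (2 powr (-\<beta>)) ^ k))
      = ennreal (A * 2 powr (2 * d - \<beta>) * \<rho> powr \<beta> / (1 - 2 powr (-\<beta>)))"
    using A q1 by (intro suminf_ennreal_geometric) auto
  also have "(\<Sum>k. ennreal (A * 2 powr d * \<rho> powr \<beta> * (2 powr (\<beta> - 1)) ^ k))
      = ennreal (A * 2 powr d * \<rho> powr \<beta> / (1 - 2 powr (\<beta> - 1)))"
    using A q2 by (intro suminf_ennreal_geometric) auto
  also have "ennreal (A * 2 powr (2 * d - \<beta>) * \<rho> powr \<beta> / (1 - 2 powr (-\<beta>)))
    + ennreal (A * 2 powr d * \<rho> powr \<beta> / (1 - 2 powr (\<beta> - 1))) = ennreal ((C1 + C2) * \<rho> powr \<beta>)"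
    using A q1 q2 by (subst ennreal_plus[symmetric]) (auto simp: C1_def C2_def algebra_simps)
  also have "\<dots> \<le> ennreal ((C1 + C2 + 1) * \<rho> powr \<beta>)"
    by (intro ennreal_leI mult_right_mono) auto
  finally show "(\<integral>\<^sup>+x. ennreal (dist x z powr (\<beta> - d) * min 1 (\<rho> / dist x z)) \<partial>M)
    \<le> ennreal ((C1 + C2 + 1) * \<rho> powr \<beta>)" by (simp add: f_def)
qed

text \<open>The identity min(1, D/\<rho>) = (D/\<rho>) min(1, \<rho>/D) turns this into
  \<open>potential_bound\<close> with \<beta> = 1 - \<gamma>. The minimum now tames the singularity
  at the centre, while the power alone gives decay at infinity.\<close>

lemma potential_bound_far:
  fixes M :: "'a::euclidean_space measure" and A d \<gamma> :: real
  assumes sets[measurable_cong]: "sets M = sets borel"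
    and bound: "\<And>z r. 0 < r \<Longrightarrow> emeasure M (ball z r) \<le> ennreal (A * r powr d)"
    and \<gamma>: "0 < \<gamma>" "\<gamma> < 1" "1 - \<gamma> \<le> d" and A: "0 \<le> A"
  obtains C where "0 < C" and "\<And>z \<rho>. 0 < \<rho> \<Longrightarrow>
    (\<integral>\<^sup>+x. ennreal (dist x z powr (- d - \<gamma>) * min 1 (dist x z / \<rho>)) \<partial>M) \<le> ennreal (C * \<rho> powr -\<gamma>)"
proof -
  obtain C where C: "0 < C" "\<And>z \<rho>. 0 < \<rho> \<Longrightarrow>
    (\<integral>\<^sup>+x. ennreal (dist x z powr (1 - \<gamma> - d) * min 1 (\<rho> / dist x z)) \<partial>M) \<le> ennreal (C * \<rho> powr (1 - \<gamma>))"
    using potential_bound[OF sets bound, of "1 - \<gamma>"] \<gamma> A by auto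
  show thesis
  proof (rule that[OF C(1)])
    fix z :: 'a and \<rho> :: real assume \<rho>: "0 < \<rho>"
    have eq: "D powr (- d - \<gamma>) * min 1 (D / \<rho>) = 1 / \<rho> * (D powr (1 - \<gamma> - d) * min 1 (\<rho> / D))"
      if "0 \<le> D" for D :: real
    proof (cases "D = 0")
      case False
      then have D: "0 < D" using that by simp
      have "min 1 (D / \<rho>) = D / \<rho> * min 1 (\<rho> / D)"
        using D \<rho> by (auto simp: min_def field_simps)
      moreover have "D powr (1 - \<gamma> - d) = D * D powr (- d - \<gamma>)"
        using D powr_add[of D 1 "- d - \<gamma>"] by (simp add: algebra_simps)
      ultimately show ?thesis by simp
    qed simp
    have "(\<integral>\<^sup>+x. ennreal (dist x z powr (- d - \<gamma>) * min 1 (dist x z / \<rho>)) \<partial>M)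
       = (\<integral>\<^sup>+x. ennreal (1 / \<rho>) * ennreal (dist x z powr (1 - \<gamma> - d) * min 1 (\<rho> / dist x z)) \<partial>M)"
      using \<rho> by (intro nn_integral_cong) (simp add: eq ennreal_mult[symmetric])
    also have "\<dots> = ennreal (1 / \<rho>) * (\<integral>\<^sup>+x. ennreal (dist x z powr (1 - \<gamma> - d) * min 1 (\<rho> / dist x z)) \<partial>M)"
      by (intro nn_integral_cmult) measurable
    also have "\<dots> \<le> ennreal (1 / \<rho>) * ennreal (C * \<rho> powr (1 - \<gamma>))"
      using C \<rho> by (intro mult_left_mono) auto
    also have "\<dots> = ennreal (C * \<rho> powr -\<gamma>)"
      using C \<rho> by (subst ennreal_mult[symmetric]) (auto simp: powr_diff powr_minus field_simps)
    finally show "(\<integral>\<^sup>+x. ennreal (dist x z powr (- d - \<gamma>) * min 1 (dist x z / \<rho>)) \<partial>M) \<le> ennreal (C * \<rho> powr -\<gamma>)" .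
  qed
qed

text \<open>Schur's test with the weight hidden in a factorisation: K is at most sqrt k1 sqrt k2,
  Cauchy-Schwarz in y uses up the k2-integral, and Fubini then uses up the k1-integral. The quotient
  k1/k2 is thus the square of a weight that may depend on both variables jointly, a freedom the
  kernels below rely on.\<close>

lemma schur_bound:
  fixes K k1 k2 :: "'x \<Rightarrow> 'y \<Rightarrow> real" and G :: "'y \<Rightarrow> ennreal"
  assumes "sigma_finite_measure M" "sigma_finite_measure N"
    and [measurable]: "case_prod K \<in> borel_measurable (M \<Otimes>\<^sub>M N)"
      "case_prod k1 \<in> borel_measurable (M \<Otimes>\<^sub>M N)" "case_prod k2 \<in> borel_measurable (M \<Otimes>\<^sub>M N)"
      "G \<in> borel_measurable N"
    and nonneg: "\<And>x y. 0 \<le> K x y" "\<And>x y. 0 \<le> k1 x y" "\<And>x y. 0 \<le> k2 x y"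
    and K: "\<And>x y. (K x y)\<^sup>2 \<le> k1 x y * k2 x y"
    and C2: "\<And>x. x \<in> space M \<Longrightarrow> (\<integral>\<^sup>+y. ennreal (k2 x y) \<partial>N) \<le> C2"
    and C1: "\<And>y. y \<in> space N \<Longrightarrow> (\<integral>\<^sup>+x. ennreal (k1 x y) \<partial>M) \<le> C1"
  shows "(\<integral>\<^sup>+x. (\<integral>\<^sup>+y. ennreal (K x y) * G y \<partial>N)\<^sup>2 \<partial>M) \<le> C2 * C1 * (\<integral>\<^sup>+y. (G y)\<^sup>2 \<partial>N)"
proof -
  interpret M: sigma_finite_measure M by fact
  interpret N: sigma_finite_measure N by fact
  interpret pair_sigma_finite M N ..
  have 1: "(\<integral>\<^sup>+y. ennreal (K x y) * G y \<partial>N)\<^sup>2 \<le> C2 * (\<integral>\<^sup>+y. ennreal (k1 x y) * (G y)\<^sup>2 \<partial>N)"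
    if x[measurable]: "x \<in> space M" for x
  proof -
    have "ennreal (K x y) * G y \<le> ennreal (sqrt (k2 x y)) * (ennreal (sqrt (k1 x y)) * G y)" for y
    proof -
      have "K x y \<le> sqrt (k1 x y * k2 x y)" using K[of x y] by (intro real_le_rsqrt)
      also have "\<dots> = sqrt (k2 x y) * sqrt (k1 x y)" by (simp add: real_sqrt_mult)
      finally have "ennreal (K x y) \<le> ennreal (sqrt (k2 x y) * sqrt (k1 x y))" by (rule ennreal_leI)
      then have "ennreal (K x y) \<le> ennreal (sqrt (k2 x y)) * ennreal (sqrt (k1 x y))"
        using nonneg by (simp add: ennreal_mult)
      then show ?thesis unfolding mult.assoc[symmetric] by (rule mult_right_mono) simp
    qed
    then have "(\<integral>\<^sup>+y. ennreal (K x y) * G y \<partial>N)\<^sup>2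
       \<le> (\<integral>\<^sup>+y. ennreal (sqrt (k2 x y)) * (ennreal (sqrt (k1 x y)) * G y) \<partial>N)\<^sup>2"
      by (intro power_mono nn_integral_mono) auto
    also have "\<dots> \<le> (\<integral>\<^sup>+y. (ennreal (sqrt (k2 x y)))\<^sup>2 \<partial>N) * (\<integral>\<^sup>+y. (ennreal (sqrt (k1 x y)) * G y)\<^sup>2 \<partial>N)"
      by (intro Cauchy_Schwarz_nn_integral) measurable
    also have "\<dots> = (\<integral>\<^sup>+y. ennreal (k2 x y) \<partial>N) * (\<integral>\<^sup>+y. ennreal (k1 x y) * (G y)\<^sup>2 \<partial>N)"
      using nonneg by (simp add: power_mult_distrib ennreal_power)
    also have "\<dots> \<le> C2 * (\<integral>\<^sup>+y. ennreal (k1 x y) * (G y)\<^sup>2 \<partial>N)"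
      using C2[OF x] by (intro mult_right_mono) auto
    finally show ?thesis .
  qed
  have "(\<integral>\<^sup>+x. (\<integral>\<^sup>+y. ennreal (K x y) * G y \<partial>N)\<^sup>2 \<partial>M) \<le> (\<integral>\<^sup>+x. C2 * (\<integral>\<^sup>+y. ennreal (k1 x y) * (G y)\<^sup>2 \<partial>N) \<partial>M)"
    by (intro nn_integral_mono 1)
  also have "\<dots> = C2 * (\<integral>\<^sup>+x. \<integral>\<^sup>+y. ennreal (k1 x y) * (G y)\<^sup>2 \<partial>N \<partial>M)"
    by (intro nn_integral_cmult) measurable
  also have "(\<integral>\<^sup>+x. \<integral>\<^sup>+y. ennreal (k1 x y) * (G y)\<^sup>2 \<partial>N \<partial>M) = (\<integral>\<^sup>+y. \<integral>\<^sup>+x. ennreal (k1 x y) * (G y)\<^sup>2 \<partial>M \<partial>N)"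
    by (rule Fubini'[symmetric]) measurable
  also have "\<dots> = (\<integral>\<^sup>+y. (\<integral>\<^sup>+x. ennreal (k1 x y) \<partial>M) * (G y)\<^sup>2 \<partial>N)"
    by (intro nn_integral_cong nn_integral_multc) measurable
  also have "\<dots> \<le> (\<integral>\<^sup>+y. C1 * (G y)\<^sup>2 \<partial>N)"
    by (intro nn_integral_mono mult_right_mono C1) auto
  also have "\<dots> = C1 * (\<integral>\<^sup>+y. (G y)\<^sup>2 \<partial>N)"
    by (intro nn_integral_cmult) measurable
  finally show ?thesis by (simp add: mult_left_mono mult.assoc)
qed

section \<open>Surface measure and corkscrew regions\<close>

text \<open>A frontier point is outside the open set, so it cannot lie above the graph; if it lay
  strictly below, continuity would give a neighbourhood of it missing the domain, against its being
  in the closure.\<close>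

lemma frontier_subset_graph:
  fixes \<Omega> :: "'a::euclidean_space set"
  assumes "open \<Omega>" and "norm e = 1" and h: "L-lipschitz_on {y. y \<bullet> e = 0} h"
    and chart: "\<And>x. x \<in> ball p r \<Longrightarrow> x \<in> \<Omega> \<longleftrightarrow> x \<bullet> e > h (x - (x \<bullet> e) *\<^sub>R e)"
  shows "frontier \<Omega> \<inter> ball p r \<subseteq> {x. x \<bullet> e = h (x - (x \<bullet> e) *\<^sub>R e)}"
proof
  fix x assume x: "x \<in> frontier \<Omega> \<inter> ball p r"
  define F where "F z = z \<bullet> e - h (z - (z \<bullet> e) *\<^sub>R e)" for z
  have ee: "e \<bullet> e = 1" using assms(2) by (simp add: norm_eq_1)
  have "continuous_on {y. y \<bullet> e = 0} h" using h by (rule lipschitz_on_continuous_on)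
  then have cF: "continuous_on UNIV F"
    unfolding F_def
    by (intro continuous_on_diff continuous_on_compose2[of "{y. y \<bullet> e = 0}" h UNIV "\<lambda>z. z - (z \<bullet> e) *\<^sub>R e"])
       (auto simp: inner_diff_left ee intro!: continuous_intros)
  have "x \<notin> \<Omega>" using x assms(1) by (auto simp: frontier_def interior_open)
  then have 1: "F x \<le> 0" using chart[of x] x by (auto simp: F_def)
  have "F x \<ge> 0"
  proof (rule ccontr)
    assume "\<not> F x \<ge> 0"
    have "open (F -` {..<0})" using open_vimage[OF open_lessThan cF, of 0] by simp
    then have open_domain: "open ((F -` {..<0}) \<inter> ball p r)" by auto
    have "x \<in> (F -` {..<0}) \<inter> ball p r" using x \<open>\<not> F x \<ge> 0\<close> by auto
    moreover have "x \<in> closure \<Omega>" using x by (auto simp: frontier_def)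
    ultimately have "(F -` {..<0}) \<inter> ball p r \<inter> \<Omega> \<noteq> {}"
      using open_Int_closure_eq_empty[OF open_domain, of \<Omega>] by blast
    then show False using chart by (auto simp: F_def)
  qed
  with 1 show "x \<in> {x. x \<bullet> e = h (x - (x \<bullet> e) *\<^sub>R e)}" by (simp add: F_def)
qed

section \<open>Hausdorff content of Lipschitz graphs\<close>

lemma graph_lipschitz:
  fixes h :: "'a::euclidean_space \<Rightarrow> real"
  assumes "norm e = 1" and h: "L-lipschitz_on {y. y \<bullet> e = 0} h"
    and x: "x \<bullet> e = h (x - (x \<bullet> e) *\<^sub>R e)" and y: "y \<bullet> e = h (y - (y \<bullet> e) *\<^sub>R e)"
  shows "dist x y \<le> (1 + L) * norm ((x - y) - ((x - y) \<bullet> e) *\<^sub>R e)"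
proof -
  let ?P = "\<lambda>z. z - (z \<bullet> e) *\<^sub>R e"
  have ee: "e \<bullet> e = 1" using assms(1) by (simp add: norm_eq_1)
  have P: "?P z \<in> {y. y \<bullet> e = 0}" for z by (simp add: inner_diff_left ee)
  have "\<bar>x \<bullet> e - y \<bullet> e\<bar> \<le> L * dist (?P x) (?P y)"
    using lipschitz_onD[OF h P P, of x y] x y by (simp add: dist_real_def)
  also have "dist (?P x) (?P y) = norm (?P (x - y))"
    by (simp add: dist_norm algebra_simps)
  finally have 1: "\<bar>(x - y) \<bullet> e\<bar> \<le> L * norm (?P (x - y))" by (simp add: inner_diff_left)
  have "dist x y = norm (?P (x - y) + ((x - y) \<bullet> e) *\<^sub>R e)" by (simp add: dist_norm)
  also have "\<dots> \<le> norm (?P (x - y)) + norm (((x - y) \<bullet> e) *\<^sub>R e)" by (rule norm_triangle_ineq)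
  also have "norm (((x - y) \<bullet> e) *\<^sub>R e) = \<bar>(x - y) \<bullet> e\<bar>" using assms(1) by simp
  finally show ?thesis using 1 by (simp add: algebra_simps)
qed

lemma norm_le_sum_orthonormal:
  fixes B :: "'a::euclidean_space set"
  assumes "finite B" "pairwise orthogonal B" "\<And>b. b \<in> B \<Longrightarrow> norm b = 1" "x \<in> span B"
  shows "norm x \<le> (\<Sum>b\<in>B. \<bar>x \<bullet> b\<bar>)"
proof -
  obtain u where u: "x = (\<Sum>b\<in>B. u b *\<^sub>R b)"
    using assms(1,4) by (auto simp: span_finite)
  have "x \<bullet> b = u b" if b: "b \<in> B" for b
  proof -
    have "x \<bullet> b = (\<Sum>c\<in>B. u c * (c \<bullet> b))" unfolding u by (simp add: inner_sum_left)
    also have "\<dots> = (\<Sum>c\<in>B. if c = b then u b else 0)"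
      using assms(2,3) b by (intro sum.cong) (auto simp: pairwise_def orthogonal_def norm_eq_1)
    also have "\<dots> = u b" using b assms(1) by simp
    finally show ?thesis .
  qed
  moreover have "norm x \<le> (\<Sum>b\<in>B. norm (u b *\<^sub>R b))" unfolding u by (rule norm_sum)
  ultimately have "norm x \<le> (\<Sum>b\<in>B. norm ((x \<bullet> b) *\<^sub>R b))" by simp
  also have "\<dots> = (\<Sum>b\<in>B. \<bar>x \<bullet> b\<bar>)" using assms(3) by (intro sum.cong) auto
  finally show ?thesis .
qed

lemma hyperplane_orthonormal_basis:
  fixes e :: "'a::euclidean_space"
  assumes "e \<noteq> 0"
  obtains B where "finite B" "card B = DIM('a) - 1" "pairwise orthogonal B"
    "\<And>b. b \<in> B \<Longrightarrow> norm b = 1" "\<And>b. b \<in> B \<Longrightarrow> b \<bullet> e = 0" "span B = {y. y \<bullet> e = 0}"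
proof -
  have sub: "subspace {y. e \<bullet> y = 0}" by (rule subspace_hyperplane)
  obtain B where B: "B \<subseteq> {y. e \<bullet> y = 0}" "pairwise orthogonal B" "\<And>b. b \<in> B \<Longrightarrow> norm b = 1"
    "independent B" "card B = dim {y. e \<bullet> y = 0}" "span B = {y. e \<bullet> y = 0}"
    using orthonormal_basis_subspace[OF sub] by metis
  have "dim {y. e \<bullet> y = 0} = DIM('a) - 1" using assms by (rule dim_hyperplane)
  moreover have "{y. e \<bullet> y = 0} = {y. y \<bullet> e = 0}" by (simp add: inner_commute)
  ultimately show thesis
    by (intro that[of B]) (use B in \<open>auto simp: independent_imp_finite\<close>)
qed

text \<open>The shadow of \<open>S\<close> in the hyperplane is cut into N^(n-1) cubes of side
  2\<rho>/N. The graph over one cube has diameter at most M/N, so the total N^(n-1) (M/N)^(n-1) does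
  not depend on N. Letting N be large meets any \<delta> at no cost, which is why \<delta> is absent
  from the bound.\<close>

lemma hausdorff_content_graph:
  fixes h :: "'a::euclidean_space \<Rightarrow> real"
  assumes e: "norm e = 1" and h: "L-lipschitz_on {y. y \<bullet> e = 0} h" and n: "DIM('a) \<ge> 2"
    and S: "S \<subseteq> {x. x \<bullet> e = h (x - (x \<bullet> e) *\<^sub>R e)}" "S \<subseteq> ball c \<rho>" and "0 < \<rho>" "0 < \<delta>"
  shows "hausdorff_content (real DIM('a) - 1) \<delta> S
    \<le> ennreal (unit_ball_vol (real DIM('a) - 1) / 2 powr (real DIM('a) - 1)
         * ((1 + L) * real DIM('a) * 2) powr (real DIM('a) - 1) * \<rho> powr (real DIM('a) - 1))"
proof -
  define d where "d = real DIM('a) - 1"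
  have d: "d \<ge> 1" using n by (simp add: d_def)
  have L: "0 \<le> L" using h by (rule lipschitz_on_nonneg)
  obtain B where B: "finite B" "card B = DIM('a) - 1" "pairwise orthogonal B"
    "\<And>b. b \<in> B \<Longrightarrow> norm b = 1" "\<And>b. b \<in> B \<Longrightarrow> b \<bullet> e = 0" "span B = {y. y \<bullet> e = 0}"
    by (rule hyperplane_orthonormal_basis[of e]) (use e in auto)
  \<comment> \<open>Side length 2\<rho> of the big cube, times the dimension for the passage from
    coordinates to the norm, times 1 + L for the lift to the graph.\<close>
  define M where "M = (1 + L) * real DIM('a) * 2 * \<rho>"
  have M: "M > 0" using L \<open>0 < \<rho>\<close> by (simp add: M_def)
  obtain N0 :: nat where N0: "M / \<delta> < real N0" using reals_Archimedean2 by blast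
  define N where "N = max 1 N0"
  have N: "N \<ge> 1" "M / real N < \<delta>"
  proof -
    show N1: "N \<ge> 1" by (simp add: N_def)
    have "M / \<delta> < real N" using N0 by (simp add: N_def)
    then show "M / real N < \<delta>" using N1 \<open>0 < \<delta>\<close> by (simp add: field_simps)
  qed
  define \<eta> where "\<eta> = 2 * \<rho> / real N"
  have eta: "\<eta> > 0" using N \<open>0 < \<rho>\<close> by (simp add: \<eta>_def)
  define I where "I = B \<rightarrow>\<^sub>E {..<N}"
  have finI: "finite I" unfolding I_def by (intro finite_PiE B) auto
  have cardI: "card I = N ^ (DIM('a) - 1)"
    unfolding I_def using B by (simp add: card_PiE)
  \<comment> \<open>The part of \<open>S\<close> above the i-th cube. Cubes are closed and share
    faces; the overlap is harmless for an upper bound and spares a case distinction in the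
    covering.\<close>
  define P where "P i = {x \<in> S. \<forall>b\<in>B. c \<bullet> b - \<rho> + real (i b) * \<eta> \<le> x \<bullet> b \<and> x \<bullet> b \<le> c \<bullet> b - \<rho> + (real (i b) + 1) * \<eta>}" for i
  have diamP: "dist x y \<le> M / real N" if "x \<in> P i" "y \<in> P i" for x y i
  proof -
    let ?z = "(x - y) - ((x - y) \<bullet> e) *\<^sub>R e"
    have ee: "e \<bullet> e = 1" using e by (simp add: norm_eq_1)
    have xy: "x \<in> S" "y \<in> S" using that by (auto simp: P_def)
    have "dist x y \<le> (1 + L) * norm ?z"
      using S xy by (intro graph_lipschitz[OF e h]) auto
    also have "norm ?z \<le> (\<Sum>b\<in>B. \<bar>?z \<bullet> b\<bar>)"
      using B by (intro norm_le_sum_orthonormal) (auto simp: inner_diff_left ee)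
    also have "\<dots> \<le> (\<Sum>b\<in>B. \<eta>)"
    proof (rule sum_mono)
      fix b assume b: "b \<in> B"
      have "e \<bullet> b = 0" using B(5)[OF b] by (simp add: inner_commute)
      then have "?z \<bullet> b = x \<bullet> b - y \<bullet> b" by (simp add: inner_diff_left)
      moreover have "c \<bullet> b - \<rho> + real (i b) * \<eta> \<le> x \<bullet> b" "x \<bullet> b \<le> c \<bullet> b - \<rho> + (real (i b) + 1) * \<eta>"
        "c \<bullet> b - \<rho> + real (i b) * \<eta> \<le> y \<bullet> b" "y \<bullet> b \<le> c \<bullet> b - \<rho> + (real (i b) + 1) * \<eta>"
        using that b by (auto simp: P_def)
      ultimately show "\<bar>?z \<bullet> b\<bar> \<le> \<eta>" unfolding abs_le_iff distrib_right by linarith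
    qed
    also have "\<dots> \<le> real DIM('a) * \<eta>" using B(2) eta by (simp add: mult_right_mono)
    finally have "dist x y \<le> (1 + L) * (real DIM('a) * \<eta>)" using L by (simp add: mult_left_mono)
    then show ?thesis by (simp add: M_def \<eta>_def mult_ac)
  qed
  have cover: "S \<subseteq> (\<Union>i\<in>I. P i)"
  proof
    fix x assume x: "x \<in> S"
    define i where "i = restrict (\<lambda>b. nat \<lfloor>(x \<bullet> b - (c \<bullet> b - \<rho>)) / \<eta>\<rfloor>) B"
    have *: "i b < N \<and> c \<bullet> b - \<rho> + real (i b) * \<eta> \<le> x \<bullet> b \<and> x \<bullet> b \<le> c \<bullet> b - \<rho> + (real (i b) + 1) * \<eta>"
      if b: "b \<in> B" for b
    proof -
      define t where "t = x \<bullet> b - (c \<bullet> b - \<rho>)"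
      have "\<bar>(x - c) \<bullet> b\<bar> \<le> norm (x - c) * norm b" by (rule Cauchy_Schwarz_ineq2)
      also have "\<dots> < \<rho>" using S(2) x B(4)[OF b] by (auto simp: dist_norm norm_minus_commute)
      finally have t: "0 < t" "t < 2 * \<rho>" by (auto simp: t_def inner_diff_left abs_less_iff)
      have ib: "real (i b) = real_of_int \<lfloor>t / \<eta>\<rfloor>"
        using b t eta by (simp add: i_def t_def)
      have f: "real_of_int \<lfloor>t / \<eta>\<rfloor> \<le> t / \<eta>" "t / \<eta> \<le> real_of_int \<lfloor>t / \<eta>\<rfloor> + 1" by linarith+
      have "t / \<eta> < real N" using t eta N \<open>0 < \<rho>\<close> by (simp add: \<eta>_def field_simps)
      then have "real (i b) < real N" using ib f by linarith
      moreover have "real (i b) * \<eta> \<le> t" "t \<le> (real (i b) + 1) * \<eta>"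
        using mult_right_mono[OF f(1), of \<eta>] mult_right_mono[OF f(2), of \<eta>] eta unfolding ib by simp_all
      ultimately show ?thesis by (simp add: t_def)
    qed
    then have "i \<in> I" "x \<in> P i" using x by (auto simp: I_def P_def i_def)
    then show "x \<in> (\<Union>i\<in>I. P i)" by blast
  qed
  obtain f where f: "bij_betw f {..<card I} I" using finI ex_bij_betw_nat_finite[OF finI] by (auto simp: atLeast0LessThan)
  \<comment> \<open>The content is an infimum over sequences of sets, so the finite family is
    enumerated and continued by empty sets. These contribute 0, as the diameter of the empty set is
    0 and \<open>0 powr d = 0\<close>.\<close>
  define C where "C k = (if k < card I then P (f k) else {})" for k
  have SC: "S \<subseteq> (\<Union>k. C k)"
  proof
    fix x assume "x \<in> S"
    then obtain i where i: "i \<in> I" "x \<in> P i" using cover by auto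
    then have "i \<in> f ` {..<card I}" using f by (simp add: bij_betw_def)
    then obtain k where "k < card I" "f k = i" by auto
    then show "x \<in> (\<Union>k. C k)" using i by (auto simp: C_def intro!: exI[of _ k])
  qed
  have dC: "diameter (C k) \<le> M / real N" for k
    using M diamP[of _ "f k"] by (intro diameter_le) (auto simp: C_def dist_norm split: if_splits)
  have bC: "bounded (C k)" for k
    using S(2) by (intro bounded_subset[of "ball c \<rho>" "C k"]) (auto simp: C_def P_def)
  have dC0: "0 \<le> diameter (C k)" for k using bC by (rule diameter_ge_0)
  define \<kappa> where "\<kappa> = unit_ball_vol d / 2 powr d"
  have kap: "0 \<le> \<kappa>" using d by (simp add: \<kappa>_def unit_ball_vol_nonneg)
  have "hausdorff_content d \<delta> S \<le> (\<Sum>k. ennreal (\<kappa> * diameter (C k) powr d))"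
    unfolding hausdorff_content_def \<kappa>_def
    by (intro INF_lower) (use SC bC dC N in \<open>auto intro: le_less_trans\<close>)
  also have "\<dots> = (\<Sum>k<card I. ennreal (\<kappa> * diameter (C k) powr d))"
    by (intro suminf_finite) (auto simp: C_def)
  also have "\<dots> \<le> (\<Sum>k<card I. ennreal (\<kappa> * (M / real N) powr d))"
    using dC dC0 kap d by (intro sum_mono ennreal_leI mult_left_mono powr_mono2) auto
  also have "\<dots> = ennreal (real (card I) * (\<kappa> * (M / real N) powr d))"
    using kap by (simp add: ennreal_of_nat_eq_real_of_nat ennreal_mult)
  also have "real (card I) * (\<kappa> * (M / real N) powr d) = \<kappa> * M powr d"
  proof -
    have "real (card I) = real N powr d"
      unfolding cardI d_def using N n by (simp add: powr_realpow[symmetric] of_nat_diff)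
    then show ?thesis using M N by (simp add: powr_divide)
  qed
  also have "M powr d = ((1 + L) * real DIM('a) * 2) powr d * \<rho> powr d"
    using L \<open>0 < \<rho>\<close> unfolding M_def by (subst powr_mult[symmetric]) auto
  finally show ?thesis by (simp add: d_def \<kappa>_def mult.assoc)
qed


lemma hausdorff_outer_graph:
  fixes h :: "'a::euclidean_space \<Rightarrow> real"
  assumes e: "norm e = 1" and h: "L-lipschitz_on {y. y \<bullet> e = 0} h" and n: "DIM('a) \<ge> 2"
  obtains A where "0 \<le> A" "\<And>S c \<rho>. S \<subseteq> {x. x \<bullet> e = h (x - (x \<bullet> e) *\<^sub>R e)} \<Longrightarrow> S \<subseteq> ball c \<rho> \<Longrightarrow> 0 < \<rho> \<Longrightarrow>
    hausdorff_outer (real DIM('a) - 1) S \<le> ennreal (A * \<rho> powr (real DIM('a) - 1))"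
proof
  show "0 \<le> unit_ball_vol (real DIM('a) - 1) / 2 powr (real DIM('a) - 1)
         * ((1 + L) * real DIM('a) * 2) powr (real DIM('a) - 1)"
    using n by (simp add: unit_ball_vol_nonneg)
next
  fix S c \<rho>
  assume "S \<subseteq> {x. x \<bullet> e = h (x - (x \<bullet> e) *\<^sub>R e)}" "S \<subseteq> ball c \<rho>" "0 < \<rho>"
  then show "hausdorff_outer (real DIM('a) - 1) S \<le> ennreal (unit_ball_vol (real DIM('a) - 1) / 2 powr (real DIM('a) - 1)
         * ((1 + L) * real DIM('a) * 2) powr (real DIM('a) - 1) * \<rho> powr (real DIM('a) - 1))"
    unfolding hausdorff_outer_def by (intro SUP_least hausdorff_content_graph[OF e h n]) auto
qed

section \<open>Surface measure, its push-forward to the whole space, and its growth on balls\<close>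

lemma sets_surface_measure: "sets (surface_measure \<Omega>) = sets (restrict_space borel (frontier \<Omega>))"
proof -
  have "sets (surface_measure \<Omega>) = sigma_sets (frontier \<Omega>) (sets (restrict_space lborel (frontier \<Omega>)))"
    unfolding surface_measure_def
    by (intro sets_measure_of) (auto simp: sets_restrict_space)
  also have "\<dots> = sets (restrict_space lborel (frontier \<Omega>))"
    using sets.sigma_sets_eq[of "restrict_space lborel (frontier \<Omega>)"]
    by (simp add: space_restrict_space)
  finally show ?thesis by (simp add: sets_restrict_space)
qed

lemma space_surface_measure: "space (surface_measure \<Omega>) = frontier \<Omega>"
  unfolding surface_measure_def by (intro space_measure_of) (auto simp: sets_restrict_space)

text \<open>\<open>measure_of\<close> yields the given set function if that is a measure on the
  generated sigma-algebra and the zero measure otherwise; the inequality holds in both cases. Later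
  estimates consult surface measure only through upper bounds of this kind.\<close>

lemma emeasure_surface_measure_le:
  "emeasure (surface_measure \<Omega>) X \<le> hausdorff_outer (real DIM('a) - 1) (X :: 'a::euclidean_space set)"
  unfolding surface_measure_def by (simp add: emeasure_measure_of_conv)

text \<open>Pushed forward to the whole space, so that all integrands below are plain Borel functions.\<close>
definition bdry_measure :: "'a::euclidean_space set \<Rightarrow> 'a measure" where
  "bdry_measure \<Omega> = distr (surface_measure \<Omega>) borel (\<lambda>x. x)"

lemma sets_bdry_measure [simp, measurable_cong]: "sets (bdry_measure \<Omega>) = sets borel"
  by (simp add: bdry_measure_def)

lemma space_bdry_measure [simp]: "space (bdry_measure \<Omega>) = UNIV"
  by (simp add: bdry_measure_def)

lemma borel_measurable_surface_measure:
  "f \<in> borel_measurable borel \<Longrightarrow> f \<in> borel_measurable (surface_measure \<Omega>)"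
  unfolding measurable_cong_sets[OF sets_surface_measure refl] by (rule measurable_restrict_space1)

lemma id_measurable_surface_measure: "(\<lambda>x. x) \<in> surface_measure \<Omega> \<rightarrow>\<^sub>M borel"
  by (rule borel_measurable_surface_measure) simp

lemma nn_integral_bdry_measure:
  "f \<in> borel_measurable borel \<Longrightarrow> (\<integral>\<^sup>+x. f x \<partial>bdry_measure \<Omega>) = (\<integral>\<^sup>+x. f x \<partial>surface_measure \<Omega>)"
  unfolding bdry_measure_def by (intro nn_integral_distr id_measurable_surface_measure) auto

lemma AE_bdry_measure: "AE x in bdry_measure \<Omega>. x \<in> frontier \<Omega>"
proof -
  have "AE x in surface_measure \<Omega>. x \<in> frontier \<Omega>"
    using AE_space[of "surface_measure \<Omega>"] by (simp add: space_surface_measure)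
  then show ?thesis
    unfolding bdry_measure_def by (subst AE_distr_iff[OF id_measurable_surface_measure]) simp_all
qed

lemma frontier_finite_cover:
  fixes \<Omega> :: "'a::euclidean_space set"
  assumes "bounded \<Omega>" and r: "\<And>p. p \<in> frontier \<Omega> \<Longrightarrow> 0 < r p"
  shows "\<exists>F. finite F \<and> F \<subseteq> frontier \<Omega> \<and> frontier \<Omega> \<subseteq> (\<Union>p\<in>F. ball p (r p))"
proof -
  have c: "compact (frontier \<Omega>)" using assms by (simp add: compact_frontier_bounded)
  have s: "frontier \<Omega> \<subseteq> (\<Union>p\<in>frontier \<Omega>. ball p (r p))" using r by force
  show ?thesis
    by (rule compactE_image[OF c _ s]) auto
qed

definition graph_chart :: "'a::euclidean_space set \<Rightarrow> 'a \<Rightarrow> real \<Rightarrow> 'a \<Rightarrow> real \<Rightarrow> ('a \<Rightarrow> real) \<Rightarrow> bool" where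
  "graph_chart \<Omega> p r e L h \<longleftrightarrow> 0 < r \<and> norm e = 1 \<and> L-lipschitz_on {y. y \<bullet> e = 0} h \<and>
      (\<forall>x \<in> ball p r. x \<in> \<Omega> \<longleftrightarrow> x \<bullet> e > h (x - (x \<bullet> e) *\<^sub>R e))"

lemma lipschitz_domain_charts:
  fixes \<Omega> :: "'a::euclidean_space set"
  assumes "lipschitz_domain \<Omega>"
  shows "\<exists>r e L h. \<forall>p\<in>frontier \<Omega>. graph_chart \<Omega> p (r p) (e p) (L p) (h p)"
proof -
  have "\<forall>p\<in>frontier \<Omega>. \<exists>r e L h. graph_chart \<Omega> p r e L h"
    using assms unfolding lipschitz_domain_def graph_chart_def by blast
  then show ?thesis unfolding bchoice_iff .
qed

text \<open>Compactness gives finitely many charts. In each of them the graph estimate holds for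
  balls of every radius and centre, since the set is first cut down to the chart; the constants of
  the charts then add up.\<close>

lemma bdry_measure_upper_regular:
  fixes \<Omega> :: "'a::euclidean_space set"
  assumes \<Omega>: "lipschitz_domain \<Omega>" and n: "DIM('a) \<ge> 2"
  obtains A where "0 \<le> A"
    "\<And>z r. 0 < r \<Longrightarrow> emeasure (bdry_measure \<Omega>) (ball z r) \<le> ennreal (A * r powr (real DIM('a) - 1))"
proof -
  let ?d = "real DIM('a) - 1"
  have open_domain: "open \<Omega>" and bd: "bounded \<Omega>" using \<Omega> by (auto simp: lipschitz_domain_def)
  obtain r e h L where charts: "\<forall>p\<in>frontier \<Omega>. graph_chart \<Omega> p (r p) (e p) (L p) (h p)"
    using lipschitz_domain_charts[OF \<Omega>] by blast
  then have ch: "\<And>p. p \<in> frontier \<Omega> \<Longrightarrow> 0 < r p" "\<And>p. p \<in> frontier \<Omega> \<Longrightarrow> norm (e p) = 1"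
    "\<And>p. p \<in> frontier \<Omega> \<Longrightarrow> (L p)-lipschitz_on {y. y \<bullet> e p = 0} (h p :: 'a \<Rightarrow> real)"
    "\<And>p x. p \<in> frontier \<Omega> \<Longrightarrow> x \<in> ball p (r p) \<Longrightarrow> x \<in> \<Omega> \<longleftrightarrow> x \<bullet> e p > h p (x - (x \<bullet> e p) *\<^sub>R e p)"
    unfolding graph_chart_def by auto
  have "\<exists>F. finite F \<and> F \<subseteq> frontier \<Omega> \<and> frontier \<Omega> \<subseteq> (\<Union>p\<in>F. ball p (r p))"
    using bd ch(1) by (rule frontier_finite_cover)
  then obtain F where F: "finite F" "F \<subseteq> frontier \<Omega>" "frontier \<Omega> \<subseteq> (\<Union>p\<in>F. ball p (r p))"
    by (elim exE conjE)
  have "\<forall>p\<in>F. \<exists>A\<ge>0. \<forall>z \<rho>. 0 < \<rho> \<longrightarrow>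
     hausdorff_outer ?d (frontier \<Omega> \<inter> ball p (r p) \<inter> ball z \<rho>) \<le> ennreal (A * \<rho> powr ?d)"
  proof
    fix p assume "p \<in> F"
    then have p: "p \<in> frontier \<Omega>" using F by auto
    obtain A where A: "0 \<le> A" "\<And>S c \<rho>. S \<subseteq> {x. x \<bullet> e p = h p (x - (x \<bullet> e p) *\<^sub>R e p)} \<Longrightarrow> S \<subseteq> ball c \<rho> \<Longrightarrow> 0 < \<rho> \<Longrightarrow>
      hausdorff_outer ?d S \<le> ennreal (A * \<rho> powr ?d)"
      by (rule hausdorff_outer_graph[OF ch(2)[OF p] ch(3)[OF p] n]) blast
    have "frontier \<Omega> \<inter> ball p (r p) \<subseteq> {x. x \<bullet> e p = h p (x - (x \<bullet> e p) *\<^sub>R e p)}"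
      using frontier_subset_graph[OF open_domain ch(2)[OF p] ch(3)[OF p] ch(4)[OF p]] by blast
    then show "\<exists>A\<ge>0. \<forall>z \<rho>. 0 < \<rho> \<longrightarrow>
     hausdorff_outer ?d (frontier \<Omega> \<inter> ball p (r p) \<inter> ball z \<rho>) \<le> ennreal (A * \<rho> powr ?d)"
      using A by (intro exI[of _ A]) blast
  qed
  then obtain A where A: "\<And>p. p \<in> F \<Longrightarrow> 0 \<le> A p"
    "\<And>p z \<rho>. p \<in> F \<Longrightarrow> 0 < \<rho> \<Longrightarrow> hausdorff_outer ?d (frontier \<Omega> \<inter> ball p (r p) \<inter> ball z \<rho>) \<le> ennreal (A p * \<rho> powr ?d)"
    unfolding bchoice_iff by blast
  show thesis
  proof
    show "0 \<le> (\<Sum>p\<in>F. A p)" using A by (intro sum_nonneg)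
    fix z \<rho> assume \<rho>: "(0::real) < \<rho>"
    let ?S = "\<lambda>p. frontier \<Omega> \<inter> ball p (r p) \<inter> ball z \<rho>"
    have S: "?S p \<in> sets (surface_measure \<Omega>)" for p
      unfolding sets_surface_measure sets_restrict_space by (auto intro!: image_eqI[of _ _ "ball p (r p) \<inter> ball z \<rho>"])
    have "emeasure (bdry_measure \<Omega>) (ball z \<rho>) = emeasure (surface_measure \<Omega>) (ball z \<rho> \<inter> frontier \<Omega>)"
      unfolding bdry_measure_def
      by (subst emeasure_distr[OF id_measurable_surface_measure]) (auto simp: space_surface_measure)
    also have "\<dots> \<le> emeasure (surface_measure \<Omega>) (\<Union>p\<in>F. ?S p)"
      using F(3) S by (intro emeasure_mono sets.finite_UN F) auto
    also have "\<dots> \<le> (\<Sum>p\<in>F. emeasure (surface_measure \<Omega>) (?S p))"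
      using S F by (intro emeasure_subadditive_finite) auto
    also have "\<dots> \<le> (\<Sum>p\<in>F. ennreal (A p * \<rho> powr ?d))"
      using A \<rho> by (intro sum_mono order_trans[OF emeasure_surface_measure_le]) auto
    also have "\<dots> = ennreal ((\<Sum>p\<in>F. A p) * \<rho> powr ?d)"
      using A by (subst sum_ennreal) (auto simp: sum_distrib_right)
    finally show "emeasure (bdry_measure \<Omega>) (ball z \<rho>) \<le> ennreal ((\<Sum>p\<in>F. A p) * \<rho> powr ?d)" .
  qed
qed

text \<open>Locally the frontier lies in the image of a hyperplane under the Lipschitz map y -> y +
  h(y) e. The result is needed because on the frontier the single layer potential is
  \<open>T\<close> applied to a singular kernel, a value over which nothing is known; it must be
  invisible to volume integrals.\<close>

lemma negligible_frontier_lipschitz_domain: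
  fixes \<Omega> :: "'a::euclidean_space set"
  assumes \<Omega>: "lipschitz_domain \<Omega>"
  shows "negligible (frontier \<Omega>)"
proof -
  have open_domain: "open \<Omega>" and bd: "bounded \<Omega>" using \<Omega> by (auto simp: lipschitz_domain_def)
  obtain r e h L where charts: "\<forall>p\<in>frontier \<Omega>. graph_chart \<Omega> p (r p) (e p) (L p) (h p)"
    using lipschitz_domain_charts[OF \<Omega>] by blast
  then have ch: "\<And>p. p \<in> frontier \<Omega> \<Longrightarrow> 0 < r p" "\<And>p. p \<in> frontier \<Omega> \<Longrightarrow> norm (e p) = 1"
    "\<And>p. p \<in> frontier \<Omega> \<Longrightarrow> (L p)-lipschitz_on {y. y \<bullet> e p = 0} (h p :: 'a \<Rightarrow> real)"
    "\<And>p x. p \<in> frontier \<Omega> \<Longrightarrow> x \<in> ball p (r p) \<Longrightarrow> x \<in> \<Omega> \<longleftrightarrow> x \<bullet> e p > h p (x - (x \<bullet> e p) *\<^sub>R e p)"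
    unfolding graph_chart_def by auto
  have "\<exists>F. finite F \<and> F \<subseteq> frontier \<Omega> \<and> frontier \<Omega> \<subseteq> (\<Union>p\<in>F. ball p (r p))"
    using bd ch(1) by (rule frontier_finite_cover)
  then obtain F where F: "finite F" "F \<subseteq> frontier \<Omega>" "frontier \<Omega> \<subseteq> (\<Union>p\<in>F. ball p (r p))"
    by (elim exE conjE)
  have "negligible (frontier \<Omega> \<inter> ball p (r p))" if "p \<in> F" for p
  proof -
    have p: "p \<in> frontier \<Omega>" using F that by auto
    have ee: "e p \<bullet> e p = 1" using ch(2)[OF p] by (simp add: norm_eq_1)
    let ?H = "{y. y \<bullet> e p = 0}"
    let ?g = "\<lambda>y. y + h p y *\<^sub>R e p"
    have "negligible ?H"
    proof -
      have "{y. y \<bullet> e p = 0} = {y. e p \<bullet> y = 0}" by (simp add: inner_commute)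
      moreover have "e p \<noteq> 0" using ch(2)[OF p] by auto
      ultimately show ?thesis using negligible_hyperplane[of "e p" 0] by simp
    qed
    moreover have "norm (?g y - ?g x) \<le> (1 + L p) * norm (y - x)" if "x \<in> ?H" "y \<in> ?H" for x y
    proof -
      have "norm (?g y - ?g x) = norm ((y - x) + (h p y - h p x) *\<^sub>R e p)" by (simp add: algebra_simps)
      also have "\<dots> \<le> norm (y - x) + norm ((h p y - h p x) *\<^sub>R e p)" by (rule norm_triangle_ineq)
      also have "norm ((h p y - h p x) *\<^sub>R e p) = \<bar>h p y - h p x\<bar>" using ch(2)[OF p] by simp
      also have "\<dots> \<le> L p * norm (y - x)"
        using lipschitz_onD[OF ch(3)[OF p] that(2,1)] by (simp add: dist_norm)
      finally show ?thesis by (simp add: algebra_simps)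
    qed
    ultimately have "negligible (?g ` ?H)"
      by (intro negligible_locally_Lipschitz_image) (auto intro!: exI[of _ UNIV])
    moreover have "frontier \<Omega> \<inter> ball p (r p) \<subseteq> ?g ` ?H"
    proof
      fix x assume "x \<in> frontier \<Omega> \<inter> ball p (r p)"
      then have "x \<bullet> e p = h p (x - (x \<bullet> e p) *\<^sub>R e p)"
        using frontier_subset_graph[OF open_domain ch(2)[OF p] ch(3)[OF p] ch(4)[OF p]] by blast
      then show "x \<in> ?g ` ?H"
        by (intro image_eqI[of _ _ "x - (x \<bullet> e p) *\<^sub>R e p"]) (auto simp: inner_diff_left ee)
    qed
    ultimately show ?thesis by (rule negligible_subset)
  qed
  then have "negligible (\<Union>p\<in>F. frontier \<Omega> \<inter> ball p (r p))"
    using F by (intro negligible_Union) auto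
  then show ?thesis by (rule negligible_subset) (use F in auto)
qed

text \<open>The whole region far from the boundary, rather than a ball around a chosen centre: it depends
  measurably on \<open>P\<close> without any selection argument.\<close>
definition corkscrew :: "'a::euclidean_space set \<Rightarrow> real \<Rightarrow> 'a \<Rightarrow> real \<Rightarrow> 'a set" where
  "corkscrew \<Omega> c P r = {x \<in> \<Omega>. dist x P < r \<and> c * r < infdist x (frontier \<Omega>)}"

lemma open_corkscrew: "open \<Omega> \<Longrightarrow> open (corkscrew \<Omega> c P r)"
proof -
  assume "open \<Omega>"
  have "corkscrew \<Omega> c P r = \<Omega> \<inter> ball P r \<inter> (\<lambda>x. infdist x (frontier \<Omega>)) -` {c * r<..}"
    by (auto simp: corkscrew_def dist_commute)
  moreover have "open ((\<lambda>x. infdist x (frontier \<Omega>)) -` {c * r<..})"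
    by (intro open_vimage continuous_intros open_greaterThan)
  ultimately show ?thesis using \<open>open \<Omega>\<close> by auto
qed

lemma corkscrew_mono: "c' \<le> c \<Longrightarrow> 0 < r \<Longrightarrow> corkscrew \<Omega> c P r \<subseteq> corkscrew \<Omega> c' P r"
proof -
  assume "c' \<le> c" "0 < r"
  then have "c' * r \<le> c * r" by (intro mult_right_mono) auto
  then show ?thesis by (auto simp: corkscrew_def)
qed

text \<open>Moving from \<open>P\<close> by \<rho>/2 in the direction \<open>e\<close> reaches a
  point well above the graph. A perturbation w changes the height over the graph by at most (1 +
  L)|w|, so a ball of radius proportional to \<rho>/(1 + L) stays inside the domain.\<close>

lemma corkscrew_near_chart:
  fixes \<Omega> :: "'a::euclidean_space set"
  assumes open_domain: "open \<Omega>" and e: "norm e = 1" and h: "L-lipschitz_on {y. y \<bullet> e = 0} h" and "0 < r"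
    and chart: "\<And>x. x \<in> ball p r \<Longrightarrow> x \<in> \<Omega> \<longleftrightarrow> x \<bullet> e > h (x - (x \<bullet> e) *\<^sub>R e)"
  obtains c where "0 < c" "\<And>P \<rho>. P \<in> frontier \<Omega> \<inter> ball p (r/2) \<Longrightarrow> 0 < \<rho> \<Longrightarrow> \<rho> \<le> r / 2 \<Longrightarrow>
     \<exists>x. ball x (c * \<rho>) \<subseteq> corkscrew \<Omega> c P \<rho>"
proof -
  have L: "0 \<le> L" using h by (rule lipschitz_on_nonneg)
  have ee: "e \<bullet> e = 1" using e by (simp add: norm_eq_1)
  \<comment> \<open>Chosen so that (1 + L) \<kappa> = 1/4, half of the available height 1/2.\<close>
  define \<kappa> where "\<kappa> = 1 / (4 * (1 + L))"
  have k: "0 < \<kappa>" "\<kappa> \<le> 1/4" "(1 + L) * \<kappa> = 1/4" using L by (auto simp: \<kappa>_def field_simps)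
  show thesis
  proof (rule that[of "\<kappa> / 4"])
    show "0 < \<kappa> / 4" using k by simp
    fix P \<rho> assume P: "P \<in> frontier \<Omega> \<inter> ball p (r/2)" and \<rho>: "0 < \<rho>" "\<rho> \<le> r / 2"
    let ?Q = "\<lambda>z. z - (z \<bullet> e) *\<^sub>R e"
    have "P \<in> frontier \<Omega> \<inter> ball p r" using P \<open>0 < r\<close> by auto
    then have Pe: "P \<bullet> e = h (?Q P)" using frontier_subset_graph[OF open_domain e h chart] by blast
    define x where "x = P + (\<rho>/2) *\<^sub>R e"
    have big: "z \<in> \<Omega>" if "dist z x < \<kappa> * \<rho>" for z
    proof -
      define w where "w = z - x"
      have w: "norm w < \<kappa> * \<rho>" using that by (simp add: w_def dist_norm)
      have z: "z = P + (\<rho>/2) *\<^sub>R e + w" by (simp add: w_def x_def)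
      have "\<kappa> * \<rho> \<le> \<rho> / 4" using k \<rho> mult_right_mono[of \<kappa> "1/4" \<rho>] by simp
      moreover have "norm ((\<rho>/2) *\<^sub>R e) = \<rho>/2" using e \<rho> by simp
      ultimately have "norm ((\<rho>/2) *\<^sub>R e + w) < \<rho>"
        using norm_triangle_ineq[of "(\<rho>/2) *\<^sub>R e" w] w \<rho> by linarith
      moreover have "z - P = (\<rho>/2) *\<^sub>R e + w" unfolding z by simp
      ultimately have "dist P z < \<rho>" by (metis dist_commute dist_norm)
      then have zb: "z \<in> ball p r" using P \<rho> dist_triangle[of p z P] by auto
      have Qz: "?Q z - ?Q P = ?Q w" unfolding z by (simp add: inner_add_left ee algebra_simps)
      have "norm (?Q w) \<le> norm w"
      proof -
        have "(norm (?Q w))\<^sup>2 = (norm w)\<^sup>2 - (w \<bullet> e)\<^sup>2"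
          unfolding power2_norm_eq_inner
          by (simp add: inner_diff_left inner_diff_right ee inner_commute[of e w] power2_eq_square algebra_simps)
        then have "(norm (?Q w))\<^sup>2 \<le> (norm w)\<^sup>2" by simp
        then show ?thesis by (rule power2_le_imp_le) simp
      qed
      have "h (?Q z) - h (?Q P) \<le> L * dist (?Q z) (?Q P)"
      proof -
        have "?Q y \<in> {y. y \<bullet> e = 0}" for y by (simp add: inner_diff_left ee)
        from lipschitz_onD[OF h this this, of z P] show ?thesis by (simp add: dist_real_def)
      qed
      also have "dist (?Q z) (?Q P) = norm (?Q w)" using Qz by (simp add: dist_norm)
      also have "L * norm (?Q w) \<le> L * norm w" using \<open>norm (?Q w) \<le> norm w\<close> L by (rule mult_left_mono)
      finally have 1: "h (?Q z) \<le> P \<bullet> e + L * norm w" using Pe by simp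
      have "\<bar>w \<bullet> e\<bar> \<le> norm w" using Cauchy_Schwarz_ineq2[of w e] e by simp
      then have 2: "z \<bullet> e \<ge> P \<bullet> e + \<rho>/2 - norm w" unfolding z by (simp add: inner_add_left ee)
      have "(1 + L) * norm w \<le> (1 + L) * (\<kappa> * \<rho>)" using w L by (intro mult_left_mono) auto
      also have "\<dots> = \<rho> / 4" using k(3) by (simp add: mult.assoc[symmetric])
      finally have "norm w + L * norm w < \<rho> / 2" using \<rho> by (simp add: algebra_simps)
      with 1 2 have "z \<bullet> e > h (?Q z)" by linarith
      then show "z \<in> \<Omega>" using chart[OF zb] by simp
    qed
    \<comment> \<open>The ball of radius \<kappa>\<rho> lies in the domain. Shrinking it to a
      quarter leaves each of its points at distance at least \<kappa>\<rho>/2 from the frontier,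
      which exceeds the required \<kappa>\<rho>/4.\<close>
    have "ball x (\<kappa> / 4 * \<rho>) \<subseteq> corkscrew \<Omega> (\<kappa> / 4) P \<rho>"
    proof
      fix z assume "z \<in> ball x (\<kappa> / 4 * \<rho>)"
      then have z: "dist z x < \<kappa> / 4 * \<rho>" by (simp add: dist_commute)
      have kr: "0 < \<kappa> * \<rho>" "\<kappa> * \<rho> \<le> \<rho> / 4" using k \<rho> mult_right_mono[of \<kappa> "1/4" \<rho>] by auto
      have "z \<in> \<Omega>" using big[of z] z kr by simp
      moreover have "dist z P < \<rho>"
      proof -
        have "dist x P = \<rho> / 2" using e \<rho> by (simp add: x_def dist_norm)
        then show ?thesis using dist_triangle[of z P x] z kr \<rho> by (simp; linarith)
      qed
      moreover have "\<kappa> / 4 * \<rho> < infdist z (frontier \<Omega>)"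
      proof -
        have "\<kappa> * \<rho> / 2 \<le> dist z y" if "y \<in> frontier \<Omega>" for y
        proof (rule ccontr)
          assume "\<not> \<kappa> * \<rho> / 2 \<le> dist z y"
          then have "dist y x < \<kappa> * \<rho>" using z dist_triangle[of y x z] kr by (simp add: dist_commute)
          then have "y \<in> \<Omega>" by (rule big)
          then show False using that open_domain by (simp add: frontier_def interior_open)
        qed
        then have "\<kappa> * \<rho> / 2 \<le> infdist z (frontier \<Omega>)"
          using P by (subst infdist_notempty) (blast intro: cINF_greatest)+
        then show ?thesis using kr by simp
      qed
      ultimately show "z \<in> corkscrew \<Omega> (\<kappa> / 4) P \<rho>" by (simp add: corkscrew_def)
    qed
    then show "\<exists>x. ball x (\<kappa> / 4 * \<rho>) \<subseteq> corkscrew \<Omega> (\<kappa> / 4) P \<rho>" by blast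
  qed
qed

text \<open>A single constant plays three roles: opening of the region, largest admissible scale,
  and relative volume. Lowering the opening enlarges the region (\<open>corkscrew_mono\<close>), so
  one minimum over the finitely many charts serves all of them.\<close>

lemma corkscrew_condition:
  fixes \<Omega> :: "'a::euclidean_space set"
  assumes \<Omega>: "lipschitz_domain \<Omega>"
  obtains c where "0 < c" "c < 1" "\<And>P \<rho>. P \<in> frontier \<Omega> \<Longrightarrow> 0 < \<rho> \<Longrightarrow> \<rho> \<le> c \<Longrightarrow>
     ennreal (c * \<rho> ^ DIM('a)) \<le> emeasure lborel (corkscrew \<Omega> c P \<rho>)"
proof -
  let ?n = "DIM('a)"
  have open_domain: "open \<Omega>" and bd: "bounded \<Omega>" using \<Omega> by (auto simp: lipschitz_domain_def)
  obtain r e h L where charts: "\<forall>p\<in>frontier \<Omega>. graph_chart \<Omega> p (r p) (e p) (L p) (h p)"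
    using lipschitz_domain_charts[OF \<Omega>] by blast
  then have ch: "\<And>p. p \<in> frontier \<Omega> \<Longrightarrow> 0 < r p" "\<And>p. p \<in> frontier \<Omega> \<Longrightarrow> norm (e p) = 1"
    "\<And>p. p \<in> frontier \<Omega> \<Longrightarrow> (L p)-lipschitz_on {y. y \<bullet> e p = 0} (h p :: 'a \<Rightarrow> real)"
    "\<And>p x. p \<in> frontier \<Omega> \<Longrightarrow> x \<in> ball p (r p) \<Longrightarrow> x \<in> \<Omega> \<longleftrightarrow> x \<bullet> e p > h p (x - (x \<bullet> e p) *\<^sub>R e p)"
    unfolding graph_chart_def by auto
  have "\<exists>F. finite F \<and> F \<subseteq> frontier \<Omega> \<and> frontier \<Omega> \<subseteq> (\<Union>p\<in>F. ball p (r p / 2))"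
    using bd by (rule frontier_finite_cover) (use ch(1) in auto)
  then obtain F where F: "finite F" "F \<subseteq> frontier \<Omega>" "frontier \<Omega> \<subseteq> (\<Union>p\<in>F. ball p (r p / 2))"
    by (elim exE conjE)
  have "\<forall>p\<in>F. \<exists>c>0. \<forall>P \<rho>. P \<in> frontier \<Omega> \<inter> ball p (r p/2) \<longrightarrow> 0 < \<rho> \<longrightarrow> \<rho> \<le> r p / 2 \<longrightarrow>
     (\<exists>x. ball x (c * \<rho>) \<subseteq> corkscrew \<Omega> c P \<rho>)"
  proof
    fix p assume "p \<in> F"
    then have p: "p \<in> frontier \<Omega>" using F by auto
    show "\<exists>c>0. \<forall>P \<rho>. P \<in> frontier \<Omega> \<inter> ball p (r p/2) \<longrightarrow> 0 < \<rho> \<longrightarrow> \<rho> \<le> r p / 2 \<longrightarrow>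
     (\<exists>x. ball x (c * \<rho>) \<subseteq> corkscrew \<Omega> c P \<rho>)"
      by (rule corkscrew_near_chart[OF open_domain ch(2)[OF p] ch(3)[OF p] ch(1)[OF p] ch(4)[OF p]]) blast+
  qed
  then obtain c where c: "\<And>p. p \<in> F \<Longrightarrow> 0 < c p" "\<And>p P \<rho>. p \<in> F \<Longrightarrow> P \<in> frontier \<Omega> \<inter> ball p (r p/2) \<Longrightarrow>
     0 < \<rho> \<Longrightarrow> \<rho> \<le> r p / 2 \<Longrightarrow> \<exists>x. ball x (c p * \<rho>) \<subseteq> corkscrew \<Omega> (c p) P \<rho>"
    unfolding bchoice_iff by blast
  define m where "m = Min (insert (1/2) (c ` F \<union> (\<lambda>p. r p / 2) ` F))"
  have fin: "finite (insert (1/2) (c ` F \<union> (\<lambda>p. r p / 2) ` F))" using F by auto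
  have m: "0 < m" "m \<le> 1/2" "\<And>p. p \<in> F \<Longrightarrow> m \<le> c p" "\<And>p. p \<in> F \<Longrightarrow> m \<le> r p / 2"
  proof -
    show "0 < m" unfolding m_def using fin c(1) ch(1) F(2) by (subst Min_gr_iff) auto
    show "m \<le> 1/2" unfolding m_def using fin by (rule Min_le) simp
    show "m \<le> c p" if "p \<in> F" for p unfolding m_def using fin by (rule Min_le) (use that in simp)
    show "m \<le> r p / 2" if "p \<in> F" for p unfolding m_def using fin by (rule Min_le) (use that in simp)
  qed
  define V where "V = unit_ball_vol (real ?n) * m ^ ?n"
  have V: "0 < V" using m by (simp add: V_def unit_ball_vol_pos)
  \<comment> \<open>\<open>m\<close> takes care of opening and scale, \<open>V\<close> of the volume
    of the inscribed ball of radius m\<rho>.\<close>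
  define c' where "c' = min m V"
  have c': "0 < c'" "c' \<le> m" "c' \<le> V" using m V by (auto simp: c'_def)
  show thesis
  proof (rule that[of c'])
    show "0 < c'" "c' < 1" using c' m by auto
    fix P \<rho> assume P: "P \<in> frontier \<Omega>" and \<rho>: "0 < \<rho>" "\<rho> \<le> c'"
    obtain p where p: "p \<in> F" "P \<in> ball p (r p/2)" using P F(3) by auto
    then obtain x where x: "ball x (c p * \<rho>) \<subseteq> corkscrew \<Omega> (c p) P \<rho>"
      using c(2)[of p P \<rho>] P \<rho> c' m(4)[of p] by auto
    have "ball x (m * \<rho>) \<subseteq> ball x (c p * \<rho>)"
      using m(3)[OF p(1)] \<rho> by (intro subset_ball mult_right_mono) auto
    also have "\<dots> \<subseteq> corkscrew \<Omega> (c p) P \<rho>" by (rule x)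
    also have "\<dots> \<subseteq> corkscrew \<Omega> c' P \<rho>" using c' m(3)[OF p(1)] \<rho> by (intro corkscrew_mono) auto
    finally have sub: "ball x (m * \<rho>) \<subseteq> corkscrew \<Omega> c' P \<rho>" .
    have "ennreal (c' * \<rho> ^ ?n) \<le> ennreal (V * \<rho> ^ ?n)" using c' \<rho> by (intro ennreal_leI mult_right_mono) auto
    also have "\<dots> = ennreal (unit_ball_vol (real ?n) * (m * \<rho>) ^ ?n)"
      by (simp add: V_def power_mult_distrib mult.assoc)
    also have "\<dots> = emeasure lborel (ball x (m * \<rho>))"
      using m \<rho> by (simp add: emeasure_ball)
    also have "\<dots> \<le> emeasure lborel (corkscrew \<Omega> c' P \<rho>)"
      using sub open_domain by (intro emeasure_mono) (auto simp: open_corkscrew)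
    finally show "ennreal (c' * \<rho> ^ ?n) \<le> emeasure lborel (corkscrew \<Omega> c' P \<rho>)" .
  qed
qed

section \<open>Fractional Sobolev spaces and Riesz representation\<close>

text \<open>The discriminant criterion. It is used twice below: for the Cauchy-Schwarz inequality of
  a semidefinite form, and for the approximate Euler-Lagrange equation at a near-minimiser.\<close>

lemma quadratic_nonneg_imp:
  fixes a b c :: real
  assumes "\<And>t. 0 \<le> a + 2 * t * b + t\<^sup>2 * c" "0 \<le> a" "0 \<le> c"
  shows "b\<^sup>2 \<le> a * c"
proof (cases "c = 0")
  case True
  have "b = 0"
  proof (rule ccontr)
    assume "b \<noteq> 0"
    then show False using assms(1)[of "- (a + 1) / (2 * b)"] True by (simp add: field_simps)
  qed
  then show ?thesis using True by simp
next
  case False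
  then have c: "0 < c" using assms by simp
  have "0 \<le> a + 2 * (- b / c) * b + (- b / c)\<^sup>2 * c" by (rule assms(1))
  also have "\<dots> = a - b\<^sup>2 / c" using c by (simp add: power2_eq_square field_simps)
  finally show ?thesis using c by (simp add: field_simps)
qed

lemma abs_le_of_square_le: "x\<^sup>2 \<le> y\<^sup>2 \<Longrightarrow> 0 \<le> y \<Longrightarrow> \<bar>x\<bar> \<le> (y::real)"
  using abs_le_square_iff[of x y] by simp

text \<open>No quotient by null functions and no type-class instance: approximate minimisers of \<open>B f f - 2 T f\<close> form a Cauchy sequence by the parallelogram law.\<close>
lemma riesz_representation:
  fixes V :: "('x \<Rightarrow> real) set" and B :: "('x \<Rightarrow> real) \<Rightarrow> ('x \<Rightarrow> real) \<Rightarrow> real" and T :: "('x \<Rightarrow> real) \<Rightarrow> real"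
  assumes V: "\<And>f g a b. f \<in> V \<Longrightarrow> g \<in> V \<Longrightarrow> (\<lambda>x. a * f x + b * g x) \<in> V" "(\<lambda>_. 0) \<in> V"
    and sym: "\<And>f g. f \<in> V \<Longrightarrow> g \<in> V \<Longrightarrow> B f g = B g f"
    and lin: "\<And>f g h a b. f \<in> V \<Longrightarrow> g \<in> V \<Longrightarrow> h \<in> V \<Longrightarrow> B (\<lambda>x. a * f x + b * g x) h = a * B f h + b * B g h"
    and pos: "\<And>f. f \<in> V \<Longrightarrow> 0 \<le> B f f"
    and T: "\<And>f g a b. f \<in> V \<Longrightarrow> g \<in> V \<Longrightarrow> T (\<lambda>x. a * f x + b * g x) = a * T f + b * T g"
      "\<And>f. f \<in> V \<Longrightarrow> \<bar>T f\<bar> \<le> C * sqrt (B f f)"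
    and complete: "\<And>F. (\<And>k::nat. F k \<in> V) \<Longrightarrow>
      (\<And>k j. k \<le> j \<Longrightarrow> B (\<lambda>x. F k x - F j x) (\<lambda>x. F k x - F j x) \<le> (1/4) ^ k) \<Longrightarrow>
      \<exists>f\<in>V. \<forall>k. B (\<lambda>x. F k x - f x) (\<lambda>x. F k x - f x) \<le> (1/4) ^ k"
  shows "\<exists>\<tau>\<in>V. \<forall>f\<in>V. T f = B \<tau> f"
proof -
  define J where "J f = B f f - 2 * T f" for f
  have lin2: "B h (\<lambda>x. a * f x + b * g x) = a * B h f + b * B h g" if "f \<in> V" "g \<in> V" "h \<in> V" for f g h a b
    using lin[OF that] sym that V(1)[OF that(1,2)] by simp
  have Bquad: "B (\<lambda>x. a * f x + b * g x) (\<lambda>x. a * f x + b * g x) = a\<^sup>2 * B f f + 2 * a * b * B f g + b\<^sup>2 * B g g"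
    if "f \<in> V" "g \<in> V" for f g a b
  proof -
    have "B (\<lambda>x. a * f x + b * g x) (\<lambda>x. a * f x + b * g x)
      = a * B f (\<lambda>x. a * f x + b * g x) + b * B g (\<lambda>x. a * f x + b * g x)"
      using that V(1)[OF that] by (intro lin)
    then show ?thesis using that lin2 sym[of g f] by (simp add: power2_eq_square algebra_simps)
  qed
  have CS: "(B f g)\<^sup>2 \<le> B f f * B g g" if "f \<in> V" "g \<in> V" for f g
  proof (rule quadratic_nonneg_imp)
    fix t :: real
    show "0 \<le> B f f + 2 * t * B f g + t\<^sup>2 * B g g"
      using pos[OF V(1)[OF that, of 1 t]] unfolding Bquad[OF that] by simp
  qed (use pos that in auto)
  \<comment> \<open>Completing the square: \<open>J f\<close> is at least b^2 - 2 C b with b = sqrt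
    (B f f), and this is at least -C^2.\<close>
  have J_lower: "- C\<^sup>2 \<le> J f" if "f \<in> V" for f
  proof -
    have "\<bar>T f\<bar> \<le> C * sqrt (B f f)" by (rule T(2)[OF that])
    moreover have "0 \<le> (sqrt (B f f) - C)\<^sup>2" by simp
    ultimately show ?thesis using pos[OF that] by (simp add: J_def power2_diff abs_le_iff algebra_simps)
  qed
  define m where "m = Inf (J ` V)"
  have bounded_domain: "bdd_below (J ` V)" using J_lower by (intro bdd_belowI[of _ "- C\<^sup>2"]) auto
  have m: "m \<le> J f" if "f \<in> V" for f unfolding m_def using bounded_domain that by (intro cInf_lower) auto
  \<comment> \<open>With this rate the parallelogram law bounds the distance of the k-th and j-th
    minimisers by 2 \<epsilon> k + 2 \<epsilon> j, at most 4 \<epsilon> k = (1/4)^k for k <= j,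
    exactly the rate that \<open>complete\<close> asks for.\<close>
  define \<epsilon> :: "nat \<Rightarrow> real" where "\<epsilon> k = (1/4) ^ k / 4" for k
  have eps: "0 < \<epsilon> k" for k by (simp add: \<epsilon>_def)
  have "\<exists>f\<in>V. J f < m + \<epsilon> k" for k
  proof -
    have "Inf (J ` V) < m + \<epsilon> k" using eps by (simp add: m_def)
    then show ?thesis using cInf_lessD[of "J ` V"] V(2) by auto
  qed
  then obtain F where F: "\<And>k. F k \<in> V" "\<And>k. J (F k) < m + \<epsilon> k" by metis
  have Jmid: "B (\<lambda>x. f x - g x) (\<lambda>x. f x - g x) = 2 * J f + 2 * J g - 4 * J (\<lambda>x. (1/2) * f x + (1/2) * g x)"
    if "f \<in> V" "g \<in> V" for f g
  proof -
    have 1: "(\<lambda>x. f x - g x) = (\<lambda>x. 1 * f x + (-1) * g x)" by simp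
    show ?thesis
      unfolding J_def 1 Bquad[OF that] T(1)[OF that] by (simp add: power2_eq_square)
  qed
  have cauchy: "B (\<lambda>x. F k x - F j x) (\<lambda>x. F k x - F j x) \<le> (1/4) ^ k" if "k \<le> j" for k j
  proof -
    have "(1/4::real) ^ j \<le> (1/4) ^ k" using that by (intro power_decreasing) auto
    then show ?thesis
      using F(2)[of k] F(2)[of j] m[OF V(1)[OF F(1) F(1)], of "1/2" k "1/2" j]
      unfolding Jmid[OF F(1) F(1)] \<epsilon>_def by linarith
  qed
  obtain \<tau> where \<tau>: "\<tau> \<in> V" "\<And>k. B (\<lambda>x. F k x - \<tau> x) (\<lambda>x. F k x - \<tau> x) \<le> (1/4) ^ k"
    using complete[OF F(1) cauchy] by blast
  have "T f = B \<tau> f" if f: "f \<in> V" for f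
  proof -
    have sq: "(1/4::real) ^ k = ((1/2) ^ k)\<^sup>2" for k :: nat
      by (simp add: power2_eq_square power_mult_distrib[symmetric])
    have 1: "\<bar>B (F k) f - T f\<bar> \<le> (1/2) ^ k * sqrt (B f f)" for k
    proof -
      have "(B (F k) f - T f)\<^sup>2 \<le> \<epsilon> k * B f f"
      proof (rule quadratic_nonneg_imp)
        fix t :: real
        \<comment> \<open>Near-minimality says that moving from \<open>F k\<close> in the direction
          f lowers J by at most \<epsilon> k. The resulting quadratic in t is nonnegative, and its
          discriminant bounds the defect \<open>B (F k) f - T f\<close>.\<close>
        have "J (\<lambda>x. 1 * F k x + t * f x) = J (F k) + 2 * t * (B (F k) f - T f) + t\<^sup>2 * B f f"
          unfolding J_def Bquad[OF F(1) f] T(1)[OF F(1) f] by (simp add: algebra_simps)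
        then show "0 \<le> \<epsilon> k + 2 * t * (B (F k) f - T f) + t\<^sup>2 * B f f"
          using m[OF V(1)[OF F(1)[of k] f], of 1 t] F(2)[of k] by linarith
      qed (use eps[of k] pos[OF f] in auto)
      also have "\<dots> \<le> (1/4) ^ k * B f f" using pos[OF f] by (simp add: \<epsilon>_def mult_right_mono)
      also have "\<dots> = ((1/2) ^ k * sqrt (B f f))\<^sup>2"
        using pos[OF f] by (simp add: sq power_mult_distrib)
      finally show ?thesis using pos[OF f] by (intro abs_le_of_square_le) auto
    qed
    have 2: "\<bar>B (F k) f - B \<tau> f\<bar> \<le> (1/2) ^ k * sqrt (B f f)" for k
    proof -
      have d: "(\<lambda>x. F k x - \<tau> x) = (\<lambda>x. 1 * F k x + (-1) * \<tau> x)" by simp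
      have dV: "(\<lambda>x. F k x - \<tau> x) \<in> V" unfolding d using V(1)[OF F(1) \<tau>(1)] .
      have "B (F k) f - B \<tau> f = B (\<lambda>x. F k x - \<tau> x) f" unfolding d lin[OF F(1) \<tau>(1) f] by simp
      then have "(B (F k) f - B \<tau> f)\<^sup>2 \<le> B (\<lambda>x. F k x - \<tau> x) (\<lambda>x. F k x - \<tau> x) * B f f"
        using CS[OF dV f] by simp
      also have "\<dots> \<le> (1/4) ^ k * B f f" using \<tau>(2) pos[OF f] by (intro mult_right_mono) auto
      also have "\<dots> = ((1/2) ^ k * sqrt (B f f))\<^sup>2"
        using pos[OF f] by (simp add: sq power_mult_distrib)
      finally show ?thesis using pos[OF f] by (intro abs_le_of_square_le) auto
    qed
    have "\<bar>T f - B \<tau> f\<bar> \<le> 2 * sqrt (B f f) * (1/2) ^ k" for k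
    proof -
      have "\<bar>T f - B \<tau> f\<bar> \<le> \<bar>B (F k) f - T f\<bar> + \<bar>B (F k) f - B \<tau> f\<bar>" by linarith
      also have "\<dots> \<le> (1/2) ^ k * sqrt (B f f) + (1/2) ^ k * sqrt (B f f)" by (intro add_mono 1 2)
      finally show ?thesis by (simp add: mult_ac)
    qed
    moreover have "(\<lambda>k. 2 * sqrt (B f f) * (1/2) ^ k) \<longlonglongrightarrow> 2 * sqrt (B f f) * 0"
      by (intro tendsto_mult tendsto_const LIMSEQ_realpow_zero) auto
    ultimately have "\<bar>T f - B \<tau> f\<bar> \<le> 0"
      by (intro LIMSEQ_le_const[of "\<lambda>k. 2 * sqrt (B f f) * (1/2) ^ k"]) auto
    then show ?thesis by simp
  qed
  then show ?thesis using \<tau>(1) by blast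
qed

text \<open>Half of the exponent is put into the quotient, so that the seminorm becomes an honest
  L^2 norm, over pairs of points, of a function depending linearly on f. On the diagonal the
  numerator vanishes, and the quotient is 0.\<close>

definition diffq :: "real \<Rightarrow> ('a::metric_space \<Rightarrow> real) \<Rightarrow> 'a \<times> 'a \<Rightarrow> real" where
  "diffq q f z = (f (fst z) - f (snd z)) / dist (fst z) (snd z) powr (q / 2)"

definition energy :: "'a::metric_space measure \<Rightarrow> real \<Rightarrow> ('a \<Rightarrow> real) \<Rightarrow> ennreal" where
  "energy \<mu> q f = (\<integral>\<^sup>+x. ennreal ((f x)\<^sup>2) \<partial>\<mu>) + (\<integral>\<^sup>+z. ennreal ((diffq q f z)\<^sup>2) \<partial>(\<mu> \<Otimes>\<^sub>M \<mu>))"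

lemma diffq_squared: "(diffq q f z)\<^sup>2 = (f (fst z) - f (snd z))\<^sup>2 / dist (fst z) (snd z) powr q"
  by (simp add: diffq_def power_divide power2_eq_square[of "_ powr _"] powr_add[symmetric])

lemma measurable_diffq [measurable]:
  fixes f :: "'a::euclidean_space \<Rightarrow> real"
  assumes [measurable_cong]: "sets M = sets borel" and [measurable]: "f \<in> borel_measurable borel"
  shows "diffq q f \<in> borel_measurable (M \<Otimes>\<^sub>M M)"
  unfolding diffq_def by measurable

lemma liminf_add_ennreal:
  fixes a b :: "nat \<Rightarrow> ennreal"
  shows "liminf a + liminf b \<le> liminf (\<lambda>k. a k + b k)"
proof -
  have "liminf a + liminf b = (SUP n. (INF k\<in>{n..}. a k) + (INF k\<in>{n..}. b k))"
    unfolding liminf_SUP_INF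
    by (intro ennreal_SUP_add[symmetric] monoI INF_superset_mono) auto
  also have "\<dots> \<le> (SUP n. INF k\<in>{n..}. a k + b k)"
    by (intro SUP_mono' INF_greatest add_mono INF_lower) auto
  finally show ?thesis by (simp add: liminf_SUP_INF)
qed

lemma convergent_of_summable_increments:
  fixes a b :: "nat \<Rightarrow> real"
  assumes "\<And>k. \<bar>a (Suc k) - a k\<bar> \<le> (1/2) ^ k + b k" "summable b"
  shows "convergent a"
proof -
  have "summable (\<lambda>k. (1/2) ^ k + b k)"
    using assms by (intro summable_add summable_geometric) auto
  then have "summable (\<lambda>k. a (Suc k) - a k)"
    by (rule summable_comparison_test') (use assms(1) in auto)
  then have "convergent (\<lambda>n. \<Sum>k<n. a (Suc k) - a k)" by (simp add: summable_iff_convergent)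
  then have "convergent (\<lambda>n. a n - a 0)" by (simp add: sum_lessThan_telescope)
  then have "convergent (\<lambda>n. (a n - a 0) + a 0)" by (intro convergent_add convergent_const)
  then show ?thesis by simp
qed

text \<open>Convergence almost everywhere passes to both coordinates of almost every pair, and Fatou
  is applied to each part of the energy. It is the source of completeness of the energy space and
  also of the final bound for an arbitrary trace, where only L^2 convergence on the boundary is
  given.\<close>

lemma energy_fatou:
  fixes \<mu> :: "'a::euclidean_space measure" and g :: "nat \<Rightarrow> 'a \<Rightarrow> real"
  assumes sets[measurable_cong]: "sets \<mu> = sets borel" and sf: "sigma_finite_measure \<mu>"
    and g[measurable]: "\<And>j. g j \<in> borel_measurable borel" "h \<in> borel_measurable borel"
    and lim: "AE x in \<mu>. (\<lambda>j. g j x) \<longlonglongrightarrow> h x"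
  shows "energy \<mu> q h \<le> liminf (\<lambda>j. energy \<mu> q (g j))"
proof -
  interpret sigma_finite_measure \<mu> by fact
  interpret P: pair_sigma_finite \<mu> \<mu> ..
  have [measurable]: "diffq q f \<in> borel_measurable (\<mu> \<Otimes>\<^sub>M \<mu>)" if "f \<in> borel_measurable borel" for f
    using measurable_diffq[OF sets that] .
  have "(\<integral>\<^sup>+x. ennreal ((h x)\<^sup>2) \<partial>\<mu>) = (\<integral>\<^sup>+x. liminf (\<lambda>j. ennreal ((g j x)\<^sup>2)) \<partial>\<mu>)"
    using lim
    by (intro nn_integral_cong_AE, elim AE_mp, intro AE_I2 impI)
       (auto intro!: lim_imp_Liminf[symmetric] tendsto_ennrealI tendsto_power)
  also have "\<dots> \<le> liminf (\<lambda>j. \<integral>\<^sup>+x. ennreal ((g j x)\<^sup>2) \<partial>\<mu>)"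
    by (intro nn_integral_liminf) measurable
  finally have 1: "(\<integral>\<^sup>+x. ennreal ((h x)\<^sup>2) \<partial>\<mu>) \<le> liminf (\<lambda>j. \<integral>\<^sup>+x. ennreal ((g j x)\<^sup>2) \<partial>\<mu>)" .
  have AEp: "AE z in \<mu> \<Otimes>\<^sub>M \<mu>. (\<lambda>j. g j (fst z)) \<longlonglongrightarrow> h (fst z) \<and> (\<lambda>j. g j (snd z)) \<longlonglongrightarrow> h (snd z)"
  proof (rule P.AE_pair_measure)
    show "{x \<in> space (\<mu> \<Otimes>\<^sub>M \<mu>). (\<lambda>j. g j (fst x)) \<longlonglongrightarrow> h (fst x) \<and> (\<lambda>j. g j (snd x)) \<longlonglongrightarrow> h (snd x)} \<in> sets (\<mu> \<Otimes>\<^sub>M \<mu>)"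
      by measurable
    show "AE x in \<mu>. AE y in \<mu>. (\<lambda>j. g j (fst (x, y))) \<longlonglongrightarrow> h (fst (x, y)) \<and> (\<lambda>j. g j (snd (x, y))) \<longlonglongrightarrow> h (snd (x, y))"
      using lim by (auto elim!: AE_mp)
  qed
  have "(\<integral>\<^sup>+z. ennreal ((diffq q h z)\<^sup>2) \<partial>(\<mu> \<Otimes>\<^sub>M \<mu>)) = (\<integral>\<^sup>+z. liminf (\<lambda>j. ennreal ((diffq q (g j) z)\<^sup>2)) \<partial>(\<mu> \<Otimes>\<^sub>M \<mu>))"
    using AEp
    by (intro nn_integral_cong_AE, elim AE_mp, intro AE_I2 impI)
       (auto simp: diffq_squared divide_inverse intro!: lim_imp_Liminf[symmetric] tendsto_ennrealI tendsto_intros)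
  also have "\<dots> \<le> liminf (\<lambda>j. \<integral>\<^sup>+z. ennreal ((diffq q (g j) z)\<^sup>2) \<partial>(\<mu> \<Otimes>\<^sub>M \<mu>))"
    by (intro nn_integral_liminf) measurable
  finally have 2: "(\<integral>\<^sup>+z. ennreal ((diffq q h z)\<^sup>2) \<partial>(\<mu> \<Otimes>\<^sub>M \<mu>)) \<le> liminf (\<lambda>j. \<integral>\<^sup>+z. ennreal ((diffq q (g j) z)\<^sup>2) \<partial>(\<mu> \<Otimes>\<^sub>M \<mu>))" .
  show ?thesis unfolding energy_def
    by (rule order_trans[OF add_mono[OF 1 2] liminf_add_ennreal])
qed

text \<open>The squared increments are summable even with weight 2^k, since 2^k (1/4)^k = (1/2)^k.
  Their absolute values are then summable by the elementary inequality d <= 2^(-k) + 2^k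
  d^2.\<close>

lemma AE_convergent_of_fast_cauchy:
  fixes F :: "nat \<Rightarrow> 'a \<Rightarrow> real"
  assumes [measurable]: "\<And>k. F k \<in> borel_measurable M"
    and fast: "\<And>k. (\<integral>\<^sup>+x. ennreal ((F k x - F (Suc k) x)\<^sup>2) \<partial>M) \<le> ennreal ((1/4) ^ k)"
  shows "AE x in M. convergent (\<lambda>k. F k x)"
proof -
  have "(\<integral>\<^sup>+x. (\<Sum>k. ennreal (2 ^ k * (F k x - F (Suc k) x)\<^sup>2)) \<partial>M)
      = (\<Sum>k. \<integral>\<^sup>+x. ennreal (2 ^ k * (F k x - F (Suc k) x)\<^sup>2) \<partial>M)"
    by (intro nn_integral_suminf) measurable
  also have "\<dots> = (\<Sum>k. ennreal (2 ^ k) * (\<integral>\<^sup>+x. ennreal ((F k x - F (Suc k) x)\<^sup>2) \<partial>M))"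
    by (subst nn_integral_cmult[symmetric]) (auto simp: ennreal_mult)
  also have "\<dots> \<le> (\<Sum>k. ennreal (2 ^ k) * ennreal ((1/4) ^ k))"
    by (intro suminf_le mult_left_mono fast) auto
  also have "\<dots> = (\<Sum>k. ennreal (1 * (1/2) ^ k))"
    by (intro suminf_cong) (simp add: ennreal_mult[symmetric] power_mult_distrib[symmetric])
  also have "\<dots> = ennreal (1 / (1 - 1/2))" by (rule suminf_ennreal_geometric) auto
  finally have "(\<integral>\<^sup>+x. (\<Sum>k. ennreal (2 ^ k * (F k x - F (Suc k) x)\<^sup>2)) \<partial>M) < \<infinity>"
    by (auto intro: le_less_trans)
  then have "AE x in M. (\<Sum>k. ennreal (2 ^ k * (F k x - F (Suc k) x)\<^sup>2)) \<noteq> \<infinity>"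
    by (intro nn_integral_noteq_infinite) auto
  then show ?thesis
  proof (elim AE_mp, intro AE_I2 impI)
    fix x assume "(\<Sum>k. ennreal (2 ^ k * (F k x - F (Suc k) x)\<^sup>2)) \<noteq> \<infinity>"
    then have "summable (\<lambda>k. 2 ^ k * (F k x - F (Suc k) x)\<^sup>2)"
      by (rule summable_suminf_not_top[rotated, unfolded infinity_ennreal_def[symmetric]]) simp
    moreover have "\<bar>F (Suc k) x - F k x\<bar> \<le> (1/2) ^ k + 2 ^ k * (F k x - F (Suc k) x)\<^sup>2" for k
    proof -
      define d where "d = \<bar>F (Suc k) x - F k x\<bar>"
      have "0 \<le> (2 ^ k * d - 1)\<^sup>2" by simp
      then have "2 * (2 ^ k * d) \<le> 1 + (2 ^ k)\<^sup>2 * d\<^sup>2" by (simp add: power2_diff power_mult_distrib)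
      moreover have "0 \<le> 2 ^ k * d" by (simp add: d_def)
      ultimately have "2 ^ k * d \<le> 1 + (2 ^ k)\<^sup>2 * d\<^sup>2" by linarith
      then have "d \<le> (1 + (2 ^ k)\<^sup>2 * d\<^sup>2) / 2 ^ k" by (simp add: pos_le_divide_eq mult.commute)
      also have "\<dots> = (1/2) ^ k + 2 ^ k * d\<^sup>2" by (simp add: add_divide_distrib power2_eq_square power_one_over)
      finally show ?thesis by (simp add: d_def power2_commute)
    qed
    ultimately show "convergent (\<lambda>k. F k x)" by (rule convergent_of_summable_increments[rotated])
  qed
qed

text \<open>The Riesz-Fischer argument: the pointwise limit exists almost everywhere, and Fatou in
  the second index transfers the Cauchy estimate to the limit. \<open>lim\<close> provides a Borel
  function defined everywhere, whatever happens on the exceptional set.\<close>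

lemma energy_complete:
  fixes \<mu> :: "'a::euclidean_space measure" and F :: "nat \<Rightarrow> 'a \<Rightarrow> real"
  assumes sets[measurable_cong]: "sets \<mu> = sets borel" and sf: "sigma_finite_measure \<mu>"
    and F[measurable]: "\<And>j. F j \<in> borel_measurable borel"
    and fast: "\<And>k j. k \<le> j \<Longrightarrow> energy \<mu> q (\<lambda>x. F k x - F j x) \<le> ennreal ((1/4) ^ k)"
  shows "\<exists>f\<in>borel_measurable borel. \<forall>k. energy \<mu> q (\<lambda>x. F k x - f x) \<le> ennreal ((1/4) ^ k)"
proof -
  define f where "f x = lim (\<lambda>k. F k x)" for x
  have f[measurable]: "f \<in> borel_measurable borel" unfolding f_def by measurable
  have "AE x in \<mu>. convergent (\<lambda>k. F k x)"
  proof (rule AE_convergent_of_fast_cauchy)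
    fix k
    show "(\<integral>\<^sup>+x. ennreal ((F k x - F (Suc k) x)\<^sup>2) \<partial>\<mu>) \<le> ennreal ((1/4) ^ k)"
      by (rule order_trans[OF _ fast[of k "Suc k"]]) (auto simp: energy_def)
  qed measurable
  then have lim: "AE x in \<mu>. (\<lambda>k. F k x) \<longlonglongrightarrow> f x"
    by (auto simp: f_def convergent_LIMSEQ_iff)
  have "energy \<mu> q (\<lambda>x. F k x - f x) \<le> ennreal ((1/4) ^ k)" for k
  proof -
    have "energy \<mu> q (\<lambda>x. F k x - f x) \<le> liminf (\<lambda>j. energy \<mu> q (\<lambda>x. F k x - F j x))"
      using lim by (intro energy_fatou sets sf) (auto elim!: AE_mp intro!: tendsto_intros)
    also have "\<dots> \<le> liminf (\<lambda>j. ennreal ((1/4) ^ k))"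
      by (intro Liminf_mono) (auto simp: eventually_sequentially intro!: exI[of _ k] fast)
    also have "\<dots> = ennreal ((1/4) ^ k)" by (simp add: Liminf_const)
    finally show ?thesis .
  qed
  with f show ?thesis by blast
qed

lemma integrable_mult_square:
  fixes f g :: "'a \<Rightarrow> real"
  assumes [measurable]: "f \<in> borel_measurable M" "g \<in> borel_measurable M"
    and "integrable M (\<lambda>x. (f x)\<^sup>2)" "integrable M (\<lambda>x. (g x)\<^sup>2)"
  shows "integrable M (\<lambda>x. f x * g x)"
proof (rule Bochner_Integration.integrable_bound)
  show "integrable M (\<lambda>x. (f x)\<^sup>2 + (g x)\<^sup>2)" using assms by (intro Bochner_Integration.integrable_add)
  have "\<bar>a * b\<bar> \<le> a\<^sup>2 + b\<^sup>2" for a b :: real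
  proof -
    have "0 \<le> (\<bar>a\<bar> - \<bar>b\<bar>)\<^sup>2" by simp
    then have "2 * \<bar>a * b\<bar> \<le> a\<^sup>2 + b\<^sup>2" by (simp add: power2_diff abs_mult)
    then show ?thesis using abs_ge_zero[of "a * b"] by linarith
  qed
  then show "AE x in M. norm (f x * g x) \<le> norm ((f x)\<^sup>2 + (g x)\<^sup>2)" by auto
qed measurable

definition espace :: "'a::euclidean_space measure \<Rightarrow> real \<Rightarrow> ('a \<Rightarrow> real) set" where
  "espace \<mu> q = {f. f \<in> borel_measurable borel \<and> energy \<mu> q f < \<infinity>}"

definition eform :: "'a::euclidean_space measure \<Rightarrow> real \<Rightarrow> ('a \<Rightarrow> real) \<Rightarrow> ('a \<Rightarrow> real) \<Rightarrow> real" where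
  "eform \<mu> q f g = (\<integral>x. f x * g x \<partial>\<mu>) + (\<integral>z. diffq q f z * diffq q g z \<partial>(\<mu> \<Otimes>\<^sub>M \<mu>))"

lemma diffq_lin: "diffq q (\<lambda>x. a * f x + b * g x) z = a * diffq q f z + b * diffq q g z"
  by (simp add: diffq_def add_divide_distrib diff_divide_distrib algebra_simps)

context
  fixes \<mu> :: "'a::euclidean_space measure" and q :: real
  assumes sets[measurable_cong]: "sets \<mu> = sets borel" and sf: "sigma_finite_measure \<mu>"
begin

lemma measurable_diffq' [measurable]: "f \<in> borel_measurable borel \<Longrightarrow> diffq q f \<in> borel_measurable (\<mu> \<Otimes>\<^sub>M \<mu>)"
  by (rule measurable_diffq[OF sets])

lemma espace_integrable:
  assumes "f \<in> espace \<mu> q"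
  shows "f \<in> borel_measurable borel" "integrable \<mu> (\<lambda>x. (f x)\<^sup>2)" "integrable (\<mu> \<Otimes>\<^sub>M \<mu>) (\<lambda>z. (diffq q f z)\<^sup>2)"
proof -
  show f[measurable]: "f \<in> borel_measurable borel" using assms by (simp add: espace_def)
  have "(\<integral>\<^sup>+x. ennreal ((f x)\<^sup>2) \<partial>\<mu>) \<le> energy \<mu> q f" "(\<integral>\<^sup>+z. ennreal ((diffq q f z)\<^sup>2) \<partial>(\<mu> \<Otimes>\<^sub>M \<mu>)) \<le> energy \<mu> q f"
    by (auto simp: energy_def)
  then have "(\<integral>\<^sup>+x. ennreal ((f x)\<^sup>2) \<partial>\<mu>) < \<infinity>" "(\<integral>\<^sup>+z. ennreal ((diffq q f z)\<^sup>2) \<partial>(\<mu> \<Otimes>\<^sub>M \<mu>)) < \<infinity>"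
    using assms by (auto simp: espace_def intro: le_less_trans)
  then show "integrable \<mu> (\<lambda>x. (f x)\<^sup>2)" "integrable (\<mu> \<Otimes>\<^sub>M \<mu>) (\<lambda>z. (diffq q f z)\<^sup>2)"
    by (auto intro!: integrableI_nonneg)
qed

lemma energy_eq_eform:
  assumes "f \<in> espace \<mu> q"
  shows "energy \<mu> q f = ennreal (eform \<mu> q f f)"
  unfolding energy_def eform_def power2_eq_square[symmetric]
  using espace_integrable[OF assms]
  by (simp add: nn_integral_eq_integral ennreal_plus)

lemma eform_nonneg: "0 \<le> eform \<mu> q f f"
  unfolding eform_def power2_eq_square[symmetric] by (intro add_nonneg_nonneg integral_nonneg_AE) auto

lemma espace_lin:
  assumes f: "f \<in> espace \<mu> q" and g: "g \<in> espace \<mu> q"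
  shows "(\<lambda>x. a * f x + b * g x) \<in> espace \<mu> q"
proof -
  note F = espace_integrable[OF f] and G = espace_integrable[OF g]
  note [measurable] = F(1) G(1)
  have 1: "integrable \<mu> (\<lambda>x. (a * f x + b * g x)\<^sup>2)"
  proof -
    have "(\<lambda>x. (a * f x + b * g x)\<^sup>2) = (\<lambda>x. a\<^sup>2 * (f x)\<^sup>2 + 2 * a * b * (f x * g x) + b\<^sup>2 * (g x)\<^sup>2)"
      by (simp add: power2_eq_square algebra_simps)
    moreover have "integrable \<mu> (\<lambda>x. f x * g x)" using F G by (intro integrable_mult_square) (auto cong: measurable_cong_sets simp: sets)
    ultimately show ?thesis using F G
      by (simp only:) (intro Bochner_Integration.integrable_add integrable_mult_right)
  qed
  have 2: "integrable (\<mu> \<Otimes>\<^sub>M \<mu>) (\<lambda>z. (diffq q (\<lambda>x. a * f x + b * g x) z)\<^sup>2)"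
  proof -
    have "(\<lambda>z. (diffq q (\<lambda>x. a * f x + b * g x) z)\<^sup>2)
       = (\<lambda>z. a\<^sup>2 * (diffq q f z)\<^sup>2 + 2 * a * b * (diffq q f z * diffq q g z) + b\<^sup>2 * (diffq q g z)\<^sup>2)"
      unfolding diffq_lin by (simp add: power2_eq_square algebra_simps)
    moreover have "integrable (\<mu> \<Otimes>\<^sub>M \<mu>) (\<lambda>z. diffq q f z * diffq q g z)"
      using F G by (intro integrable_mult_square measurable_diffq') auto
    ultimately show ?thesis using F G
      by (simp only:) (intro Bochner_Integration.integrable_add integrable_mult_right)
  qed
  have "energy \<mu> q (\<lambda>x. a * f x + b * g x) < \<infinity>"
    unfolding energy_def using 1 2 by (simp add: nn_integral_eq_integral)
  then show ?thesis by (simp add: espace_def)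
qed

lemma eform_lin:
  assumes f: "f \<in> espace \<mu> q" and g: "g \<in> espace \<mu> q" and h: "h \<in> espace \<mu> q"
  shows "eform \<mu> q (\<lambda>x. a * f x + b * g x) h = a * eform \<mu> q f h + b * eform \<mu> q g h"
proof -
  note F = espace_integrable[OF f] and G = espace_integrable[OF g] and H = espace_integrable[OF h]
  have m: "f \<in> borel_measurable \<mu>" "g \<in> borel_measurable \<mu>" "h \<in> borel_measurable \<mu>"
    using F(1) G(1) H(1) by (simp_all cong: measurable_cong_sets add: sets)
  have i: "integrable \<mu> (\<lambda>x. f x * h x)" "integrable \<mu> (\<lambda>x. g x * h x)"
    using F G H m by (auto intro!: integrable_mult_square)
  have j: "integrable (\<mu> \<Otimes>\<^sub>M \<mu>) (\<lambda>z. diffq q f z * diffq q h z)" "integrable (\<mu> \<Otimes>\<^sub>M \<mu>) (\<lambda>z. diffq q g z * diffq q h z)"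
    using F G H by (auto intro!: integrable_mult_square measurable_diffq')
  have "(\<integral>x. (a * f x + b * g x) * h x \<partial>\<mu>) = (\<integral>x. a * (f x * h x) + b * (g x * h x) \<partial>\<mu>)"
    by (simp add: algebra_simps)
  also have "\<dots> = a * (\<integral>x. f x * h x \<partial>\<mu>) + b * (\<integral>x. g x * h x \<partial>\<mu>)"
    using i by (subst Bochner_Integration.integral_add) auto
  finally have 1: "(\<integral>x. (a * f x + b * g x) * h x \<partial>\<mu>) = a * (\<integral>x. f x * h x \<partial>\<mu>) + b * (\<integral>x. g x * h x \<partial>\<mu>)" .
  have "(\<integral>z. diffq q (\<lambda>x. a * f x + b * g x) z * diffq q h z \<partial>(\<mu> \<Otimes>\<^sub>M \<mu>))
      = (\<integral>z. a * (diffq q f z * diffq q h z) + b * (diffq q g z * diffq q h z) \<partial>(\<mu> \<Otimes>\<^sub>M \<mu>))"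
    unfolding diffq_lin by (simp add: algebra_simps)
  also have "\<dots> = a * (\<integral>z. diffq q f z * diffq q h z \<partial>(\<mu> \<Otimes>\<^sub>M \<mu>)) + b * (\<integral>z. diffq q g z * diffq q h z \<partial>(\<mu> \<Otimes>\<^sub>M \<mu>))"
    using j by (subst Bochner_Integration.integral_add) auto
  finally show ?thesis unfolding eform_def 1 by (simp add: algebra_simps)
qed

text \<open>The passage from signed Bochner integrals to nonnegative ones. Beyond this point the
  sign of the representer is discarded, and all estimates can be made with kernels acting on
  absolute values.\<close>

lemma eform_nn_bound:
  assumes f: "f \<in> espace \<mu> q" and g: "g \<in> espace \<mu> q"
  shows "ennreal \<bar>eform \<mu> q f g\<bar> \<le> (\<integral>\<^sup>+x. ennreal (\<bar>f x\<bar> * \<bar>g x\<bar>) \<partial>\<mu>)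
      + (\<integral>\<^sup>+z. ennreal (\<bar>diffq q f z\<bar> * \<bar>diffq q g z\<bar>) \<partial>(\<mu> \<Otimes>\<^sub>M \<mu>))"
proof -
  note F = espace_integrable[OF f] and G = espace_integrable[OF g]
  have m: "f \<in> borel_measurable \<mu>" "g \<in> borel_measurable \<mu>"
    using F(1) G(1) by (simp_all cong: measurable_cong_sets add: sets)
  have i: "integrable \<mu> (\<lambda>x. f x * g x)"
    using F G m by (auto intro!: integrable_mult_square)
  have j: "integrable (\<mu> \<Otimes>\<^sub>M \<mu>) (\<lambda>z. diffq q f z * diffq q g z)"
    using F G by (auto intro!: integrable_mult_square measurable_diffq')
  have "ennreal \<bar>eform \<mu> q f g\<bar> \<le> ennreal (\<bar>\<integral>x. f x * g x \<partial>\<mu>\<bar> + \<bar>\<integral>z. diffq q f z * diffq q g z \<partial>(\<mu> \<Otimes>\<^sub>M \<mu>)\<bar>)"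
    unfolding eform_def by (intro ennreal_leI abs_triangle_ineq)
  also have "\<dots> = ennreal \<bar>\<integral>x. f x * g x \<partial>\<mu>\<bar> + ennreal \<bar>\<integral>z. diffq q f z * diffq q g z \<partial>(\<mu> \<Otimes>\<^sub>M \<mu>)\<bar>"
    by (simp add: ennreal_plus)
  also have "\<dots> \<le> (\<integral>\<^sup>+x. ennreal (norm (f x * g x)) \<partial>\<mu>)
      + (\<integral>\<^sup>+z. ennreal (norm (diffq q f z * diffq q g z)) \<partial>(\<mu> \<Otimes>\<^sub>M \<mu>))"
    using integral_norm_bound_ennreal[OF i] integral_norm_bound_ennreal[OF j] by (intro add_mono) simp_all
  finally show ?thesis by (simp add: abs_mult)
qed

text \<open>Only the inequality for absolute values and the size of the representer are exported;
  everything later works with those two.\<close>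

lemma riesz_energy:
  assumes lin: "\<And>f g a b. f \<in> espace \<mu> q \<Longrightarrow> g \<in> espace \<mu> q \<Longrightarrow> T (\<lambda>x. a * f x + b * g x) = a * T f + b * T g"
    and bd: "\<And>f. f \<in> espace \<mu> q \<Longrightarrow> \<bar>T f\<bar> \<le> C * sqrt (enn2real (energy \<mu> q f))" and C: "0 \<le> C"
  obtains \<tau> where "\<tau> \<in> espace \<mu> q" "energy \<mu> q \<tau> \<le> ennreal (C\<^sup>2)"
    "\<And>f. f \<in> espace \<mu> q \<Longrightarrow> ennreal \<bar>T f\<bar> \<le> (\<integral>\<^sup>+x. ennreal (\<bar>\<tau> x\<bar> * \<bar>f x\<bar>) \<partial>\<mu>)
      + (\<integral>\<^sup>+z. ennreal (\<bar>diffq q \<tau> z\<bar> * \<bar>diffq q f z\<bar>) \<partial>(\<mu> \<Otimes>\<^sub>M \<mu>))"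
proof -
  have bd': "\<bar>T f\<bar> \<le> C * sqrt (eform \<mu> q f f)" if "f \<in> espace \<mu> q" for f
    using bd[OF that] energy_eq_eform[OF that] eform_nonneg[of f] by simp
  have minus: "(\<lambda>x. f x - g x) \<in> espace \<mu> q" if "f \<in> espace \<mu> q" "g \<in> espace \<mu> q" for f g
    using espace_lin[OF that, of 1 "-1"] by simp
  have "\<exists>\<tau>\<in>espace \<mu> q. \<forall>f\<in>espace \<mu> q. T f = eform \<mu> q \<tau> f"
  proof (rule riesz_representation[where C = C])
    show "(\<lambda>_. 0) \<in> espace \<mu> q" by (simp add: espace_def energy_def diffq_def)
    show "eform \<mu> q f g = eform \<mu> q g f" for f g by (simp add: eform_def mult.commute)
  next
    fix F assume F: "\<And>k::nat. F k \<in> espace \<mu> q"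
      and "\<And>k j. k \<le> j \<Longrightarrow> eform \<mu> q (\<lambda>x. F k x - F j x) (\<lambda>x. F k x - F j x) \<le> (1/4) ^ k"
    then have "energy \<mu> q (\<lambda>x. F k x - F j x) \<le> ennreal ((1/4) ^ k)" if "k \<le> j" for k j
      unfolding energy_eq_eform[OF minus[OF F F]] using that by (intro ennreal_leI)
    then obtain f where f: "f \<in> borel_measurable borel" "\<And>k. energy \<mu> q (\<lambda>x. F k x - f x) \<le> ennreal ((1/4) ^ k)"
    proof -
      assume *: "\<And>k j. k \<le> j \<Longrightarrow> energy \<mu> q (\<lambda>x. F k x - F j x) \<le> ennreal ((1/4) ^ k)"
        and **: "\<And>f. f \<in> borel_measurable borel \<Longrightarrow> (\<And>k. energy \<mu> q (\<lambda>x. F k x - f x) \<le> ennreal ((1/4) ^ k)) \<Longrightarrow> thesis"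
      show thesis using energy_complete[OF sets sf espace_integrable(1)[OF F] *] ** by auto
    qed
    have d: "(\<lambda>x. F k x - f x) \<in> espace \<mu> q" for k
      using f espace_integrable(1)[OF F] le_less_trans[OF f(2)] by (auto simp: espace_def)
    have "f \<in> espace \<mu> q" using minus[OF F[of 0] d[of 0]] by simp
    moreover have "eform \<mu> q (\<lambda>x. F k x - f x) (\<lambda>x. F k x - f x) \<le> (1/4) ^ k" for k
      using f(2)[of k] unfolding energy_eq_eform[OF d] by (simp add: ennreal_le_iff)
    ultimately show "\<exists>f\<in>espace \<mu> q. \<forall>k. eform \<mu> q (\<lambda>x. F k x - f x) (\<lambda>x. F k x - f x) \<le> (1/4) ^ k" by blast
  qed (rule espace_lin eform_lin eform_nonneg lin bd'; assumption)+
  then obtain \<tau> where \<tau>: "\<tau> \<in> espace \<mu> q" "\<And>f. f \<in> espace \<mu> q \<Longrightarrow> T f = eform \<mu> q \<tau> f" by blast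
  show thesis
  proof (rule that[OF \<tau>(1)])
    let ?b = "eform \<mu> q \<tau> \<tau>"
    \<comment> \<open>Testing \<open>T\<close> on its own representer: the squared norm equals
      \<open>T \<tau>\<close>, hence is at most C times the norm.\<close>
    have "?b \<le> C * sqrt ?b" using bd'[OF \<tau>(1)] \<tau>(2)[OF \<tau>(1)] by simp
    then have *: "sqrt ?b * sqrt ?b \<le> C * sqrt ?b" using eform_nonneg[of \<tau>] by simp
    have "sqrt ?b \<le> C"
    proof (cases "?b = 0")
      case False
      then have "0 < sqrt ?b" using eform_nonneg[of \<tau>] by simp
      with * show ?thesis by (rule mult_right_le_imp_le)
    qed (use C in simp)
    then have "?b \<le> C\<^sup>2" by (rule sqrt_le_D)
    then show "energy \<mu> q \<tau> \<le> ennreal (C\<^sup>2)" unfolding energy_eq_eform[OF \<tau>(1)] by (rule ennreal_leI)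
  qed (use \<tau> eform_nn_bound in auto)
qed

end

section \<open>The trace inequality\<close>

definition mean :: "('a::euclidean_space \<Rightarrow> real) \<Rightarrow> 'a set \<Rightarrow> real" where
  "mean v X = (\<integral>x. indicator X x * v x \<partial>lborel) / measure lborel X"

text \<open>Expanding the square shows that the integral of (v - m)^2 over X is its minimal value,
  attained at the mean, plus |X| times (mean - m)^2. The bound \<open>B\<close> makes all integrals
  in the expansion finite.\<close>

lemma mean_square_le:
  fixes v :: "'a::euclidean_space \<Rightarrow> real"
  assumes [measurable]: "v \<in> borel_measurable borel" "X \<in> sets borel"
    and fin: "emeasure lborel X < \<infinity>" and pos: "0 < measure lborel X"
    and bd: "\<And>x. x \<in> X \<Longrightarrow> \<bar>v x\<bar> \<le> B"
  shows "ennreal (measure lborel X * (mean v X - m)\<^sup>2) \<le> (\<integral>\<^sup>+x. indicator X x * ennreal ((v x - m)\<^sup>2) \<partial>lborel)"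
proof -
  let ?M = "measure lborel X"
  let ?I = "\<lambda>f. \<integral>x. indicator X x * (f x) \<partial>(lborel :: 'a measure)"
  have i0: "integrable lborel (indicator X :: 'a \<Rightarrow> real)" using fin by simp
  have int: "integrable lborel (\<lambda>x. indicator X x * f x)"
    if "f \<in> borel_measurable borel" "\<And>x. x \<in> X \<Longrightarrow> \<bar>f x\<bar> \<le> b" for f :: "'a \<Rightarrow> real" and b
  proof (rule Bochner_Integration.integrable_bound)
    show "integrable lborel (\<lambda>x. b * indicator X x :: real)" using i0 by (rule integrable_mult_right)
    show "AE x in lborel. norm (indicator X x * f x) \<le> norm (b * indicator X x)"
      using that(2) by (intro AE_I2) (force simp: indicator_def intro: order_trans[OF _ abs_ge_self])
  qed (use that(1) in measurable)
  have iv: "integrable lborel (\<lambda>x. indicator X x * v x)" using bd by (intro int) auto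
  have iv2: "integrable lborel (\<lambda>x. indicator X x * (v x)\<^sup>2)"
    using bd by (intro int[of _ "B\<^sup>2"]) (auto simp: abs_le_square_iff[symmetric] intro: order_trans[OF _ abs_ge_self])
  have expand: "(\<lambda>x. indicator X x * (v x - t)\<^sup>2) = (\<lambda>x. indicator X x * (v x)\<^sup>2 - 2 * t * (indicator X x * v x) + t\<^sup>2 * indicator X x)" for t
    by (auto simp: power2_diff algebra_simps)
  have ivt: "integrable lborel (\<lambda>x. indicator X x * (v x - t)\<^sup>2)" for t
    unfolding expand by (intro Bochner_Integration.integrable_add Bochner_Integration.integrable_diff integrable_mult_right iv iv2 i0)
  have It: "?I (\<lambda>x. (v x - t)\<^sup>2) = ?I (\<lambda>x. (v x)\<^sup>2) - 2 * t * ?I v + t\<^sup>2 * ?M" for t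
  proof -
    have "?I (\<lambda>x. (v x - t)\<^sup>2) = (\<integral>x. indicator X x * (v x)\<^sup>2 - 2 * t * (indicator X x * v x) \<partial>lborel) + (\<integral>x. t\<^sup>2 * indicator X x \<partial>lborel)"
      unfolding expand by (intro Bochner_Integration.integral_add Bochner_Integration.integrable_diff integrable_mult_right iv iv2 i0)
    also have "(\<integral>x. indicator X x * (v x)\<^sup>2 - 2 * t * (indicator X x * v x) \<partial>lborel) = ?I (\<lambda>x. (v x)\<^sup>2) - (\<integral>x. 2 * t * (indicator X x * v x) \<partial>lborel)"
      by (intro Bochner_Integration.integral_diff integrable_mult_right iv iv2)
    finally show ?thesis by simp
  qed
  have Iv: "?I v = mean v X * ?M" using pos by (simp add: mean_def)
  have "0 \<le> ?I (\<lambda>x. (v x - mean v X)\<^sup>2)" by (intro integral_nonneg_AE) auto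
  then have "?M * (mean v X - m)\<^sup>2 \<le> ?I (\<lambda>x. (v x - m)\<^sup>2)"
    unfolding It Iv by (simp add: power2_eq_square algebra_simps)
  then have "ennreal (?M * (mean v X - m)\<^sup>2) \<le> ennreal (?I (\<lambda>x. (v x - m)\<^sup>2))" by (rule ennreal_leI)
  also have "\<dots> = (\<integral>\<^sup>+x. ennreal (indicator X x * (v x - m)\<^sup>2) \<partial>lborel)"
    by (intro nn_integral_eq_integral[symmetric] ivt) auto
  also have "\<dots> = (\<integral>\<^sup>+x. indicator X x * ennreal ((v x - m)\<^sup>2) \<partial>lborel)"
    by (intro nn_integral_cong) (auto simp: indicator_def)
  finally show ?thesis .
qed

text \<open>\<open>mean_square_le\<close> is used twice: over Y with m = v x for fixed x, then over
  X with m the mean over Y. Since all distances are at most R, the factor (R / |x - y|)^p >= 1 may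
  be inserted, which produces the fractional seminorm of v over X and Y.\<close>

lemma mean_diff_square_le:
  fixes v :: "'a::euclidean_space \<Rightarrow> real"
  assumes v[measurable]: "v \<in> borel_measurable borel" and XY[measurable]: "X \<in> sets borel" "Y \<in> sets borel"
    and fin: "emeasure lborel X < \<infinity>" "emeasure lborel Y < \<infinity>"
    and V: "0 < V" "ennreal V \<le> emeasure lborel X" "ennreal V \<le> emeasure lborel Y"
    and bd: "\<And>x. x \<in> X \<union> Y \<Longrightarrow> \<bar>v x\<bar> \<le> B"
    and R: "\<And>x y. x \<in> X \<Longrightarrow> y \<in> Y \<Longrightarrow> dist x y \<le> R" and p: "0 \<le> p"
  shows "ennreal ((mean v X - mean v Y)\<^sup>2) \<le> ennreal (R powr p / V\<^sup>2) *
     (\<integral>\<^sup>+x. indicator X x * (\<integral>\<^sup>+y. indicator Y y * ennreal ((v x - v y)\<^sup>2 / dist x y powr p) \<partial>lborel) \<partial>lborel)"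
proof -
  let ?MX = "measure lborel X" and ?MY = "measure lborel Y"
  have eX: "emeasure lborel X = ennreal ?MX" and eY: "emeasure lborel Y = ennreal ?MY"
    using fin by (auto simp: emeasure_eq_ennreal_measure)
  have MX: "V \<le> ?MX" and MY: "V \<le> ?MY"
    using V(2,3) unfolding eX eY by (auto simp: ennreal_le_iff)
  have ptw: "ennreal (V * (v x - mean v Y)\<^sup>2) \<le> ennreal (R powr p) * (\<integral>\<^sup>+y. indicator Y y * ennreal ((v x - v y)\<^sup>2 / dist x y powr p) \<partial>lborel)"
    if x: "x \<in> X" for x
  proof -
    have "ennreal (V * (v x - mean v Y)\<^sup>2) \<le> ennreal (?MY * (mean v Y - v x)\<^sup>2)"
      using MY by (intro ennreal_leI) (simp add: power2_commute mult_right_mono)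
    also have "\<dots> \<le> (\<integral>\<^sup>+y. indicator Y y * ennreal ((v y - v x)\<^sup>2) \<partial>lborel)"
      using V(1) MY bd by (intro mean_square_le v XY fin) auto
    also have "\<dots> \<le> (\<integral>\<^sup>+y. ennreal (R powr p) * (indicator Y y * ennreal ((v x - v y)\<^sup>2 / dist x y powr p)) \<partial>lborel)"
    proof (intro nn_integral_mono)
      fix y
      have "(v y - v x)\<^sup>2 \<le> R powr p * ((v x - v y)\<^sup>2 / dist x y powr p)" if y: "y \<in> Y"
      proof (cases "x = y")
        case False
        then have d: "0 < dist x y powr p" by simp
        have "dist x y powr p \<le> R powr p" using R[OF x y] p by (intro powr_mono2) auto
        then have "1 \<le> R powr p / dist x y powr p" using d by simp
        then have "(v x - v y)\<^sup>2 * 1 \<le> (v x - v y)\<^sup>2 * (R powr p / dist x y powr p)"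
          by (intro mult_left_mono) auto
        then show ?thesis by (simp add: power2_commute mult_ac)
      qed simp
      then show "indicator Y y * ennreal ((v y - v x)\<^sup>2) \<le> ennreal (R powr p) * (indicator Y y * ennreal ((v x - v y)\<^sup>2 / dist x y powr p))"
        by (auto simp: indicator_def ennreal_mult[symmetric] intro!: ennreal_leI)
    qed
    also have "\<dots> = ennreal (R powr p) * (\<integral>\<^sup>+y. indicator Y y * ennreal ((v x - v y)\<^sup>2 / dist x y powr p) \<partial>lborel)"
      by (intro nn_integral_cmult) measurable
    finally show ?thesis .
  qed
  have "ennreal (V\<^sup>2 * (mean v X - mean v Y)\<^sup>2) \<le> ennreal (V * (?MX * (mean v X - mean v Y)\<^sup>2))"
    using MX V(1) by (intro ennreal_leI) (simp add: power2_eq_square mult_right_mono)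
  also have "\<dots> = ennreal V * ennreal (?MX * (mean v X - mean v Y)\<^sup>2)"
    using V(1) by (intro ennreal_mult) auto
  also have "\<dots> \<le> ennreal V * (\<integral>\<^sup>+x. indicator X x * ennreal ((v x - mean v Y)\<^sup>2) \<partial>lborel)"
    using V(1) MX bd by (intro mult_left_mono mean_square_le v XY fin) auto
  also have "\<dots> = (\<integral>\<^sup>+x. ennreal V * (indicator X x * ennreal ((v x - mean v Y)\<^sup>2)) \<partial>lborel)"
    by (intro nn_integral_cmult[symmetric]) measurable
  also have "\<dots> \<le> (\<integral>\<^sup>+x. ennreal (R powr p) * (indicator X x * (\<integral>\<^sup>+y. indicator Y y * ennreal ((v x - v y)\<^sup>2 / dist x y powr p) \<partial>lborel)) \<partial>lborel)"
    using ptw V(1) by (intro nn_integral_mono) (auto simp: indicator_def ennreal_mult)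
  also have "\<dots> = ennreal (R powr p) * (\<integral>\<^sup>+x. indicator X x * (\<integral>\<^sup>+y. indicator Y y * ennreal ((v x - v y)\<^sup>2 / dist x y powr p) \<partial>lborel) \<partial>lborel)"
    (is "_ = _ * ?I") by (intro nn_integral_cmult) measurable
  finally have "ennreal (V\<^sup>2 * (mean v X - mean v Y)\<^sup>2) \<le> ennreal (R powr p) * ?I" .
  then have "ennreal (1 / V\<^sup>2) * ennreal (V\<^sup>2 * (mean v X - mean v Y)\<^sup>2) \<le> ennreal (1 / V\<^sup>2) * (ennreal (R powr p) * ?I)"
    by (rule mult_left_mono) simp
  moreover have "ennreal (1 / V\<^sup>2) * ennreal (V\<^sup>2 * (mean v X - mean v Y)\<^sup>2) = ennreal ((mean v X - mean v Y)\<^sup>2)"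
    using V(1) by (subst ennreal_mult[symmetric]) auto
  moreover have "ennreal (1 / V\<^sup>2) * (ennreal (R powr p) * ?I) = ennreal (R powr p / V\<^sup>2) * ?I"
    by (simp add: mult.assoc[symmetric] ennreal_mult[symmetric])
  ultimately show ?thesis by simp
qed

text \<open>Together with \<open>dyadic_tails_sum\<close> below this is a discrete Hardy inequality.\<close>
lemma dyadic_telescope:
  fixes A :: "nat \<Rightarrow> real" and b :: "nat \<Rightarrow> ennreal"
  assumes \<rho>: "0 < \<rho>" "\<rho> < 1" and lim: "A \<longlonglongrightarrow> a"
    and inc: "\<And>j. ennreal ((A (Suc j) - A j)\<^sup>2) \<le> ennreal (\<rho> ^ (2 * j)) * b j"
  shows "ennreal ((a - A k)\<^sup>2) \<le> ennreal (\<rho> ^ (2 * k) / (1 - \<rho>)) * (\<Sum>i. ennreal (\<rho> ^ i) * b (k + i))"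
proof -
  let ?E = "\<Sum>i. ennreal (\<rho> ^ i) * b (k + i)"
  define d where "d i = A (k + Suc i) - A (k + i)" for i
  have step: "ennreal ((A (k + m) - A k)\<^sup>2) \<le> ennreal (\<rho> ^ (2 * k) / (1 - \<rho>)) * ?E" for m
  proof -
    have tel: "A (k + m) - A k = (\<Sum>i<m. d i)"
      unfolding d_def by (induction m) (auto simp: sum.lessThan_Suc)
    \<comment> \<open>Cauchy-Schwarz with weights \<rho>^(i/2). Of the decay \<rho>^(2(k+i)) of the
      squared increments, one factor \<rho>^i pays for the weights, \<rho>^(2k) is pulled out, and
      the remaining \<rho>^i stays in the tail so that the tails can still be summed over k.\<close>
    have sq: "sqrt (\<rho> ^ i) * (d i / sqrt (\<rho> ^ i)) = d i" "(sqrt (\<rho> ^ i))\<^sup>2 = \<rho> ^ i" for i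
      using \<rho> by (auto simp: power_divide)
    have "(\<Sum>i<m. d i)\<^sup>2 = (\<Sum>i<m. sqrt (\<rho> ^ i) * (d i / sqrt (\<rho> ^ i)))\<^sup>2" by (simp only: sq)
    also have "\<dots> \<le> (\<Sum>i<m. (sqrt (\<rho> ^ i))\<^sup>2) * (\<Sum>i<m. (d i / sqrt (\<rho> ^ i))\<^sup>2)"
      by (rule Cauchy_Schwarz_ineq_sum)
    also have "\<dots> = (\<Sum>i<m. \<rho> ^ i) * (\<Sum>i<m. (d i)\<^sup>2 / \<rho> ^ i)"
      by (simp only: power_divide sq)
    also have "\<dots> \<le> 1 / (1 - \<rho>) * (\<Sum>i<m. (d i)\<^sup>2 / \<rho> ^ i)"
    proof (intro mult_right_mono sum_nonneg)
      show "(\<Sum>i<m. \<rho> ^ i) \<le> 1 / (1 - \<rho>)"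
        using \<rho> sum_le_suminf[of "\<lambda>i. \<rho> ^ i" "{..<m}"] suminf_geometric[of \<rho>] by (simp add: summable_geometric)
    qed (use \<rho> in auto)
    finally have "ennreal ((A (k + m) - A k)\<^sup>2) \<le> ennreal (1 / (1 - \<rho>) * (\<Sum>i<m. (d i)\<^sup>2 / \<rho> ^ i))"
      unfolding tel by (rule ennreal_leI)
    also have "\<dots> = ennreal (1 / (1 - \<rho>)) * (\<Sum>i<m. ennreal ((d i)\<^sup>2 / \<rho> ^ i))"
      using \<rho> by (subst ennreal_mult) (auto intro!: sum_nonneg simp: sum_ennreal)
    also have "\<dots> \<le> ennreal (1 / (1 - \<rho>)) * (\<Sum>i<m. ennreal (\<rho> ^ (2 * k)) * (ennreal (\<rho> ^ i) * b (k + i)))"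
    proof (intro mult_left_mono sum_mono)
      fix i
      have "ennreal ((d i)\<^sup>2 / \<rho> ^ i) = ennreal (1 / \<rho> ^ i) * ennreal ((d i)\<^sup>2)"
        using \<rho> by (subst ennreal_mult[symmetric]) auto
      also have "\<dots> \<le> ennreal (1 / \<rho> ^ i) * (ennreal (\<rho> ^ (2 * (k + i))) * b (k + i))"
        using inc[of "k + i"] by (intro mult_left_mono) (auto simp: d_def)
      also have "\<dots> = ennreal (1 / \<rho> ^ i * \<rho> ^ (2 * (k + i))) * b (k + i)"
        using \<rho> by (subst ennreal_mult) (auto simp: mult.assoc)
      also have "1 / \<rho> ^ i * \<rho> ^ (2 * (k + i)) = \<rho> ^ (2 * k) * \<rho> ^ i"
      proof -
        have "\<rho> ^ (2 * (k + i)) = \<rho> ^ (2 * k) * \<rho> ^ i * \<rho> ^ i"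
          by (simp add: power_add[symmetric] algebra_simps)
        then show ?thesis using \<rho> by simp
      qed
      also have "ennreal (\<rho> ^ (2 * k) * \<rho> ^ i) * b (k + i) = ennreal (\<rho> ^ (2 * k)) * (ennreal (\<rho> ^ i) * b (k + i))"
        using \<rho> by (subst ennreal_mult) (auto simp: mult.assoc)
      finally show "ennreal ((d i)\<^sup>2 / \<rho> ^ i) \<le> ennreal (\<rho> ^ (2 * k)) * (ennreal (\<rho> ^ i) * b (k + i))" .
    qed auto
    also have "\<dots> = ennreal (1 / (1 - \<rho>)) * (ennreal (\<rho> ^ (2 * k)) * (\<Sum>i<m. ennreal (\<rho> ^ i) * b (k + i)))"
      by (simp only: sum_distrib_left)
    also have "\<dots> \<le> ennreal (1 / (1 - \<rho>)) * (ennreal (\<rho> ^ (2 * k)) * ?E)"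
      by (intro mult_left_mono sum_le_suminf) auto
    also have "\<dots> = ennreal (\<rho> ^ (2 * k) / (1 - \<rho>)) * ?E"
      using \<rho> by (simp add: mult.assoc[symmetric] ennreal_mult[symmetric])
    finally show ?thesis .
  qed
  have "(\<lambda>m. A (k + m)) \<longlonglongrightarrow> a"
    using lim LIMSEQ_ignore_initial_segment[OF lim, of k] by (simp add: add.commute)
  then have "(\<lambda>m. ennreal ((A (k + m) - A k)\<^sup>2)) \<longlonglongrightarrow> ennreal ((a - A k)\<^sup>2)"
    by (intro tendsto_ennrealI tendsto_intros)
  then show ?thesis by (rule LIMSEQ_le_const2) (use step in auto)
qed

lemma suminf_swap_ennreal:
  fixes f :: "nat \<Rightarrow> nat \<Rightarrow> ennreal"
  shows "(\<Sum>k. \<Sum>i. f k i) = (\<Sum>i. \<Sum>k. f k i)"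
proof -
  have "(\<Sum>k. \<Sum>i. f k i) = (\<integral>\<^sup>+k. (\<Sum>i. f k i) \<partial>count_space UNIV)" by (simp add: nn_integral_count_space_nat)
  also have "\<dots> = (\<Sum>i. \<integral>\<^sup>+k. f k i \<partial>count_space UNIV)" by (intro nn_integral_suminf) simp
  also have "\<dots> = (\<Sum>i. \<Sum>k. f k i)" by (simp add: nn_integral_count_space_nat)
  finally show ?thesis .
qed

text \<open>After exchanging the sums each b j is collected with weights \<rho>^i of total mass at
  most 1/(1 - \<rho>). Summing over all starting scales therefore loses only a constant, not the
  number of scales.\<close>

lemma dyadic_tails_sum:
  fixes b :: "nat \<Rightarrow> ennreal"
  assumes "0 < \<rho>" "\<rho> < 1"
  shows "(\<Sum>k. \<Sum>i. ennreal (\<rho> ^ i) * b (k + i)) \<le> ennreal (1 / (1 - \<rho>)) * (\<Sum>j. b j)"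
proof -
  have shift: "(\<Sum>k. b (k + i)) \<le> (\<Sum>j. b j)" for i
    using suminf_offset[of b i] by (metis add.commute le_iff_add summableI)
  have "(\<Sum>k. \<Sum>i. ennreal (\<rho> ^ i) * b (k + i)) = (\<Sum>i. ennreal (\<rho> ^ i) * (\<Sum>k. b (k + i)))"
    by (subst suminf_swap_ennreal) simp
  also have "\<dots> \<le> (\<Sum>i. ennreal (\<rho> ^ i) * (\<Sum>j. b j))"
    by (intro suminf_le mult_left_mono shift) auto
  also have "\<dots> = (\<Sum>i. ennreal (1 * \<rho> ^ i)) * (\<Sum>j. b j)" by simp
  also have "(\<Sum>i. ennreal (1 * \<rho> ^ i)) = ennreal (1 / (1 - \<rho>))"
    using assms by (intro suminf_ennreal_geometric) auto
  finally show ?thesis .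
qed

text \<open>Bounded overlap of corkscrew regions: a point at distance \<delta> from the boundary can
  belong only to scales with c times the radius < \<delta> < radius. From the first such scale on, m
  halvings bring the radius below c times its original value.\<close>

lemma dyadic_scale_count:
  fixes c \<delta> :: real
  assumes "0 < c" "1 \<le> 2 ^ m * c"
  shows "(\<Sum>j. (if c * (c / 2 ^ j) < \<delta> \<and> \<delta> < c / 2 ^ j then 1 else 0 :: ennreal)) \<le> of_nat m"
proof -
  define S where "S = {j::nat. c * (c / 2 ^ j) < \<delta> \<and> \<delta> < c / 2 ^ j}"
  have eq: "(\<Sum>j. (if c * (c / 2 ^ j) < \<delta> \<and> \<delta> < c / 2 ^ j then 1 else 0 :: ennreal)) = (\<Sum>j. indicator S j)"
    by (intro suminf_cong) (auto simp: S_def)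
  show ?thesis
  proof (cases "S = {}")
    case True
    then have "(\<lambda>j. indicator S j :: ennreal) = (\<lambda>_. 0)" by simp
    then show ?thesis unfolding eq by (simp only: suminf_zero) simp
  next
    case False
    define j0 where "j0 = (LEAST j. j \<in> S)"
    have j0: "j0 \<in> S" "\<And>j. j \<in> S \<Longrightarrow> j0 \<le> j"
      using False unfolding j0_def by (auto intro: LeastI Least_le)
    have "S \<subseteq> {j0..<j0 + m}"
    proof
      fix j assume j: "j \<in> S"
      have "j < j0 + m"
      proof (rule ccontr)
        assume "\<not> j < j0 + m"
        then have "(2::real) ^ (j0 + m) \<le> 2 ^ j" by (intro power_increasing) auto
        then have "c / 2 ^ j \<le> c / 2 ^ (j0 + m)" using assms by (intro divide_left_mono) auto
        also have "\<dots> = (c / 2 ^ j0) / 2 ^ m" by (simp add: power_add)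
        also have "\<dots> \<le> c * (c / 2 ^ j0)"
          using mult_left_mono[OF assms(2), of "c / 2 ^ j0"] assms(1) by (simp add: field_simps)
        also have "\<dots> < \<delta>" using j0(1) by (simp add: S_def)
        finally show False using j by (simp add: S_def)
      qed
      then show "j \<in> {j0..<j0 + m}" using j0(2)[OF j] by simp
    qed
    then have "(\<Sum>j. indicator S j :: ennreal) \<le> (\<Sum>j. indicator {j0..<j0 + m} j)"
      by (intro suminf_le) (auto simp: indicator_def)
    also have "\<dots> = (\<Sum>j\<in>{j0..<j0 + m}. indicator {j0..<j0 + m} j)"
      by (intro suminf_finite) auto
    also have "\<dots> = of_nat m" by simp
    finally show ?thesis unfolding eq .
  qed
qed

section \<open>Auxiliary inequalities, integrals over pairs, and the dual norm\<close>

lemma sum_square_3: "(a + b + d)\<^sup>2 \<le> 3 * (a\<^sup>2 + b\<^sup>2 + (d::real)\<^sup>2)"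
proof -
  have "0 \<le> (a - b)\<^sup>2 + (b - d)\<^sup>2 + (a - d)\<^sup>2" by simp
  then show ?thesis by (simp add: power2_eq_square algebra_simps)
qed

lemma sum_square_2: "(a + b)\<^sup>2 \<le> 2 * a\<^sup>2 + 2 * (b::real)\<^sup>2"
proof -
  have "0 \<le> (a - b)\<^sup>2" by simp
  then show ?thesis by (simp add: power2_eq_square algebra_simps)
qed

lemma half_powr: "(x / 2) powr - p = 2 powr p * x powr - p" for x p :: real
  unfolding powr_minus powr_divide by (simp add: inverse_eq_divide)

lemma nn_integral_pair_swap:
  assumes "sigma_finite_measure M" and [measurable]: "f \<in> borel_measurable (M \<Otimes>\<^sub>M M)"
  shows "(\<integral>\<^sup>+z. f (snd z, fst z) \<partial>(M \<Otimes>\<^sub>M M)) = (\<integral>\<^sup>+z. f z \<partial>(M \<Otimes>\<^sub>M M))"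
proof -
  interpret sigma_finite_measure M by fact
  interpret pair_sigma_finite M M ..
  have "(\<integral>\<^sup>+z. f z \<partial>(M \<Otimes>\<^sub>M M)) = (\<integral>\<^sup>+z. f z \<partial>distr (M \<Otimes>\<^sub>M M) (M \<Otimes>\<^sub>M M) (\<lambda>(x, y). (y, x)))"
    using distr_pair_swap by simp
  also have "\<dots> = (\<integral>\<^sup>+z. f ((\<lambda>(x, y). (y, x)) z) \<partial>(M \<Otimes>\<^sub>M M))"
    by (intro nn_integral_distr) measurable
  finally show ?thesis by (simp add: case_prod_beta)
qed

text \<open>Made for the Schur integrals: g is integrated first with x frozen. Its bound is a power
  of a distance from x to a fixed point and holds only when that distance is positive; where it
  vanishes, so does the factor a, which is why the bound is asked for only where a does not
  vanish.\<close>

lemma nn_integral_two_step: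
  fixes a b :: "'x \<Rightarrow> real" and g :: "'x \<Rightarrow> 'y \<Rightarrow> real"
  assumes "sigma_finite_measure N"
    and m: "(\<lambda>z. f (fst z) (snd z)) \<in> borel_measurable (M \<Otimes>\<^sub>M N)" "\<And>x. x \<in> space M \<Longrightarrow> (\<lambda>y. g x y) \<in> borel_measurable N"
    and f: "\<And>x y. f x y = a x * g x y" and nn: "\<And>x. 0 \<le> a x" "\<And>x y. 0 \<le> g x y" "\<And>x. 0 \<le> b x"
    and g: "\<And>x. x \<in> space M \<Longrightarrow> a x \<noteq> 0 \<Longrightarrow> (\<integral>\<^sup>+y. ennreal (g x y) \<partial>N) \<le> ennreal (b x)"
    and C: "(\<integral>\<^sup>+x. ennreal (a x * b x) \<partial>M) \<le> C"
  shows "(\<integral>\<^sup>+z. ennreal (f (fst z) (snd z)) \<partial>(M \<Otimes>\<^sub>M N)) \<le> C"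
proof -
  interpret sigma_finite_measure N by fact
  have "(\<integral>\<^sup>+z. ennreal (f (fst z) (snd z)) \<partial>(M \<Otimes>\<^sub>M N)) = (\<integral>\<^sup>+x. \<integral>\<^sup>+y. ennreal (f x y) \<partial>N \<partial>M)"
    using m by (subst nn_integral_fst[symmetric]) auto
  also have "\<dots> \<le> (\<integral>\<^sup>+x. ennreal (a x * b x) \<partial>M)"
  proof (rule nn_integral_mono)
    fix x assume x: "x \<in> space M"
    have "(\<integral>\<^sup>+y. ennreal (f x y) \<partial>N) = (\<integral>\<^sup>+y. ennreal (a x) * ennreal (g x y) \<partial>N)"
      unfolding f using nn by (simp add: ennreal_mult)
    also have "\<dots> = ennreal (a x) * (\<integral>\<^sup>+y. ennreal (g x y) \<partial>N)"
      using m(2)[OF x] by (intro nn_integral_cmult) measurable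
    also have "\<dots> \<le> ennreal (a x) * ennreal (b x)"
      using g[OF x] by (cases "a x = 0") (auto intro: mult_left_mono)
    finally show "(\<integral>\<^sup>+y. ennreal (f x y) \<partial>N) \<le> ennreal (a x * b x)" using nn by (simp add: ennreal_mult)
  qed
  finally show ?thesis using C by simp
qed

lemma emeasure_lborel_ball_le:
  "0 < r \<Longrightarrow> emeasure lborel (ball (z::'a::euclidean_space) r) \<le> ennreal (unit_ball_vol (real DIM('a)) * r powr real DIM('a))"
  by (simp add: emeasure_ball powr_realpow)

lemma ennreal_sum_square_2: "(a + b)\<^sup>2 \<le> 2 * a\<^sup>2 + 2 * (b::ennreal)\<^sup>2"
proof (cases a; cases b)
  fix r t assume a: "a = ennreal r" "0 \<le> r" and b: "b = ennreal t" "0 \<le> t"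
  have "a + b = ennreal (r + t)" using a b by simp
  then have "(a + b)\<^sup>2 = ennreal ((r + t)\<^sup>2)" using a b by (simp only: ennreal_power add_nonneg_nonneg)
  also have "\<dots> \<le> ennreal (2 * r\<^sup>2 + 2 * t\<^sup>2)" by (intro ennreal_leI sum_square_2)
  also have "\<dots> = 2 * a\<^sup>2 + 2 * b\<^sup>2" using a b by (simp add: ennreal_plus ennreal_mult ennreal_power)
  finally show ?thesis .
qed (auto simp: power2_eq_square ennreal_mult_top ennreal_top_mult)

text \<open>The dual norm is an infimum of admissible constants, so it has to be seen that it is
  itself admissible. Functions of norm 0 need separate care, as one cannot divide; there any
  admissible constant forces \<open>T f = 0\<close>.\<close>

lemma bdry_Hneg_bound:
  assumes "T \<in> bdry_Hneg \<Omega> \<alpha>"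
  shows "0 \<le> bdry_Hneg_norm \<Omega> \<alpha> T" "f \<in> bdry_H \<Omega> \<alpha> \<Longrightarrow> \<bar>T f\<bar> \<le> bdry_Hneg_norm \<Omega> \<alpha> T * bdry_H_norm \<Omega> \<alpha> f"
proof -
  let ?S = "{C. 0 \<le> C \<and> (\<forall>f \<in> bdry_H \<Omega> \<alpha>. \<bar>T f\<bar> \<le> C * bdry_H_norm \<Omega> \<alpha> f)}"
  have n0: "0 \<le> bdry_H_norm \<Omega> \<alpha> f" for f by (simp add: bdry_H_norm_def)
  obtain C where C: "\<forall>f \<in> bdry_H \<Omega> \<alpha>. \<bar>T f\<bar> \<le> C * bdry_H_norm \<Omega> \<alpha> f"
    using assms by (auto simp: bdry_Hneg_def)
  have mem: "max 0 C \<in> ?S"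
  proof (intro CollectI conjI ballI)
    fix f assume "f \<in> bdry_H \<Omega> \<alpha>"
    then have "\<bar>T f\<bar> \<le> C * bdry_H_norm \<Omega> \<alpha> f" using C by blast
    also have "\<dots> \<le> max 0 C * bdry_H_norm \<Omega> \<alpha> f" using n0 by (intro mult_right_mono) auto
    finally show "\<bar>T f\<bar> \<le> max 0 C * bdry_H_norm \<Omega> \<alpha> f" .
  qed simp
  show "0 \<le> bdry_Hneg_norm \<Omega> \<alpha> T"
    unfolding bdry_Hneg_norm_def using mem by (intro cInf_greatest) blast+
  assume f: "f \<in> bdry_H \<Omega> \<alpha>"
  show "\<bar>T f\<bar> \<le> bdry_Hneg_norm \<Omega> \<alpha> T * bdry_H_norm \<Omega> \<alpha> f"
  proof (cases "bdry_H_norm \<Omega> \<alpha> f = 0")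
    case True
    then show ?thesis using C f by force
  next
    case False
    then have pos: "0 < bdry_H_norm \<Omega> \<alpha> f" using n0[of f] by linarith
    have "\<bar>T f\<bar> / bdry_H_norm \<Omega> \<alpha> f \<le> bdry_Hneg_norm \<Omega> \<alpha> T"
      unfolding bdry_Hneg_norm_def
    proof (rule cInf_greatest)
      show "?S \<noteq> {}" using mem by blast
    qed (use f pos in \<open>auto simp: divide_le_eq\<close>)
    then show ?thesis using pos by (simp add: divide_le_eq)
  qed
qed

text \<open>Companion of \<open>AE_convergent_of_fast_cauchy\<close> for a prescribed limit: the
  squared errors are summable almost everywhere, so they tend to 0.\<close>

lemma AE_tendsto_of_fast:
  fixes F :: "nat \<Rightarrow> 'a \<Rightarrow> real"
  assumes [measurable]: "\<And>k. F k \<in> borel_measurable M" "h \<in> borel_measurable M"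
    and fast: "\<And>k. (\<integral>\<^sup>+x. ennreal ((F k x - h x)\<^sup>2) \<partial>M) \<le> ennreal ((1/4) ^ k)"
  shows "AE x in M. (\<lambda>k. F k x) \<longlonglongrightarrow> h x"
proof -
  have "(\<integral>\<^sup>+x. (\<Sum>k. ennreal ((F k x - h x)\<^sup>2)) \<partial>M) = (\<Sum>k. \<integral>\<^sup>+x. ennreal ((F k x - h x)\<^sup>2) \<partial>M)"
    by (intro nn_integral_suminf) measurable
  also have "\<dots> \<le> (\<Sum>k. ennreal (1 * (1/4) ^ k))" using fast by (intro suminf_le) auto
  also have "\<dots> = ennreal (1 / (1 - 1/4))" by (rule suminf_ennreal_geometric) auto
  finally have "(\<integral>\<^sup>+x. (\<Sum>k. ennreal ((F k x - h x)\<^sup>2)) \<partial>M) < \<infinity>" by (auto intro: le_less_trans)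
  then have "AE x in M. (\<Sum>k. ennreal ((F k x - h x)\<^sup>2)) \<noteq> \<infinity>" by (intro nn_integral_noteq_infinite) auto
  then show ?thesis
  proof (elim AE_mp, intro AE_I2 impI)
    fix x assume "(\<Sum>k. ennreal ((F k x - h x)\<^sup>2)) \<noteq> \<infinity>"
    then have "summable (\<lambda>k. (F k x - h x)\<^sup>2)"
      by (rule summable_suminf_not_top[rotated, unfolded infinity_ennreal_def[symmetric]]) simp
    then have "(\<lambda>k. (F k x - h x)\<^sup>2) \<longlonglongrightarrow> 0" by (rule summable_LIMSEQ_zero)
    then have "(\<lambda>k. sqrt ((F k x - h x)\<^sup>2)) \<longlonglongrightarrow> sqrt 0" by (rule tendsto_real_sqrt)
    then have "(\<lambda>k. \<bar>F k x - h x\<bar>) \<longlonglongrightarrow> 0" by simp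
    then have "(\<lambda>k. F k x - h x) \<longlonglongrightarrow> 0" by (rule tendsto_rabs_zero_cancel)
    then show "(\<lambda>k. F k x) \<longlonglongrightarrow> h x" by (rule LIM_zero_cancel)
  qed
qed

section \<open>Energies over corkscrew regions at dyadic scales\<close>

locale lipschitz_trace =
  fixes \<Omega> :: "'a::euclidean_space set" and s A c :: real
  assumes \<Omega>: "lipschitz_domain \<Omega>" and n: "2 \<le> DIM('a)" and s: "1/2 < s" "s < 1"
    and A: "0 \<le> A" "\<And>z r. 0 < r \<Longrightarrow> emeasure (bdry_measure \<Omega>) (ball z r) \<le> ennreal (A * r powr (real DIM('a) - 1))"
    and c: "0 < c" "c < 1" "\<And>P r. P \<in> frontier \<Omega> \<Longrightarrow> 0 < r \<Longrightarrow> r \<le> c \<Longrightarrow>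
       ennreal (c * r ^ DIM('a)) \<le> emeasure lborel (corkscrew \<Omega> c P r)"
begin

abbreviation "K \<equiv> frontier \<Omega>"
abbreviation "\<mu> \<equiv> bdry_measure \<Omega>"
abbreviation rad :: "nat \<Rightarrow> real" where "rad j \<equiv> c / 2 ^ j"
abbreviation W :: "nat \<Rightarrow> 'a \<Rightarrow> 'a set" where "W j P \<equiv> corkscrew \<Omega> c P (rad j)"

text \<open>The exponent \<open>n - 1 + 2 (s - 1/2)\<close> of the seminorm of \<open>H\<^sup>s\<^sup>-\<^sup>1\<^sup>/\<^sup>2\<close> of the boundary.\<close>
definition q :: real where "q = real DIM('a) + 2 * s - 2"

definition gagliardo :: "('a \<Rightarrow> real) \<Rightarrow> 'a \<Rightarrow> 'a \<Rightarrow> ennreal" where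
  "gagliardo v x y = ennreal ((v x - v y)\<^sup>2 / dist x y powr (real DIM('a) + 2 * s))"

definition gagliardo_at :: "('a \<Rightarrow> real) \<Rightarrow> 'a \<Rightarrow> ennreal" where
  "gagliardo_at v x = (\<integral>\<^sup>+y. indicator \<Omega> y * gagliardo v x y \<partial>lborel)"

definition Dsemi :: "('a \<Rightarrow> real) \<Rightarrow> ennreal" where
  "Dsemi v = (\<integral>\<^sup>+x. indicator \<Omega> x * gagliardo_at v x \<partial>lborel)"

text \<open>The factor with exponent 1 - n compensates the surface measure of the set of boundary
  points whose region at this scale contains a given x. Integrated over the boundary, each scale
  thus counts the interior energy with a weight independent of the scale
  (\<open>scale_one\<close>).\<close>

definition cork_energy :: "('a \<Rightarrow> real) \<Rightarrow> nat \<Rightarrow> 'a \<Rightarrow> ennreal" where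
  "cork_energy v j P = ennreal (rad j powr (1 - real DIM('a))) * (\<integral>\<^sup>+x. indicator (W j P) x * gagliardo_at v x \<partial>lborel)"

lemma open_domain: "open \<Omega>" and bounded_domain: "bounded \<Omega>" using \<Omega> by (auto simp: lipschitz_domain_def)

lemma \<Omega>_borel [measurable]: "\<Omega> \<in> sets borel" using open_domain by simp

lemma W_borel [measurable]: "W j P \<in> sets borel" using open_corkscrew[OF open_domain] by simp

lemma rad_pos: "0 < rad j" "rad j \<le> c" using c by (auto simp: divide_le_eq mult_le_cancel_left1)

lemma finite_measure_bdry: "finite_measure \<mu>"
proof
  obtain R where R: "0 < R" "closure \<Omega> \<subseteq> ball 0 R"
    using bounded_domain bounded_subset_ballD[of "closure \<Omega>" 0] by (auto simp: bounded_closure)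
  have "emeasure \<mu> (space \<mu>) = emeasure \<mu> (ball 0 R)"
  proof (rule emeasure_eq_AE)
    show "AE x in \<mu>. (x \<in> space \<mu>) = (x \<in> ball 0 R)"
      using AE_bdry_measure[of \<Omega>] R(2) by (elim AE_mp) (auto simp: frontier_def intro!: AE_I2)
  qed auto
  also have "\<dots> \<le> ennreal (A * R powr (real DIM('a) - 1))" using A R by auto
  also have "\<dots> < \<infinity>" by simp
  finally show "emeasure \<mu> (space \<mu>) \<noteq> \<infinity>" by simp
qed

sublocale fm: finite_measure \<mu> by (rule finite_measure_bdry)
sublocale lb: pair_sigma_finite "lborel :: 'a measure" \<mu> ..
sublocale bb: pair_sigma_finite \<mu> \<mu> ..

lemma measurable_infdist [measurable]: "(\<lambda>x. infdist x K) \<in> borel_measurable borel"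
  by (intro borel_measurable_continuous_onI continuous_intros)

lemma measurable_corkscrew_indicator [measurable]:
  assumes [measurable]: "f \<in> M \<rightarrow>\<^sub>M borel" "g \<in> M \<rightarrow>\<^sub>M borel"
  shows "(\<lambda>z. indicator (corkscrew \<Omega> c (f z) r) (g z) :: ennreal) \<in> borel_measurable M"
proof -
  have "(\<lambda>z. indicator (corkscrew \<Omega> c (f z) r) (g z) :: ennreal)
    = (\<lambda>z. if g z \<in> \<Omega> \<and> dist (g z) (f z) < r \<and> c * r < infdist (g z) K then 1 else 0)"
    by (auto simp: corkscrew_def indicator_def)
  then show ?thesis by simp
qed

lemma measurable_gagliardo [measurable]:
  assumes [measurable]: "v \<in> borel_measurable borel" "f \<in> M \<rightarrow>\<^sub>M borel" "g \<in> M \<rightarrow>\<^sub>M borel"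
  shows "(\<lambda>z. gagliardo v (f z) (g z)) \<in> borel_measurable M"
  unfolding gagliardo_def by measurable

lemma measurable_gagliardo_at [measurable]:
  assumes [measurable]: "v \<in> borel_measurable borel"
  shows "gagliardo_at v \<in> borel_measurable borel"
  unfolding gagliardo_at_def by measurable

lemma measurable_cork_energy [measurable]:
  assumes [measurable]: "v \<in> borel_measurable borel"
  shows "cork_energy v j \<in> borel_measurable borel"
  unfolding cork_energy_def by measurable

abbreviation J :: "nat \<Rightarrow> 'a \<Rightarrow> ennreal" where
  "J j x \<equiv> (if c * rad j < infdist x K \<and> infdist x K < rad j then 1 else 0)"

text \<open>If x lies in the region of \<open>P\<close>, then P is within \<open>rad j\<close> of x,
  which bounds the surface measure; and the distance of x to the boundary lies between c
  \<open>rad j\<close> and \<open>rad j\<close>, which is recorded by \<open>J\<close>.\<close>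

lemma integral_corkscrew_le:
  "(\<integral>\<^sup>+P. indicator (W j P) x \<partial>\<mu>) \<le> ennreal (A * rad j powr (real DIM('a) - 1)) * (indicator \<Omega> x * J j x)"
proof -
  have "(\<integral>\<^sup>+P. indicator (W j P) x \<partial>\<mu>) \<le> (\<integral>\<^sup>+P. (indicator \<Omega> x * J j x) * indicator (ball x (rad j)) P \<partial>\<mu>)"
  proof (rule nn_integral_mono_AE)
    show "AE P in \<mu>. indicator (W j P) x \<le> (indicator \<Omega> x * J j x) * indicator (ball x (rad j)) P"
      using AE_bdry_measure[of \<Omega>]
    proof (elim AE_mp, intro AE_I2 impI)
      fix P assume P: "P \<in> K"
      show "indicator (W j P) x \<le> (indicator \<Omega> x * J j x) * indicator (ball x (rad j)) P"
      proof (cases "x \<in> W j P")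
        case True
        then have "x \<in> \<Omega>" "dist x P < rad j" "c * rad j < infdist x K" by (auto simp: corkscrew_def)
        moreover have "infdist x K \<le> dist x P" using P by (rule infdist_le)
        ultimately show ?thesis using True by simp
      qed simp
    qed
  qed
  also have "\<dots> = (indicator \<Omega> x * J j x) * emeasure \<mu> (ball x (rad j))"
    by (intro nn_integral_cmult_indicator) auto
  also have "\<dots> \<le> (indicator \<Omega> x * J j x) * ennreal (A * rad j powr (real DIM('a) - 1))"
    using rad_pos[of j] by (intro mult_left_mono A) auto
  finally show ?thesis by (simp add: mult.commute)
qed

lemma scale_one: "ennreal (rad j powr (1 - real DIM('a))) * ennreal (A * rad j powr (real DIM('a) - 1)) = ennreal A"
proof -
  have "rad j powr (1 - real DIM('a)) * (A * rad j powr (real DIM('a) - 1)) = A * (rad j powr (1 - real DIM('a)) * rad j powr (real DIM('a) - 1))"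
    by (simp only: mult_ac)
  also have "rad j powr (1 - real DIM('a)) * rad j powr (real DIM('a) - 1) = 1"
    using rad_pos[of j] by (simp add: powr_add[symmetric])
  finally show ?thesis using A(1) by (simp add: ennreal_mult[symmetric])
qed

text \<open>Fubini moves the boundary integral inside, where \<open>scale_one\<close> cancels the
  normalisation. What is left is, for each x, the number of scales at which x is visible, and by
  \<open>dyadic_scale_count\<close> that is at most m.\<close>

lemma sum_cork_energy_le:
  assumes v[measurable]: "v \<in> borel_measurable borel" and m: "1 \<le> 2 ^ m * c"
  shows "(\<integral>\<^sup>+P. (\<Sum>j. cork_energy v j P) \<partial>\<mu>) \<le> ennreal A * of_nat m * Dsemi v"
proof -
  have 1: "(\<integral>\<^sup>+P. cork_energy v j P \<partial>\<mu>) \<le> (\<integral>\<^sup>+x. ennreal A * (J j x * (indicator \<Omega> x * gagliardo_at v x)) \<partial>lborel)" for j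
  proof -
    have "(\<integral>\<^sup>+P. cork_energy v j P \<partial>\<mu>) = ennreal (rad j powr (1 - real DIM('a))) * (\<integral>\<^sup>+P. \<integral>\<^sup>+x. indicator (W j P) x * gagliardo_at v x \<partial>lborel \<partial>\<mu>)"
      unfolding cork_energy_def by (intro nn_integral_cmult) measurable
    also have "\<dots> \<le> ennreal (rad j powr (1 - real DIM('a))) * (ennreal (A * rad j powr (real DIM('a) - 1)) * (\<integral>\<^sup>+x. J j x * (indicator \<Omega> x * gagliardo_at v x) \<partial>lborel))"
    proof (rule mult_left_mono)
    have "(\<integral>\<^sup>+P. \<integral>\<^sup>+x. indicator (W j P) x * gagliardo_at v x \<partial>lborel \<partial>\<mu>) = (\<integral>\<^sup>+x. \<integral>\<^sup>+P. indicator (W j P) x * gagliardo_at v x \<partial>\<mu> \<partial>lborel)"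
      by (rule lb.Fubini') measurable
    also have "\<dots> = (\<integral>\<^sup>+x. (\<integral>\<^sup>+P. indicator (W j P) x \<partial>\<mu>) * gagliardo_at v x \<partial>lborel)"
      by (intro nn_integral_cong nn_integral_multc) measurable
    also have "\<dots> \<le> (\<integral>\<^sup>+x. ennreal (A * rad j powr (real DIM('a) - 1)) * (indicator \<Omega> x * J j x) * gagliardo_at v x \<partial>lborel)"
      by (rule nn_integral_mono, rule mult_right_mono, rule integral_corkscrew_le) simp
    also have "\<dots> = ennreal (A * rad j powr (real DIM('a) - 1)) * (\<integral>\<^sup>+x. J j x * (indicator \<Omega> x * gagliardo_at v x) \<partial>lborel)"
    proof -
      have ac: "a * (b * d) * e = a * (d * (b * e))" for a b d e :: ennreal by (simp only: mult_ac)
      have "(\<integral>\<^sup>+x. ennreal (A * rad j powr (real DIM('a) - 1)) * (indicator \<Omega> x * J j x) * gagliardo_at v x \<partial>lborel)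
        = (\<integral>\<^sup>+x. ennreal (A * rad j powr (real DIM('a) - 1)) * (J j x * (indicator \<Omega> x * gagliardo_at v x)) \<partial>lborel)"
        by (rule nn_integral_cong) (rule ac)
      also have "\<dots> = ennreal (A * rad j powr (real DIM('a) - 1)) * (\<integral>\<^sup>+x. J j x * (indicator \<Omega> x * gagliardo_at v x) \<partial>lborel)"
        by (intro nn_integral_cmult) measurable
      finally show ?thesis .
    qed
    finally show "(\<integral>\<^sup>+P. \<integral>\<^sup>+x. indicator (W j P) x * gagliardo_at v x \<partial>lborel \<partial>\<mu>)
        \<le> ennreal (A * rad j powr (real DIM('a) - 1)) * (\<integral>\<^sup>+x. J j x * (indicator \<Omega> x * gagliardo_at v x) \<partial>lborel)" .
    qed simp
    also have "\<dots> = ennreal A * (\<integral>\<^sup>+x. J j x * (indicator \<Omega> x * gagliardo_at v x) \<partial>lborel)"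
      by (simp only: mult.assoc[symmetric] scale_one)
    also have "\<dots> = (\<integral>\<^sup>+x. ennreal A * (J j x * (indicator \<Omega> x * gagliardo_at v x)) \<partial>lborel)"
      by (intro nn_integral_cmult[symmetric]) measurable
    finally show ?thesis .
  qed
  have "(\<integral>\<^sup>+P. (\<Sum>j. cork_energy v j P) \<partial>\<mu>) = (\<Sum>j. \<integral>\<^sup>+P. cork_energy v j P \<partial>\<mu>)"
    by (intro nn_integral_suminf) measurable
  also have "\<dots> \<le> (\<Sum>j. \<integral>\<^sup>+x. ennreal A * (J j x * (indicator \<Omega> x * gagliardo_at v x)) \<partial>lborel)"
    by (intro suminf_le 1) auto
  also have "\<dots> = (\<integral>\<^sup>+x. (\<Sum>j. ennreal A * (J j x * (indicator \<Omega> x * gagliardo_at v x))) \<partial>lborel)"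
    by (intro nn_integral_suminf[symmetric]) measurable
  also have "\<dots> = (\<integral>\<^sup>+x. ennreal A * ((\<Sum>j. J j x) * (indicator \<Omega> x * gagliardo_at v x)) \<partial>lborel)"
    by (simp only: ennreal_suminf_cmult ennreal_suminf_multc)
  also have "\<dots> \<le> (\<integral>\<^sup>+x. ennreal A * (of_nat m * (indicator \<Omega> x * gagliardo_at v x)) \<partial>lborel)"
    using c(1) m by (intro nn_integral_mono mult_left_mono mult_right_mono dyadic_scale_count) auto
  also have "\<dots> = (\<integral>\<^sup>+x. (ennreal A * of_nat m) * (indicator \<Omega> x * gagliardo_at v x) \<partial>lborel)"
    by (simp only: mult.assoc)
  also have "\<dots> = ennreal A * of_nat m * Dsemi v"
    unfolding Dsemi_def by (intro nn_integral_cmult) measurable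
  finally show ?thesis .
qed

lemma emeasure_W: "emeasure lborel (W j P) < \<infinity>"
proof -
  have "W j P \<subseteq> ball P (rad j)" by (auto simp: corkscrew_def dist_commute)
  then have "emeasure lborel (W j P) \<le> emeasure lborel (ball P (rad j))" by (intro emeasure_mono) auto
  also have "\<dots> < \<infinity>" using emeasure_bounded_finite[of "ball P (rad j)"] by simp
  finally show ?thesis .
qed

lemma W_large: "P \<in> K \<Longrightarrow> ennreal (c * rad j ^ DIM('a)) \<le> emeasure lborel (W j P)"
  using c(3)[of P "rad j"] rad_pos[of j] by simp

lemma rad_powr_quotient:
  assumes "0 \<le> t" "0 < \<theta>"
  shows "(t * rad j) powr (real DIM('a) + 2 * s) / (\<theta> * (rad j) ^ DIM('a))\<^sup>2 = t powr (real DIM('a) + 2 * s) / \<theta>\<^sup>2 * rad j powr (2 * s - real DIM('a))"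
proof -
  have "(rad j ^ DIM('a))\<^sup>2 = rad j powr (2 * real DIM('a))"
    using rad_pos[of j] by (simp add: powr_realpow[symmetric] power2_eq_square powr_add[symmetric])
  moreover have "rad j powr (real DIM('a) + 2 * s) / rad j powr (2 * real DIM('a)) = rad j powr (2 * s - real DIM('a))"
    using rad_pos[of j] by (simp add: powr_diff[symmetric])
  moreover have "(t * rad j) powr (real DIM('a) + 2 * s) = t powr (real DIM('a) + 2 * s) * rad j powr (real DIM('a) + 2 * s)"
    by (rule powr_mult)
  ultimately show ?thesis by (simp only: power_mult_distrib times_divide_times_eq[symmetric])
qed

text \<open>Both regions lie in a ball of radius \<open>rad j\<close> around P and fill a fixed
  fraction of it. The powers combine to \<open>rad j\<close> to the power 2s - n; the part 1 - n
  goes into \<open>cork_energy\<close>, leaving the exponent 2s - 1 > 0 that drives the convergence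
  of the means.\<close>

lemma mean_increment:
  assumes v[measurable]: "v \<in> borel_measurable borel" and B: "\<And>x. x \<in> \<Omega> \<Longrightarrow> \<bar>v x\<bar> \<le> B" and P: "P \<in> K"
  shows "ennreal ((mean v (W (Suc j) P) - mean v (W j P))\<^sup>2)
     \<le> ennreal (2 powr (real DIM('a) + 2 * s) * 4 ^ DIM('a) / c\<^sup>2 * rad j powr (2 * s - 1)) * cork_energy v j P"
proof -
  \<comment> \<open>The guaranteed volume at the finer of the two scales, which is also a lower
    bound at the coarser one.\<close>
  let ?V = "(c / 2 ^ DIM('a)) * rad j ^ DIM('a)"
  have V: "?V = c * rad (Suc j) ^ DIM('a)" by (simp add: power_divide power_mult_distrib)
  have "rad (Suc j) ^ DIM('a) \<le> rad j ^ DIM('a)"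
    using rad_pos[of j] rad_pos[of "Suc j"] by (intro power_mono) auto
  then have V2: "?V \<le> c * rad j ^ DIM('a)" unfolding V using c by (intro mult_left_mono) auto
  have "ennreal ((mean v (W j P) - mean v (W (Suc j) P))\<^sup>2) \<le> ennreal ((2 * rad j) powr (real DIM('a) + 2 * s) / ?V\<^sup>2) *
     (\<integral>\<^sup>+x. indicator (W j P) x * (\<integral>\<^sup>+y. indicator (W (Suc j) P) y * ennreal ((v x - v y)\<^sup>2 / dist x y powr (real DIM('a) + 2 * s)) \<partial>lborel) \<partial>lborel)"
  proof (rule mean_diff_square_le)
    show "0 < ?V" using rad_pos[of j] c by simp
    show "ennreal ?V \<le> emeasure lborel (W j P)"
      using W_large[OF P, of j] ennreal_leI[OF V2] by (rule order_trans[rotated])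
    show "ennreal ?V \<le> emeasure lborel (W (Suc j) P)" unfolding V by (rule W_large[OF P])
    show "\<bar>v x\<bar> \<le> B" if "x \<in> W j P \<union> W (Suc j) P" for x using that B by (auto simp: corkscrew_def)
    show "dist x y \<le> 2 * rad j" if "x \<in> W j P" "y \<in> W (Suc j) P" for x y
    proof -
      have "dist x P < rad j" "dist y P < rad (Suc j)" using that by (auto simp: corkscrew_def)
      moreover have "rad (Suc j) \<le> rad j" using rad_pos[of j] by simp
      ultimately show ?thesis using dist_triangle2[of x y P] by linarith
    qed
  qed (use emeasure_W[of P j] emeasure_W[of P "Suc j"] W_borel[of P j] W_borel[of P "Suc j"] s in auto)
  also have "(2 * rad j) powr (real DIM('a) + 2 * s) / ?V\<^sup>2 = 2 powr (real DIM('a) + 2 * s) / (c / 2 ^ DIM('a))\<^sup>2 * rad j powr (2 * s - real DIM('a))"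
    using c by (intro rad_powr_quotient) auto
  also have "\<dots> = (2 powr (real DIM('a) + 2 * s) * 4 ^ DIM('a) / c\<^sup>2 * rad j powr (2 * s - 1)) * rad j powr (1 - real DIM('a))"
  proof -
    have "(2 ^ DIM('a))\<^sup>2 = (4 ^ DIM('a) :: real)" by (simp add: power2_eq_square power_mult_distrib[symmetric])
    moreover have "rad j powr (2 * s - 1) * rad j powr (1 - real DIM('a)) = rad j powr (2 * s - real DIM('a))"
      using rad_pos[of j] by (simp add: powr_add[symmetric])
    ultimately show ?thesis by (simp add: power_divide mult.assoc)
  qed
  also have "ennreal ((2 powr (real DIM('a) + 2 * s) * 4 ^ DIM('a) / c\<^sup>2 * rad j powr (2 * s - 1)) * rad j powr (1 - real DIM('a))) *
      (\<integral>\<^sup>+x. indicator (W j P) x * (\<integral>\<^sup>+y. indicator (W (Suc j) P) y * ennreal ((v x - v y)\<^sup>2 / dist x y powr (real DIM('a) + 2 * s)) \<partial>lborel) \<partial>lborel)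
    \<le> ennreal ((2 powr (real DIM('a) + 2 * s) * 4 ^ DIM('a) / c\<^sup>2 * rad j powr (2 * s - 1)) * rad j powr (1 - real DIM('a))) *
      (\<integral>\<^sup>+x. indicator (W j P) x * gagliardo_at v x \<partial>lborel)"
    unfolding gagliardo_at_def gagliardo_def
    by (intro mult_left_mono nn_integral_mono mult_right_mono) (auto simp: indicator_def corkscrew_def)
  also have "\<dots> = ennreal (2 powr (real DIM('a) + 2 * s) * 4 ^ DIM('a) / c\<^sup>2 * rad j powr (2 * s - 1)) * cork_energy v j P"
    unfolding cork_energy_def by (subst ennreal_mult) (auto simp: mult.assoc)
  finally show ?thesis by (simp add: power2_commute)
qed

text \<open>The same comparison, now at one scale for two boundary points no farther apart than that
  scale; the diameter is three radii, one for each region and one for the distance of the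
  points.\<close>

lemma mean_pair_diff:
  assumes v[measurable]: "v \<in> borel_measurable borel" and B: "\<And>x. x \<in> \<Omega> \<Longrightarrow> \<bar>v x\<bar> \<le> B" and PQ: "P \<in> K" "Q \<in> K" "dist P Q \<le> rad k"
  shows "ennreal ((mean v (W k P) - mean v (W k Q))\<^sup>2) \<le> ennreal (3 powr (real DIM('a) + 2 * s) / c\<^sup>2 * rad k powr (2 * s - real DIM('a))) *
     (\<integral>\<^sup>+x. indicator (W k P) x * (\<integral>\<^sup>+y. indicator (W k Q) y * gagliardo v x y \<partial>lborel) \<partial>lborel)"
proof -
  have "ennreal ((mean v (W k P) - mean v (W k Q))\<^sup>2) \<le> ennreal ((3 * rad k) powr (real DIM('a) + 2 * s) / (c * rad k ^ DIM('a))\<^sup>2) *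
     (\<integral>\<^sup>+x. indicator (W k P) x * (\<integral>\<^sup>+y. indicator (W k Q) y * ennreal ((v x - v y)\<^sup>2 / dist x y powr (real DIM('a) + 2 * s)) \<partial>lborel) \<partial>lborel)"
  proof (rule mean_diff_square_le)
    show "0 < c * rad k ^ DIM('a)" using rad_pos[of k] c by simp
    show "\<bar>v x\<bar> \<le> B" if "x \<in> W k P \<union> W k Q" for x using that B by (auto simp: corkscrew_def)
    show "dist x y \<le> 3 * rad k" if "x \<in> W k P" "y \<in> W k Q" for x y
    proof -
      have "dist x P < rad k" "dist y Q < rad k" using that by (auto simp: corkscrew_def)
      moreover have "dist x y \<le> dist x P + dist P Q + dist y Q"
        using dist_triangle[of x y P] dist_triangle[of P y Q] by (simp add: dist_commute)
      ultimately show ?thesis using PQ by linarith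
    qed
  qed (use W_large PQ emeasure_W s in auto)
  also have "(3 * rad k) powr (real DIM('a) + 2 * s) / (c * rad k ^ DIM('a))\<^sup>2 = 3 powr (real DIM('a) + 2 * s) / c\<^sup>2 * rad k powr (2 * s - real DIM('a))"
    using c by (intro rad_powr_quotient) auto
  finally show ?thesis by (simp add: gagliardo_def)
qed

lemma mean_tendsto:
  assumes v[measurable]: "v \<in> borel_measurable borel" and cont: "continuous_on (closure \<Omega>) v"
    and B: "\<And>x. x \<in> \<Omega> \<Longrightarrow> \<bar>v x\<bar> \<le> B" and P: "P \<in> K"
  shows "(\<lambda>j. mean v (W j P)) \<longlonglongrightarrow> v P"
proof (rule LIMSEQ_I)
  fix \<epsilon> :: real assume \<epsilon>: "0 < \<epsilon>"
  have "P \<in> closure \<Omega>" using P by (simp add: frontier_def)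
  then obtain \<delta> where \<delta>: "0 < \<delta>" "\<And>x. x \<in> closure \<Omega> \<Longrightarrow> dist x P < \<delta> \<Longrightarrow> dist (v x) (v P) < \<epsilon> / 2"
    using cont \<epsilon> unfolding continuous_on_iff by (metis half_gt_zero)
  have "(\<lambda>j. c * (1/2) ^ j) \<longlonglongrightarrow> 0"
    by (intro tendsto_mult_right_zero LIMSEQ_power_zero) simp
  then have "rad \<longlonglongrightarrow> 0" by (simp add: power_one_over)
  then obtain N where N: "\<And>j. N \<le> j \<Longrightarrow> rad j < \<delta>"
    using order_tendstoD(2)[OF \<open>rad \<longlonglongrightarrow> 0\<close> \<delta>(1)] unfolding eventually_sequentially by blast
  have "norm (mean v (W j P) - v P) < \<epsilon>" if "N \<le> j" for j
  proof -
    let ?M = "measure lborel (W j P)"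
    have M: "0 < ?M"
    proof -
      have e: "emeasure lborel (W j P) = ennreal ?M"
        using emeasure_W[of P j] by (intro emeasure_eq_ennreal_measure) auto
      have "0 < c * rad j ^ DIM('a)" using c(1) rad_pos[of j] by simp
      also have "\<dots> \<le> ?M" using W_large[OF P, of j] unfolding e by (simp add: ennreal_le_iff)
      finally show ?thesis .
    qed
    have "ennreal (?M * (mean v (W j P) - v P)\<^sup>2) \<le> (\<integral>\<^sup>+x. indicator (W j P) x * ennreal ((v x - v P)\<^sup>2) \<partial>lborel)"
      using M B emeasure_W by (intro mean_square_le) (auto simp: corkscrew_def)
    also have "\<dots> \<le> (\<integral>\<^sup>+x. ennreal ((\<epsilon>/2)\<^sup>2) * indicator (W j P) x \<partial>lborel)"
    proof (intro nn_integral_mono)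
      fix x
      show "indicator (W j P) x * ennreal ((v x - v P)\<^sup>2) \<le> ennreal ((\<epsilon>/2)\<^sup>2) * indicator (W j P) x"
      proof (cases "x \<in> W j P")
        case True
        then have "x \<in> closure \<Omega>" "dist x P < \<delta>"
          using N[OF that] closure_subset[of \<Omega>] by (auto simp: corkscrew_def)
        then have "\<bar>v x - v P\<bar> \<le> \<epsilon> / 2" using \<delta>(2)[of x] by (simp add: dist_real_def)
        then have "(v x - v P)\<^sup>2 \<le> (\<epsilon>/2)\<^sup>2" using \<epsilon> by (simp add: abs_le_square_iff[symmetric])
        then show ?thesis using True by (simp add: ennreal_leI)
      qed simp
    qed
    also have "\<dots> = ennreal ((\<epsilon>/2)\<^sup>2 * ?M)"
      using emeasure_W[of P j] by (subst nn_integral_cmult_indicator) (auto simp: emeasure_eq_ennreal_measure ennreal_mult)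
    finally have "?M * (mean v (W j P) - v P)\<^sup>2 \<le> ?M * (\<epsilon>/2)\<^sup>2" by (simp add: ennreal_le_iff mult.commute)
    then have "(mean v (W j P) - v P)\<^sup>2 \<le> (\<epsilon>/2)\<^sup>2" using M by simp
    then have "\<bar>mean v (W j P) - v P\<bar> \<le> \<epsilon>/2" using \<epsilon> by (intro abs_le_of_square_le) auto
    then show ?thesis using \<epsilon> by simp
  qed
  then show "\<exists>N. \<forall>j\<ge>N. norm (mean v (W j P) - v P) < \<epsilon>" by blast
qed

text \<open>The square root of 2^(1-2s), so that \<open>rad j\<close> to the power 2s - 1 is a
  constant times \<rho>^(2j), the form required by \<open>dyadic_telescope\<close>. It is below 1
  precisely when s > 1/2.\<close>

definition \<rho> :: real where "\<rho> = 2 powr (1/2 - s)"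

lemma \<rho>: "0 < \<rho>" "\<rho> < 1"
  using s powr_less_mono[of "1/2 - s" 0 2] by (auto simp: \<rho>_def)

lemma rad_powr_\<rho>: "rad j powr (2 * s - 1) = c powr (2 * s - 1) * \<rho> ^ (2 * j)"
proof -
  have "rad j powr (2 * s - 1) = c powr (2 * s - 1) * (2 ^ j) powr (1 - 2 * s)"
  proof -
    have "1 - 2 * s = - (2 * s - 1)" by simp
    then show ?thesis using c by (simp only: powr_minus_divide) (simp add: powr_divide)
  qed
  also have "(2 ^ j) powr (1 - 2 * s) = (2 powr (1 - 2 * s) :: real) ^ j" by (rule power_powr_swap)
  also have "(2 powr (1 - 2 * s) :: real) = \<rho>\<^sup>2" by (simp add: \<rho>_def power2_eq_square powr_add[symmetric])
  finally show ?thesis by (simp add: power_mult)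
qed

definition Ctel :: real where
  "Ctel = 2 powr (real DIM('a) + 2 * s) * 4 ^ DIM('a) / c\<^sup>2 * c powr (2 * s - 1)"

text \<open>The right-hand side of the telescoping estimate from scale k on, kept as a function on
  the boundary so that it can be integrated before the scales are summed.\<close>

definition tail :: "('a \<Rightarrow> real) \<Rightarrow> nat \<Rightarrow> 'a \<Rightarrow> ennreal" where
  "tail v k P = (\<Sum>i. ennreal (\<rho> ^ i) * (ennreal Ctel * cork_energy v (k + i) P))"

lemma measurable_tail [measurable]:
  assumes [measurable]: "v \<in> borel_measurable borel"
  shows "tail v k \<in> borel_measurable borel"
  unfolding tail_def by measurable

lemma trace_minus_mean:
  assumes v[measurable]: "v \<in> borel_measurable borel" and cont: "continuous_on (closure \<Omega>) v"
    and B: "\<And>x. x \<in> \<Omega> \<Longrightarrow> \<bar>v x\<bar> \<le> B" and P: "P \<in> K"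
  shows "ennreal ((v P - mean v (W k P))\<^sup>2) \<le> ennreal (\<rho> ^ (2 * k) / (1 - \<rho>)) * tail v k P"
  unfolding tail_def
proof (rule dyadic_telescope[OF \<rho>])
  show "(\<lambda>k. mean v (W k P)) \<longlonglongrightarrow> v P" by (rule mean_tendsto[OF v cont B P])
  fix j
  have "ennreal ((mean v (W (Suc j) P) - mean v (W j P))\<^sup>2)
     \<le> ennreal (2 powr (real DIM('a) + 2 * s) * 4 ^ DIM('a) / c\<^sup>2 * rad j powr (2 * s - 1)) * cork_energy v j P"
    by (rule mean_increment[OF v B P])
  also have "2 powr (real DIM('a) + 2 * s) * 4 ^ DIM('a) / c\<^sup>2 * rad j powr (2 * s - 1) = \<rho> ^ (2 * j) * Ctel"
    unfolding rad_powr_\<rho> Ctel_def by (simp only: mult_ac)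
  also have "ennreal (\<rho> ^ (2 * j) * Ctel) = ennreal (\<rho> ^ (2 * j)) * ennreal Ctel"
    using \<rho> by (intro ennreal_mult) (auto simp: Ctel_def)
  finally show "ennreal ((mean v (W (Suc j) P) - mean v (W j P))\<^sup>2) \<le> ennreal (\<rho> ^ (2 * j)) * (ennreal Ctel * cork_energy v j P)"
    by (simp add: mult.assoc)
qed

lemma integral_tails_le:
  assumes v[measurable]: "v \<in> borel_measurable borel"
  shows "(\<Sum>k. \<integral>\<^sup>+P. tail v k P \<partial>\<mu>) \<le> ennreal (1 / (1 - \<rho>)) * ennreal Ctel * (\<integral>\<^sup>+P. (\<Sum>j. cork_energy v j P) \<partial>\<mu>)"
proof -
  have "(\<Sum>k. \<integral>\<^sup>+P. tail v k P \<partial>\<mu>) = (\<integral>\<^sup>+P. (\<Sum>k. tail v k P) \<partial>\<mu>)"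
    by (intro nn_integral_suminf[symmetric]) measurable
  also have "\<dots> \<le> (\<integral>\<^sup>+P. ennreal (1 / (1 - \<rho>)) * (\<Sum>j. ennreal Ctel * cork_energy v j P) \<partial>\<mu>)"
    unfolding tail_def by (intro nn_integral_mono dyadic_tails_sum[OF \<rho>])
  also have "\<dots> = (\<integral>\<^sup>+P. (ennreal (1 / (1 - \<rho>)) * ennreal Ctel) * (\<Sum>j. cork_energy v j P) \<partial>\<mu>)"
    by (simp only: ennreal_suminf_cmult mult.assoc)
  also have "\<dots> = ennreal (1 / (1 - \<rho>)) * ennreal Ctel * (\<integral>\<^sup>+P. (\<Sum>j. cork_energy v j P) \<partial>\<mu>)"
    by (intro nn_integral_cmult) measurable
  finally show ?thesis .
qed

section \<open>Pairs of boundary points at a common scale\<close>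

definition cork_pair :: "('a \<Rightarrow> real) \<Rightarrow> nat \<Rightarrow> 'a \<Rightarrow> 'a \<Rightarrow> ennreal" where
  "cork_pair v k P Q = (\<integral>\<^sup>+x. indicator (W k P) x * (\<integral>\<^sup>+y. indicator (W k Q) y * gagliardo v x y \<partial>lborel) \<partial>lborel)"

lemma measurable_cork_pair [measurable]:
  assumes [measurable]: "v \<in> borel_measurable borel" "f \<in> M \<rightarrow>\<^sub>M borel" "g \<in> M \<rightarrow>\<^sub>M borel"
  shows "(\<lambda>z. cork_pair v k (f z) (g z)) \<in> borel_measurable M"
  unfolding cork_pair_def by measurable

text \<open>Integrating out Q turns the indicator of its region into at most A times
  \<open>rad k\<close> to the power n - 1, after which y ranges over the whole domain. The second
  power n - 1 in the result undoes the normalisation of \<open>cork_energy\<close>.\<close>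

lemma integral_cork_pair_le:
  assumes v[measurable]: "v \<in> borel_measurable borel"
  shows "(\<integral>\<^sup>+Q. cork_pair v k P Q \<partial>\<mu>) \<le> ennreal (A * rad k powr (2 * real DIM('a) - 2)) * cork_energy v k P"
proof -
  have inner: "(\<integral>\<^sup>+Q. \<integral>\<^sup>+y. indicator (W k Q) y * gagliardo v x y \<partial>lborel \<partial>\<mu>) \<le> ennreal (A * rad k powr (real DIM('a) - 1)) * gagliardo_at v x" for x
  proof -
    have "(\<integral>\<^sup>+Q. \<integral>\<^sup>+y. indicator (W k Q) y * gagliardo v x y \<partial>lborel \<partial>\<mu>) = (\<integral>\<^sup>+y. \<integral>\<^sup>+Q. indicator (W k Q) y * gagliardo v x y \<partial>\<mu> \<partial>lborel)"
      by (rule lb.Fubini') measurable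
    also have "\<dots> = (\<integral>\<^sup>+y. (\<integral>\<^sup>+Q. indicator (W k Q) y \<partial>\<mu>) * gagliardo v x y \<partial>lborel)"
      by (intro nn_integral_cong nn_integral_multc) measurable
    also have "\<dots> \<le> (\<integral>\<^sup>+y. ennreal (A * rad k powr (real DIM('a) - 1)) * (indicator \<Omega> y * gagliardo v x y) \<partial>lborel)"
    proof (rule nn_integral_mono)
      fix y
      have "(\<integral>\<^sup>+Q. indicator (W k Q) y \<partial>\<mu>) \<le> ennreal (A * rad k powr (real DIM('a) - 1)) * (indicator \<Omega> y * J k y)"
        by (rule integral_corkscrew_le)
      also have "\<dots> \<le> ennreal (A * rad k powr (real DIM('a) - 1)) * (indicator \<Omega> y * 1)"
        by (intro mult_left_mono) auto
      finally have "(\<integral>\<^sup>+Q. indicator (W k Q) y \<partial>\<mu>) * gagliardo v x y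
          \<le> ennreal (A * rad k powr (real DIM('a) - 1)) * (indicator \<Omega> y * 1) * gagliardo v x y"
        by (rule mult_right_mono) simp
      then show "(\<integral>\<^sup>+Q. indicator (W k Q) y \<partial>\<mu>) * gagliardo v x y
          \<le> ennreal (A * rad k powr (real DIM('a) - 1)) * (indicator \<Omega> y * gagliardo v x y)"
        by (simp only: mult.assoc mult_1)
    qed
    also have "\<dots> = ennreal (A * rad k powr (real DIM('a) - 1)) * gagliardo_at v x"
      unfolding gagliardo_at_def by (intro nn_integral_cmult) measurable
    finally show ?thesis .
  qed
  have "(\<integral>\<^sup>+Q. cork_pair v k P Q \<partial>\<mu>) = (\<integral>\<^sup>+x. \<integral>\<^sup>+Q. indicator (W k P) x * (\<integral>\<^sup>+y. indicator (W k Q) y * gagliardo v x y \<partial>lborel) \<partial>\<mu> \<partial>lborel)"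
    unfolding cork_pair_def by (rule lb.Fubini') measurable
  also have "\<dots> = (\<integral>\<^sup>+x. indicator (W k P) x * (\<integral>\<^sup>+Q. \<integral>\<^sup>+y. indicator (W k Q) y * gagliardo v x y \<partial>lborel \<partial>\<mu>) \<partial>lborel)"
    by (intro nn_integral_cong nn_integral_cmult) measurable
  also have "\<dots> \<le> (\<integral>\<^sup>+x. indicator (W k P) x * (ennreal (A * rad k powr (real DIM('a) - 1)) * gagliardo_at v x) \<partial>lborel)"
    by (intro nn_integral_mono mult_left_mono inner) auto
  also have "\<dots> = (\<integral>\<^sup>+x. ennreal (A * rad k powr (real DIM('a) - 1)) * (indicator (W k P) x * gagliardo_at v x) \<partial>lborel)"
    by (simp only: mult.left_commute)
  also have "\<dots> = ennreal (A * rad k powr (real DIM('a) - 1)) * (\<integral>\<^sup>+x. indicator (W k P) x * gagliardo_at v x \<partial>lborel)"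
    by (intro nn_integral_cmult) measurable
  also have "A * rad k powr (real DIM('a) - 1) = A * rad k powr (2 * real DIM('a) - 2) * rad k powr (1 - real DIM('a))"
    using rad_pos[of k] by (simp add: mult.assoc powr_add[symmetric])
  also have "ennreal \<dots> * (\<integral>\<^sup>+x. indicator (W k P) x * gagliardo_at v x \<partial>lborel) = ennreal (A * rad k powr (2 * real DIM('a) - 2)) * cork_energy v k P"
    unfolding cork_energy_def using A(1) by (subst ennreal_mult) (auto simp: mult.assoc)
  finally show ?thesis .
qed

definition near :: "nat \<Rightarrow> 'a \<Rightarrow> 'a \<Rightarrow> ennreal" where
  "near k P Q = indicator {d. d \<le> rad k} (dist P Q)"

lemma measurable_near [measurable]:
  assumes [measurable]: "f \<in> M \<rightarrow>\<^sub>M borel" "g \<in> M \<rightarrow>\<^sub>M borel"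
  shows "(\<lambda>z. near k (f z) (g z)) \<in> borel_measurable M"
  unfolding near_def by measurable

lemma integral_near: "(\<integral>\<^sup>+Q. near k P Q \<partial>\<mu>) \<le> ennreal (A * (2 * rad k) powr (real DIM('a) - 1))"
proof -
  have "(\<integral>\<^sup>+Q. near k P Q \<partial>\<mu>) \<le> (\<integral>\<^sup>+Q. indicator (ball P (2 * rad k)) Q \<partial>\<mu>)"
    using rad_pos[of k] by (intro nn_integral_mono) (auto simp: near_def indicator_def)
  also have "\<dots> = emeasure \<mu> (ball P (2 * rad k))" by simp
  also have "\<dots> \<le> ennreal (A * (2 * rad k) powr (real DIM('a) - 1))"
    using rad_pos[of k] by (intro A) auto
  finally show ?thesis .
qed

text \<open>\<open>C3\<close> is the constant of \<open>mean_pair_diff\<close>; \<open>C5\<close>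
  and \<open>C6\<close> are what remains in \<open>integral_scale_term\<close> once all powers of
  \<open>rad k\<close> have cancelled.\<close>

definition "C3 = 3 powr (real DIM('a) + 2 * s) / c\<^sup>2"
definition "C5 = 3 * 2 powr q * 2 * A * 2 powr (real DIM('a) - 1) * c powr (1 - 2 * s) / (1 - \<rho>)"
definition "C6 = 3 * 2 powr q * C3 * A"

text \<open>A majorant of the squared difference quotient for pairs at distance about
  \<open>rad k\<close>: the factor 3 comes from splitting the difference into three, 2^q from
  distances being at least half of \<open>rad k\<close>. Pairs are later bounded by the sum over all
  k, so that no scale has to be selected measurably.\<close>

definition scale_term :: "('a \<Rightarrow> real) \<Rightarrow> nat \<Rightarrow> 'a \<Rightarrow> 'a \<Rightarrow> ennreal" where
  "scale_term v k P Q = ennreal (3 * 2 powr q * rad k powr - q) *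
     (near k P Q * (ennreal (\<rho> ^ (2 * k) / (1 - \<rho>)) * (tail v k P + tail v k Q))
       + ennreal (C3 * rad k powr (2 * s - real DIM('a))) * cork_pair v k P Q)"

lemma measurable_scale_term [measurable]:
  assumes [measurable]: "v \<in> borel_measurable borel" "f \<in> M \<rightarrow>\<^sub>M borel" "g \<in> M \<rightarrow>\<^sub>M borel"
  shows "(\<lambda>z. scale_term v k (f z) (g z)) \<in> borel_measurable M"
  unfolding scale_term_def by measurable

text \<open>All powers of the radius cancel. In the tail part -q + (n - 1) = 1 - 2s, offset by
  \<rho>^(2k); in the pair part -q + (2s - n) + (2n - 2) = 0. The bound has the same constants at
  every scale, and summing it over k invokes only the overlap and Hardy estimates.\<close>

lemma integral_scale_term:
  assumes v[measurable]: "v \<in> borel_measurable borel"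
  shows "(\<integral>\<^sup>+P. \<integral>\<^sup>+Q. scale_term v k P Q \<partial>\<mu> \<partial>\<mu>) \<le> ennreal C5 * (\<integral>\<^sup>+P. tail v k P \<partial>\<mu>) + ennreal C6 * (\<integral>\<^sup>+P. cork_energy v k P \<partial>\<mu>)"
proof -
  let ?E = "3 * 2 powr q * rad k powr - q"
  let ?r = "\<rho> ^ (2 * k) / (1 - \<rho>)"
  let ?N = "A * (2 * rad k) powr (real DIM('a) - 1)"
  let ?c3 = "C3 * rad k powr (2 * s - real DIM('a))"
  let ?T = "\<integral>\<^sup>+P. tail v k P \<partial>\<mu>" and ?S = "\<integral>\<^sup>+P. cork_energy v k P \<partial>\<mu>"
  have near1: "(\<integral>\<^sup>+P. \<integral>\<^sup>+Q. near k P Q * tail v k P \<partial>\<mu> \<partial>\<mu>) \<le> ennreal ?N * ?T"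
  proof -
    have "(\<integral>\<^sup>+P. \<integral>\<^sup>+Q. near k P Q * tail v k P \<partial>\<mu> \<partial>\<mu>) = (\<integral>\<^sup>+P. (\<integral>\<^sup>+Q. near k P Q \<partial>\<mu>) * tail v k P \<partial>\<mu>)"
      by (intro nn_integral_cong nn_integral_multc) measurable
    also have "\<dots> \<le> (\<integral>\<^sup>+P. ennreal ?N * tail v k P \<partial>\<mu>)"
      by (rule nn_integral_mono, rule mult_right_mono, rule integral_near) simp
    also have "\<dots> = ennreal ?N * ?T" by (intro nn_integral_cmult) measurable
    finally show ?thesis .
  qed
  have near2: "(\<integral>\<^sup>+P. \<integral>\<^sup>+Q. near k P Q * tail v k Q \<partial>\<mu> \<partial>\<mu>) \<le> ennreal ?N * ?T"
  proof -
    have "(\<integral>\<^sup>+P. \<integral>\<^sup>+Q. near k P Q * tail v k Q \<partial>\<mu> \<partial>\<mu>) = (\<integral>\<^sup>+Q. \<integral>\<^sup>+P. near k P Q * tail v k Q \<partial>\<mu> \<partial>\<mu>)"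
      by (rule bb.Fubini') measurable
    also have "\<dots> = (\<integral>\<^sup>+P. \<integral>\<^sup>+Q. near k P Q * tail v k P \<partial>\<mu> \<partial>\<mu>)"
      by (simp add: near_def dist_commute)
    finally show ?thesis using near1 by simp
  qed
  have pr: "(\<integral>\<^sup>+P. \<integral>\<^sup>+Q. cork_pair v k P Q \<partial>\<mu> \<partial>\<mu>) \<le> ennreal (A * rad k powr (2 * real DIM('a) - 2)) * ?S"
  proof -
    have "(\<integral>\<^sup>+P. \<integral>\<^sup>+Q. cork_pair v k P Q \<partial>\<mu> \<partial>\<mu>) \<le> (\<integral>\<^sup>+P. ennreal (A * rad k powr (2 * real DIM('a) - 2)) * cork_energy v k P \<partial>\<mu>)"
      by (intro nn_integral_mono integral_cork_pair_le v)
    also have "\<dots> = ennreal (A * rad k powr (2 * real DIM('a) - 2)) * ?S" by (intro nn_integral_cmult) measurable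
    finally show ?thesis .
  qed
  have "(\<integral>\<^sup>+P. \<integral>\<^sup>+Q. scale_term v k P Q \<partial>\<mu> \<partial>\<mu>)
     = (\<integral>\<^sup>+P. \<integral>\<^sup>+Q. (ennreal ?E * ennreal ?r) * (near k P Q * tail v k P) + (ennreal ?E * ennreal ?r) * (near k P Q * tail v k Q)
        + (ennreal ?E * ennreal ?c3) * cork_pair v k P Q \<partial>\<mu> \<partial>\<mu>)"
    unfolding scale_term_def by (simp only: distrib_left mult_ac)
  also have "\<dots> = (ennreal ?E * ennreal ?r) * (\<integral>\<^sup>+P. \<integral>\<^sup>+Q. near k P Q * tail v k P \<partial>\<mu> \<partial>\<mu>)
      + (ennreal ?E * ennreal ?r) * (\<integral>\<^sup>+P. \<integral>\<^sup>+Q. near k P Q * tail v k Q \<partial>\<mu> \<partial>\<mu>)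
      + (ennreal ?E * ennreal ?c3) * (\<integral>\<^sup>+P. \<integral>\<^sup>+Q. cork_pair v k P Q \<partial>\<mu> \<partial>\<mu>)"
    by (simp add: nn_integral_add nn_integral_cmult)
  also have "\<dots> \<le> (ennreal ?E * ennreal ?r) * (ennreal ?N * ?T) + (ennreal ?E * ennreal ?r) * (ennreal ?N * ?T)
      + (ennreal ?E * ennreal ?c3) * (ennreal (A * rad k powr (2 * real DIM('a) - 2)) * ?S)"
    by (intro add_mono mult_left_mono near1 near2 pr) auto
  also have "\<dots> = (ennreal ?E * ennreal ?r * ennreal ?N + ennreal ?E * ennreal ?r * ennreal ?N) * ?T
      + (ennreal ?E * ennreal ?c3 * ennreal (A * rad k powr (2 * real DIM('a) - 2))) * ?S"
    by (simp only: distrib_right mult.assoc)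
  also have "ennreal ?E * ennreal ?r * ennreal ?N + ennreal ?E * ennreal ?r * ennreal ?N = ennreal C5"
  proof -
    have e: "rad k powr - q * rad k powr (real DIM('a) - 1) * \<rho> ^ (2 * k) = c powr (1 - 2 * s)"
    proof -
      have "rad k powr - q * rad k powr (real DIM('a) - 1) = rad k powr (1 - 2 * s)"
        using rad_pos[of k] by (simp add: powr_add[symmetric] q_def)
      also have "\<dots> = inverse (rad k powr (2 * s - 1))" by (simp add: powr_minus[symmetric])
      also have "\<dots> = c powr (1 - 2 * s) * inverse (\<rho> ^ (2 * k))"
        unfolding rad_powr_\<rho> by (simp add: powr_minus[symmetric])
      finally show ?thesis using \<rho> by simp
    qed
    have "?E * ?r * ?N + ?E * ?r * ?N = 3 * 2 powr q * 2 * A * 2 powr (real DIM('a) - 1) *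
        (rad k powr - q * rad k powr (real DIM('a) - 1) * \<rho> ^ (2 * k)) / (1 - \<rho>)"
      unfolding powr_mult by (simp add: mult_ac)
    then have "?E * ?r * ?N + ?E * ?r * ?N = C5" unfolding e C5_def .
    moreover have "ennreal ?E * ennreal ?r * ennreal ?N + ennreal ?E * ennreal ?r * ennreal ?N = ennreal (?E * ?r * ?N + ?E * ?r * ?N)"
    proof -
      have *: "ennreal a * ennreal b * ennreal d + ennreal a * ennreal b * ennreal d = ennreal (a * b * d + a * b * d)"
        if "0 \<le> a" "0 \<le> b" "0 \<le> d" for a b d using that by (simp only: ennreal_mult ennreal_plus mult_nonneg_nonneg)
      show ?thesis by (rule *) (use \<rho> A(1) in auto)
    qed
    ultimately show ?thesis by simp
  qed
  also have "ennreal ?E * ennreal ?c3 * ennreal (A * rad k powr (2 * real DIM('a) - 2)) = ennreal C6"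
  proof -
    have e: "rad k powr - q * rad k powr (2 * s - real DIM('a)) * rad k powr (2 * real DIM('a) - 2) = 1"
      using rad_pos[of k] by (simp add: powr_add[symmetric] q_def)
    have "?E * ?c3 * (A * rad k powr (2 * real DIM('a) - 2)) = 3 * 2 powr q * C3 * A *
       (rad k powr - q * rad k powr (2 * s - real DIM('a)) * rad k powr (2 * real DIM('a) - 2))"
      by (simp only: mult_ac)
    then have "?E * ?c3 * (A * rad k powr (2 * real DIM('a) - 2)) = C6" unfolding e C6_def by simp
    moreover have "0 \<le> C3" by (simp add: C3_def)
    ultimately show ?thesis using A(1) by (simp add: ennreal_mult'[symmetric])
  qed
  finally show ?thesis .
qed

text \<open>Distant pairs are paid for by the values of v. A close pair is joined by the chain v P,
  mean near P, mean near Q, v Q at the scale of its distance; the outer links are telescoping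
  errors, the middle one compares two regions of that scale.\<close>

lemma diffq_pointwise:
  assumes v[measurable]: "v \<in> borel_measurable borel" and cont: "continuous_on (closure \<Omega>) v"
    and B: "\<And>x. x \<in> \<Omega> \<Longrightarrow> \<bar>v x\<bar> \<le> B" and P: "P \<in> K" and Q: "Q \<in> K"
  shows "ennreal ((diffq q v (P, Q))\<^sup>2) \<le> ennreal (2 * c powr - q) * (ennreal ((v P)\<^sup>2) + ennreal ((v Q)\<^sup>2)) + (\<Sum>k. scale_term v k P Q)"
proof -
  have q0: "0 < q" using n s by (simp add: q_def)
  have dq: "(diffq q v (P, Q))\<^sup>2 = (v P - v Q)\<^sup>2 / dist P Q powr q" by (simp add: diffq_squared)
  consider "P = Q" | "c < dist P Q" | "P \<noteq> Q" "dist P Q \<le> c" by linarith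
  then show ?thesis
  proof cases
    case 1
    then show ?thesis by (simp add: diffq_def)
  next
    case 2
    have "(v P - v Q)\<^sup>2 \<le> 2 * (v P)\<^sup>2 + 2 * (v Q)\<^sup>2" using sum_square_2[of "v P" "- v Q"] by simp
    moreover have "dist P Q powr - q \<le> c powr - q" using 2 c q0 by (intro powr_mono2') auto
    ultimately have "(v P - v Q)\<^sup>2 * dist P Q powr - q \<le> (2 * (v P)\<^sup>2 + 2 * (v Q)\<^sup>2) * c powr - q"
      by (intro mult_mono) auto
    also have "\<dots> = 2 * c powr - q * ((v P)\<^sup>2 + (v Q)\<^sup>2)" by (simp add: algebra_simps)
    finally have "ennreal ((diffq q v (P, Q))\<^sup>2) \<le> ennreal (2 * c powr - q * ((v P)\<^sup>2 + (v Q)\<^sup>2))"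
      unfolding dq by (intro ennreal_leI) (simp add: powr_minus divide_inverse)
    also have "\<dots> = ennreal (2 * c powr - q) * (ennreal ((v P)\<^sup>2) + ennreal ((v Q)\<^sup>2))"
      by (simp add: ennreal_mult ennreal_plus)
    finally show ?thesis by (rule order_trans) simp
  next
    case 3
    let ?d = "dist P Q"
    have d: "0 < ?d" using 3 by simp
    \<comment> \<open>The scale with \<open>rad k\<close> / 2 <= |P - Q| <=
      \<open>rad k\<close>.\<close>
    obtain k where k: "2 ^ k \<le> c / ?d" "c / ?d < 2 ^ Suc k"
      using dyadic_interval[of "c / ?d"] 3 d by auto
    have dk: "?d \<le> rad k" "rad k / 2 \<le> ?d"
      using k d by (simp_all add: field_simps)
    have regroup: "(3 * (a + b + e)) * (t * r) = (3 * t * r) * ((a + e) + b)" for a b e t r :: real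
      by (simp add: algebra_simps)
    let ?a = "v P - mean v (W k P)" and ?b = "mean v (W k P) - mean v (W k Q)" and ?e = "mean v (W k Q) - v Q"
    have "(v P - v Q)\<^sup>2 \<le> 3 * (?a\<^sup>2 + ?b\<^sup>2 + ?e\<^sup>2)"
      using sum_square_3[of ?a ?b ?e] by simp
    moreover have "?d powr - q \<le> (rad k / 2) powr - q" using dk rad_pos[of k] q0 by (intro powr_mono2') auto
    ultimately have "(v P - v Q)\<^sup>2 * ?d powr - q \<le> (3 * (?a\<^sup>2 + ?b\<^sup>2 + ?e\<^sup>2)) * (rad k / 2) powr - q"
      by (intro mult_mono) auto
    also have "(rad k / 2) powr - q = 2 powr q * rad k powr - q"
      by (rule half_powr)
    finally have "(v P - v Q)\<^sup>2 * ?d powr - q \<le> (3 * 2 powr q * rad k powr - q) * ((?a\<^sup>2 + ?e\<^sup>2) + ?b\<^sup>2)"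
      by (simp only: regroup)
    then have "ennreal ((diffq q v (P, Q))\<^sup>2) \<le> ennreal ((3 * 2 powr q * rad k powr - q) * ((?a\<^sup>2 + ?e\<^sup>2) + ?b\<^sup>2))"
      unfolding dq by (intro ennreal_leI) (simp add: powr_minus divide_inverse)
    also have "\<dots> = ennreal (3 * 2 powr q * rad k powr - q) * ((ennreal (?a\<^sup>2) + ennreal (?e\<^sup>2)) + ennreal (?b\<^sup>2))"
      by (subst ennreal_mult) (auto simp: ennreal_plus)
    also have "\<dots> \<le> scale_term v k P Q"
      unfolding scale_term_def
    proof (intro mult_left_mono add_mono)
      have nr: "near k P Q = 1" using dk by (simp add: near_def)
      have 1: "ennreal (?a\<^sup>2) \<le> ennreal (\<rho> ^ (2 * k) / (1 - \<rho>)) * tail v k P" by (rule trace_minus_mean[OF v cont B P])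
      have 2: "ennreal (?e\<^sup>2) \<le> ennreal (\<rho> ^ (2 * k) / (1 - \<rho>)) * tail v k Q"
        unfolding power2_commute[of "mean v (W k Q)"] by (rule trace_minus_mean[OF v cont B Q])
      show "ennreal (?a\<^sup>2) + ennreal (?e\<^sup>2) \<le> near k P Q * (ennreal (\<rho> ^ (2 * k) / (1 - \<rho>)) * (tail v k P + tail v k Q))"
        unfolding nr distrib_left mult_1 by (intro add_mono 1 2)
      show "ennreal (?b\<^sup>2) \<le> ennreal (C3 * rad k powr (2 * s - real DIM('a))) * cork_pair v k P Q"
        unfolding C3_def cork_pair_def by (rule mean_pair_diff[OF v B P Q dk(1)])
    qed auto
    also have "\<dots> \<le> (\<Sum>k. scale_term v k P Q)" using sum_le_suminf[of "\<lambda>k. scale_term v k P Q" "{k}"] by simp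
    finally show ?thesis by (rule order_trans) simp
  qed
qed

text \<open>At the coarsest scale the region has volume at least c c^n, so the mean over it is
  controlled by the L^2 norm over the domain; the remaining difference between value and mean is the
  telescoping error from scale 0.\<close>

lemma trace_L2:
  assumes v[measurable]: "v \<in> borel_measurable borel" and cont: "continuous_on (closure \<Omega>) v"
    and B: "\<And>x. x \<in> \<Omega> \<Longrightarrow> \<bar>v x\<bar> \<le> B"
  shows "(\<integral>\<^sup>+P. ennreal ((v P)\<^sup>2) \<partial>\<mu>) \<le> ennreal (2 / (1 - \<rho>)) * (\<integral>\<^sup>+P. tail v 0 P \<partial>\<mu>)
      + ennreal (2 / (c * c ^ DIM('a))) * emeasure \<mu> UNIV * (\<integral>\<^sup>+x. indicator \<Omega> x * ennreal ((v x)\<^sup>2) \<partial>lborel)"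
proof -
  let ?L = "\<integral>\<^sup>+x. indicator \<Omega> x * ennreal ((v x)\<^sup>2) \<partial>lborel"
  let ?V = "c * c ^ DIM('a)"
  have V: "0 < ?V" using c by simp
  have pt: "ennreal ((v P)\<^sup>2) \<le> ennreal (2 / (1 - \<rho>)) * tail v 0 P + ennreal (2 / ?V) * ?L" if P: "P \<in> K" for P
  proof -
    let ?m = "mean v (W 0 P)" and ?M = "measure lborel (W 0 P)"
    have e: "emeasure lborel (W 0 P) = ennreal ?M"
      using emeasure_W[of P 0] by (intro emeasure_eq_ennreal_measure) auto
    have VM: "?V \<le> ?M" using W_large[OF P, of 0] unfolding e by (simp add: ennreal_le_iff)
    have "ennreal (?V * ?m\<^sup>2) \<le> ennreal (?M * (?m - 0)\<^sup>2)" using VM by (intro ennreal_leI) (simp add: mult_right_mono)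
    also have "\<dots> \<le> (\<integral>\<^sup>+x. indicator (W 0 P) x * ennreal ((v x - 0)\<^sup>2) \<partial>lborel)"
    proof (rule mean_square_le)
      show "\<bar>v x\<bar> \<le> B" if "x \<in> W 0 P" for x using that B by (simp add: corkscrew_def)
    qed (use V VM emeasure_W[of P 0] W_borel[of P 0] in auto)
    also have "\<dots> \<le> ?L" by (intro nn_integral_mono) (auto simp: indicator_def corkscrew_def)
    finally have m: "ennreal (?V * ?m\<^sup>2) \<le> ?L" .
    have "ennreal (2 * ?m\<^sup>2) = ennreal (2 / ?V) * ennreal (?V * ?m\<^sup>2)"
      using V c by (subst ennreal_mult[symmetric]) auto
    also have "\<dots> \<le> ennreal (2 / ?V) * ?L" by (intro mult_left_mono m) auto
    finally have m2: "ennreal (2 * ?m\<^sup>2) \<le> ennreal (2 / ?V) * ?L" .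
    have "ennreal (2 * (v P - ?m)\<^sup>2) = ennreal 2 * ennreal ((v P - ?m)\<^sup>2)" by (intro ennreal_mult) auto
    also have "\<dots> \<le> ennreal 2 * (ennreal (\<rho> ^ (2 * 0) / (1 - \<rho>)) * tail v 0 P)"
      by (intro mult_left_mono trace_minus_mean[OF v cont B P]) auto
    also have "\<dots> = ennreal (2 / (1 - \<rho>)) * tail v 0 P"
      using \<rho> by (simp only: mult.assoc[symmetric] ennreal_mult'[symmetric]) simp
    finally have m1: "ennreal (2 * (v P - ?m)\<^sup>2) \<le> ennreal (2 / (1 - \<rho>)) * tail v 0 P" .
    have "ennreal ((v P)\<^sup>2) \<le> ennreal (2 * (v P - ?m)\<^sup>2 + 2 * ?m\<^sup>2)"
      using sum_square_2[of "v P - ?m" ?m] by (intro ennreal_leI) simp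
    also have "\<dots> = ennreal (2 * (v P - ?m)\<^sup>2) + ennreal (2 * ?m\<^sup>2)" by (intro ennreal_plus) auto
    also have "\<dots> \<le> ennreal (2 / (1 - \<rho>)) * tail v 0 P + ennreal (2 / ?V) * ?L" by (intro add_mono m1 m2)
    finally show ?thesis .
  qed
  have "(\<integral>\<^sup>+P. ennreal ((v P)\<^sup>2) \<partial>\<mu>) \<le> (\<integral>\<^sup>+P. ennreal (2 / (1 - \<rho>)) * tail v 0 P + ennreal (2 / ?V) * ?L \<partial>\<mu>)"
    using AE_bdry_measure[of \<Omega>] by (intro nn_integral_mono_AE, elim AE_mp, intro AE_I2 impI pt)
  also have "\<dots> = (\<integral>\<^sup>+P. ennreal (2 / (1 - \<rho>)) * tail v 0 P \<partial>\<mu>) + (\<integral>\<^sup>+P. ennreal (2 / ?V) * ?L \<partial>\<mu>)"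
    by (intro nn_integral_add) measurable
  also have "(\<integral>\<^sup>+P. ennreal (2 / (1 - \<rho>)) * tail v 0 P \<partial>\<mu>) = ennreal (2 / (1 - \<rho>)) * (\<integral>\<^sup>+P. tail v 0 P \<partial>\<mu>)"
    by (intro nn_integral_cmult) measurable
  also have "(\<integral>\<^sup>+P. ennreal (2 / ?V) * ?L \<partial>\<mu>) = ennreal (2 / ?V) * emeasure \<mu> UNIV * ?L"
    by (simp add: mult_ac)
  finally show ?thesis .
qed

text \<open>Continuity up to the boundary is qualitative only: it makes the means converge to the
  boundary values and v bounded, but neither the bound nor the modulus of continuity enters the
  constant. Hence the inequality survives limits of continuous functions.\<close>

lemma trace_inequality:
  obtains C where "0 \<le> C" and "\<And>v. v \<in> borel_measurable borel \<Longrightarrow> continuous_on (closure \<Omega>) v \<Longrightarrow>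
     energy \<mu> q v \<le> ennreal C * ((\<integral>\<^sup>+x. indicator \<Omega> x * ennreal ((v x)\<^sup>2) \<partial>lborel) + Dsemi v)"
proof -
  obtain m where "1 / c < 2 ^ m" using real_arch_pow[of 2 "1 / c"] by auto
  then have m: "1 \<le> 2 ^ m * c" using c by (simp add: field_simps)
  define \<sigma> where "\<sigma> = emeasure \<mu> UNIV"
  have \<sigma>: "\<sigma> < \<infinity>" using fm.emeasure_finite[of UNIV] by (simp add: \<sigma>_def less_top[symmetric])
  \<comment> \<open>\<open>a1\<close> bounds the summed corkscrew energies and \<open>a2\<close> the
    summed tails; \<open>l\<close> and \<open>a3\<close> control the L^2 part of the trace,
    \<open>g\<close> the distant pairs, \<open>a4\<close> the close pairs. Extended nonnegative
    arithmetic postpones all finiteness to the single check of \<open>C\<close>.\<close>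
  define a1 where "a1 = ennreal A * of_nat m"
  define a2 where "a2 = ennreal (1 / (1 - \<rho>)) * ennreal Ctel * a1"
  define l where "l = ennreal (2 / (c * c ^ DIM('a))) * \<sigma>"
  define g where "g = ennreal (2 * c powr - q) * (2 * \<sigma>)"
  define a3 where "a3 = ennreal (2 / (1 - \<rho>)) * a2"
  define a4 where "a4 = ennreal C5 * a2 + ennreal C6 * a1"
  define C where "C = (1 + g) * (l + a3) + a4"
  have fin: "C < \<infinity>" unfolding C_def a4_def a3_def a2_def a1_def l_def g_def using \<sigma>
    by (auto simp: ennreal_mult_less_top of_nat_less_top)
  have main: "energy \<mu> q v \<le> C * ((\<integral>\<^sup>+x. indicator \<Omega> x * ennreal ((v x)\<^sup>2) \<partial>lborel) + Dsemi v)"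
    if v[measurable]: "v \<in> borel_measurable borel" and cont: "continuous_on (closure \<Omega>) v" for v
  proof -
    let ?L = "\<integral>\<^sup>+x. indicator \<Omega> x * ennreal ((v x)\<^sup>2) \<partial>lborel" and ?D = "Dsemi v"
    let ?I = "\<integral>\<^sup>+P. ennreal ((v P)\<^sup>2) \<partial>\<mu>"
    have "compact (closure \<Omega>)" using bounded_domain by simp
    then have "bounded (v ` closure \<Omega>)" by (intro compact_imp_bounded compact_continuous_image cont)
    then obtain B where "\<And>x. x \<in> closure \<Omega> \<Longrightarrow> norm (v x) \<le> B" unfolding bounded_iff by auto
    then have B: "\<And>x. x \<in> \<Omega> \<Longrightarrow> \<bar>v x\<bar> \<le> B" using closure_subset[of \<Omega>] by auto
    have S: "(\<integral>\<^sup>+P. (\<Sum>j. cork_energy v j P) \<partial>\<mu>) \<le> a1 * ?D" unfolding a1_def by (rule sum_cork_energy_le[OF v m])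
    have Sk: "(\<Sum>k. \<integral>\<^sup>+P. cork_energy v k P \<partial>\<mu>) \<le> a1 * ?D"
      using S by (subst nn_integral_suminf[symmetric]) auto
    have T: "(\<Sum>k. \<integral>\<^sup>+P. tail v k P \<partial>\<mu>) \<le> a2 * ?D"
    proof -
      have "(\<Sum>k. \<integral>\<^sup>+P. tail v k P \<partial>\<mu>) \<le> ennreal (1 / (1 - \<rho>)) * ennreal Ctel * (\<integral>\<^sup>+P. (\<Sum>j. cork_energy v j P) \<partial>\<mu>)"
        by (rule integral_tails_le[OF v])
      also have "\<dots> \<le> ennreal (1 / (1 - \<rho>)) * ennreal Ctel * (a1 * ?D)" by (intro mult_left_mono S) auto
      finally show ?thesis by (simp only: a2_def mult.assoc)
    qed
    have T0: "(\<integral>\<^sup>+P. tail v 0 P \<partial>\<mu>) \<le> a2 * ?D"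
      using sum_le_suminf[of "\<lambda>k. \<integral>\<^sup>+P. tail v k P \<partial>\<mu>" "{0}"] T by (auto intro: order_trans)
    have I: "?I \<le> l * ?L + a3 * ?D"
    proof -
      have "?I \<le> ennreal (2 / (1 - \<rho>)) * (\<integral>\<^sup>+P. tail v 0 P \<partial>\<mu>) + l * ?L"
        unfolding l_def \<sigma>_def by (rule trace_L2[OF v cont B])
      also have "\<dots> \<le> ennreal (2 / (1 - \<rho>)) * (a2 * ?D) + l * ?L" by (intro add_mono mult_left_mono T0) auto
      finally show ?thesis by (simp only: a3_def mult.assoc add.commute)
    qed
    have H: "(\<integral>\<^sup>+z. ennreal ((diffq q v z)\<^sup>2) \<partial>(\<mu> \<Otimes>\<^sub>M \<mu>)) \<le> g * ?I + a4 * ?D"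
    proof -
      have "(\<integral>\<^sup>+z. ennreal ((diffq q v z)\<^sup>2) \<partial>(\<mu> \<Otimes>\<^sub>M \<mu>)) = (\<integral>\<^sup>+P. \<integral>\<^sup>+Q. ennreal ((diffq q v (P, Q))\<^sup>2) \<partial>\<mu> \<partial>\<mu>)"
        using measurable_diffq[OF sets_bdry_measure v] by (intro fm.nn_integral_fst[symmetric]) measurable
      also have "\<dots> \<le> (\<integral>\<^sup>+P. \<integral>\<^sup>+Q. ennreal (2 * c powr - q) * (ennreal ((v P)\<^sup>2) + ennreal ((v Q)\<^sup>2)) + (\<Sum>k. scale_term v k P Q) \<partial>\<mu> \<partial>\<mu>)"
      proof (rule nn_integral_mono_AE, use AE_bdry_measure[of \<Omega>] in \<open>elim AE_mp, intro AE_I2 impI\<close>)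
        fix P assume P: "P \<in> K"
        show "(\<integral>\<^sup>+Q. ennreal ((diffq q v (P, Q))\<^sup>2) \<partial>\<mu>)
          \<le> (\<integral>\<^sup>+Q. ennreal (2 * c powr - q) * (ennreal ((v P)\<^sup>2) + ennreal ((v Q)\<^sup>2)) + (\<Sum>k. scale_term v k P Q) \<partial>\<mu>)"
          using AE_bdry_measure[of \<Omega>]
          by (intro nn_integral_mono_AE, elim AE_mp, intro AE_I2 impI diffq_pointwise[OF v cont B P])
      qed
      also have "\<dots> = ennreal (2 * c powr - q) * (\<integral>\<^sup>+P. ennreal ((v P)\<^sup>2) * \<sigma> + ?I \<partial>\<mu>) + (\<integral>\<^sup>+P. \<integral>\<^sup>+Q. (\<Sum>k. scale_term v k P Q) \<partial>\<mu> \<partial>\<mu>)"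
        by (simp add: nn_integral_add nn_integral_cmult \<sigma>_def)
      also have "(\<integral>\<^sup>+P. ennreal ((v P)\<^sup>2) * \<sigma> + ?I \<partial>\<mu>) = 2 * \<sigma> * ?I"
        by (simp add: nn_integral_add nn_integral_cmult \<sigma>_def mult_ac mult_2 distrib_right)
      also have "(\<integral>\<^sup>+P. \<integral>\<^sup>+Q. (\<Sum>k. scale_term v k P Q) \<partial>\<mu> \<partial>\<mu>) = (\<Sum>k. \<integral>\<^sup>+P. \<integral>\<^sup>+Q. scale_term v k P Q \<partial>\<mu> \<partial>\<mu>)"
        by (simp add: nn_integral_suminf)
      also have "ennreal (2 * c powr - q) * (2 * \<sigma> * ?I) = g * ?I" by (simp only: g_def mult.assoc)
      also have "(\<Sum>k. \<integral>\<^sup>+P. \<integral>\<^sup>+Q. scale_term v k P Q \<partial>\<mu> \<partial>\<mu>)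
          \<le> (\<Sum>k. ennreal C5 * (\<integral>\<^sup>+P. tail v k P \<partial>\<mu>) + ennreal C6 * (\<integral>\<^sup>+P. cork_energy v k P \<partial>\<mu>))"
        by (intro suminf_le integral_scale_term v) auto
      also have "\<dots> = ennreal C5 * (\<Sum>k. \<integral>\<^sup>+P. tail v k P \<partial>\<mu>) + ennreal C6 * (\<Sum>k. \<integral>\<^sup>+P. cork_energy v k P \<partial>\<mu>)"
        by (simp add: suminf_add[symmetric])
      also have "\<dots> \<le> ennreal C5 * (a2 * ?D) + ennreal C6 * (a1 * ?D)"
        by (intro add_mono mult_left_mono T Sk) auto
      also have "\<dots> = a4 * ?D" by (simp only: a4_def distrib_right mult.assoc)
      finally show ?thesis by (simp add: add_left_mono)
    qed
    have "energy \<mu> q v \<le> ?I + (g * ?I + a4 * ?D)" unfolding energy_def by (intro add_mono H) auto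
    also have "\<dots> = (1 + g) * ?I + a4 * ?D" by (simp add: distrib_right add.assoc)
    also have "\<dots> \<le> (1 + g) * ((l + a3) * (?L + ?D)) + a4 * (?L + ?D)"
    proof (intro add_mono mult_left_mono)
      have "?I \<le> l * ?L + a3 * ?D" by (rule I)
      also have "\<dots> \<le> l * (?L + ?D) + a3 * (?L + ?D)" by (intro add_mono mult_left_mono) auto
      finally show "?I \<le> (l + a3) * (?L + ?D)" by (simp only: distrib_right)
    qed auto
    also have "\<dots> = C * (?L + ?D)" by (simp only: C_def distrib_right mult.assoc)
    finally show ?thesis .
  qed
  show thesis
  proof (rule that[of "enn2real C"])
    have "ennreal (enn2real C) = C" using fin by simp
    then show "energy \<mu> q v \<le> ennreal (enn2real C) * ((\<integral>\<^sup>+x. indicator \<Omega> x * ennreal ((v x)\<^sup>2) \<partial>lborel) + Dsemi v)"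
      if "v \<in> borel_measurable borel" "continuous_on (closure \<Omega>) v" for v
      using main[OF that] by simp
  qed simp
qed

section \<open>Boundedness of the potential\<close>

definition p :: real where "p = real DIM('a) - 2 * s"

lemma p_pos: "0 < p" using n s by (simp add: p_def)

text \<open>Here w = (x, y) is a pair in space and z = (P, Q) a pair on the boundary. The powers of
  |x - y| and |P - Q| come from the H^s difference quotient of the potential and the boundary
  difference quotient of the kernel. Only the corner |x - P| appears; the other three arise by
  swapping the components of w or z.\<close>

definition ker1 :: "'a \<times> 'a \<Rightarrow> 'a \<times> 'a \<Rightarrow> real" where
  "ker1 w z = kap2 p (dist (fst w) (snd w)) (dist (fst z) (snd z)) (dist (fst w) (fst z))
     * dist (fst w) (snd w) powr (- real DIM('a) / 2 - s) * dist (fst z) (snd z) powr (- q / 2)"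

text \<open>Acts on \<tau> itself instead of its difference quotient. Without a boundary increment
  the kernel is no longer scale invariant, and the indicators of a bounded set U supply the missing
  decay; the same holds for \<open>ker3\<close> and \<open>ker4\<close>, which concern values of the
  potential.\<close>

definition ker2 :: "'a set \<Rightarrow> 'a \<times> 'a \<Rightarrow> 'a \<Rightarrow> real" where
  "ker2 U w P = indicator U (fst w) * indicator U P * kap1 p (dist (fst w) (snd w)) (dist (fst w) P)
     * dist (fst w) (snd w) powr (- real DIM('a) / 2 - s)"

definition ker3 :: "'a set \<Rightarrow> 'a \<Rightarrow> 'a \<Rightarrow> real" where
  "ker3 U x P = indicator U x * indicator U P * dist x P powr -p"

definition ker4 :: "'a set \<Rightarrow> 'a \<Rightarrow> 'a \<times> 'a \<Rightarrow> real" where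
  "ker4 U x z = indicator U x * indicator U (fst z) * kap1 p (dist (fst z) (snd z)) (dist x (fst z))
     * dist (fst z) (snd z) powr (- q / 2)"

section \<open>Power potentials of volume and surface measure\<close>

lemma potential_lborel_far:
  obtains C where "0 < C" "\<And>(x::'a) \<rho>. 0 < \<rho> \<Longrightarrow>
    (\<integral>\<^sup>+y. ennreal (dist x y powr (- real DIM('a) - s) * min 1 (dist x y / \<rho>)) \<partial>lborel) \<le> ennreal (C * \<rho> powr -s)"
proof -
  have "1 - s \<le> real DIM('a)" using n s by linarith
  then obtain C where "0 < C" "\<And>(z::'a) \<rho>. 0 < \<rho> \<Longrightarrow>
    (\<integral>\<^sup>+x. ennreal (dist x z powr (- real DIM('a) - s) * min 1 (dist x z / \<rho>)) \<partial>lborel) \<le> ennreal (C * \<rho> powr -s)"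
    using potential_bound_far[OF sets_lborel emeasure_lborel_ball_le, of s] s by (auto simp: unit_ball_vol_nonneg)
  note C = this
  show thesis
  proof (rule that[OF C(1)])
    fix x :: 'a and \<rho> :: real assume "0 < \<rho>"
    from C(2)[OF this, of x] show "(\<integral>\<^sup>+y. ennreal (dist x y powr (- real DIM('a) - s) * min 1 (dist x y / \<rho>)) \<partial>lborel) \<le> ennreal (C * \<rho> powr -s)"
      by (simp only: dist_commute[of _ x])
  qed
qed

lemma potential_lborel_near:
  assumes "0 < \<beta>" "\<beta> < 1"
  obtains C where "0 < C" "\<And>P \<rho>. 0 < \<rho> \<Longrightarrow>
    (\<integral>\<^sup>+x. ennreal (dist (x::'a) P powr (\<beta> - real DIM('a)) * min 1 (\<rho> / dist x P)) \<partial>lborel) \<le> ennreal (C * \<rho> powr \<beta>)"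
proof -
  have "\<beta> \<le> real DIM('a)" using n assms by linarith
  then show thesis
    using potential_bound[OF sets_lborel emeasure_lborel_ball_le, of \<beta>] assms that by (auto simp: unit_ball_vol_nonneg)
qed

lemma potential_bdry_far:
  obtains C where "0 < C" "\<And>P \<rho>. 0 < \<rho> \<Longrightarrow>
    (\<integral>\<^sup>+Q. ennreal (dist P Q powr (3/2 - real DIM('a) - s) * min 1 (dist P Q / \<rho>)) \<partial>\<mu>) \<le> ennreal (C * \<rho> powr (1/2 - s))"
proof -
  have 1: "1 - (s - 1/2) \<le> real DIM('a) - 1" using n s by linarith
  obtain C where C: "0 < C" "\<And>z \<rho>. 0 < \<rho> \<Longrightarrow>
    (\<integral>\<^sup>+x. ennreal (dist x z powr (- (real DIM('a) - 1) - (s - 1/2)) * min 1 (dist x z / \<rho>)) \<partial>\<mu>) \<le> ennreal (C * \<rho> powr -(s - 1/2))"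
    using potential_bound_far[OF sets_bdry_measure A(2) _ _ 1] s A(1) by auto
  have e: "- (real DIM('a) - 1) - (s - 1/2) = 3/2 - real DIM('a) - s" "-(s - 1/2) = 1/2 - s" by simp_all
  show thesis
  proof (rule that[OF C(1)])
    fix x :: 'a and \<rho> :: real assume "0 < \<rho>"
    from C(2)[OF this, of x] show "(\<integral>\<^sup>+y. ennreal (dist x y powr (3/2 - real DIM('a) - s) * min 1 (dist x y / \<rho>)) \<partial>\<mu>) \<le> ennreal (C * \<rho> powr (1/2 - s))"
      unfolding e by (simp only: dist_commute[of _ x])
  qed
qed

lemma potential_bdry_near:
  assumes "0 < \<beta>" "\<beta> < 1"
  obtains C where "0 < C" "\<And>x \<rho>. 0 < \<rho> \<Longrightarrow>
    (\<integral>\<^sup>+P. ennreal (dist x P powr (\<beta> - (real DIM('a) - 1)) * min 1 (\<rho> / dist x P)) \<partial>\<mu>) \<le> ennreal (C * \<rho> powr \<beta>)"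
proof -
  have 1: "\<beta> \<le> real DIM('a) - 1" using n assms by linarith
  obtain C where C: "0 < C" "\<And>z \<rho>. 0 < \<rho> \<Longrightarrow>
    (\<integral>\<^sup>+x. ennreal (dist x z powr (\<beta> - (real DIM('a) - 1)) * min 1 (\<rho> / dist x z)) \<partial>\<mu>) \<le> ennreal (C * \<rho> powr \<beta>)"
    using potential_bound[OF sets_bdry_measure A(2) _ _ 1] assms A(1) by auto
  show thesis
  proof (rule that[OF C(1)])
    fix x :: 'a and \<rho> :: real assume "0 < \<rho>"
    from C(2)[OF this, of x] show "(\<integral>\<^sup>+P. ennreal (dist x P powr (\<beta> - (real DIM('a) - 1)) * min 1 (\<rho> / dist x P)) \<partial>\<mu>) \<le> ennreal (C * \<rho> powr \<beta>)"
      by (simp only: dist_commute[of _ x])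
  qed
qed

text \<open>Both Schur integrals are scale invariant. For k2 the integral in Q gives r^(1/2-s) and
  the one in P then gives t^s, cancelling the prefactor t^(-s); for k1 the integral in y gives
  r^(-s) and the one in x gives h^(s-1/2), cancelling h^(1/2-s). No bound on the positions is
  involved.\<close>

lemma schur_ker1:
  obtains C where "C < \<infinity>" "\<And>G. G \<in> borel_measurable (\<mu> \<Otimes>\<^sub>M \<mu>) \<Longrightarrow>
    (\<integral>\<^sup>+w. (\<integral>\<^sup>+z. ennreal (ker1 w z) * G z \<partial>(\<mu> \<Otimes>\<^sub>M \<mu>))\<^sup>2 \<partial>((lborel :: 'a measure) \<Otimes>\<^sub>M lborel)) \<le> C * (\<integral>\<^sup>+z. (G z)\<^sup>2 \<partial>(\<mu> \<Otimes>\<^sub>M \<mu>))"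
proof -
  obtain c1 where c1: "0 < c1" "\<And>(x::'a) \<rho>. 0 < \<rho> \<Longrightarrow>
    (\<integral>\<^sup>+y. ennreal (dist x y powr (- real DIM('a) - s) * min 1 (dist x y / \<rho>)) \<partial>lborel) \<le> ennreal (c1 * \<rho> powr -s)"
    by (rule potential_lborel_far) blast
  obtain c2 where c2: "0 < c2" "\<And>(P::'a) \<rho>. 0 < \<rho> \<Longrightarrow>
    (\<integral>\<^sup>+x. ennreal (dist x P powr ((s - 1/2) - real DIM('a)) * min 1 (\<rho> / dist x P)) \<partial>lborel) \<le> ennreal (c2 * \<rho> powr (s - 1/2))"
    by (rule potential_lborel_near[of "s - 1/2"]) (use s in auto)
  obtain c3 where c3: "0 < c3" "\<And>P \<rho>. 0 < \<rho> \<Longrightarrow>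
    (\<integral>\<^sup>+Q. ennreal (dist P Q powr (3/2 - real DIM('a) - s) * min 1 (dist P Q / \<rho>)) \<partial>\<mu>) \<le> ennreal (c3 * \<rho> powr (1/2 - s))"
    by (rule potential_bdry_far) blast
  obtain c4 where c4: "0 < c4" "\<And>x \<rho>. 0 < \<rho> \<Longrightarrow>
    (\<integral>\<^sup>+P. ennreal (dist x P powr (s - (real DIM('a) - 1)) * min 1 (\<rho> / dist x P)) \<partial>\<mu>) \<le> ennreal (c4 * \<rho> powr s)"
    by (rule potential_bdry_near[of s]) (use s in auto)
  \<comment> \<open>With \<open>t = |fst w - snd w|\<close>, \<open>h = |fst z - snd z|\<close> and \<open>r = |fst w - fst z|\<close>, the two Schur weights
    are the kernel multiplied and divided by \<open>t powr (-n/2) * r powr (-1/2) * h powr ((n-1)/2)\<close>.\<close>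
  define k1 where "k1 w z = dist (fst z) (snd z) powr (1/2 - s) *
      dist (fst w) (fst z) powr (- p - 1/2) * min 1 (dist (fst z) (snd z) / dist (fst w) (fst z))
      * (dist (fst w) (snd w) powr (- real DIM('a) - s) * min 1 (dist (fst w) (snd w) / dist (fst w) (fst z)))" for w z :: "'a \<times> 'a"
  define k2 where "k2 w z = dist (fst w) (snd w) powr - s *
      dist (fst w) (fst z) powr (1/2 - p) * min 1 (dist (fst w) (snd w) / dist (fst w) (fst z))
      * (dist (fst z) (snd z) powr (3/2 - real DIM('a) - s) * min 1 (dist (fst z) (snd z) / dist (fst w) (fst z)))" for w z :: "'a \<times> 'a"
  show thesis
  proof (rule that)
    show "ennreal (c3 * c4) * ennreal (c1 * c2) < \<infinity>" by (simp add: ennreal_mult_less_top)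
    fix G :: "'a \<times> 'a \<Rightarrow> ennreal" assume G: "G \<in> borel_measurable (\<mu> \<Otimes>\<^sub>M \<mu>)"
    show "(\<integral>\<^sup>+w. (\<integral>\<^sup>+z. ennreal (ker1 w z) * G z \<partial>(\<mu> \<Otimes>\<^sub>M \<mu>))\<^sup>2 \<partial>(lborel \<Otimes>\<^sub>M lborel))
        \<le> ennreal (c3 * c4) * ennreal (c1 * c2) * (\<integral>\<^sup>+z. (G z)\<^sup>2 \<partial>(\<mu> \<Otimes>\<^sub>M \<mu>))"
    proof (rule schur_bound)
      show "sigma_finite_measure ((lborel :: 'a measure) \<Otimes>\<^sub>M (lborel :: 'a measure))"
        by (intro sigma_finite_pair_measure sigma_finite_lborel)
      show "sigma_finite_measure (\<mu> \<Otimes>\<^sub>M \<mu>)"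
        by (intro sigma_finite_pair_measure fm.sigma_finite_measure_axioms)
      show "case_prod ker1 \<in> borel_measurable ((lborel \<Otimes>\<^sub>M lborel) \<Otimes>\<^sub>M (\<mu> \<Otimes>\<^sub>M \<mu>))"
        unfolding ker1_def kap2_def by measurable
      show "case_prod k1 \<in> borel_measurable ((lborel \<Otimes>\<^sub>M lborel) \<Otimes>\<^sub>M (\<mu> \<Otimes>\<^sub>M \<mu>))"
        unfolding k1_def by measurable
      show "case_prod k2 \<in> borel_measurable ((lborel \<Otimes>\<^sub>M lborel) \<Otimes>\<^sub>M (\<mu> \<Otimes>\<^sub>M \<mu>))"
        unfolding k2_def by measurable
      show "G \<in> borel_measurable (\<mu> \<Otimes>\<^sub>M \<mu>)" by (rule G)
      show "0 \<le> ker1 w z" "0 \<le> k1 w z" "0 \<le> k2 w z" for w z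
        by (simp_all add: ker1_def k1_def k2_def kap2_nonneg)
      show "(ker1 w z)\<^sup>2 \<le> k1 w z * k2 w z" for w z
      proof -
        define t h r where "t = dist (fst w) (snd w)" and "h = dist (fst z) (snd z)" and "r = dist (fst w) (fst z)"
        have e1: "(t powr (- real DIM('a) / 2 - s))\<^sup>2 = t powr (- real DIM('a) - s) * t powr - s"
          by (simp add: power2_eq_square powr_add[symmetric] algebra_simps)
        have e2: "(h powr (- q / 2))\<^sup>2 = h powr (1/2 - s) * h powr (3/2 - real DIM('a) - s)"
          by (simp add: power2_eq_square powr_add[symmetric] q_def algebra_simps)
        have e3: "(r powr - p)\<^sup>2 = r powr (- p - 1/2) * r powr (1/2 - p)"
          by (simp add: power2_eq_square powr_add[symmetric])
        show ?thesis
          unfolding ker1_def k1_def k2_def kap2_def t_def[symmetric] h_def[symmetric] r_def[symmetric] power_mult_distrib e1 e2 e3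
          by (simp add: power2_eq_square mult_ac)
      qed
      show "(\<integral>\<^sup>+z. ennreal (k2 w z) \<partial>(\<mu> \<Otimes>\<^sub>M \<mu>)) \<le> ennreal (c3 * c4)" for w
      proof -
        define t where "t = dist (fst w) (snd w)"
        define a where "a P = t powr - s * dist (fst w) P powr (1/2 - p) * min 1 (t / dist (fst w) P)" for P
        define g where "g P Q = dist P Q powr (3/2 - real DIM('a) - s) * min 1 (dist P Q / dist (fst w) P)" for P Q :: 'a
        have t0: "0 \<le> t" by (simp add: t_def)
        have "(\<integral>\<^sup>+z. ennreal (a (fst z) * g (fst z) (snd z)) \<partial>(\<mu> \<Otimes>\<^sub>M \<mu>)) \<le> ennreal (c3 * c4)"
        proof (rule nn_integral_two_step[where f = "\<lambda>P Q. a P * g P Q" and a = a and g = g and b = "\<lambda>P. c3 * dist (fst w) P powr (1/2 - s)"])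
          show "(\<integral>\<^sup>+Q. ennreal (g P Q) \<partial>\<mu>) \<le> ennreal (c3 * dist (fst w) P powr (1/2 - s))" if "a P \<noteq> 0" for P
            using that unfolding g_def by (intro c3) (auto simp: a_def)
          have e: "a P * (c3 * dist (fst w) P powr (1/2 - s)) = (c3 * t powr - s) * (dist (fst w) P powr (s - (real DIM('a) - 1)) * min 1 (t / dist (fst w) P))" for P
          proof -
            have "dist (fst w) P powr (1/2 - p) * dist (fst w) P powr (1/2 - s) = dist (fst w) P powr (s - (real DIM('a) - 1))"
              by (simp add: powr_add[symmetric] p_def algebra_simps)
            then show ?thesis by (simp add: a_def mult_ac)
          qed
          have "(\<integral>\<^sup>+P. ennreal (a P * (c3 * dist (fst w) P powr (1/2 - s))) \<partial>\<mu>)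
             = ennreal (c3 * t powr - s) * (\<integral>\<^sup>+P. ennreal (dist (fst w) P powr (s - (real DIM('a) - 1)) * min 1 (t / dist (fst w) P)) \<partial>\<mu>)"
            unfolding e using c3(1) t0 by (subst nn_integral_cmult[symmetric]) (auto simp: ennreal_mult)
          also have "\<dots> \<le> ennreal (c3 * c4)"
          proof (cases "t = 0")
            case False
            then have t: "0 < t" using t0 by simp
            have "ennreal (c3 * t powr - s) * (\<integral>\<^sup>+P. ennreal (dist (fst w) P powr (s - (real DIM('a) - 1)) * min 1 (t / dist (fst w) P)) \<partial>\<mu>)
               \<le> ennreal (c3 * t powr - s) * ennreal (c4 * t powr s)" by (intro mult_left_mono c4 t) auto
            also have "\<dots> = ennreal (c3 * c4)" using c3 c4 t by (subst ennreal_mult[symmetric]) (auto simp: powr_minus)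
            finally show ?thesis .
          qed simp
          finally show "(\<integral>\<^sup>+P. ennreal (a P * (c3 * dist (fst w) P powr (1/2 - s))) \<partial>\<mu>) \<le> ennreal (c3 * c4)" .
          show "(\<lambda>z. a (fst z) * g (fst z) (snd z)) \<in> borel_measurable (\<mu> \<Otimes>\<^sub>M \<mu>)" unfolding a_def g_def by measurable
          show "(\<lambda>y. g x y) \<in> borel_measurable \<mu>" for x unfolding g_def by measurable
        qed (use c3 t0 in \<open>auto simp: a_def g_def fm.sigma_finite_measure_axioms\<close>)
        moreover have "k2 w z = a (fst z) * g (fst z) (snd z)" for z
          by (simp add: k2_def a_def g_def t_def)
        ultimately show ?thesis by simp
      qed
      show "(\<integral>\<^sup>+w. ennreal (k1 w z) \<partial>(lborel \<Otimes>\<^sub>M lborel)) \<le> ennreal (c1 * c2)" for z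
      proof -
        define h where "h = dist (fst z) (snd z)"
        define a where "a x = h powr (1/2 - s) * dist x (fst z) powr (- p - 1/2) * min 1 (h / dist x (fst z))" for x
        define g where "g x y = dist x y powr (- real DIM('a) - s) * min 1 (dist x y / dist x (fst z))" for x y :: 'a
        have h0: "0 \<le> h" by (simp add: h_def)
        have "(\<integral>\<^sup>+w. ennreal (a (fst w) * g (fst w) (snd w)) \<partial>(lborel \<Otimes>\<^sub>M lborel)) \<le> ennreal (c1 * c2)"
        proof (rule nn_integral_two_step[where f = "\<lambda>P Q. a P * g P Q" and a = a and g = g and b = "\<lambda>x. c1 * dist x (fst z) powr - s"])
          show "(\<integral>\<^sup>+y. ennreal (g x y) \<partial>lborel) \<le> ennreal (c1 * dist x (fst z) powr - s)" if "a x \<noteq> 0" for x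
            using that unfolding g_def by (intro c1) (auto simp: a_def)
          have e: "a x * (c1 * dist x (fst z) powr - s) = (c1 * h powr (1/2 - s)) * (dist x (fst z) powr ((s - 1/2) - real DIM('a)) * min 1 (h / dist x (fst z)))" for x
          proof -
            have "dist x (fst z) powr (- p - 1/2) * dist x (fst z) powr - s = dist x (fst z) powr ((s - 1/2) - real DIM('a))"
              by (simp add: powr_add[symmetric] p_def algebra_simps)
            then show ?thesis by (simp add: a_def mult_ac)
          qed
          have "(\<integral>\<^sup>+x. ennreal (a x * (c1 * dist x (fst z) powr - s)) \<partial>lborel)
             = ennreal (c1 * h powr (1/2 - s)) * (\<integral>\<^sup>+x. ennreal (dist x (fst z) powr ((s - 1/2) - real DIM('a)) * min 1 (h / dist x (fst z))) \<partial>lborel)"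
            unfolding e using c1(1) h0 by (subst nn_integral_cmult[symmetric]) (auto simp: ennreal_mult)
          also have "\<dots> \<le> ennreal (c1 * c2)"
          proof (cases "h = 0")
            case False
            then have h: "0 < h" using h0 by simp
            have "ennreal (c1 * h powr (1/2 - s)) * (\<integral>\<^sup>+x. ennreal (dist x (fst z) powr ((s - 1/2) - real DIM('a)) * min 1 (h / dist x (fst z))) \<partial>lborel)
               \<le> ennreal (c1 * h powr (1/2 - s)) * ennreal (c2 * h powr (s - 1/2))" by (intro mult_left_mono c2 h) auto
            also have "\<dots> = ennreal (c1 * c2 * (h powr (1/2 - s) * h powr (s - 1/2)))"
              using c1 c2 by (subst ennreal_mult[symmetric]) (auto simp: mult_ac)
            also have "h powr (1/2 - s) * h powr (s - 1/2) = 1" using h by (simp add: powr_add[symmetric])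
            finally show ?thesis by simp
          qed simp
          finally show "(\<integral>\<^sup>+x. ennreal (a x * (c1 * dist x (fst z) powr - s)) \<partial>lborel) \<le> ennreal (c1 * c2)" .
          show "(\<lambda>z. a (fst z) * g (fst z) (snd z)) \<in> borel_measurable (lborel \<Otimes>\<^sub>M lborel)" unfolding a_def g_def by measurable
          show "(\<lambda>y. g x y) \<in> borel_measurable lborel" for x unfolding g_def by measurable
        qed (use c1 h0 in \<open>auto simp: a_def g_def sigma_finite_lborel\<close>)
        moreover have "k1 w z = a (fst w) * g (fst w) (snd w)" for w
          by (simp add: k1_def a_def g_def h_def)
        ultimately show ?thesis by simp
      qed
    qed
  qed
qed

lemma min_1_far: "0 \<le> d \<Longrightarrow> d \<le> R \<Longrightarrow> 0 < (R::real) \<Longrightarrow> d \<noteq> 0 \<Longrightarrow> min 1 (R / d) = 1"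
  by (simp add: min_def)

text \<open>The k2-integral is scale invariant as before, but the k1-integral ends in the power
  r^(2s-1-n). This is integrable near P because s > 1/2, while at large distances the restriction to
  U is essential.\<close>

lemma schur_ker2:
  assumes U[measurable]: "U \<in> sets borel" and R: "0 < R" "\<And>x P. x \<in> U \<Longrightarrow> P \<in> U \<Longrightarrow> dist x P \<le> R"
  obtains C where "C < \<infinity>" "\<And>G. G \<in> borel_measurable \<mu> \<Longrightarrow>
    (\<integral>\<^sup>+w. (\<integral>\<^sup>+P. ennreal (ker2 U w P) * G P \<partial>\<mu>)\<^sup>2 \<partial>((lborel :: 'a measure) \<Otimes>\<^sub>M lborel)) \<le> C * (\<integral>\<^sup>+P. (G P)\<^sup>2 \<partial>\<mu>)"
proof -
  obtain c1 where c1: "0 < c1" "\<And>(x::'a) \<rho>. 0 < \<rho> \<Longrightarrow>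
    (\<integral>\<^sup>+y. ennreal (dist x y powr (- real DIM('a) - s) * min 1 (dist x y / \<rho>)) \<partial>lborel) \<le> ennreal (c1 * \<rho> powr -s)"
    by (rule potential_lborel_far) blast
  obtain c2 where c2: "0 < c2" "\<And>(P::'a) \<rho>. 0 < \<rho> \<Longrightarrow>
    (\<integral>\<^sup>+x. ennreal (dist x P powr ((2 * s - 1) - real DIM('a)) * min 1 (\<rho> / dist x P)) \<partial>lborel) \<le> ennreal (c2 * \<rho> powr (2 * s - 1))"
    by (rule potential_lborel_near[of "2 * s - 1"]) (use s in auto)
  obtain c4 where c4: "0 < c4" "\<And>x \<rho>. 0 < \<rho> \<Longrightarrow>
    (\<integral>\<^sup>+P. ennreal (dist x P powr (s - (real DIM('a) - 1)) * min 1 (\<rho> / dist x P)) \<partial>\<mu>) \<le> ennreal (c4 * \<rho> powr s)"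
    by (rule potential_bdry_near[of s]) (use s in auto)
  \<comment> \<open>With t = |x - y| and r = |x - P|, the Schur weight is t^(-n/2) r^(s-1): k1 is
    the kernel times this weight, and k2 dominates the kernel divided by it, the indicators being
    dropped.\<close>
  define k1 where "k1 w P = indicator U (fst w) * indicator U P *
      dist (fst w) P powr (s - 1 - p)
      * (dist (fst w) (snd w) powr (- real DIM('a) - s) * min 1 (dist (fst w) (snd w) / dist (fst w) P))" for w :: "'a \<times> 'a" and P :: 'a
  define k2 where "k2 w P = dist (fst w) (snd w) powr - s *
      (dist (fst w) P powr (1 - s - p) * min 1 (dist (fst w) (snd w) / dist (fst w) P))" for w :: "'a \<times> 'a" and P :: 'a
  show thesis
  proof (rule that)
    show "ennreal c4 * ennreal (c1 * (c2 * R powr (2 * s - 1))) < \<infinity>" by (simp add: ennreal_mult_less_top)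
    fix G :: "'a \<Rightarrow> ennreal" assume G: "G \<in> borel_measurable \<mu>"
    show "(\<integral>\<^sup>+w. (\<integral>\<^sup>+P. ennreal (ker2 U w P) * G P \<partial>\<mu>)\<^sup>2 \<partial>(lborel \<Otimes>\<^sub>M lborel))
        \<le> ennreal c4 * ennreal (c1 * (c2 * R powr (2 * s - 1))) * (\<integral>\<^sup>+P. (G P)\<^sup>2 \<partial>\<mu>)"
    proof (rule schur_bound)
      show "sigma_finite_measure ((lborel :: 'a measure) \<Otimes>\<^sub>M (lborel :: 'a measure))"
        by (intro sigma_finite_pair_measure sigma_finite_lborel)
      show "sigma_finite_measure \<mu>" by (rule fm.sigma_finite_measure_axioms)
      show "case_prod (ker2 U) \<in> borel_measurable ((lborel \<Otimes>\<^sub>M lborel) \<Otimes>\<^sub>M \<mu>)"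
        unfolding ker2_def kap1_def by measurable
      show "case_prod k1 \<in> borel_measurable ((lborel \<Otimes>\<^sub>M lborel) \<Otimes>\<^sub>M \<mu>)"
        unfolding k1_def by measurable
      show "case_prod k2 \<in> borel_measurable ((lborel \<Otimes>\<^sub>M lborel) \<Otimes>\<^sub>M \<mu>)"
        unfolding k2_def by measurable
      show "G \<in> borel_measurable \<mu>" by (rule G)
      show "0 \<le> ker2 U w P" "0 \<le> k1 w P" "0 \<le> k2 w P" for w P
        by (simp_all add: ker2_def k1_def k2_def kap1_nonneg)
      show "(ker2 U w P)\<^sup>2 \<le> k1 w P * k2 w P" for w P
      proof -
        define t r where "t = dist (fst w) (snd w)" and "r = dist (fst w) P"
        have e1: "(t powr (- real DIM('a) / 2 - s))\<^sup>2 = t powr (- real DIM('a) - s) * t powr - s"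
          by (simp add: power2_eq_square powr_add[symmetric] algebra_simps)
        have e3: "(r powr - p)\<^sup>2 = r powr (s - 1 - p) * r powr (1 - s - p)"
          by (simp add: power2_eq_square powr_add[symmetric])
        show ?thesis
          unfolding ker2_def k1_def k2_def kap1_def t_def[symmetric] r_def[symmetric] power_mult_distrib e1 e3
          by (simp add: power2_eq_square mult_ac indicator_def)
      qed
      show "(\<integral>\<^sup>+P. ennreal (k2 w P) \<partial>\<mu>) \<le> ennreal c4" for w
      proof (cases "dist (fst w) (snd w) = 0")
        case False
        define t where "t = dist (fst w) (snd w)"
        have t: "0 < t" using False by (simp add: t_def)
        have e: "1 - s - p = s - (real DIM('a) - 1)" by (simp add: p_def)
        have "(\<integral>\<^sup>+P. ennreal (k2 w P) \<partial>\<mu>) = ennreal (t powr - s) * (\<integral>\<^sup>+P. ennreal (dist (fst w) P powr (s - (real DIM('a) - 1)) * min 1 (t / dist (fst w) P)) \<partial>\<mu>)"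
          unfolding k2_def t_def[symmetric] e using t by (subst nn_integral_cmult[symmetric]) (auto simp: ennreal_mult)
        also have "\<dots> \<le> ennreal (t powr - s) * ennreal (c4 * t powr s)" by (intro mult_left_mono c4 t) auto
        also have "\<dots> = ennreal c4" using c4 t by (subst ennreal_mult[symmetric]) (auto simp: powr_minus)
        finally show ?thesis .
      qed (simp add: k2_def)
      show "(\<integral>\<^sup>+w. ennreal (k1 w P) \<partial>(lborel \<Otimes>\<^sub>M lborel)) \<le> ennreal (c1 * (c2 * R powr (2 * s - 1)))" for P
      proof -
        define a where "a x = indicator U x * indicator U P * dist x P powr (s - 1 - p)" for x
        define g where "g x y = dist x y powr (- real DIM('a) - s) * min 1 (dist x y / dist x P)" for x y :: 'a
        have "(\<integral>\<^sup>+w. ennreal (a (fst w) * g (fst w) (snd w)) \<partial>(lborel \<Otimes>\<^sub>M lborel)) \<le> ennreal (c1 * (c2 * R powr (2 * s - 1)))"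
        proof (rule nn_integral_two_step[where f = "\<lambda>P Q. a P * g P Q" and a = a and g = g and b = "\<lambda>x. c1 * dist x P powr - s"])
          show "(\<integral>\<^sup>+y. ennreal (g x y) \<partial>lborel) \<le> ennreal (c1 * dist x P powr - s)" if "a x \<noteq> 0" for x
            using that unfolding g_def by (intro c1) (auto simp: a_def)
          have e: "a x * (c1 * dist x P powr - s) \<le> c1 * (dist x P powr ((2 * s - 1) - real DIM('a)) * min 1 (R / dist x P))" for x
          proof (cases "a x = 0")
            case False
            then have x: "x \<in> U" "P \<in> U" "dist x P \<noteq> 0" by (auto simp: a_def indicator_def split: if_splits)
            have "min 1 (R / dist x P) = 1" using R x by (intro min_1_far) auto
            moreover have "dist x P powr (s - 1 - p) * dist x P powr - s = dist x P powr ((2 * s - 1) - real DIM('a))"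
              by (simp add: powr_add[symmetric] p_def algebra_simps)
            ultimately show ?thesis using x by (simp add: a_def mult.left_commute)
          qed (use c1 R in simp)
          have "(\<integral>\<^sup>+x. ennreal (a x * (c1 * dist x P powr - s)) \<partial>lborel)
             \<le> (\<integral>\<^sup>+x. ennreal c1 * ennreal (dist x P powr ((2 * s - 1) - real DIM('a)) * min 1 (R / dist x P)) \<partial>lborel)"
            using e c1 R by (intro nn_integral_mono) (simp add: ennreal_mult[symmetric] ennreal_leI)
          also have "\<dots> = ennreal c1 * (\<integral>\<^sup>+x. ennreal (dist x P powr ((2 * s - 1) - real DIM('a)) * min 1 (R / dist x P)) \<partial>lborel)"
            by (intro nn_integral_cmult) measurable
          also have "\<dots> \<le> ennreal c1 * ennreal (c2 * R powr (2 * s - 1))" by (intro mult_left_mono c2 R) auto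
          also have "\<dots> = ennreal (c1 * (c2 * R powr (2 * s - 1)))" using c1 c2 by (simp add: ennreal_mult[symmetric])
          finally show "(\<integral>\<^sup>+x. ennreal (a x * (c1 * dist x P powr - s)) \<partial>lborel) \<le> ennreal (c1 * (c2 * R powr (2 * s - 1)))" .
          show "(\<lambda>z. a (fst z) * g (fst z) (snd z)) \<in> borel_measurable (lborel \<Otimes>\<^sub>M lborel)" unfolding a_def g_def by measurable
          show "(\<lambda>y. g x y) \<in> borel_measurable lborel" for x unfolding g_def by measurable
        qed (use c1 in \<open>auto simp: a_def g_def sigma_finite_lborel\<close>)
        moreover have "k1 w P = a (fst w) * g (fst w) (snd w)" for w
          by (simp add: k1_def a_def g_def)
        ultimately show ?thesis by simp
      qed
    qed
  qed
qed

text \<open>No weight is necessary, the kernel serves as both of its Schur factors. On the boundary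
  -p = (2s - 1) - (n - 1), so the potential converges by s > 1/2 and the boundedness of U.\<close>

lemma schur_ker3:
  assumes U[measurable]: "U \<in> sets borel" and R: "0 < R" "\<And>x P. x \<in> U \<Longrightarrow> P \<in> U \<Longrightarrow> dist x P \<le> R"
  obtains C where "C < \<infinity>" "\<And>G. G \<in> borel_measurable \<mu> \<Longrightarrow>
    (\<integral>\<^sup>+x. (\<integral>\<^sup>+P. ennreal (ker3 U x P) * G P \<partial>\<mu>)\<^sup>2 \<partial>(lborel :: 'a measure)) \<le> C * (\<integral>\<^sup>+P. (G P)\<^sup>2 \<partial>\<mu>)"
proof -
  obtain c2 where c2: "0 < c2" "\<And>(P::'a) \<rho>. 0 < \<rho> \<Longrightarrow>
    (\<integral>\<^sup>+x. ennreal (dist x P powr ((2 * s - 1) - real DIM('a)) * min 1 (\<rho> / dist x P)) \<partial>lborel) \<le> ennreal (c2 * \<rho> powr (2 * s - 1))"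
    by (rule potential_lborel_near[of "2 * s - 1"]) (use s in auto)
  obtain c4 where c4: "0 < c4" "\<And>x \<rho>. 0 < \<rho> \<Longrightarrow>
    (\<integral>\<^sup>+P. ennreal (dist x P powr ((2 * s - 1) - (real DIM('a) - 1)) * min 1 (\<rho> / dist x P)) \<partial>\<mu>) \<le> ennreal (c4 * \<rho> powr (2 * s - 1))"
    by (rule potential_bdry_near[of "2 * s - 1"]) (use s in auto)
  show thesis
  proof (rule that)
    show "ennreal (c4 * R powr (2 * s - 1)) * ennreal (R * (c2 * R powr (2 * s - 1))) < \<infinity>" by (simp add: ennreal_mult_less_top)
    fix G :: "'a \<Rightarrow> ennreal" assume G: "G \<in> borel_measurable \<mu>"
    show "(\<integral>\<^sup>+x. (\<integral>\<^sup>+P. ennreal (ker3 U x P) * G P \<partial>\<mu>)\<^sup>2 \<partial>lborel)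
        \<le> ennreal (c4 * R powr (2 * s - 1)) * ennreal (R * (c2 * R powr (2 * s - 1))) * (\<integral>\<^sup>+P. (G P)\<^sup>2 \<partial>\<mu>)"
    proof (rule schur_bound[where ?k1.0 = "ker3 U" and ?k2.0 = "ker3 U"])
      show "case_prod (ker3 U) \<in> borel_measurable (lborel \<Otimes>\<^sub>M \<mu>)"
        unfolding ker3_def by measurable
      show "case_prod (ker3 U) \<in> borel_measurable (lborel \<Otimes>\<^sub>M \<mu>)"
        unfolding ker3_def by measurable
      show "case_prod (ker3 U) \<in> borel_measurable (lborel \<Otimes>\<^sub>M \<mu>)"
        unfolding ker3_def by measurable
      show "(\<integral>\<^sup>+P. ennreal (ker3 U x P) \<partial>\<mu>) \<le> ennreal (c4 * R powr (2 * s - 1))" for x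
      proof -
        have "(\<integral>\<^sup>+P. ennreal (ker3 U x P) \<partial>\<mu>) \<le> (\<integral>\<^sup>+P. ennreal (dist x P powr ((2 * s - 1) - (real DIM('a) - 1)) * min 1 (R / dist x P)) \<partial>\<mu>)"
        proof (intro nn_integral_mono ennreal_leI)
          fix P
          show "ker3 U x P \<le> dist x P powr ((2 * s - 1) - (real DIM('a) - 1)) * min 1 (R / dist x P)"
          proof (cases "x \<in> U \<and> P \<in> U \<and> dist x P \<noteq> 0")
            case True
            then have "min 1 (R / dist x P) = 1" using R by (intro min_1_far) auto
            then show ?thesis using True by (simp add: ker3_def p_def)
          qed (use R in \<open>auto simp: ker3_def\<close>)
        qed
        also have "\<dots> \<le> ennreal (c4 * R powr (2 * s - 1))" by (rule c4(2)[OF R(1)])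
        finally show ?thesis .
      qed
      show "(\<integral>\<^sup>+x. ennreal (ker3 U x P) \<partial>lborel) \<le> ennreal (R * (c2 * R powr (2 * s - 1)))" for P
      proof -
        have "(\<integral>\<^sup>+x. ennreal (ker3 U x P) \<partial>lborel) \<le> (\<integral>\<^sup>+x. ennreal R * ennreal (dist x P powr ((2 * s - 1) - real DIM('a)) * min 1 (R / dist x P)) \<partial>lborel)"
        proof (intro nn_integral_mono)
          fix x
          have "ker3 U x P \<le> R * (dist x P powr ((2 * s - 1) - real DIM('a)) * min 1 (R / dist x P))"
          proof (cases "x \<in> U \<and> P \<in> U \<and> dist x P \<noteq> 0")
            case True
            then have m: "min 1 (R / dist x P) = 1" using R by (intro min_1_far) auto
            \<comment> \<open>In space the singularity is milder by one power; the surplus factor |x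
              - P| is simply bounded by R, to reuse the exponent 2s - 1.\<close>
            have "dist x P powr - p = dist x P * dist x P powr ((2 * s - 1) - real DIM('a))"
              using True powr_add[of "dist x P" 1 "(2 * s - 1) - real DIM('a)"] by (simp add: p_def)
            also have "\<dots> \<le> R * dist x P powr ((2 * s - 1) - real DIM('a))"
              using True R by (intro mult_right_mono) auto
            finally show ?thesis using True m by (simp add: ker3_def)
          qed (use R in \<open>auto simp: ker3_def\<close>)
          then show "ennreal (ker3 U x P) \<le> ennreal R * ennreal (dist x P powr ((2 * s - 1) - real DIM('a)) * min 1 (R / dist x P))"
            using R by (simp add: ennreal_mult[symmetric] ennreal_leI)
        qed
        also have "\<dots> = ennreal R * (\<integral>\<^sup>+x. ennreal (dist x P powr ((2 * s - 1) - real DIM('a)) * min 1 (R / dist x P)) \<partial>lborel)"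
          by (intro nn_integral_cmult) measurable
        also have "\<dots> \<le> ennreal R * ennreal (c2 * R powr (2 * s - 1))" by (intro mult_left_mono c2 R) auto
        also have "\<dots> = ennreal (R * (c2 * R powr (2 * s - 1)))" using R c2 by (simp add: ennreal_mult[symmetric])
        finally show ?thesis .
      qed
      show "(ker3 U x P)\<^sup>2 \<le> ker3 U x P * ker3 U x P" for x P by (simp add: power2_eq_square)
    qed (use G in \<open>auto simp: ker3_def sigma_finite_lborel fm.sigma_finite_measure_axioms\<close>)
  qed
qed

text \<open>The weight is chosen so that the space integral of k1 is scale invariant and the whole
  surplus of homogeneity falls on the boundary integral of k2, where it becomes powers of R.\<close>

lemma schur_ker4:
  assumes U[measurable]: "U \<in> sets borel" and R: "0 < R" "\<And>x P. x \<in> U \<Longrightarrow> P \<in> U \<Longrightarrow> dist x P \<le> R"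
  obtains C where "C < \<infinity>" "\<And>G. G \<in> borel_measurable (\<mu> \<Otimes>\<^sub>M \<mu>) \<Longrightarrow>
    (\<integral>\<^sup>+x. (\<integral>\<^sup>+z. ennreal (ker4 U x z) * G z \<partial>(\<mu> \<Otimes>\<^sub>M \<mu>))\<^sup>2 \<partial>(lborel :: 'a measure)) \<le> C * (\<integral>\<^sup>+z. (G z)\<^sup>2 \<partial>(\<mu> \<Otimes>\<^sub>M \<mu>))"
proof -
  obtain c2 where c2: "0 < c2" "\<And>(P::'a) \<rho>. 0 < \<rho> \<Longrightarrow>
    (\<integral>\<^sup>+x. ennreal (dist x P powr ((s - 1/2) - real DIM('a)) * min 1 (\<rho> / dist x P)) \<partial>lborel) \<le> ennreal (c2 * \<rho> powr (s - 1/2))"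
    by (rule potential_lborel_near[of "s - 1/2"]) (use s in auto)
  obtain c3 where c3: "0 < c3" "\<And>P \<rho>. 0 < \<rho> \<Longrightarrow>
    (\<integral>\<^sup>+Q. ennreal (dist P Q powr (3/2 - real DIM('a) - s) * min 1 (dist P Q / \<rho>)) \<partial>\<mu>) \<le> ennreal (c3 * \<rho> powr (1/2 - s))"
    by (rule potential_bdry_far) blast
  obtain c4 where c4: "0 < c4" "\<And>x \<rho>. 0 < \<rho> \<Longrightarrow>
    (\<integral>\<^sup>+P. ennreal (dist x P powr (s - (real DIM('a) - 1)) * min 1 (\<rho> / dist x P)) \<partial>\<mu>) \<le> ennreal (c4 * \<rho> powr s)"
    by (rule potential_bdry_near[of s]) (use s in auto)
  \<comment> \<open>With r = |x - P| and h = |P - Q|, the Schur weight is r^(-s-1/2) h^((n-1)/2);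
    the indicators are kept only in k2.\<close>
  define k1 where "k1 x z = dist (fst z) (snd z) powr (1/2 - s) *
      (dist x (fst z) powr ((s - 1/2) - real DIM('a)) * min 1 (dist (fst z) (snd z) / dist x (fst z)))" for x and z :: "'a \<times> 'a"
  define k2 where "k2 x z = indicator U x * indicator U (fst z) *
      dist x (fst z) powr (s + 1/2 - p)
      * (dist (fst z) (snd z) powr (3/2 - real DIM('a) - s) * min 1 (dist (fst z) (snd z) / dist x (fst z)))" for x and z :: "'a \<times> 'a"
  let ?C2 = "c3 * R powr s * (c4 * R powr s)"
  show thesis
  proof (rule that)
    show "ennreal ?C2 * ennreal c2 < \<infinity>" by (simp add: ennreal_mult_less_top)
    fix G :: "'a \<times> 'a \<Rightarrow> ennreal" assume G: "G \<in> borel_measurable (\<mu> \<Otimes>\<^sub>M \<mu>)"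
    show "(\<integral>\<^sup>+x. (\<integral>\<^sup>+z. ennreal (ker4 U x z) * G z \<partial>(\<mu> \<Otimes>\<^sub>M \<mu>))\<^sup>2 \<partial>lborel)
        \<le> ennreal ?C2 * ennreal c2 * (\<integral>\<^sup>+z. (G z)\<^sup>2 \<partial>(\<mu> \<Otimes>\<^sub>M \<mu>))"
    proof (rule schur_bound)
      show "sigma_finite_measure (lborel :: 'a measure)" by (rule sigma_finite_lborel)
      show "sigma_finite_measure (\<mu> \<Otimes>\<^sub>M \<mu>)"
        by (intro sigma_finite_pair_measure fm.sigma_finite_measure_axioms)
      show "case_prod (ker4 U) \<in> borel_measurable (lborel \<Otimes>\<^sub>M (\<mu> \<Otimes>\<^sub>M \<mu>))"
        unfolding ker4_def kap1_def by measurable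
      show "case_prod k1 \<in> borel_measurable (lborel \<Otimes>\<^sub>M (\<mu> \<Otimes>\<^sub>M \<mu>))"
        unfolding k1_def by measurable
      show "case_prod k2 \<in> borel_measurable (lborel \<Otimes>\<^sub>M (\<mu> \<Otimes>\<^sub>M \<mu>))"
        unfolding k2_def by measurable
      show "G \<in> borel_measurable (\<mu> \<Otimes>\<^sub>M \<mu>)" by (rule G)
      show "0 \<le> ker4 U x z" "0 \<le> k1 x z" "0 \<le> k2 x z" for x z
        by (simp_all add: ker4_def k1_def k2_def kap1_nonneg)
      show "(ker4 U x z)\<^sup>2 \<le> k1 x z * k2 x z" for x z
      proof -
        define h r where "h = dist (fst z) (snd z)" and "r = dist x (fst z)"
        have e2: "(h powr (- q / 2))\<^sup>2 = h powr (1/2 - s) * h powr (3/2 - real DIM('a) - s)"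
          by (simp add: power2_eq_square powr_add[symmetric] q_def algebra_simps)
        have e3: "(r powr - p)\<^sup>2 = r powr ((s - 1/2) - real DIM('a)) * r powr (s + 1/2 - p)"
          by (simp add: power2_eq_square powr_add[symmetric] p_def algebra_simps)
        show ?thesis
          unfolding ker4_def k1_def k2_def kap1_def h_def[symmetric] r_def[symmetric] power_mult_distrib e2 e3
          by (simp add: power2_eq_square mult_ac indicator_def)
      qed
      show "(\<integral>\<^sup>+x. ennreal (k1 x z) \<partial>lborel) \<le> ennreal c2" for z
      proof (cases "dist (fst z) (snd z) = 0")
        case False
        define h where "h = dist (fst z) (snd z)"
        have h: "0 < h" using False by (simp add: h_def)
        have "(\<integral>\<^sup>+x. ennreal (k1 x z) \<partial>lborel) = ennreal (h powr (1/2 - s)) * (\<integral>\<^sup>+x. ennreal (dist x (fst z) powr ((s - 1/2) - real DIM('a)) * min 1 (h / dist x (fst z))) \<partial>lborel)"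
          unfolding k1_def h_def[symmetric] using h by (subst nn_integral_cmult[symmetric]) (auto simp: ennreal_mult)
        also have "\<dots> \<le> ennreal (h powr (1/2 - s)) * ennreal (c2 * h powr (s - 1/2))" by (intro mult_left_mono c2 h) auto
        also have "\<dots> = ennreal (c2 * (h powr (1/2 - s) * h powr (s - 1/2)))"
          using c2 by (subst ennreal_mult[symmetric]) (auto simp: mult_ac)
        also have "h powr (1/2 - s) * h powr (s - 1/2) = 1" using h by (simp add: powr_add[symmetric])
        finally show ?thesis by simp
      qed (simp add: k1_def)
      show "(\<integral>\<^sup>+z. ennreal (k2 x z) \<partial>(\<mu> \<Otimes>\<^sub>M \<mu>)) \<le> ennreal ?C2" for x
      proof -
        define a where "a P = indicator U x * indicator U P * dist x P powr (s + 1/2 - p)" for P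
        define g where "g P Q = dist P Q powr (3/2 - real DIM('a) - s) * min 1 (dist P Q / dist x P)" for P Q :: 'a
        have "(\<integral>\<^sup>+z. ennreal (a (fst z) * g (fst z) (snd z)) \<partial>(\<mu> \<Otimes>\<^sub>M \<mu>)) \<le> ennreal ?C2"
        proof (rule nn_integral_two_step[where f = "\<lambda>P Q. a P * g P Q" and a = a and g = g and b = "\<lambda>P. c3 * dist x P powr (1/2 - s)"])
          show "(\<integral>\<^sup>+Q. ennreal (g P Q) \<partial>\<mu>) \<le> ennreal (c3 * dist x P powr (1/2 - s))" if "a P \<noteq> 0" for P
            using that unfolding g_def by (intro c3) (auto simp: a_def)
          have e: "a P * (c3 * dist x P powr (1/2 - s)) \<le> (c3 * R powr s) * (dist x P powr (s - (real DIM('a) - 1)) * min 1 (R / dist x P))" for P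
          proof (cases "a P = 0")
            case False
            then have x: "x \<in> U" "P \<in> U" "dist x P \<noteq> 0" by (auto simp: a_def indicator_def split: if_splits)
            have m: "min 1 (R / dist x P) = 1" using R x by (intro min_1_far) auto
            have "dist x P powr (s + 1/2 - p) * dist x P powr (1/2 - s) = dist x P powr s * dist x P powr (s - (real DIM('a) - 1))"
              by (simp add: powr_add[symmetric] p_def algebra_simps)
            also have "\<dots> \<le> R powr s * dist x P powr (s - (real DIM('a) - 1))"
              using R x s by (intro mult_right_mono powr_mono2) auto
            finally have "c3 * (dist x P powr (s + 1/2 - p) * dist x P powr (1/2 - s)) \<le> c3 * (R powr s * dist x P powr (s - (real DIM('a) - 1)))"
              using c3 by (intro mult_left_mono) auto
            then show ?thesis using x m by (simp add: a_def mult_ac)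
          qed (use c3 R in simp)
          have "(\<integral>\<^sup>+P. ennreal (a P * (c3 * dist x P powr (1/2 - s))) \<partial>\<mu>)
             \<le> (\<integral>\<^sup>+P. ennreal (c3 * R powr s) * ennreal (dist x P powr (s - (real DIM('a) - 1)) * min 1 (R / dist x P)) \<partial>\<mu>)"
            using e c3 R by (intro nn_integral_mono) (simp add: ennreal_mult[symmetric] ennreal_leI)
          also have "\<dots> = ennreal (c3 * R powr s) * (\<integral>\<^sup>+P. ennreal (dist x P powr (s - (real DIM('a) - 1)) * min 1 (R / dist x P)) \<partial>\<mu>)"
            by (intro nn_integral_cmult) measurable
          also have "\<dots> \<le> ennreal (c3 * R powr s) * ennreal (c4 * R powr s)" by (intro mult_left_mono c4 R) auto
          also have "\<dots> = ennreal ?C2" using c3 c4 by (simp add: ennreal_mult[symmetric])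
          finally show "(\<integral>\<^sup>+P. ennreal (a P * (c3 * dist x P powr (1/2 - s))) \<partial>\<mu>) \<le> ennreal ?C2" .
          show "(\<lambda>z. a (fst z) * g (fst z) (snd z)) \<in> borel_measurable (\<mu> \<Otimes>\<^sub>M \<mu>)" unfolding a_def g_def by measurable
          show "(\<lambda>y. g x y) \<in> borel_measurable \<mu>" for x unfolding g_def by measurable
        qed (use c3 in \<open>auto simp: a_def g_def fm.sigma_finite_measure_axioms\<close>)
        moreover have "k2 x z = a (fst z) * g (fst z) (snd z)" for z
          by (simp add: k2_def a_def g_def)
        ultimately show ?thesis by simp
      qed
    qed
  qed
qed

text \<open>The second coordinate of \<open>X\<close> is a height: away from height \<open>0\<close> the kernel has no singularity on the
  boundary.\<close>
definition Phi :: "'a \<times> real \<Rightarrow> 'a \<Rightarrow> real" where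
  "Phi X P = norm (X - (P, 0)) powr -p"

section \<open>The kernel lifted by a height, and continuity of the functional along it\<close>

lemma Phi_measurable [measurable]: "Phi X \<in> borel_measurable borel"
  unfolding Phi_def by measurable

lemma compact_K: "compact K" using bounded_domain by (simp add: compact_frontier_bounded)

lemma kap1_le: "0 < \<delta> \<Longrightarrow> \<delta> \<le> r \<Longrightarrow> 0 \<le> t \<Longrightarrow> kap1 p t r \<le> \<delta> powr (-p-1) * t"
proof -
  assume *: "0 < \<delta>" "\<delta> \<le> r" "0 \<le> t"
  have "kap1 p t r \<le> kap1 p t \<delta>" using * p_pos by (intro kap1_antimono) auto
  also have "\<dots> \<le> \<delta> powr -p * (t / \<delta>)" unfolding kap1_def by (intro mult_left_mono) auto
  also have "\<dots> = \<delta> powr (-p-1) * t" using * by (simp add: powr_diff)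
  finally show ?thesis .
qed

lemma kap2_le: "0 < \<delta> \<Longrightarrow> \<delta> \<le> r \<Longrightarrow> 0 \<le> t \<Longrightarrow> 0 \<le> h \<Longrightarrow> kap2 p t h r \<le> \<delta> powr (-p-2) * t * h"
proof -
  assume *: "0 < \<delta>" "\<delta> \<le> r" "0 \<le> t" "0 \<le> h"
  have "kap2 p t h r \<le> kap2 p t h \<delta>" using * p_pos by (intro kap2_antimono) auto
  also have "\<dots> \<le> \<delta> powr -p * (t / \<delta>) * (h / \<delta>)" unfolding kap2_def using * by (intro mult_mono mult_left_mono) auto
  also have "\<dots> = \<delta> powr (-p-2) * t * h" using * by (simp add: powr_diff power2_eq_square)
  finally show ?thesis .
qed

lemma Phi_bounds:
  assumes \<delta>: "0 < \<delta>" and X: "\<And>P. P \<in> K \<Longrightarrow> \<delta> \<le> norm (X - (P, 0))" and PQ: "P \<in> K" "Q \<in> K"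
  shows "\<bar>Phi X P\<bar> \<le> \<delta> powr -p" "\<bar>Phi X P - Phi X Q\<bar> \<le> 2 * (1 + p) * \<delta> powr (-p-1) * dist P Q"
proof -
  show "\<bar>Phi X P\<bar> \<le> \<delta> powr -p"
    unfolding Phi_def using X[OF PQ(1)] \<delta> p_pos by (simp add: powr_mono2')
  have nz: "X - (P, 0) \<noteq> 0" "X - (Q, 0) \<noteq> 0" using X[OF PQ(1)] X[OF PQ(2)] \<delta> by force+
  have d: "norm ((X - (P, 0)) - (X - (Q, 0))) = dist P Q"
    by (cases X) (simp add: norm_Pair dist_norm norm_minus_commute)
  have "\<bar>Phi X P - Phi X Q\<bar> \<le> (1 + p) * (kap1 p (dist P Q) (norm (X - (P, 0))) + kap1 p (dist P Q) (norm (X - (Q, 0))))"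
    using kernel_diff1[OF nz p_pos] unfolding Phi_def d .
  also have "\<dots> \<le> (1 + p) * (\<delta> powr (-p-1) * dist P Q + \<delta> powr (-p-1) * dist P Q)"
    using p_pos by (intro mult_left_mono add_mono kap1_le \<delta> X PQ) auto
  finally show "\<bar>Phi X P - Phi X Q\<bar> \<le> 2 * (1 + p) * \<delta> powr (-p-1) * dist P Q" by (simp add: algebra_simps)
qed

lemma second_difference:
  obtains C where "0 < C" and "\<And>X Y P Q. X \<noteq> (P, 0) \<Longrightarrow> Y \<noteq> (P, 0) \<Longrightarrow> X \<noteq> (Q, 0) \<Longrightarrow> Y \<noteq> (Q, 0) \<Longrightarrow>
    \<bar>(Phi X P - Phi Y P) - (Phi X Q - Phi Y Q)\<bar> \<le> C * (kap2 p (norm (X - Y)) (dist P Q) (norm (X - (P, 0)))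
      + kap2 p (norm (X - Y)) (dist P Q) (norm (Y - (P, 0)))
      + kap2 p (norm (X - Y)) (dist P Q) (norm (X - (Q, 0)))
      + kap2 p (norm (X - Y)) (dist P Q) (norm (Y - (Q, 0))))"
proof -
  obtain C where C: "0 < C" "\<And>a k l :: 'a \<times> real. a \<noteq> 0 \<Longrightarrow> a + k \<noteq> 0 \<Longrightarrow> a + l \<noteq> 0 \<Longrightarrow> a + k + l \<noteq> 0 \<Longrightarrow>
     \<bar>norm a powr -p - norm (a + k) powr -p - norm (a + l) powr -p + norm (a + k + l) powr -p\<bar>
    \<le> C * (kap2 p (norm k) (norm l) (norm a) + kap2 p (norm k) (norm l) (norm (a + k))
       + kap2 p (norm k) (norm l) (norm (a + l)) + kap2 p (norm k) (norm l) (norm (a + k + l)))"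
    using kernel_diff2[OF p_pos, where 'b = "'a \<times> real"] by blast
  show thesis
  proof (rule that[OF C(1)])
    fix X Y :: "'a \<times> real" and P Q :: 'a
    assume nz: "X \<noteq> (P, 0)" "Y \<noteq> (P, 0)" "X \<noteq> (Q, 0)" "Y \<noteq> (Q, 0)"
    \<comment> \<open>The four arguments X - P, Y - P, X - Q, Y - Q become the corners a, a + k, a +
      l, a + k + l of a parallelogram, and the mixed difference becomes the second difference of
      \<open>kernel_diff2\<close>.\<close>
    define a k l where "a = X - (P, 0)" and "k = Y - X" and "l = (P - Q, 0::real)"
    have e: "a + k = Y - (P, 0)" "a + l = X - (Q, 0)" "a + k + l = Y - (Q, 0)"
      by (auto simp: a_def k_def l_def prod_eq_iff)
    have nk: "norm k = norm (X - Y)" by (simp add: k_def norm_minus_commute)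
    have nl: "norm l = dist P Q" by (simp add: l_def norm_Pair dist_norm)
    have "\<bar>norm a powr -p - norm (a + k) powr -p - norm (a + l) powr -p + norm (a + k + l) powr -p\<bar>
    \<le> C * (kap2 p (norm k) (norm l) (norm a) + kap2 p (norm k) (norm l) (norm (a + k))
       + kap2 p (norm k) (norm l) (norm (a + l)) + kap2 p (norm k) (norm l) (norm (a + k + l)))"
    proof (rule C(2))
      show "a \<noteq> 0" using nz by (simp add: a_def)
      show "a + k \<noteq> 0" unfolding e(1) using nz by simp
      show "a + l \<noteq> 0" unfolding e(2) using nz by simp
      show "a + k + l \<noteq> 0" unfolding e(3) using nz by simp
    qed
    then show "\<bar>(Phi X P - Phi Y P) - (Phi X Q - Phi Y Q)\<bar> \<le> C * (kap2 p (norm (X - Y)) (dist P Q) (norm (X - (P, 0)))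
      + kap2 p (norm (X - Y)) (dist P Q) (norm (Y - (P, 0)))
      + kap2 p (norm (X - Y)) (dist P Q) (norm (X - (Q, 0)))
      + kap2 p (norm (X - Y)) (dist P Q) (norm (Y - (Q, 0))))"
      unfolding e(3) unfolding e(1,2) nk nl unfolding a_def Phi_def by (simp add: algebra_simps)
  qed
qed

text \<open>For a Lipschitz function the squared quotient is at most b^2 |P - Q|^(2-q). Writing 2 -
  q = (2 - s) + ((1 - s) - (n - 1)), the first part is bounded by a power of the diameter and the
  second is an integrable potential. The dependence on a^2 + b^2 is explicit because the bound must
  also yield small energies for small functions.\<close>

lemma energy_lipschitz_bound:
  obtains L where "L < \<infinity>" "\<And>f a b. f \<in> borel_measurable borel \<Longrightarrow> (\<And>P. P \<in> K \<Longrightarrow> \<bar>f P\<bar> \<le> a) \<Longrightarrow>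
     (\<And>P Q. P \<in> K \<Longrightarrow> Q \<in> K \<Longrightarrow> \<bar>f P - f Q\<bar> \<le> b * dist P Q) \<Longrightarrow> energy \<mu> q f \<le> ennreal (a\<^sup>2 + b\<^sup>2) * L"
proof -
  obtain R where R: "0 < R" "\<And>P Q. P \<in> K \<Longrightarrow> Q \<in> K \<Longrightarrow> dist P Q \<le> R"
  proof -
    have "bounded K" using compact_K by (rule compact_imp_bounded)
    then obtain e where "\<forall>x\<in>K. \<forall>y\<in>K. dist x y \<le> e" unfolding bounded_two_points by blast
    then show thesis by (intro that[of "max 1 e"]) (auto simp: le_max_iff_disj)
  qed
  obtain c4 where c4: "0 < c4" "\<And>x \<rho>. 0 < \<rho> \<Longrightarrow>
    (\<integral>\<^sup>+P. ennreal (dist x P powr ((1 - s) - (real DIM('a) - 1)) * min 1 (\<rho> / dist x P)) \<partial>\<mu>) \<le> ennreal (c4 * \<rho> powr (1 - s))"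
    by (rule potential_bdry_near[of "1 - s"]) (use s in auto)
  define L2 where "L2 = (\<integral>\<^sup>+z. indicator (K \<times> K) z * ennreal (dist (fst z) (snd z) powr (2 - q)) \<partial>(\<mu> \<Otimes>\<^sub>M \<mu>))"
  have [measurable]: "K \<in> sets borel" by simp
  have "L2 = (\<integral>\<^sup>+P. \<integral>\<^sup>+Q. indicator (K \<times> K) (P, Q) * ennreal (dist P Q powr (2 - q)) \<partial>\<mu> \<partial>\<mu>)"
    unfolding L2_def by (subst fm.nn_integral_fst[symmetric]) auto
  also have "\<dots> \<le> (\<integral>\<^sup>+P. ennreal (R powr (2 - s) * (c4 * R powr (1 - s))) \<partial>\<mu>)"
  proof (rule nn_integral_mono)
    fix P
    have "(\<integral>\<^sup>+Q. indicator (K \<times> K) (P, Q) * ennreal (dist P Q powr (2 - q)) \<partial>\<mu>)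
      \<le> (\<integral>\<^sup>+Q. ennreal (R powr (2 - s)) * ennreal (dist P Q powr ((1 - s) - (real DIM('a) - 1)) * min 1 (R / dist P Q)) \<partial>\<mu>)"
    proof (rule nn_integral_mono)
      fix Q
      show "indicator (K \<times> K) (P, Q) * ennreal (dist P Q powr (2 - q))
        \<le> ennreal (R powr (2 - s)) * ennreal (dist P Q powr ((1 - s) - (real DIM('a) - 1)) * min 1 (R / dist P Q))"
      proof (cases "P \<in> K \<and> Q \<in> K \<and> dist P Q \<noteq> 0")
        case True
        then have "min 1 (R / dist P Q) = 1" using R by (intro min_1_far) auto
        moreover have "dist P Q powr (2 - q) \<le> R powr (2 - s) * dist P Q powr ((1 - s) - (real DIM('a) - 1))"
        proof -
          have "dist P Q powr (2 - q) = dist P Q powr (2 - s) * dist P Q powr ((1 - s) - (real DIM('a) - 1))"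
            by (simp add: powr_add[symmetric] q_def algebra_simps)
          also have "\<dots> \<le> R powr (2 - s) * dist P Q powr ((1 - s) - (real DIM('a) - 1))"
            using True R s by (intro mult_right_mono powr_mono2) auto
          finally show ?thesis .
        qed
        ultimately show ?thesis using True by (simp add: ennreal_mult[symmetric] ennreal_leI)
      qed (auto simp: indicator_def)
    qed
    also have "\<dots> = ennreal (R powr (2 - s)) * (\<integral>\<^sup>+Q. ennreal (dist P Q powr ((1 - s) - (real DIM('a) - 1)) * min 1 (R / dist P Q)) \<partial>\<mu>)"
      by (intro nn_integral_cmult) measurable
    also have "\<dots> \<le> ennreal (R powr (2 - s)) * ennreal (c4 * R powr (1 - s))" by (intro mult_left_mono c4 R) auto
    also have "\<dots> = ennreal (R powr (2 - s) * (c4 * R powr (1 - s)))" using c4 by (simp add: ennreal_mult[symmetric])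
    finally show "(\<integral>\<^sup>+Q. indicator (K \<times> K) (P, Q) * ennreal (dist P Q powr (2 - q)) \<partial>\<mu>) \<le> \<dots>" .
  qed
  also have "\<dots> < \<infinity>"
  proof -
    have "emeasure \<mu> UNIV < \<infinity>" using fm.emeasure_finite[of UNIV] by (simp add: less_top[symmetric])
    then show ?thesis by (simp add: ennreal_mult_less_top)
  qed
  finally have L2: "L2 < \<infinity>" .
  show thesis
  proof (rule that[of "emeasure \<mu> UNIV + L2"])
    show "emeasure \<mu> UNIV + L2 < \<infinity>" using L2 fm.emeasure_finite[of UNIV] by (simp add: less_top[symmetric])
    fix f :: "'a \<Rightarrow> real" and a b
    assume f[measurable]: "f \<in> borel_measurable borel" and a: "\<And>P. P \<in> K \<Longrightarrow> \<bar>f P\<bar> \<le> a"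
      and b: "\<And>P Q. P \<in> K \<Longrightarrow> Q \<in> K \<Longrightarrow> \<bar>f P - f Q\<bar> \<le> b * dist P Q"
    have "(\<integral>\<^sup>+x. ennreal ((f x)\<^sup>2) \<partial>\<mu>) \<le> (\<integral>\<^sup>+x. ennreal (a\<^sup>2) \<partial>\<mu>)"
    proof (rule nn_integral_mono_AE, use AE_bdry_measure[of \<Omega>] in \<open>elim AE_mp, intro AE_I2 impI ennreal_leI\<close>)
      fix P assume "P \<in> K"
      then have "\<bar>f P\<bar> \<le> \<bar>a\<bar>" using a[of P] by linarith
      then show "(f P)\<^sup>2 \<le> a\<^sup>2" by (simp add: abs_le_square_iff)
    qed
    then have 1: "(\<integral>\<^sup>+x. ennreal ((f x)\<^sup>2) \<partial>\<mu>) \<le> ennreal (a\<^sup>2 + b\<^sup>2) * emeasure \<mu> UNIV"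
      by (rule order_trans) (auto intro!: mult_right_mono ennreal_leI)
    have AE2: "AE z in \<mu> \<Otimes>\<^sub>M \<mu>. z \<in> K \<times> K"
    proof (rule bb.AE_pair_measure)
      show "AE x in \<mu>. AE y in \<mu>. (x, y) \<in> K \<times> K"
        using AE_bdry_measure[of \<Omega>] by (auto elim!: AE_mp)
    qed measurable
    have "(\<integral>\<^sup>+z. ennreal ((diffq q f z)\<^sup>2) \<partial>(\<mu> \<Otimes>\<^sub>M \<mu>)) \<le> (\<integral>\<^sup>+z. ennreal (b\<^sup>2) * (indicator (K \<times> K) z * ennreal (dist (fst z) (snd z) powr (2 - q))) \<partial>(\<mu> \<Otimes>\<^sub>M \<mu>))"
    proof (rule nn_integral_mono_AE, use AE2 in \<open>elim AE_mp, intro AE_I2 impI\<close>)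
      fix z assume z: "z \<in> K \<times> K"
      let ?h = "dist (fst z) (snd z)"
      have "\<bar>f (fst z) - f (snd z)\<bar> \<le> \<bar>b * ?h\<bar>" using b[of "fst z" "snd z"] z by force
      then have "(f (fst z) - f (snd z))\<^sup>2 \<le> b\<^sup>2 * ?h\<^sup>2" unfolding abs_le_square_iff by (simp add: power_mult_distrib)
      then have "(diffq q f z)\<^sup>2 \<le> b\<^sup>2 * ?h\<^sup>2 / ?h powr q"
        unfolding diffq_squared by (intro divide_right_mono) auto
      also have "\<dots> = b\<^sup>2 * ?h powr (2 - q)"
        by (cases "?h = 0") (auto simp: powr_diff)
      finally show "ennreal ((diffq q f z)\<^sup>2) \<le> ennreal (b\<^sup>2) * (indicator (K \<times> K) z * ennreal (?h powr (2 - q)))"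
        using z by (simp add: ennreal_mult[symmetric] ennreal_leI)
    qed
    also have "\<dots> = ennreal (b\<^sup>2) * L2" unfolding L2_def by (intro nn_integral_cmult) measurable
    also have "\<dots> \<le> ennreal (a\<^sup>2 + b\<^sup>2) * L2" by (intro mult_right_mono ennreal_leI) auto
    finally show "energy \<mu> q f \<le> ennreal (a\<^sup>2 + b\<^sup>2) * (emeasure \<mu> UNIV + L2)"
      unfolding energy_def distrib_left by (intro add_mono 1)
  qed
qed

lemma Phi_espace:
  assumes "X \<notin> K \<times> {0}"
  shows "Phi X \<in> espace \<mu> q"
proof -
  have "closed (K \<times> {0::real})" by (intro closed_Times) auto
  then obtain \<delta> where \<delta>: "0 < \<delta>" "\<And>Z. Z \<in> K \<times> {0} \<Longrightarrow> \<delta> \<le> dist X Z"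
    using separate_point_closed[OF _ assms] by blast
  then have X: "\<And>P. P \<in> K \<Longrightarrow> \<delta> \<le> norm (X - (P, 0))" by (force simp: dist_norm)
  obtain L where L: "L < \<infinity>" "\<And>f a b. f \<in> borel_measurable borel \<Longrightarrow> (\<And>P. P \<in> K \<Longrightarrow> \<bar>f P\<bar> \<le> a) \<Longrightarrow>
     (\<And>P Q. P \<in> K \<Longrightarrow> Q \<in> K \<Longrightarrow> \<bar>f P - f Q\<bar> \<le> b * dist P Q) \<Longrightarrow> energy \<mu> q f \<le> ennreal (a\<^sup>2 + b\<^sup>2) * L"
    by (rule energy_lipschitz_bound) blast
  have "energy \<mu> q (Phi X) \<le> ennreal ((\<delta> powr -p)\<^sup>2 + (2 * (1 + p) * \<delta> powr (-p-1))\<^sup>2) * L"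
    using Phi_bounds[OF \<delta>(1) X] by (intro L) auto
  also have "\<dots> < \<infinity>" using L(1) by (simp add: ennreal_mult_less_top)
  finally show ?thesis by (simp add: espace_def)
qed

text \<open>For Y near X the function \<open>Phi Y - Phi X\<close> has supremum and Lipschitz
  constant of order |Y - X| on the boundary, by first and second differences respectively. Its
  energy is thus of order |Y - X|^2, and the functional is locally Lipschitz in X.\<close>

lemma functional_continuous:
  assumes lin: "\<And>f g a b. f \<in> espace \<mu> q \<Longrightarrow> g \<in> espace \<mu> q \<Longrightarrow> T (\<lambda>x. a * f x + b * g x) = a * T f + b * T g"
    and bd: "\<And>f. f \<in> espace \<mu> q \<Longrightarrow> \<bar>T f\<bar> \<le> N * sqrt (enn2real (energy \<mu> q f))" and N: "0 \<le> N"
  shows "continuous_on (- (K \<times> {0})) (\<lambda>X. T (Phi X))"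
proof -
  have cl: "closed (K \<times> {0::real})" by (intro closed_Times) auto
  obtain L where L: "L < \<infinity>" "\<And>f a b. f \<in> borel_measurable borel \<Longrightarrow> (\<And>P. P \<in> K \<Longrightarrow> \<bar>f P\<bar> \<le> a) \<Longrightarrow>
     (\<And>P Q. P \<in> K \<Longrightarrow> Q \<in> K \<Longrightarrow> \<bar>f P - f Q\<bar> \<le> b * dist P Q) \<Longrightarrow> energy \<mu> q f \<le> ennreal (a\<^sup>2 + b\<^sup>2) * L"
    by (rule energy_lipschitz_bound) blast
  obtain C where C: "0 < C" "\<And>X Y P Q. X \<noteq> (P, 0) \<Longrightarrow> Y \<noteq> (P, 0) \<Longrightarrow> X \<noteq> (Q, 0) \<Longrightarrow> Y \<noteq> (Q, 0) \<Longrightarrow>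
    \<bar>(Phi X P - Phi Y P) - (Phi X Q - Phi Y Q)\<bar> \<le> C * (kap2 p (norm (X - Y)) (dist P Q) (norm (X - (P, 0)))
      + kap2 p (norm (X - Y)) (dist P Q) (norm (Y - (P, 0)))
      + kap2 p (norm (X - Y)) (dist P Q) (norm (X - (Q, 0)))
      + kap2 p (norm (X - Y)) (dist P Q) (norm (Y - (Q, 0))))"
    by (rule second_difference) blast
  have "isCont (\<lambda>X. T (Phi X)) X" if X0: "X \<notin> K \<times> {0}" for X
  proof -
    obtain \<delta>' where "0 < \<delta>'" "\<And>Z. Z \<in> K \<times> {0} \<Longrightarrow> \<delta>' \<le> dist X Z"
      using separate_point_closed[OF cl X0] by blast
    \<comment> \<open>Half the distance to the boundary, so that every Y within \<delta> of X still
      has distance at least \<delta>.\<close>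
    moreover define \<delta> where "\<delta> = \<delta>' / 2"
    ultimately have \<delta>: "0 < \<delta>" and X': "\<And>P. P \<in> K \<Longrightarrow> 2 * \<delta> \<le> norm (X - (P, 0))" by (force simp: dist_norm)+
    define M where "M = (2 * (1 + p) * \<delta> powr (-p-1))\<^sup>2 + (4 * C * \<delta> powr (-p-2))\<^sup>2"
    have est: "\<bar>T (Phi Y) - T (Phi X)\<bar> \<le> N * sqrt (M * enn2real L) * norm (Y - X)" if Y: "norm (Y - X) < \<delta>" for Y
    proof -
      let ?t = "norm (Y - X)"
      have X: "\<delta> \<le> norm (X - (P, 0))" if "P \<in> K" for P using X'[OF that] \<delta> by linarith
      have Yd: "\<delta> \<le> norm (Y - (P, 0))" if "P \<in> K" for P
        using X'[OF that] Y norm_triangle_ineq4[of "Y - (P, 0)" "Y - X"] by (simp add: algebra_simps)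
      have nz: "X \<noteq> (P, 0)" "Y \<noteq> (P, 0)" if "P \<in> K" for P using X[OF that] Yd[OF that] \<delta> by auto
      have sp: "Phi X \<in> espace \<mu> q" "Phi Y \<in> espace \<mu> q"
        using nz by (auto intro!: Phi_espace)
      let ?f = "\<lambda>P. 1 * Phi Y P + (-1) * Phi X P"
      have "energy \<mu> q ?f \<le> ennreal ((2 * (1 + p) * \<delta> powr (-p-1) * ?t)\<^sup>2 + (4 * C * \<delta> powr (-p-2) * ?t)\<^sup>2) * L"
      proof (rule L)
        show "\<bar>?f P\<bar> \<le> 2 * (1 + p) * \<delta> powr (-p-1) * ?t" if P: "P \<in> K" for P
        proof -
          have "\<bar>Phi Y P - Phi X P\<bar> \<le> (1 + p) * (kap1 p ?t (norm (Y - (P, 0))) + kap1 p ?t (norm (X - (P, 0))))"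
            using kernel_diff1[of "Y - (P, 0)" "X - (P, 0)" p] nz[OF P] p_pos by (simp add: Phi_def)
          also have "\<dots> \<le> (1 + p) * (\<delta> powr (-p-1) * ?t + \<delta> powr (-p-1) * ?t)"
            using p_pos by (intro mult_left_mono add_mono kap1_le \<delta> X Yd P) auto
          finally show ?thesis by (simp add: algebra_simps)
        qed
        show "\<bar>?f P - ?f Q\<bar> \<le> 4 * C * \<delta> powr (-p-2) * ?t * dist P Q" if P: "P \<in> K" and Q: "Q \<in> K" for P Q
        proof -
          have "\<bar>(Phi Y P - Phi X P) - (Phi Y Q - Phi X Q)\<bar> \<le> C * (kap2 p ?t (dist P Q) (norm (Y - (P, 0)))
            + kap2 p ?t (dist P Q) (norm (X - (P, 0))) + kap2 p ?t (dist P Q) (norm (Y - (Q, 0)))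
            + kap2 p ?t (dist P Q) (norm (X - (Q, 0))))"
            using nz[OF P] nz[OF Q] by (intro C) auto
          also have "\<dots> \<le> C * (\<delta> powr (-p-2) * ?t * dist P Q + \<delta> powr (-p-2) * ?t * dist P Q
            + \<delta> powr (-p-2) * ?t * dist P Q + \<delta> powr (-p-2) * ?t * dist P Q)"
            using C(1) by (intro mult_left_mono add_mono kap2_le \<delta> X Yd P Q) auto
          finally show ?thesis by (simp add: algebra_simps)
        qed
      qed measurable
      also have "(2 * (1 + p) * \<delta> powr (-p-1) * ?t)\<^sup>2 + (4 * C * \<delta> powr (-p-2) * ?t)\<^sup>2 = M * ?t\<^sup>2"
        unfolding M_def power_mult_distrib distrib_right ..
      also have "ennreal (M * ?t\<^sup>2) * L = ennreal (M * ?t\<^sup>2 * enn2real L)"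
        using L(1) by (simp add: ennreal_mult M_def)
      finally have "enn2real (energy \<mu> q ?f) \<le> M * ?t\<^sup>2 * enn2real L"
        by (intro enn2real_leI) (auto simp: M_def)
      then have "sqrt (enn2real (energy \<mu> q ?f)) \<le> sqrt (M * enn2real L * ?t\<^sup>2)" by (simp add: mult_ac)
      also have "\<dots> = sqrt (M * enn2real L) * ?t" by (simp add: real_sqrt_mult)
      finally have "N * sqrt (enn2real (energy \<mu> q ?f)) \<le> N * (sqrt (M * enn2real L) * ?t)" using N by (rule mult_left_mono)
      moreover have "\<bar>T (Phi Y) - T (Phi X)\<bar> \<le> N * sqrt (enn2real (energy \<mu> q ?f))"
        using bd[OF espace_lin[OF sets_bdry_measure fm.sigma_finite_measure_axioms sp(2,1), of 1 "-1"]] lin[OF sp(2,1), of 1 "-1"] by simp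
      ultimately show ?thesis by (simp add: mult.assoc)
    qed
    have "(\<lambda>Y. T (Phi Y)) \<midarrow>X\<rightarrow> T (Phi X)"
    proof (rule Lim_null[THEN iffD2], rule Lim_null_comparison)
      show "\<forall>\<^sub>F Y in at X. norm (T (Phi Y) - T (Phi X)) \<le> N * sqrt (M * enn2real L) * norm (Y - X)"
        using est \<delta> by (auto simp: eventually_at dist_norm intro!: exI[of _ \<delta>])
      have "(\<lambda>Y. N * sqrt (M * enn2real L) * norm (Y - X)) \<midarrow>X\<rightarrow> N * sqrt (M * enn2real L) * norm (X - X)"
        by (intro tendsto_intros)
      then show "(\<lambda>Y. N * sqrt (M * enn2real L) * norm (Y - X)) \<midarrow>X\<rightarrow> 0" by simp
    qed
    then show ?thesis by (simp add: isCont_def)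
  qed
  then show ?thesis by (intro continuous_at_imp_continuous_on) auto
qed

section \<open>Majorants of the potential that do not depend on the height\<close>

definition diff_pot_L2 :: "'a set \<Rightarrow> ('a \<Rightarrow> real) \<Rightarrow> 'a \<times> 'a \<Rightarrow> ennreal" where
  "diff_pot_L2 U \<tau> w = (\<integral>\<^sup>+P. ennreal (ker2 U w P) * ennreal \<bar>\<tau> P\<bar> \<partial>\<mu>)"

definition diff_pot_semi :: "('a \<Rightarrow> real) \<Rightarrow> 'a \<times> 'a \<Rightarrow> ennreal" where
  "diff_pot_semi \<tau> w = (\<integral>\<^sup>+z. ennreal (ker1 w z) * ennreal \<bar>diffq q \<tau> z\<bar> \<partial>(\<mu> \<Otimes>\<^sub>M \<mu>))"

definition val_pot_L2 :: "'a set \<Rightarrow> ('a \<Rightarrow> real) \<Rightarrow> 'a \<Rightarrow> ennreal" where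
  "val_pot_L2 U \<tau> x = (\<integral>\<^sup>+P. ennreal (ker3 U x P) * ennreal \<bar>\<tau> P\<bar> \<partial>\<mu>)"

definition val_pot_semi :: "'a set \<Rightarrow> ('a \<Rightarrow> real) \<Rightarrow> 'a \<Rightarrow> ennreal" where
  "val_pot_semi U \<tau> x = (\<integral>\<^sup>+z. ennreal (ker4 U x z) * ennreal \<bar>diffq q \<tau> z\<bar> \<partial>(\<mu> \<Otimes>\<^sub>M \<mu>))"

lemma sigma_finite_bdry_pairs: "sigma_finite_measure (\<mu> \<Otimes>\<^sub>M \<mu>)"
  by (intro sigma_finite_pair_measure fm.sigma_finite_measure_axioms)

sublocale sfbb: sigma_finite_measure "\<mu> \<Otimes>\<^sub>M \<mu>" by (rule sigma_finite_bdry_pairs)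

lemma measurable_diffq_bdry [measurable]:
  "f \<in> borel_measurable borel \<Longrightarrow> diffq r f \<in> borel_measurable (\<mu> \<Otimes>\<^sub>M \<mu>)"
  by (rule measurable_diffq[OF sets_bdry_measure])

lemma measurable_diff_pot_L2 [measurable]:
  assumes [measurable]: "U \<in> sets borel" "\<tau> \<in> borel_measurable borel"
  shows "diff_pot_L2 U \<tau> \<in> borel_measurable (lborel \<Otimes>\<^sub>M lborel)"
  unfolding diff_pot_L2_def ker2_def kap1_def by measurable

lemma measurable_diff_pot_semi [measurable]:
  assumes [measurable]: "\<tau> \<in> borel_measurable borel"
  shows "diff_pot_semi \<tau> \<in> borel_measurable (lborel \<Otimes>\<^sub>M lborel)"
  unfolding diff_pot_semi_def ker1_def kap2_def by measurable

lemma measurable_val_pot_L2 [measurable]: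
  assumes [measurable]: "U \<in> sets borel" "\<tau> \<in> borel_measurable borel"
  shows "val_pot_L2 U \<tau> \<in> borel_measurable lborel"
  unfolding val_pot_L2_def ker3_def by measurable

lemma measurable_val_pot_semi [measurable]:
  assumes [measurable]: "U \<in> sets borel" "\<tau> \<in> borel_measurable borel"
  shows "val_pot_semi U \<tau> \<in> borel_measurable lborel"
  unfolding val_pot_semi_def ker4_def kap1_def by measurable

lemma diffq_swap: "\<bar>diffq r f (snd z, fst z)\<bar> = \<bar>diffq r f z\<bar>"
  by (simp add: diffq_def dist_commute abs_minus_commute)

lemma abs_diffq: "\<bar>diffq r f (P, Q)\<bar> = \<bar>f P - f Q\<bar> * dist P Q powr (- r / 2)"
proof -
  have "dist P Q powr (- r / 2) = 1 / dist P Q powr (r / 2)"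
    using powr_minus_divide[of "dist P Q" "r / 2"] by simp
  then show ?thesis by (simp add: diffq_def)
qed

text \<open>The second difference also has singular corners at Q. The absolute difference quotient
  of \<tau> and the product measure are symmetric in P and Q, so these corners give the same
  potential as those at P; \<open>ker4_swap_integral\<close> does the same for values.\<close>

lemma ker1_swap_integral:
  assumes [measurable]: "\<tau> \<in> borel_measurable borel"
  shows "(\<integral>\<^sup>+z. ennreal (ker1 w (snd z, fst z)) * ennreal \<bar>diffq q \<tau> z\<bar> \<partial>(\<mu> \<Otimes>\<^sub>M \<mu>)) = diff_pot_semi \<tau> w"
proof -
  have "(\<integral>\<^sup>+z. ennreal (ker1 w (snd z, fst z)) * ennreal \<bar>diffq q \<tau> z\<bar> \<partial>(\<mu> \<Otimes>\<^sub>M \<mu>))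
     = (\<integral>\<^sup>+z. (\<lambda>z. ennreal (ker1 w z) * ennreal \<bar>diffq q \<tau> z\<bar>) (snd z, fst z) \<partial>(\<mu> \<Otimes>\<^sub>M \<mu>))"
    by (simp add: diffq_swap)
  also have "\<dots> = diff_pot_semi \<tau> w"
    unfolding diff_pot_semi_def ker1_def kap2_def
    by (intro nn_integral_pair_swap fm.sigma_finite_measure_axioms) measurable
  finally show ?thesis .
qed

lemma ker4_swap_integral:
  assumes [measurable]: "\<tau> \<in> borel_measurable borel" "U \<in> sets borel"
  shows "(\<integral>\<^sup>+z. ennreal (ker4 U x (snd z, fst z)) * ennreal \<bar>diffq q \<tau> z\<bar> \<partial>(\<mu> \<Otimes>\<^sub>M \<mu>)) = val_pot_semi U \<tau> x"
proof -
  have "(\<integral>\<^sup>+z. ennreal (ker4 U x (snd z, fst z)) * ennreal \<bar>diffq q \<tau> z\<bar> \<partial>(\<mu> \<Otimes>\<^sub>M \<mu>))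
     = (\<integral>\<^sup>+z. (\<lambda>z. ennreal (ker4 U x z) * ennreal \<bar>diffq q \<tau> z\<bar>) (snd z, fst z) \<partial>(\<mu> \<Otimes>\<^sub>M \<mu>))"
    by (simp add: diffq_swap)
  also have "\<dots> = val_pot_semi U \<tau> x"
    unfolding val_pot_semi_def ker4_def kap1_def
    by (intro nn_integral_pair_swap fm.sigma_finite_measure_axioms) measurable
  finally show ?thesis .
qed

text \<open>The reason why all majorants are uniform in the height e.\<close>

lemma norm_shift: "dist x P \<le> norm ((x, e) - (P, 0 :: real))" for x P :: 'a
  using norm_fst_le[of "(x - P)" e] by (simp add: dist_norm)

lemma norm_same_height: "norm ((x, e) - (y, e :: real)) = dist x y" for x y :: 'a
  by (simp add: norm_Pair dist_norm)

lemma AE_K_times_K: "AE z in \<mu> \<Otimes>\<^sub>M \<mu>. z \<in> K \<times> K"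
proof (rule bb.AE_pair_measure)
  have [measurable]: "K \<in> sets borel" by simp
  show "{x \<in> space (\<mu> \<Otimes>\<^sub>M \<mu>). x \<in> K \<times> K} \<in> sets (\<mu> \<Otimes>\<^sub>M \<mu>)" by measurable
  show "AE x in \<mu>. AE y in \<mu>. (x, y) \<in> K \<times> K"
    using AE_bdry_measure[of \<Omega>] by (auto elim!: AE_mp)
qed

definition pairing :: "('a \<Rightarrow> real) \<Rightarrow> ('a \<Rightarrow> real) \<Rightarrow> ennreal" where
  "pairing \<tau> f = (\<integral>\<^sup>+P. ennreal (\<bar>\<tau> P\<bar> * \<bar>f P\<bar>) \<partial>\<mu>)
      + (\<integral>\<^sup>+z. ennreal (\<bar>diffq q \<tau> z\<bar> * \<bar>diffq q f z\<bar>) \<partial>(\<mu> \<Otimes>\<^sub>M \<mu>))"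

text \<open>In the value part of the pairing a first difference of the kernel meets \<tau>, in the
  other part a second difference meets its quotient. Multiplying by the square root of the H^s
  weight turns the bounds into \<open>ker2\<close> and \<open>ker1\<close>. The factor 2 collects
  the corners at Q after swapping.\<close>

lemma pairing_difference_le:
  assumes U[measurable]: "U \<in> sets borel" and KU: "K \<subseteq> U"
  obtains C where "0 < C" "\<And>\<tau> x y e. \<tau> \<in> borel_measurable borel \<Longrightarrow> x \<in> U - K \<Longrightarrow> y \<in> U - K \<Longrightarrow>
    pairing \<tau> (\<lambda>P. Phi (x, e) P - Phi (y, e) P) * ennreal (dist x y powr (- real DIM('a) / 2 - s))
      \<le> ennreal C * ((diff_pot_L2 U \<tau> (x, y) + diff_pot_L2 U \<tau> (y, x)) + 2 * (diff_pot_semi \<tau> (x, y) + diff_pot_semi \<tau> (y, x)))"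
proof -
  obtain C2 where C2: "0 < C2" "\<And>X Y P Q. X \<noteq> (P, 0) \<Longrightarrow> Y \<noteq> (P, 0) \<Longrightarrow> X \<noteq> (Q, 0) \<Longrightarrow> Y \<noteq> (Q, 0) \<Longrightarrow>
    \<bar>(Phi X P - Phi Y P) - (Phi X Q - Phi Y Q)\<bar> \<le> C2 * (kap2 p (norm (X - Y)) (dist P Q) (norm (X - (P, 0)))
      + kap2 p (norm (X - Y)) (dist P Q) (norm (Y - (P, 0)))
      + kap2 p (norm (X - Y)) (dist P Q) (norm (X - (Q, 0)))
      + kap2 p (norm (X - Y)) (dist P Q) (norm (Y - (Q, 0))))"
    by (rule second_difference) blast
  define C where "C = max (1 + p) C2"
  have C: "0 < C" "1 + p \<le> C" "C2 \<le> C" using p_pos by (auto simp: C_def)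
  show thesis
  proof (rule that[OF C(1)])
    fix \<tau> :: "'a \<Rightarrow> real" and x y and e :: real
    assume \<tau>[measurable]: "\<tau> \<in> borel_measurable borel" and x: "x \<in> U - K" and y: "y \<in> U - K"
    let ?X = "(x, e)" and ?Y = "(y, e)"
    let ?f = "\<lambda>P. Phi ?X P - Phi ?Y P"
    let ?t = "dist x y powr (- real DIM('a) / 2 - s)"
    have nz: "?X \<noteq> (P, 0)" "?Y \<noteq> (P, 0)" "0 < dist x P" "0 < dist y P" if "P \<in> K" for P
      using x y that by auto
    have p1: "\<bar>?f P\<bar> * ?t \<le> C * (ker2 U (x, y) P + ker2 U (y, x) P)" if P: "P \<in> K" for P
    proof -
      have "\<bar>?f P\<bar> \<le> (1 + p) * (kap1 p (dist x y) (norm (?X - (P, 0))) + kap1 p (dist x y) (norm (?Y - (P, 0))))"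
      proof -
        have d: "norm ((?X - (P, 0)) - (?Y - (P, 0))) = dist x y" by (simp add: norm_Pair dist_norm)
        have "?X - (P, 0) \<noteq> 0" "?Y - (P, 0) \<noteq> 0" using nz(1,2)[OF P] unfolding right_minus_eq by auto
        from kernel_diff1[OF this p_pos] show ?thesis unfolding d Phi_def .
      qed
      also have "\<dots> \<le> C * (kap1 p (dist x y) (dist x P) + kap1 p (dist x y) (dist y P))"
        using C p_pos nz[OF P] by (intro mult_mono add_mono kap1_antimono norm_shift add_nonneg_nonneg kap1_nonneg) auto
      finally have "\<bar>?f P\<bar> * ?t \<le> C * (kap1 p (dist x y) (dist x P) + kap1 p (dist x y) (dist y P)) * ?t"
        by (rule mult_right_mono) simp
      then show ?thesis using x y P KU by (simp add: ker2_def dist_commute[of y x] algebra_simps subset_iff)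
    qed
    have p2: "\<bar>diffq q ?f z\<bar> * ?t \<le> C * ((ker1 (x, y) z + ker1 (y, x) z) + (ker1 (x, y) (snd z, fst z) + ker1 (y, x) (snd z, fst z)))"
      if z: "z \<in> K \<times> K" for z
    proof -
      obtain P Q where PQ: "z = (P, Q)" "P \<in> K" "Q \<in> K" using z by auto
      have "\<bar>?f P - ?f Q\<bar> \<le> C2 * (kap2 p (dist x y) (dist P Q) (norm (?X - (P, 0)))
          + kap2 p (dist x y) (dist P Q) (norm (?Y - (P, 0)))
          + kap2 p (dist x y) (dist P Q) (norm (?X - (Q, 0)))
          + kap2 p (dist x y) (dist P Q) (norm (?Y - (Q, 0))))"
        using C2(2)[of ?X P ?Y Q] nz[OF PQ(2)] nz[OF PQ(3)] unfolding norm_same_height by blast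
      also have "\<dots> \<le> C * (kap2 p (dist x y) (dist P Q) (dist x P)
          + kap2 p (dist x y) (dist P Q) (dist y P)
          + kap2 p (dist x y) (dist P Q) (dist x Q)
          + kap2 p (dist x y) (dist P Q) (dist y Q))"
        using C C2(1) p_pos nz[OF PQ(2)] nz[OF PQ(3)]
        by (intro mult_mono add_mono kap2_antimono norm_shift add_nonneg_nonneg kap2_nonneg) auto
      finally have "\<bar>?f P - ?f Q\<bar> * (dist P Q powr (- q / 2) * ?t) \<le> C * (kap2 p (dist x y) (dist P Q) (dist x P)
          + kap2 p (dist x y) (dist P Q) (dist y P) + kap2 p (dist x y) (dist P Q) (dist x Q)
          + kap2 p (dist x y) (dist P Q) (dist y Q)) * (dist P Q powr (- q / 2) * ?t)"
        by (rule mult_right_mono) simp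
      moreover have "\<bar>diffq q ?f z\<bar> = \<bar>?f P - ?f Q\<bar> * dist P Q powr (- q / 2)"
        unfolding PQ(1) by (rule abs_diffq)
      ultimately show ?thesis
        by (simp add: ker1_def PQ(1) dist_commute[of y x] dist_commute[of Q P] algebra_simps)
    qed
    have 1: "(\<integral>\<^sup>+P. ennreal (\<bar>\<tau> P\<bar> * \<bar>?f P\<bar>) \<partial>\<mu>) * ennreal ?t \<le> ennreal C * (diff_pot_L2 U \<tau> (x, y) + diff_pot_L2 U \<tau> (y, x))"
    proof -
      have "(\<integral>\<^sup>+P. ennreal (\<bar>\<tau> P\<bar> * \<bar>?f P\<bar>) \<partial>\<mu>) * ennreal ?t = (\<integral>\<^sup>+P. ennreal (\<bar>\<tau> P\<bar> * \<bar>?f P\<bar>) * ennreal ?t \<partial>\<mu>)"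
        by (intro nn_integral_multc[symmetric]) measurable
      also have "\<dots> \<le> (\<integral>\<^sup>+P. ennreal C * (ennreal (ker2 U (x, y) P) * ennreal \<bar>\<tau> P\<bar> + ennreal (ker2 U (y, x) P) * ennreal \<bar>\<tau> P\<bar>) \<partial>\<mu>)"
      proof (rule nn_integral_mono_AE, use AE_bdry_measure[of \<Omega>] in \<open>elim AE_mp, intro AE_I2 impI\<close>)
        fix P assume P: "P \<in> K"
        have k: "0 \<le> ker2 U (x, y) P" "0 \<le> ker2 U (y, x) P" by (simp_all add: ker2_def kap1_nonneg)
        have "ennreal (\<bar>\<tau> P\<bar> * \<bar>?f P\<bar>) * ennreal ?t = ennreal (\<bar>\<tau> P\<bar> * (\<bar>?f P\<bar> * ?t))"
          by (simp add: ennreal_mult[symmetric] mult.assoc)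
        also have "\<dots> \<le> ennreal (\<bar>\<tau> P\<bar> * (C * (ker2 U (x, y) P + ker2 U (y, x) P)))"
          by (intro ennreal_leI mult_left_mono p1 P) auto
        also have "\<dots> = ennreal C * (ennreal (ker2 U (x, y) P) * ennreal \<bar>\<tau> P\<bar> + ennreal (ker2 U (y, x) P) * ennreal \<bar>\<tau> P\<bar>)"
          using C k by (simp add: ennreal_mult ennreal_plus algebra_simps)
        finally show "ennreal (\<bar>\<tau> P\<bar> * \<bar>?f P\<bar>) * ennreal ?t \<le> ennreal C * (ennreal (ker2 U (x, y) P) * ennreal \<bar>\<tau> P\<bar> + ennreal (ker2 U (y, x) P) * ennreal \<bar>\<tau> P\<bar>)" .
      qed
      also have "\<dots> = ennreal C * (diff_pot_L2 U \<tau> (x, y) + diff_pot_L2 U \<tau> (y, x))"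
        unfolding diff_pot_L2_def ker2_def kap1_def by (subst nn_integral_cmult, measurable) (subst nn_integral_add; measurable)
      finally show ?thesis .
    qed
    have 2: "(\<integral>\<^sup>+z. ennreal (\<bar>diffq q \<tau> z\<bar> * \<bar>diffq q ?f z\<bar>) \<partial>(\<mu> \<Otimes>\<^sub>M \<mu>)) * ennreal ?t \<le> ennreal C * (2 * (diff_pot_semi \<tau> (x, y) + diff_pot_semi \<tau> (y, x)))"
    proof -
      have "(\<integral>\<^sup>+z. ennreal (\<bar>diffq q \<tau> z\<bar> * \<bar>diffq q ?f z\<bar>) \<partial>(\<mu> \<Otimes>\<^sub>M \<mu>)) * ennreal ?t
          = (\<integral>\<^sup>+z. ennreal (\<bar>diffq q \<tau> z\<bar> * \<bar>diffq q ?f z\<bar>) * ennreal ?t \<partial>(\<mu> \<Otimes>\<^sub>M \<mu>))"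
        by (intro nn_integral_multc[symmetric]) measurable
      also have "\<dots> \<le> (\<integral>\<^sup>+z. ennreal C * ((ennreal (ker1 (x, y) z) * ennreal \<bar>diffq q \<tau> z\<bar> + ennreal (ker1 (y, x) z) * ennreal \<bar>diffq q \<tau> z\<bar>)
          + (ennreal (ker1 (x, y) (snd z, fst z)) * ennreal \<bar>diffq q \<tau> z\<bar> + ennreal (ker1 (y, x) (snd z, fst z)) * ennreal \<bar>diffq q \<tau> z\<bar>)) \<partial>(\<mu> \<Otimes>\<^sub>M \<mu>))"
      proof (rule nn_integral_mono_AE, use AE_K_times_K in \<open>elim AE_mp, intro AE_I2 impI\<close>)
        fix z assume z: "z \<in> K \<times> K"
        have k: "0 \<le> ker1 w u" for w u by (simp add: ker1_def kap2_nonneg)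
        have "ennreal (\<bar>diffq q \<tau> z\<bar> * \<bar>diffq q ?f z\<bar>) * ennreal ?t = ennreal (\<bar>diffq q \<tau> z\<bar> * (\<bar>diffq q ?f z\<bar> * ?t))"
          by (simp add: ennreal_mult[symmetric] mult.assoc)
        also have "\<dots> \<le> ennreal (\<bar>diffq q \<tau> z\<bar> * (C * ((ker1 (x, y) z + ker1 (y, x) z) + (ker1 (x, y) (snd z, fst z) + ker1 (y, x) (snd z, fst z)))))"
          by (intro ennreal_leI mult_left_mono p2 z) auto
        also have "\<dots> = ennreal C * ((ennreal (ker1 (x, y) z) * ennreal \<bar>diffq q \<tau> z\<bar> + ennreal (ker1 (y, x) z) * ennreal \<bar>diffq q \<tau> z\<bar>)
          + (ennreal (ker1 (x, y) (snd z, fst z)) * ennreal \<bar>diffq q \<tau> z\<bar> + ennreal (ker1 (y, x) (snd z, fst z)) * ennreal \<bar>diffq q \<tau> z\<bar>))"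
          using C k by (simp add: ennreal_mult ennreal_plus algebra_simps)
        finally show "ennreal (\<bar>diffq q \<tau> z\<bar> * \<bar>diffq q ?f z\<bar>) * ennreal ?t \<le> ennreal C * ((ennreal (ker1 (x, y) z) * ennreal \<bar>diffq q \<tau> z\<bar> + ennreal (ker1 (y, x) z) * ennreal \<bar>diffq q \<tau> z\<bar>)
          + (ennreal (ker1 (x, y) (snd z, fst z)) * ennreal \<bar>diffq q \<tau> z\<bar> + ennreal (ker1 (y, x) (snd z, fst z)) * ennreal \<bar>diffq q \<tau> z\<bar>))" .
      qed
      also have "\<dots> = ennreal C * ((diff_pot_semi \<tau> (x, y) + diff_pot_semi \<tau> (y, x)) + (diff_pot_semi \<tau> (x, y) + diff_pot_semi \<tau> (y, x)))"
      proof -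
        have [measurable]: "(\<lambda>z. ker1 w z) \<in> borel_measurable (\<mu> \<Otimes>\<^sub>M \<mu>)" "(\<lambda>z. ker1 w (snd z, fst z)) \<in> borel_measurable (\<mu> \<Otimes>\<^sub>M \<mu>)" for w
          unfolding ker1_def kap2_def by measurable
        show ?thesis
          by (simp add: nn_integral_cmult nn_integral_add ker1_swap_integral[OF \<tau>] diff_pot_semi_def[symmetric])
      qed
      finally show ?thesis by (simp only: mult_2)
    qed
    show "pairing \<tau> ?f * ennreal ?t \<le> ennreal C * ((diff_pot_L2 U \<tau> (x, y) + diff_pot_L2 U \<tau> (y, x)) + 2 * (diff_pot_semi \<tau> (x, y) + diff_pot_semi \<tau> (y, x)))"
    proof -
      have "pairing \<tau> ?f * ennreal ?t \<le> ennreal C * (diff_pot_L2 U \<tau> (x, y) + diff_pot_L2 U \<tau> (y, x)) + ennreal C * (2 * (diff_pot_semi \<tau> (x, y) + diff_pot_semi \<tau> (y, x)))"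
        unfolding pairing_def distrib_right by (rule add_mono[OF 1 2])
      also have "\<dots> = ennreal C * ((diff_pot_L2 U \<tau> (x, y) + diff_pot_L2 U \<tau> (y, x)) + 2 * (diff_pot_semi \<tau> (x, y) + diff_pot_semi \<tau> (y, x)))"
        by (rule distrib_left[symmetric])
      finally show ?thesis .
    qed
  qed
qed

text \<open>Here the point x is fixed, so the value part meets the kernel itself and the quotient
  part only a first difference of it, taken along the boundary.\<close>

lemma pairing_value_le:
  assumes U[measurable]: "U \<in> sets borel" and KU: "K \<subseteq> U"
    and \<tau>[measurable]: "\<tau> \<in> borel_measurable borel" and x: "x \<in> U - K"
  shows "pairing \<tau> (Phi (x, e)) \<le> val_pot_L2 U \<tau> x + ennreal (2 * (1 + p)) * val_pot_semi U \<tau> x"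
proof -
  let ?X = "(x, e)"
  have nz: "?X \<noteq> (P, 0)" "0 < dist x P" if "P \<in> K" for P using x that by auto
  have 1: "(\<integral>\<^sup>+P. ennreal (\<bar>\<tau> P\<bar> * \<bar>Phi ?X P\<bar>) \<partial>\<mu>) \<le> val_pot_L2 U \<tau> x"
    unfolding val_pot_L2_def
  proof (rule nn_integral_mono_AE, use AE_bdry_measure[of \<Omega>] in \<open>elim AE_mp, intro AE_I2 impI\<close>)
    fix P assume P: "P \<in> K"
    have "\<bar>Phi ?X P\<bar> \<le> dist x P powr - p"
      unfolding Phi_def using nz[OF P] p_pos norm_shift[of x P e] by (simp add: powr_mono2')
    also have "\<dots> = ker3 U x P" using x P KU by (auto simp: ker3_def)
    finally have "\<bar>\<tau> P\<bar> * \<bar>Phi ?X P\<bar> \<le> ker3 U x P * \<bar>\<tau> P\<bar>" by (simp add: mult.commute mult_left_mono)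
    then show "ennreal (\<bar>\<tau> P\<bar> * \<bar>Phi ?X P\<bar>) \<le> ennreal (ker3 U x P) * ennreal \<bar>\<tau> P\<bar>"
      by (subst ennreal_mult[symmetric]) (auto simp: ker3_def intro: ennreal_leI)
  qed
  have 2: "(\<integral>\<^sup>+z. ennreal (\<bar>diffq q \<tau> z\<bar> * \<bar>diffq q (Phi ?X) z\<bar>) \<partial>(\<mu> \<Otimes>\<^sub>M \<mu>)) \<le> ennreal (2 * (1 + p)) * val_pot_semi U \<tau> x"
  proof -
    have k: "0 \<le> ker4 U x u" for u by (simp add: ker4_def kap1_nonneg)
    have "(\<integral>\<^sup>+z. ennreal (\<bar>diffq q \<tau> z\<bar> * \<bar>diffq q (Phi ?X) z\<bar>) \<partial>(\<mu> \<Otimes>\<^sub>M \<mu>))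
      \<le> (\<integral>\<^sup>+z. ennreal (1 + p) * (ennreal (ker4 U x z) * ennreal \<bar>diffq q \<tau> z\<bar> + ennreal (ker4 U x (snd z, fst z)) * ennreal \<bar>diffq q \<tau> z\<bar>) \<partial>(\<mu> \<Otimes>\<^sub>M \<mu>))"
    proof (rule nn_integral_mono_AE, use AE_K_times_K in \<open>elim AE_mp, intro AE_I2 impI\<close>)
      fix z assume z: "z \<in> K \<times> K"
      obtain P Q where PQ: "z = (P, Q)" "P \<in> K" "Q \<in> K" using z by auto
      have d: "norm ((?X - (P, 0)) - (?X - (Q, 0))) = dist P Q"
        by (simp add: norm_Pair dist_norm norm_minus_commute)
      have "\<bar>Phi ?X P - Phi ?X Q\<bar> \<le> (1 + p) * (kap1 p (dist P Q) (norm (?X - (P, 0))) + kap1 p (dist P Q) (norm (?X - (Q, 0))))"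
      proof -
        have "?X - (P, 0) \<noteq> 0" "?X - (Q, 0) \<noteq> 0"
          using nz(1)[OF PQ(2)] nz(1)[OF PQ(3)] unfolding right_minus_eq by auto
        from kernel_diff1[OF this p_pos] show ?thesis unfolding d Phi_def .
      qed
      also have "\<dots> \<le> (1 + p) * (kap1 p (dist P Q) (dist x P) + kap1 p (dist P Q) (dist x Q))"
        using p_pos nz[OF PQ(2)] nz[OF PQ(3)] by (intro mult_left_mono add_mono kap1_antimono norm_shift) auto
      finally have "\<bar>Phi ?X P - Phi ?X Q\<bar> * dist P Q powr (- q / 2) \<le> (1 + p) * (kap1 p (dist P Q) (dist x P) + kap1 p (dist P Q) (dist x Q)) * dist P Q powr (- q / 2)"
        by (rule mult_right_mono) simp
      moreover have "\<bar>diffq q (Phi ?X) z\<bar> = \<bar>Phi ?X P - Phi ?X Q\<bar> * dist P Q powr (- q / 2)"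
        unfolding PQ(1) by (rule abs_diffq)
      ultimately have "\<bar>diffq q (Phi ?X) z\<bar> \<le> (1 + p) * (ker4 U x z + ker4 U x (snd z, fst z))"
        using x PQ KU by (simp add: ker4_def PQ(1) dist_commute[of Q P] algebra_simps subset_iff)
      then have "\<bar>diffq q \<tau> z\<bar> * \<bar>diffq q (Phi ?X) z\<bar> \<le> \<bar>diffq q \<tau> z\<bar> * ((1 + p) * (ker4 U x z + ker4 U x (snd z, fst z)))"
        by (rule mult_left_mono) simp
      then have "ennreal (\<bar>diffq q \<tau> z\<bar> * \<bar>diffq q (Phi ?X) z\<bar>) \<le> ennreal (\<bar>diffq q \<tau> z\<bar> * ((1 + p) * (ker4 U x z + ker4 U x (snd z, fst z))))"
        by (rule ennreal_leI)
      also have "\<dots> = ennreal (1 + p) * (ennreal (ker4 U x z) * ennreal \<bar>diffq q \<tau> z\<bar> + ennreal (ker4 U x (snd z, fst z)) * ennreal \<bar>diffq q \<tau> z\<bar>)"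
      proof -
        have *: "ennreal (d * (r * (a + b))) = ennreal r * (ennreal a * ennreal d + ennreal b * ennreal d)"
          if "0 \<le> d" "0 \<le> r" "0 \<le> a" "0 \<le> b" for d r a b
          using that by (simp add: ennreal_mult algebra_simps)
        show ?thesis using p_pos k by (intro *) auto
      qed
      finally show "ennreal (\<bar>diffq q \<tau> z\<bar> * \<bar>diffq q (Phi ?X) z\<bar>) \<le> ennreal (1 + p) * (ennreal (ker4 U x z) * ennreal \<bar>diffq q \<tau> z\<bar> + ennreal (ker4 U x (snd z, fst z)) * ennreal \<bar>diffq q \<tau> z\<bar>)" .
    qed
    also have "\<dots> = ennreal (1 + p) * (val_pot_semi U \<tau> x + val_pot_semi U \<tau> x)"
    proof -
      have [measurable]: "(\<lambda>z. ker4 U x z) \<in> borel_measurable (\<mu> \<Otimes>\<^sub>M \<mu>)" "(\<lambda>z. ker4 U x (snd z, fst z)) \<in> borel_measurable (\<mu> \<Otimes>\<^sub>M \<mu>)"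
        unfolding ker4_def kap1_def by measurable
      show ?thesis
        by (simp add: nn_integral_cmult nn_integral_add ker4_swap_integral[OF \<tau> U] val_pot_semi_def[symmetric])
    qed
    also have "\<dots> = ennreal (2 * (1 + p)) * val_pot_semi U \<tau> x"
    proof -
      have "ennreal (2 * (1 + p)) = 2 * ennreal (1 + p)"
        using ennreal_mult[of 2 "1 + p"] p_pos by simp
      then show ?thesis by (simp only: distrib_left distrib_right mult_2)
    qed
    finally show ?thesis .
  qed
  show ?thesis unfolding pairing_def by (rule add_mono[OF 1 2])
qed

text \<open>One pair of majorants covers every height e and serves two purposes: at e = 0 it bounds
  the H^s norm of the potential on U, and along e tending to 0 it is the dominating function that
  makes the lifted potentials converge. The constant is fixed before T, so the bound is uniform in
  the functional.\<close>

lemma potential_domination: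
  assumes U[measurable]: "U \<in> sets borel" and KU: "K \<subseteq> U" and R: "0 < R" "\<And>x P. x \<in> U \<Longrightarrow> P \<in> U \<Longrightarrow> dist x P \<le> R"
  obtains C where "C < \<infinity>" "\<And>T N.
    (\<And>f g a b. f \<in> espace \<mu> q \<Longrightarrow> g \<in> espace \<mu> q \<Longrightarrow> T (\<lambda>x. a * f x + b * g x) = a * T f + b * T g) \<Longrightarrow>
    (\<And>f. f \<in> espace \<mu> q \<Longrightarrow> \<bar>T f\<bar> \<le> N * sqrt (enn2real (energy \<mu> q f))) \<Longrightarrow> 0 \<le> N \<Longrightarrow>
    \<exists>H0 H. H0 \<in> borel_measurable lborel \<and> H \<in> borel_measurable (lborel \<Otimes>\<^sub>M lborel) \<and>
      (\<integral>\<^sup>+x. H0 x \<partial>lborel) \<le> C * ennreal (N\<^sup>2) \<and> (\<integral>\<^sup>+w. H w \<partial>(lborel \<Otimes>\<^sub>M lborel)) \<le> C * ennreal (N\<^sup>2) \<and>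
      (\<forall>x y e. x \<in> U - K \<longrightarrow> y \<in> U - K \<longrightarrow> ennreal ((T (Phi (x, e)))\<^sup>2) \<le> H0 x \<and>
        ennreal ((T (Phi (x, e)) - T (Phi (y, e)))\<^sup>2 / dist x y powr (real DIM('a) + 2 * s)) \<le> H (x, y))"
proof -
  obtain c1 where c1: "c1 < \<infinity>" "\<And>G. G \<in> borel_measurable (\<mu> \<Otimes>\<^sub>M \<mu>) \<Longrightarrow>
    (\<integral>\<^sup>+w. (\<integral>\<^sup>+z. ennreal (ker1 w z) * G z \<partial>(\<mu> \<Otimes>\<^sub>M \<mu>))\<^sup>2 \<partial>((lborel :: 'a measure) \<Otimes>\<^sub>M lborel)) \<le> c1 * (\<integral>\<^sup>+z. (G z)\<^sup>2 \<partial>(\<mu> \<Otimes>\<^sub>M \<mu>))"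
    by (rule schur_ker1) blast
  obtain c2 where c2: "c2 < \<infinity>" "\<And>G. G \<in> borel_measurable \<mu> \<Longrightarrow>
    (\<integral>\<^sup>+w. (\<integral>\<^sup>+P. ennreal (ker2 U w P) * G P \<partial>\<mu>)\<^sup>2 \<partial>((lborel :: 'a measure) \<Otimes>\<^sub>M lborel)) \<le> c2 * (\<integral>\<^sup>+P. (G P)\<^sup>2 \<partial>\<mu>)"
    by (rule schur_ker2[OF U R]) blast+
  obtain c3 where c3: "c3 < \<infinity>" "\<And>G. G \<in> borel_measurable \<mu> \<Longrightarrow>
    (\<integral>\<^sup>+x. (\<integral>\<^sup>+P. ennreal (ker3 U x P) * G P \<partial>\<mu>)\<^sup>2 \<partial>(lborel :: 'a measure)) \<le> c3 * (\<integral>\<^sup>+P. (G P)\<^sup>2 \<partial>\<mu>)"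
    by (rule schur_ker3[OF U R]) blast+
  obtain c4 where c4: "c4 < \<infinity>" "\<And>G. G \<in> borel_measurable (\<mu> \<Otimes>\<^sub>M \<mu>) \<Longrightarrow>
    (\<integral>\<^sup>+x. (\<integral>\<^sup>+z. ennreal (ker4 U x z) * G z \<partial>(\<mu> \<Otimes>\<^sub>M \<mu>))\<^sup>2 \<partial>(lborel :: 'a measure)) \<le> c4 * (\<integral>\<^sup>+z. (G z)\<^sup>2 \<partial>(\<mu> \<Otimes>\<^sub>M \<mu>))"
    by (rule schur_ker4[OF U R]) blast+
  obtain Cp where Cp: "0 < Cp" "\<And>\<tau> x y e. \<tau> \<in> borel_measurable borel \<Longrightarrow> x \<in> U - K \<Longrightarrow> y \<in> U - K \<Longrightarrow>
    pairing \<tau> (\<lambda>P. Phi (x, e) P - Phi (y, e) P) * ennreal (dist x y powr (- real DIM('a) / 2 - s))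
      \<le> ennreal Cp * ((diff_pot_L2 U \<tau> (x, y) + diff_pot_L2 U \<tau> (y, x)) + 2 * (diff_pot_semi \<tau> (x, y) + diff_pot_semi \<tau> (y, x)))"
    by (rule pairing_difference_le[OF U KU]) blast
  define c0 where "c0 = ennreal (2 * (1 + p))"
  \<comment> \<open>Squaring a + a' + 2 (b + b') gives at most 4 a^2 + 4 a'^2 + 16 b^2 + 16 b'^2,
    and swapped terms have the same bound, whence 8 and 32; the second bracket comes from squaring
    the majorant of the values.\<close>
  define D where "D = (ennreal Cp)\<^sup>2 * (8 * c2 + 32 * c1) + (2 * c3 + 2 * c0\<^sup>2 * c4)"
  show thesis
  proof (rule that[of D])
    show "D < \<infinity>" using c1(1) c2(1) c3(1) c4(1)
      by (auto simp: D_def c0_def ennreal_mult_less_top power2_eq_square)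
    fix T N
    assume lin: "\<And>f g a b. f \<in> espace \<mu> q \<Longrightarrow> g \<in> espace \<mu> q \<Longrightarrow> T (\<lambda>x. a * f x + b * g x) = a * T f + b * T g"
      and bd: "\<And>f. f \<in> espace \<mu> q \<Longrightarrow> \<bar>T f\<bar> \<le> N * sqrt (enn2real (energy \<mu> q f))" and N: "0 \<le> N"
    obtain \<tau> where \<tau>: "\<tau> \<in> espace \<mu> q" "energy \<mu> q \<tau> \<le> ennreal (N\<^sup>2)" "\<And>f. f \<in> espace \<mu> q \<Longrightarrow> ennreal \<bar>T f\<bar> \<le> pairing \<tau> f"
      unfolding pairing_def
      by (rule riesz_energy[OF sets_bdry_measure fm.sigma_finite_measure_axioms, of q T N]) (use lin bd N in blast)+
    have m[measurable]: "\<tau> \<in> borel_measurable borel" using \<tau>(1) by (simp add: espace_def)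
    let ?t2 = "\<integral>\<^sup>+P. ennreal ((\<tau> P)\<^sup>2) \<partial>\<mu>" and ?d2 = "\<integral>\<^sup>+z. ennreal ((diffq q \<tau> z)\<^sup>2) \<partial>(\<mu> \<Otimes>\<^sub>M \<mu>)"
    have t2: "?t2 \<le> ennreal (N\<^sup>2)" by (rule order_trans[OF _ \<tau>(2)]) (simp add: energy_def)
    have d2: "?d2 \<le> ennreal (N\<^sup>2)" by (rule order_trans[OF _ \<tau>(2)]) (simp add: energy_def)
    have sqr: "(ennreal \<bar>r\<bar>)\<^sup>2 = ennreal (r\<^sup>2)" for r by (simp add: ennreal_power)
    have A: "(\<integral>\<^sup>+w. (diff_pot_L2 U \<tau> w)\<^sup>2 \<partial>(lborel \<Otimes>\<^sub>M lborel)) \<le> c2 * ennreal (N\<^sup>2)"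
      unfolding diff_pot_L2_def by (rule order_trans[OF c2(2)]) (auto simp: sqr intro!: mult_left_mono t2)
    have B: "(\<integral>\<^sup>+w. (diff_pot_semi \<tau> w)\<^sup>2 \<partial>(lborel \<Otimes>\<^sub>M lborel)) \<le> c1 * ennreal (N\<^sup>2)"
      unfolding diff_pot_semi_def by (rule order_trans[OF c1(2)]) (auto simp: sqr intro!: mult_left_mono d2)
    have A0: "(\<integral>\<^sup>+x. (val_pot_L2 U \<tau> x)\<^sup>2 \<partial>lborel) \<le> c3 * ennreal (N\<^sup>2)"
      unfolding val_pot_L2_def by (rule order_trans[OF c3(2)]) (auto simp: sqr intro!: mult_left_mono t2)
    have B0: "(\<integral>\<^sup>+x. (val_pot_semi U \<tau> x)\<^sup>2 \<partial>lborel) \<le> c4 * ennreal (N\<^sup>2)"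
      unfolding val_pot_semi_def by (rule order_trans[OF c4(2)]) (auto simp: sqr intro!: mult_left_mono d2)
    have A': "(\<integral>\<^sup>+w. (diff_pot_L2 U \<tau> (snd w, fst w))\<^sup>2 \<partial>(lborel \<Otimes>\<^sub>M lborel)) \<le> c2 * ennreal (N\<^sup>2)"
      using A by (subst nn_integral_pair_swap[of lborel "\<lambda>w. (diff_pot_L2 U \<tau> w)\<^sup>2"]) (auto simp: sigma_finite_lborel)
    have B': "(\<integral>\<^sup>+w. (diff_pot_semi \<tau> (snd w, fst w))\<^sup>2 \<partial>(lborel \<Otimes>\<^sub>M lborel)) \<le> c1 * ennreal (N\<^sup>2)"
      using B by (subst nn_integral_pair_swap[of lborel "\<lambda>w. (diff_pot_semi \<tau> w)\<^sup>2"]) (auto simp: sigma_finite_lborel)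
    define S where "S w = (diff_pot_L2 U \<tau> w + diff_pot_L2 U \<tau> (snd w, fst w)) + 2 * (diff_pot_semi \<tau> w + diff_pot_semi \<tau> (snd w, fst w))" for w
    define H where "H w = (ennreal Cp * S w)\<^sup>2" for w
    define H0 where "H0 x = (val_pot_L2 U \<tau> x + c0 * val_pot_semi U \<tau> x)\<^sup>2" for x
    have H0m: "H0 \<in> borel_measurable lborel" unfolding H0_def by measurable
    have Hm: "H \<in> borel_measurable (lborel \<Otimes>\<^sub>M lborel)" unfolding H_def S_def by measurable
    have iH0: "(\<integral>\<^sup>+x. H0 x \<partial>lborel) \<le> D * ennreal (N\<^sup>2)"
    proof -
      have "(\<integral>\<^sup>+x. H0 x \<partial>lborel) \<le> (\<integral>\<^sup>+x. 2 * (val_pot_L2 U \<tau> x)\<^sup>2 + (2 * c0\<^sup>2) * (val_pot_semi U \<tau> x)\<^sup>2 \<partial>lborel)"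
        unfolding H0_def
        using ennreal_sum_square_2[of "val_pot_L2 U \<tau> x" "c0 * val_pot_semi U \<tau> x" for x]
        by (intro nn_integral_mono) (simp add: power_mult_distrib mult.assoc)
      also have "\<dots> = 2 * (\<integral>\<^sup>+x. (val_pot_L2 U \<tau> x)\<^sup>2 \<partial>lborel) + (2 * c0\<^sup>2) * (\<integral>\<^sup>+x. (val_pot_semi U \<tau> x)\<^sup>2 \<partial>lborel)"
        by (simp add: nn_integral_add nn_integral_cmult)
      also have "\<dots> \<le> 2 * (c3 * ennreal (N\<^sup>2)) + (2 * c0\<^sup>2) * (c4 * ennreal (N\<^sup>2))"
        by (intro add_mono mult_left_mono A0 B0) auto
      also have "\<dots> = (2 * c3 + 2 * c0\<^sup>2 * c4) * ennreal (N\<^sup>2)" by (simp add: distrib_right mult.assoc)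
      also have "\<dots> \<le> D * ennreal (N\<^sup>2)" unfolding D_def by (intro mult_right_mono) auto
      finally show ?thesis .
    qed
    have iH: "(\<integral>\<^sup>+w. H w \<partial>(lborel \<Otimes>\<^sub>M lborel)) \<le> D * ennreal (N\<^sup>2)"
    proof -
      have Sb: "(S w)\<^sup>2 \<le> (4 * (diff_pot_L2 U \<tau> w)\<^sup>2 + 4 * (diff_pot_L2 U \<tau> (snd w, fst w))\<^sup>2) + (16 * (diff_pot_semi \<tau> w)\<^sup>2 + 16 * (diff_pot_semi \<tau> (snd w, fst w))\<^sup>2)" for w
      proof -
        let ?a = "diff_pot_L2 U \<tau> w" and ?a' = "diff_pot_L2 U \<tau> (snd w, fst w)" and ?b = "diff_pot_semi \<tau> w" and ?b' = "diff_pot_semi \<tau> (snd w, fst w)"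
        have "(S w)\<^sup>2 \<le> 2 * (?a + ?a')\<^sup>2 + 2 * (2 * (?b + ?b'))\<^sup>2" unfolding S_def by (rule ennreal_sum_square_2)
        also have "\<dots> = 2 * (?a + ?a')\<^sup>2 + 8 * (?b + ?b')\<^sup>2"
        proof -
          have "2 * (2 * z)\<^sup>2 = 8 * z\<^sup>2" for z :: ennreal by (simp add: power_mult_distrib mult.assoc[symmetric])
          then show ?thesis by (simp only:)
        qed
        also have "\<dots> \<le> 2 * (2 * ?a\<^sup>2 + 2 * ?a'\<^sup>2) + 8 * (2 * ?b\<^sup>2 + 2 * ?b'\<^sup>2)"
          by (intro add_mono mult_left_mono ennreal_sum_square_2) auto
        finally show ?thesis by (simp add: distrib_left mult.assoc[symmetric])
      qed
      have "(\<integral>\<^sup>+w. H w \<partial>(lborel \<Otimes>\<^sub>M lborel)) \<le> (\<integral>\<^sup>+w. (ennreal Cp)\<^sup>2 * ((4 * (diff_pot_L2 U \<tau> w)\<^sup>2 + 4 * (diff_pot_L2 U \<tau> (snd w, fst w))\<^sup>2) + (16 * (diff_pot_semi \<tau> w)\<^sup>2 + 16 * (diff_pot_semi \<tau> (snd w, fst w))\<^sup>2)) \<partial>(lborel \<Otimes>\<^sub>M lborel))"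
        unfolding H_def power_mult_distrib by (intro nn_integral_mono mult_left_mono Sb) auto
      also have "\<dots> = (ennreal Cp)\<^sup>2 * ((4 * (\<integral>\<^sup>+w. (diff_pot_L2 U \<tau> w)\<^sup>2 \<partial>(lborel \<Otimes>\<^sub>M lborel)) + 4 * (\<integral>\<^sup>+w. (diff_pot_L2 U \<tau> (snd w, fst w))\<^sup>2 \<partial>(lborel \<Otimes>\<^sub>M lborel)))
         + (16 * (\<integral>\<^sup>+w. (diff_pot_semi \<tau> w)\<^sup>2 \<partial>(lborel \<Otimes>\<^sub>M lborel)) + 16 * (\<integral>\<^sup>+w. (diff_pot_semi \<tau> (snd w, fst w))\<^sup>2 \<partial>(lborel \<Otimes>\<^sub>M lborel))))"
        by (simp add: nn_integral_add nn_integral_cmult)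
      also have "\<dots> \<le> (ennreal Cp)\<^sup>2 * ((4 * (c2 * ennreal (N\<^sup>2)) + 4 * (c2 * ennreal (N\<^sup>2))) + (16 * (c1 * ennreal (N\<^sup>2)) + 16 * (c1 * ennreal (N\<^sup>2))))"
        by (intro mult_left_mono add_mono A A' B B') auto
      also have "\<dots> = (ennreal Cp)\<^sup>2 * (8 * c2 + 32 * c1) * ennreal (N\<^sup>2)"
      proof -
        have "4 * (c2 * x) + 4 * (c2 * x) = 8 * c2 * x" "16 * (c1 * x) + 16 * (c1 * x) = 32 * c1 * x" for x :: ennreal
          by (simp_all add: mult.assoc[symmetric] distrib_right[symmetric])
        then show ?thesis by (simp only: distrib_right mult.assoc)
      qed
      also have "\<dots> \<le> D * ennreal (N\<^sup>2)" unfolding D_def by (intro mult_right_mono) auto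
      finally show ?thesis .
    qed
    have pt: "ennreal ((T (Phi (x, e)))\<^sup>2) \<le> H0 x \<and>
        ennreal ((T (Phi (x, e)) - T (Phi (y, e)))\<^sup>2 / dist x y powr (real DIM('a) + 2 * s)) \<le> H (x, y)"
      if x: "x \<in> U - K" and y: "y \<in> U - K" for x y e
    proof
      have sp: "Phi (x, e) \<in> espace \<mu> q" "Phi (y, e) \<in> espace \<mu> q" using x y by (auto intro!: Phi_espace)
      have "ennreal \<bar>T (Phi (x, e))\<bar> \<le> val_pot_L2 U \<tau> x + c0 * val_pot_semi U \<tau> x"
        using \<tau>(3)[OF sp(1)] pairing_value_le[OF U KU m x, of e] unfolding c0_def by (rule order_trans)
      then have "(ennreal \<bar>T (Phi (x, e))\<bar>)\<^sup>2 \<le> H0 x" unfolding H0_def by (rule power_mono) simp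
      then show "ennreal ((T (Phi (x, e)))\<^sup>2) \<le> H0 x" by (simp only: sqr)
      let ?f = "\<lambda>P. Phi (x, e) P - Phi (y, e) P"
      let ?t = "dist x y powr (- real DIM('a) / 2 - s)"
      have fe: "?f = (\<lambda>P. 1 * Phi (x, e) P + (-1) * Phi (y, e) P)" by simp
      have f: "?f \<in> espace \<mu> q" unfolding fe by (rule espace_lin[OF sets_bdry_measure fm.sigma_finite_measure_axioms sp])
      have Tf: "T ?f = T (Phi (x, e)) - T (Phi (y, e))" unfolding fe lin[OF sp] by simp
      have "ennreal \<bar>T ?f\<bar> * ennreal ?t \<le> pairing \<tau> ?f * ennreal ?t" by (intro mult_right_mono \<tau>(3) f) auto
      also have "\<dots> \<le> ennreal Cp * S (x, y)" unfolding S_def fst_conv snd_conv by (rule Cp(2)[OF m x y])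
      finally have "(ennreal \<bar>T ?f\<bar> * ennreal ?t)\<^sup>2 \<le> H (x, y)" unfolding H_def by (rule power_mono) simp
      moreover have "(ennreal \<bar>T ?f\<bar> * ennreal ?t)\<^sup>2 = ennreal ((T ?f)\<^sup>2 * ?t\<^sup>2)"
        by (simp add: power_mult_distrib ennreal_power ennreal_mult)
      moreover have "?t\<^sup>2 = inverse (dist x y powr (real DIM('a) + 2 * s))"
      proof -
        have "?t\<^sup>2 = dist x y powr (- (real DIM('a) + 2 * s))"
          by (simp add: power2_eq_square powr_add[symmetric])
        then show ?thesis by (simp only: powr_minus)
      qed
      ultimately show "ennreal ((T (Phi (x, e)) - T (Phi (y, e)))\<^sup>2 / dist x y powr (real DIM('a) + 2 * s)) \<le> H (x, y)"
        unfolding Tf divide_inverse by simp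
    qed
    show "\<exists>H0 H. H0 \<in> borel_measurable lborel \<and> H \<in> borel_measurable (lborel \<Otimes>\<^sub>M lborel) \<and>
      (\<integral>\<^sup>+x. H0 x \<partial>lborel) \<le> D * ennreal (N\<^sup>2) \<and> (\<integral>\<^sup>+w. H w \<partial>(lborel \<Otimes>\<^sub>M lborel)) \<le> D * ennreal (N\<^sup>2) \<and>
      (\<forall>x y e. x \<in> U - K \<longrightarrow> y \<in> U - K \<longrightarrow> ennreal ((T (Phi (x, e)))\<^sup>2) \<le> H0 x \<and>
        ennreal ((T (Phi (x, e)) - T (Phi (y, e)))\<^sup>2 / dist x y powr (real DIM('a) + 2 * s)) \<le> H (x, y))"
      by (intro exI[of _ H0] exI[of _ H] conjI H0m Hm iH0 iH allI impI pt)
  qed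
qed

section \<open>Translation between the energy space and the boundary Sobolev space\<close>

lemma bdry_energy:
  assumes f[measurable]: "f \<in> borel_measurable borel"
  shows "bdry_L2sq \<Omega> f + bdry_semi \<Omega> (s - 1/2) f = energy \<mu> q f"
proof -
  have e: "real DIM('a) - 1 + 2 * (s - 1/2) = q" by (simp add: q_def)
  have 1: "bdry_L2sq \<Omega> f = (\<integral>\<^sup>+x. ennreal ((f x)\<^sup>2) \<partial>\<mu>)"
    unfolding bdry_L2sq_def by (rule nn_integral_bdry_measure[symmetric]) measurable
  have "bdry_semi \<Omega> (s - 1/2) f = (\<integral>\<^sup>+P. \<integral>\<^sup>+Q. ennreal ((f P - f Q)\<^sup>2 / dist P Q powr q) \<partial>\<mu> \<partial>surface_measure \<Omega>)"
    unfolding bdry_semi_def e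
    by (intro nn_integral_cong nn_integral_bdry_measure[symmetric]) measurable
  also have "\<dots> = (\<integral>\<^sup>+P. \<integral>\<^sup>+Q. ennreal ((f P - f Q)\<^sup>2 / dist P Q powr q) \<partial>\<mu> \<partial>\<mu>)"
    by (rule nn_integral_bdry_measure[symmetric]) measurable
  also have "\<dots> = (\<integral>\<^sup>+P. \<integral>\<^sup>+Q. ennreal ((diffq q f (P, Q))\<^sup>2) \<partial>\<mu> \<partial>\<mu>)"
    by (simp add: diffq_squared)
  also have "\<dots> = (\<integral>\<^sup>+z. ennreal ((diffq q f z)\<^sup>2) \<partial>(\<mu> \<Otimes>\<^sub>M \<mu>))"
    by (intro fm.nn_integral_fst) measurable
  finally show ?thesis unfolding energy_def 1 by simp
qed

lemma bdry_cong:
  assumes "\<And>P. P \<in> K \<Longrightarrow> f P = g P"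
  shows "bdry_L2sq \<Omega> f = bdry_L2sq \<Omega> g" "bdry_semi \<Omega> \<alpha> f = bdry_semi \<Omega> \<alpha> g"
  unfolding bdry_L2sq_def bdry_semi_def using assms
  by (auto intro!: nn_integral_cong simp: space_surface_measure)

lemma bdry_H_norm_energy:
  assumes "f \<in> borel_measurable borel" "energy \<mu> q f < \<infinity>"
  shows "f \<in> bdry_H \<Omega> (s - 1/2)" "bdry_H_norm \<Omega> (s - 1/2) f = sqrt (enn2real (energy \<mu> q f))"
proof -
  have "bdry_L2sq \<Omega> f < \<infinity>" "bdry_semi \<Omega> (s - 1/2) f < \<infinity>"
    using assms(2) unfolding bdry_energy[OF assms(1), symmetric] by auto
  then show "f \<in> bdry_H \<Omega> (s - 1/2)" "bdry_H_norm \<Omega> (s - 1/2) f = sqrt (enn2real (energy \<mu> q f))"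
    using borel_measurable_surface_measure[OF assms(1)]
    by (auto simp: bdry_H_def bdry_H_norm_def bdry_energy[OF assms(1), symmetric] enn2real_plus)
qed

lemma espace_subset: "espace \<mu> q \<subseteq> bdry_H \<Omega> (s - 1/2)"
  using bdry_H_norm_energy(1) by (auto simp: espace_def)

lemma AE_not_frontier: "AE x in lborel. x \<notin> K"
proof -
  have "K \<in> null_sets lebesgue"
    using negligible_frontier_lipschitz_domain[OF \<Omega>] by (simp add: negligible_iff_null_sets)
  then have "K \<in> null_sets lborel" by (simp add: null_sets_completion_iff)
  then show ?thesis by (rule AE_not_in)
qed

section \<open>The trace of the single layer potential\<close>

definition dom_energy :: "'a set \<Rightarrow> ('a \<Rightarrow> real) \<Rightarrow> ennreal" where
  "dom_energy U u = dom_L2sq U u + dom_semi U s u"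

lemma dom_energy_mono: "V \<subseteq> U \<Longrightarrow> dom_energy V u \<le> dom_energy U u"
  unfolding dom_energy_def dom_L2sq_def dom_semi_def
  by (intro add_mono nn_integral_mono mult_mono) (auto simp: indicator_def intro!: nn_integral_mono)

lemma dom_energy_\<Omega>: "dom_energy \<Omega> v = (\<integral>\<^sup>+x. indicator \<Omega> x * ennreal ((v x)\<^sup>2) \<partial>lborel) + Dsemi v"
  unfolding dom_energy_def dom_L2sq_def dom_semi_def Dsemi_def gagliardo_at_def gagliardo_def
  by (simp add: nn_integral_completion mult.commute)

lemma dom_energy_cong:
  assumes "\<And>x. x \<in> U \<Longrightarrow> u x = v x"
  shows "dom_energy U u = dom_energy U v"
  unfolding dom_energy_def dom_L2sq_def dom_semi_def using assms
  by (auto intro!: nn_integral_cong arg_cong2[where f = "(+)"] simp: indicator_def)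

text \<open>The functions to be integrated are known only off the null set \<open>K\<close>.
  Replacing them by a Borel representative changes Lebesgue into Borel integrals and makes Tonelli
  applicable to the double integral.\<close>

lemma dom_energy_borel:
  assumes f0[measurable]: "f0 \<in> borel_measurable borel" and U[measurable]: "U \<in> sets borel"
    and f: "\<And>x. x \<notin> K \<Longrightarrow> f x = f0 x"
  shows "dom_L2sq U f = (\<integral>\<^sup>+x. ennreal ((f0 x)\<^sup>2) * indicator U x \<partial>lborel)"
    "dom_semi U s f = (\<integral>\<^sup>+w. ennreal ((f0 (fst w) - f0 (snd w))\<^sup>2 / dist (fst w) (snd w) powr (real DIM('a) + 2 * s)) * indicator (U \<times> U) w \<partial>(lborel \<Otimes>\<^sub>M lborel))"
proof -
  show "dom_L2sq U f = (\<integral>\<^sup>+x. ennreal ((f0 x)\<^sup>2) * indicator U x \<partial>lborel)"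
    unfolding dom_L2sq_def nn_integral_completion
    by (rule nn_integral_cong_AE, use AE_not_frontier in \<open>elim AE_mp, intro AE_I2 impI\<close>) (simp add: f)
  have "dom_semi U s f = (\<integral>\<^sup>+x. (\<integral>\<^sup>+y. ennreal ((f x - f y)\<^sup>2 / dist x y powr (real DIM('a) + 2 * s)) * indicator U y \<partial>lborel) * indicator U x \<partial>lborel)"
    unfolding dom_semi_def nn_integral_completion ..
  also have "\<dots> = (\<integral>\<^sup>+x. (\<integral>\<^sup>+y. ennreal ((f0 x - f0 y)\<^sup>2 / dist x y powr (real DIM('a) + 2 * s)) * indicator U y \<partial>lborel) * indicator U x \<partial>lborel)"
  proof (rule nn_integral_cong_AE, use AE_not_frontier in \<open>elim AE_mp, intro AE_I2 impI\<close>)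
    fix x assume x: "x \<notin> K"
    have "(\<integral>\<^sup>+y. ennreal ((f x - f y)\<^sup>2 / dist x y powr (real DIM('a) + 2 * s)) * indicator U y \<partial>lborel)
      = (\<integral>\<^sup>+y. ennreal ((f0 x - f0 y)\<^sup>2 / dist x y powr (real DIM('a) + 2 * s)) * indicator U y \<partial>lborel)"
      by (rule nn_integral_cong_AE, use AE_not_frontier in \<open>elim AE_mp, intro AE_I2 impI\<close>) (simp add: f x)
    then show "(\<integral>\<^sup>+y. ennreal ((f x - f y)\<^sup>2 / dist x y powr (real DIM('a) + 2 * s)) * indicator U y \<partial>lborel) * indicator U x
      = (\<integral>\<^sup>+y. ennreal ((f0 x - f0 y)\<^sup>2 / dist x y powr (real DIM('a) + 2 * s)) * indicator U y \<partial>lborel) * indicator U x"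
      by simp
  qed
  also have "\<dots> = (\<integral>\<^sup>+x. \<integral>\<^sup>+y. ennreal ((f0 x - f0 y)\<^sup>2 / dist x y powr (real DIM('a) + 2 * s)) * indicator (U \<times> U) (x, y) \<partial>lborel \<partial>lborel)"
    by (intro nn_integral_cong) (auto simp: indicator_def nn_integral_0_iff_AE)
  also have "\<dots> = (\<integral>\<^sup>+w. ennreal ((f0 (fst w) - f0 (snd w))\<^sup>2 / dist (fst w) (snd w) powr (real DIM('a) + 2 * s)) * indicator (U \<times> U) w \<partial>(lborel \<Otimes>\<^sub>M lborel))"
    by (subst lborel.nn_integral_fst[symmetric]) auto
  finally show "dom_semi U s f = \<dots>" .
qed

lemma dom_energy_add_le:
  assumes [measurable]: "f \<in> borel_measurable borel" "g \<in> borel_measurable borel"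
  shows "dom_energy \<Omega> (\<lambda>x. f x + g x) \<le> 2 * dom_energy \<Omega> f + 2 * dom_energy \<Omega> g"
proof -
  have [measurable]: "\<Omega> \<times> \<Omega> \<in> sets (lborel \<Otimes>\<^sub>M lborel)" by measurable
  let ?I = "\<lambda>f. \<integral>\<^sup>+x. ennreal ((f x)\<^sup>2) * indicator \<Omega> x \<partial>lborel"
  let ?J = "\<lambda>f. \<integral>\<^sup>+w. ennreal ((f (fst w) - f (snd w))\<^sup>2 / dist (fst w) (snd w) powr (real DIM('a) + 2 * s)) * indicator (\<Omega> \<times> \<Omega>) w \<partial>(lborel \<Otimes>\<^sub>M lborel)"
  have "?I (\<lambda>x. f x + g x) \<le> (\<integral>\<^sup>+x. 2 * (ennreal ((f x)\<^sup>2) * indicator \<Omega> x) + 2 * (ennreal ((g x)\<^sup>2) * indicator \<Omega> x) \<partial>lborel)"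
  proof (rule nn_integral_mono)
    fix x
    have "ennreal ((f x + g x)\<^sup>2) \<le> ennreal (2 * (f x)\<^sup>2 + 2 * (g x)\<^sup>2)" by (intro ennreal_leI sum_square_2)
    then show "ennreal ((f x + g x)\<^sup>2) * indicator \<Omega> x \<le> 2 * (ennreal ((f x)\<^sup>2) * indicator \<Omega> x) + 2 * (ennreal ((g x)\<^sup>2) * indicator \<Omega> x)"
      by (simp add: indicator_def ennreal_mult)
  qed
  also have "\<dots> = 2 * ?I f + 2 * ?I g" by (simp add: nn_integral_add nn_integral_cmult)
  finally have I: "?I (\<lambda>x. f x + g x) \<le> 2 * ?I f + 2 * ?I g" .
  have "?J (\<lambda>x. f x + g x) \<le> (\<integral>\<^sup>+w. 2 * (ennreal ((f (fst w) - f (snd w))\<^sup>2 / dist (fst w) (snd w) powr (real DIM('a) + 2 * s)) * indicator (\<Omega> \<times> \<Omega>) w)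
     + 2 * (ennreal ((g (fst w) - g (snd w))\<^sup>2 / dist (fst w) (snd w) powr (real DIM('a) + 2 * s)) * indicator (\<Omega> \<times> \<Omega>) w) \<partial>(lborel \<Otimes>\<^sub>M lborel))"
  proof (rule nn_integral_mono)
    fix w :: "'a \<times> 'a"
    let ?t = "dist (fst w) (snd w) powr (real DIM('a) + 2 * s)" and ?a = "f (fst w) - f (snd w)" and ?b = "g (fst w) - g (snd w)"
    have "((f (fst w) + g (fst w)) - (f (snd w) + g (snd w)))\<^sup>2 = (?a + ?b)\<^sup>2" by (simp add: algebra_simps)
    also have "\<dots> \<le> 2 * ?a\<^sup>2 + 2 * ?b\<^sup>2" by (rule sum_square_2)
    finally have "((f (fst w) + g (fst w)) - (f (snd w) + g (snd w)))\<^sup>2 / ?t \<le> (2 * ?a\<^sup>2 + 2 * ?b\<^sup>2) / ?t"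
      by (rule divide_right_mono) simp
    also have "\<dots> = 2 * (?a\<^sup>2 / ?t) + 2 * (?b\<^sup>2 / ?t)" by (simp add: add_divide_distrib)
    finally have "ennreal (((f (fst w) + g (fst w)) - (f (snd w) + g (snd w)))\<^sup>2 / ?t) \<le> ennreal (2 * (?a\<^sup>2 / ?t) + 2 * (?b\<^sup>2 / ?t))"
      by (rule ennreal_leI)
    also have "\<dots> = 2 * ennreal (?a\<^sup>2 / ?t) + 2 * ennreal (?b\<^sup>2 / ?t)"
    proof -
      have *: "ennreal (2 * a + 2 * b) = 2 * ennreal a + 2 * ennreal b" if "0 \<le> a" "0 \<le> b" for a b
        using that by (simp add: ennreal_mult)
      show ?thesis by (rule *) auto
    qed
    finally show "ennreal (((f (fst w) + g (fst w)) - (f (snd w) + g (snd w)))\<^sup>2 / ?t) * indicator (\<Omega> \<times> \<Omega>) w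
       \<le> 2 * (ennreal (?a\<^sup>2 / ?t) * indicator (\<Omega> \<times> \<Omega>) w) + 2 * (ennreal (?b\<^sup>2 / ?t) * indicator (\<Omega> \<times> \<Omega>) w)"
      by (auto simp: indicator_def)
  qed
  also have "\<dots> = 2 * ?J f + 2 * ?J g" by (simp add: nn_integral_add nn_integral_cmult)
  finally have J: "?J (\<lambda>x. f x + g x) \<le> 2 * ?J f + 2 * ?J g" .
  have b: "dom_energy \<Omega> h = ?I h + ?J h" if "h \<in> borel_measurable borel" for h
    unfolding dom_energy_def using dom_energy_borel[OF that \<Omega>_borel, of h] by simp
  have m: "(\<lambda>x. f x + g x) \<in> borel_measurable borel" by measurable
  have "dom_energy \<Omega> (\<lambda>x. f x + g x) \<le> (2 * ?I f + 2 * ?I g) + (2 * ?J f + 2 * ?J g)"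
    unfolding b[OF m] by (intro add_mono I J)
  also have "\<dots> = 2 * dom_energy \<Omega> f + 2 * dom_energy \<Omega> g"
    by (simp add: b distrib_left add_ac)
  finally show ?thesis .
qed

lemma single_layer_Phi:
  assumes T: "T \<in> bdry_Hneg \<Omega> (s - 1/2)" and x: "x \<notin> K"
  shows "single_layer s T x = riesz_const DIM('a) s * T (Phi (x, 0))"
proof -
  have sp: "Phi (x, 0) \<in> bdry_H \<Omega> (s - 1/2)" using x espace_subset by (auto intro!: Phi_espace)
  \<comment> \<open>Membership in \<open>bdry_Hneg\<close> grants linearity in the form of two-term
    combinations, so the scalar multiple is written with a second term of coefficient 0.\<close>
  have "(\<lambda>Q. riesz_kernel s (x - Q)) = (\<lambda>Q. riesz_const DIM('a) s * Phi (x, 0) Q + 0 * Phi (x, 0) Q)"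
    by (simp add: riesz_kernel_def Phi_def p_def norm_Pair)
  then have "single_layer s T x = T (\<lambda>Q. riesz_const DIM('a) s * Phi (x, 0) Q + 0 * Phi (x, 0) Q)"
    by (simp add: single_layer_def)
  also have "\<dots> = riesz_const DIM('a) s * T (Phi (x, 0)) + 0 * T (Phi (x, 0))"
    using T sp unfolding bdry_Hneg_def by blast
  finally show ?thesis by simp
qed

lemma functional_facts:
  assumes T: "T \<in> bdry_Hneg \<Omega> (s - 1/2)"
  shows "\<And>f g a b. f \<in> espace \<mu> q \<Longrightarrow> g \<in> espace \<mu> q \<Longrightarrow> T (\<lambda>x. a * f x + b * g x) = a * T f + b * T g"
    "\<And>f. f \<in> espace \<mu> q \<Longrightarrow> \<bar>T f\<bar> \<le> bdry_Hneg_norm \<Omega> (s - 1/2) T * sqrt (enn2real (energy \<mu> q f))"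
proof -
  show "T (\<lambda>x. a * f x + b * g x) = a * T f + b * T g" if "f \<in> espace \<mu> q" "g \<in> espace \<mu> q" for f g a b
    using T that espace_subset unfolding bdry_Hneg_def by blast
  show "\<bar>T f\<bar> \<le> bdry_Hneg_norm \<Omega> (s - 1/2) T * sqrt (enn2real (energy \<mu> q f))" if "f \<in> espace \<mu> q" for f
    using bdry_Hneg_bound(2)[OF T bdry_H_norm_energy(1)[of f]] bdry_H_norm_energy(2)[of f] that
    by (auto simp: espace_def)
qed

text \<open>Size and approximability are proved together, as both rest on the same
  majorants.\<close>

lemma single_layer_approximation:
  assumes U[measurable]: "U \<in> sets borel" and KU: "K \<subseteq> U" and R: "0 < R" "\<And>x P. x \<in> U \<Longrightarrow> P \<in> U \<Longrightarrow> dist x P \<le> R"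
  obtains C where "C < \<infinity>" "\<And>T. T \<in> bdry_Hneg \<Omega> (s - 1/2) \<Longrightarrow>
      dom_energy U (single_layer s T) \<le> C * ennreal ((bdry_Hneg_norm \<Omega> (s - 1/2) T)\<^sup>2)"
    "\<And>T. T \<in> bdry_Hneg \<Omega> (s - 1/2) \<Longrightarrow> \<exists>v :: nat \<Rightarrow> 'a \<Rightarrow> real.
      (\<forall>k. continuous_on UNIV (v k) \<and> (\<lambda>x. v k x - single_layer s T x) \<in> dom_H U s) \<and>
      (\<lambda>k. dom_energy U (\<lambda>x. v k x - single_layer s T x)) \<longlonglongrightarrow> 0"
proof -
  obtain C where C: "C < \<infinity>" "\<And>T N.
    (\<And>f g a b. f \<in> espace \<mu> q \<Longrightarrow> g \<in> espace \<mu> q \<Longrightarrow> T (\<lambda>x. a * f x + b * g x) = a * T f + b * T g) \<Longrightarrow>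
    (\<And>f. f \<in> espace \<mu> q \<Longrightarrow> \<bar>T f\<bar> \<le> N * sqrt (enn2real (energy \<mu> q f))) \<Longrightarrow> 0 \<le> N \<Longrightarrow>
    \<exists>H0 H. H0 \<in> borel_measurable lborel \<and> H \<in> borel_measurable (lborel \<Otimes>\<^sub>M lborel) \<and>
      (\<integral>\<^sup>+x. H0 x \<partial>lborel) \<le> C * ennreal (N\<^sup>2) \<and> (\<integral>\<^sup>+w. H w \<partial>(lborel \<Otimes>\<^sub>M lborel)) \<le> C * ennreal (N\<^sup>2) \<and>
      (\<forall>x y e. x \<in> U - K \<longrightarrow> y \<in> U - K \<longrightarrow> ennreal ((T (Phi (x, e)))\<^sup>2) \<le> H0 x \<and>
        ennreal ((T (Phi (x, e)) - T (Phi (y, e)))\<^sup>2 / dist x y powr (real DIM('a) + 2 * s)) \<le> H (x, y))"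
    by (rule potential_domination[OF U KU R]) blast+
  define rc where "rc = riesz_const DIM('a) s"
  have [measurable]: "K \<in> sets borel" by simp
  have both: "dom_energy U (single_layer s T) \<le> (2 * ennreal (rc\<^sup>2) * C) * ennreal ((bdry_Hneg_norm \<Omega> (s - 1/2) T)\<^sup>2) \<and>
     (\<exists>v :: nat \<Rightarrow> 'a \<Rightarrow> real. (\<forall>k. continuous_on UNIV (v k) \<and> (\<lambda>x. v k x - single_layer s T x) \<in> dom_H U s) \<and>
      (\<lambda>k. dom_energy U (\<lambda>x. v k x - single_layer s T x)) \<longlonglongrightarrow> 0)"
    if T: "T \<in> bdry_Hneg \<Omega> (s - 1/2)" for T
  proof -
    define N where "N = bdry_Hneg_norm \<Omega> (s - 1/2) T"
    have N: "0 \<le> N" unfolding N_def by (rule bdry_Hneg_bound(1)[OF T])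
    note F = functional_facts[OF T, folded N_def]
    obtain H0 H where H[measurable]: "H0 \<in> borel_measurable lborel" "H \<in> borel_measurable (lborel \<Otimes>\<^sub>M lborel)"
      and iH: "(\<integral>\<^sup>+x. H0 x \<partial>lborel) \<le> C * ennreal (N\<^sup>2)" "(\<integral>\<^sup>+w. H w \<partial>(lborel \<Otimes>\<^sub>M lborel)) \<le> C * ennreal (N\<^sup>2)"
      and bH: "\<And>x y e. x \<in> U - K \<Longrightarrow> y \<in> U - K \<Longrightarrow> ennreal ((T (Phi (x, e)))\<^sup>2) \<le> H0 x \<and>
        ennreal ((T (Phi (x, e)) - T (Phi (y, e)))\<^sup>2 / dist x y powr (real DIM('a) + 2 * s)) \<le> H (x, y)"
      using C(2)[OF F N] by blast
    have fin: "C * ennreal (N\<^sup>2) < \<infinity>" using C(1) by (simp add: ennreal_mult_less_top)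
    have cW: "continuous_on (- (K \<times> {0})) (\<lambda>X. T (Phi X))" by (rule functional_continuous[OF F N])
    have W_cont: "continuous_on (- K) (\<lambda>x. T (Phi (x, 0)))"
      by (rule continuous_on_compose2[OF cW]) (auto intro!: continuous_intros)
    \<comment> \<open>A Borel representative of the potential, set to 0 on the boundary, where the
      functional is applied to a kernel outside its reliable domain.\<close>
    define u0 where "u0 x = indicator (- K) x *\<^sub>R (rc * T (Phi (x, 0)))" for x
    have u0[measurable]: "u0 \<in> borel_measurable borel"
      unfolding u0_def by (intro borel_measurable_continuous_on_indicator continuous_intros W_cont) auto
    \<comment> \<open>The height 1/(k+1) is never 0, so the lifted point avoids the singular set for
      every x and v k is continuous on the whole space, across the boundary included.\<close>
    define v where "v k x = rc * T (Phi (x, 1 / real (Suc k)))" for k x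
    have v_cont: "continuous_on UNIV (v k)" for k
      unfolding v_def
      by (intro continuous_intros continuous_on_compose2[OF cW, of UNIV "\<lambda>x. (x, 1 / real (Suc k))"]) (auto intro!: continuous_intros)
    have v[measurable]: "v k \<in> borel_measurable borel" for k by (intro borel_measurable_continuous_onI v_cont)
    have u_eq: "single_layer s T x = u0 x" if "x \<notin> K" for x
      using single_layer_Phi[OF T that] that by (simp add: u0_def rc_def)
    have bL: "ennreal ((rc * T (Phi (x, e)))\<^sup>2) \<le> ennreal (rc\<^sup>2) * H0 x" if "x \<in> U - K" for x e
    proof -
      have "ennreal ((rc * T (Phi (x, e)))\<^sup>2) = ennreal (rc\<^sup>2) * ennreal ((T (Phi (x, e)))\<^sup>2)"
        by (simp add: power_mult_distrib ennreal_mult)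
      also have "\<dots> \<le> ennreal (rc\<^sup>2) * H0 x" using bH[OF that that] by (intro mult_left_mono) auto
      finally show ?thesis .
    qed
    have bS: "ennreal ((rc * T (Phi (x, e)) - rc * T (Phi (y, e)))\<^sup>2 / dist x y powr (real DIM('a) + 2 * s)) \<le> ennreal (rc\<^sup>2) * H (x, y)"
      if "x \<in> U - K" "y \<in> U - K" for x y e
    proof -
      have "(rc * T (Phi (x, e)) - rc * T (Phi (y, e)))\<^sup>2 = rc\<^sup>2 * (T (Phi (x, e)) - T (Phi (y, e)))\<^sup>2"
        by (simp add: right_diff_distrib[symmetric] power_mult_distrib)
      then have "ennreal ((rc * T (Phi (x, e)) - rc * T (Phi (y, e)))\<^sup>2 / dist x y powr (real DIM('a) + 2 * s))
        = ennreal (rc\<^sup>2) * ennreal ((T (Phi (x, e)) - T (Phi (y, e)))\<^sup>2 / dist x y powr (real DIM('a) + 2 * s))"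
        by (simp add: ennreal_mult[symmetric])
      also have "\<dots> \<le> ennreal (rc\<^sup>2) * H (x, y)" using bH[OF that] by (intro mult_left_mono) auto
      finally show ?thesis .
    qed
    have AE2: "AE w in lborel \<Otimes>\<^sub>M lborel. fst w \<notin> K \<and> snd w \<notin> K"
    proof (rule lborel_pair.AE_pair_measure)
      show "AE x in lborel. AE y in lborel. fst (x, y) \<notin> K \<and> snd (x, y) \<notin> K"
        using AE_not_frontier by (auto elim!: AE_mp)
    qed measurable
    have part1: "dom_energy U (single_layer s T) \<le> (2 * ennreal (rc\<^sup>2) * C) * ennreal (N\<^sup>2)"
    proof -
      have L0: "dom_L2sq U (single_layer s T) = (\<integral>\<^sup>+x. ennreal ((u0 x)\<^sup>2) * indicator U x \<partial>lborel)"
        by (rule dom_energy_borel(1)[OF u0 U u_eq])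
      have S0: "dom_semi U s (single_layer s T) = (\<integral>\<^sup>+w. ennreal ((u0 (fst w) - u0 (snd w))\<^sup>2 / dist (fst w) (snd w) powr (real DIM('a) + 2 * s)) * indicator (U \<times> U) w \<partial>(lborel \<Otimes>\<^sub>M lborel))"
        by (rule dom_energy_borel(2)[OF u0 U u_eq])
      have "dom_L2sq U (single_layer s T) \<le> (\<integral>\<^sup>+x. ennreal (rc\<^sup>2) * H0 x \<partial>lborel)"
        unfolding L0
        by (rule nn_integral_mono_AE, use AE_not_frontier in \<open>elim AE_mp, intro AE_I2 impI\<close>)
           (use bL in \<open>auto simp: u0_def indicator_def\<close>)
      also have "\<dots> = ennreal (rc\<^sup>2) * (\<integral>\<^sup>+x. H0 x \<partial>lborel)" by (intro nn_integral_cmult H)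
      also have "\<dots> \<le> ennreal (rc\<^sup>2) * (C * ennreal (N\<^sup>2))" by (intro mult_left_mono iH) auto
      finally have 1: "dom_L2sq U (single_layer s T) \<le> ennreal (rc\<^sup>2) * (C * ennreal (N\<^sup>2))" .
      have "dom_semi U s (single_layer s T) \<le> (\<integral>\<^sup>+w. ennreal (rc\<^sup>2) * H w \<partial>(lborel \<Otimes>\<^sub>M lborel))"
        unfolding S0
        by (rule nn_integral_mono_AE, use AE2 in \<open>elim AE_mp, intro AE_I2 impI\<close>)
           (use bS in \<open>auto simp: u0_def indicator_def\<close>)
      also have "\<dots> = ennreal (rc\<^sup>2) * (\<integral>\<^sup>+w. H w \<partial>(lborel \<Otimes>\<^sub>M lborel))" by (intro nn_integral_cmult H)
      also have "\<dots> \<le> ennreal (rc\<^sup>2) * (C * ennreal (N\<^sup>2))" by (intro mult_left_mono iH) auto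
      finally have 2: "dom_semi U s (single_layer s T) \<le> ennreal (rc\<^sup>2) * (C * ennreal (N\<^sup>2))" .
      have "dom_energy U (single_layer s T) \<le> ennreal (rc\<^sup>2) * (C * ennreal (N\<^sup>2)) + ennreal (rc\<^sup>2) * (C * ennreal (N\<^sup>2))"
        unfolding dom_energy_def by (rule add_mono[OF 1 2])
      then show ?thesis by (simp only: mult_2[symmetric] mult.assoc)
    qed
    \<comment> \<open>Cut off on the boundary, so that d k tends to 0 at every point; it agrees with
      the approximation error almost everywhere.\<close>
    define d where "d k x = indicator (- K) x * (v k x - u0 x)" for k x
    have d[measurable]: "d k \<in> borel_measurable borel" for k unfolding d_def by measurable
    have d_eq: "v k x - single_layer s T x = d k x" if "x \<notin> K" for k x using u_eq[OF that] that by (simp add: d_def)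
    have d_lim: "(\<lambda>k. d k x) \<longlonglongrightarrow> 0" for x
    proof (cases "x \<in> K")
      case False
      have X: "(x, 0) \<in> - (K \<times> {0})" using False by simp
      have opn: "open (- (K \<times> {0::real}))" by (intro open_Compl closed_Times) auto
      have "isCont (\<lambda>X. T (Phi X)) (x, 0)" using cW X opn by (simp add: continuous_on_eq_continuous_at)
      moreover have "(\<lambda>k. (x, 1 / real (Suc k))) \<longlonglongrightarrow> (x, 0)"
        by (intro tendsto_Pair tendsto_const LIMSEQ_Suc lim_1_over_n)
      ultimately have "(\<lambda>k. T (Phi (x, 1 / real (Suc k)))) \<longlonglongrightarrow> T (Phi (x, 0))"
        by (rule isCont_tendsto_compose)
      then have "(\<lambda>k. v k x - u0 x) \<longlonglongrightarrow> rc * T (Phi (x, 0)) - u0 x"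
        unfolding v_def by (intro tendsto_intros)
      then show ?thesis using False by (simp add: d_def u0_def)
    qed (simp add: d_def)
    have dL: "ennreal ((d k x)\<^sup>2) * indicator U x \<le> 4 * ennreal (rc\<^sup>2) * H0 x" for k x
    proof (cases "x \<in> U - K")
      case True
      have "ennreal ((d k x)\<^sup>2) \<le> ennreal (2 * (v k x)\<^sup>2 + 2 * (u0 x)\<^sup>2)"
        using sum_square_2[of "v k x" "- u0 x"] True by (intro ennreal_leI) (simp add: d_def)
      also have "\<dots> = 2 * ennreal ((v k x)\<^sup>2) + 2 * ennreal ((u0 x)\<^sup>2)" by (simp add: ennreal_mult)
      also have "\<dots> \<le> 2 * (ennreal (rc\<^sup>2) * H0 x) + 2 * (ennreal (rc\<^sup>2) * H0 x)"
        using True bL[OF True] by (intro add_mono mult_left_mono) (auto simp: v_def u0_def)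
      also have "\<dots> = 4 * ennreal (rc\<^sup>2) * H0 x" by (simp add: mult.assoc[symmetric] distrib_right[symmetric])
      finally show ?thesis using True by simp
    qed (auto simp: d_def indicator_def)
    have dS: "ennreal ((d k x - d k y)\<^sup>2 / dist x y powr (real DIM('a) + 2 * s)) \<le> 4 * ennreal (rc\<^sup>2) * H (x, y)"
      if x: "x \<in> U - K" and y: "y \<in> U - K" for k x y
    proof -
      let ?t = "dist x y powr (real DIM('a) + 2 * s)"
      have "(d k x - d k y)\<^sup>2 = ((v k x - v k y) + (- (u0 x - u0 y)))\<^sup>2" using x y by (simp add: d_def algebra_simps)
      also have "\<dots> \<le> 2 * (v k x - v k y)\<^sup>2 + 2 * (- (u0 x - u0 y))\<^sup>2" by (rule sum_square_2)
      finally have "(d k x - d k y)\<^sup>2 / ?t \<le> (2 * (v k x - v k y)\<^sup>2 + 2 * (u0 x - u0 y)\<^sup>2) / ?t"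
        by (intro divide_right_mono) (simp_all add: power2_commute)
      also have "\<dots> = 2 * ((v k x - v k y)\<^sup>2 / ?t) + 2 * ((u0 x - u0 y)\<^sup>2 / ?t)" by (simp add: add_divide_distrib)
      finally have "ennreal ((d k x - d k y)\<^sup>2 / ?t) \<le> ennreal (2 * ((v k x - v k y)\<^sup>2 / ?t) + 2 * ((u0 x - u0 y)\<^sup>2 / ?t))"
        by (rule ennreal_leI)
      also have "\<dots> = 2 * ennreal ((v k x - v k y)\<^sup>2 / ?t) + 2 * ennreal ((u0 x - u0 y)\<^sup>2 / ?t)"
      proof -
        have *: "ennreal (2 * a + 2 * b) = 2 * ennreal a + 2 * ennreal b" if "0 \<le> a" "0 \<le> b" for a b
          using that by (simp add: ennreal_mult)
        show ?thesis by (rule *) auto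
      qed
      also have "\<dots> \<le> 2 * (ennreal (rc\<^sup>2) * H (x, y)) + 2 * (ennreal (rc\<^sup>2) * H (x, y))"
      proof (intro add_mono mult_left_mono)
        show "ennreal ((v k x - v k y)\<^sup>2 / ?t) \<le> ennreal (rc\<^sup>2) * H (x, y)" unfolding v_def by (rule bS[OF x y])
        have "u0 x = rc * T (Phi (x, 0))" "u0 y = rc * T (Phi (y, 0))" using x y by (simp_all add: u0_def)
        then show "ennreal ((u0 x - u0 y)\<^sup>2 / ?t) \<le> ennreal (rc\<^sup>2) * H (x, y)" by (simp only: bS[OF x y])
      qed auto
      also have "\<dots> = 4 * ennreal (rc\<^sup>2) * H (x, y)" by (simp add: mult.assoc[symmetric] distrib_right[symmetric])
      finally show ?thesis .
    qed
    have big: "(\<integral>\<^sup>+x. 4 * ennreal (rc\<^sup>2) * H0 x \<partial>lborel) < \<infinity>" "(\<integral>\<^sup>+w. 4 * ennreal (rc\<^sup>2) * H w \<partial>(lborel \<Otimes>\<^sub>M lborel)) < \<infinity>"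
      using iH fin by (auto simp: nn_integral_cmult ennreal_mult_less_top intro: le_less_trans)
    have L_eq: "dom_L2sq U (\<lambda>x. v k x - single_layer s T x) = (\<integral>\<^sup>+x. ennreal ((d k x)\<^sup>2) * indicator U x \<partial>lborel)" for k
      by (rule dom_energy_borel(1)[OF d U d_eq])
    have S_eq: "dom_semi U s (\<lambda>x. v k x - single_layer s T x) = (\<integral>\<^sup>+w. ennreal ((d k (fst w) - d k (snd w))\<^sup>2 / dist (fst w) (snd w) powr (real DIM('a) + 2 * s)) * indicator (U \<times> U) w \<partial>(lborel \<Otimes>\<^sub>M lborel))" for k
      by (rule dom_energy_borel(2)[OF d U d_eq])
    have S_bd: "AE w in lborel \<Otimes>\<^sub>M lborel. ennreal ((d k (fst w) - d k (snd w))\<^sup>2 / dist (fst w) (snd w) powr (real DIM('a) + 2 * s)) * indicator (U \<times> U) w \<le> 4 * ennreal (rc\<^sup>2) * H w" for k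
      using AE2
    proof (elim AE_mp, intro AE_I2 impI)
      fix w :: "'a \<times> 'a" assume "fst w \<notin> K \<and> snd w \<notin> K"
      then show "ennreal ((d k (fst w) - d k (snd w))\<^sup>2 / dist (fst w) (snd w) powr (real DIM('a) + 2 * s)) * indicator (U \<times> U) w \<le> 4 * ennreal (rc\<^sup>2) * H w"
        using dS[of "fst w" "snd w" k] by (cases "w \<in> U \<times> U") auto
    qed
    have "(\<lambda>k. \<integral>\<^sup>+x. ennreal ((d k x)\<^sup>2) * indicator U x \<partial>lborel) \<longlonglongrightarrow> (\<integral>\<^sup>+x. 0 \<partial>(lborel :: 'a measure))"
    proof (rule nn_integral_dominated_convergence[OF _ _ _ _ big(1)])
      show "AE x in lborel. ennreal ((d j x)\<^sup>2) * indicator U x \<le> 4 * ennreal (rc\<^sup>2) * H0 x" for j using dL by auto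
      show "AE x in lborel. (\<lambda>k. ennreal ((d k x)\<^sup>2) * indicator U x) \<longlonglongrightarrow> 0"
      proof (rule AE_I2)
        fix x
        have "(\<lambda>k. ennreal ((d k x)\<^sup>2)) \<longlonglongrightarrow> ennreal (0\<^sup>2)" by (intro tendsto_ennrealI tendsto_power d_lim)
        then show "(\<lambda>k. ennreal ((d k x)\<^sup>2) * indicator U x) \<longlonglongrightarrow> 0" by (auto simp: indicator_def)
      qed
    qed measurable
    then have L_lim: "(\<lambda>k. dom_L2sq U (\<lambda>x. v k x - single_layer s T x)) \<longlonglongrightarrow> 0" unfolding L_eq by simp
    have "(\<lambda>k. \<integral>\<^sup>+w. ennreal ((d k (fst w) - d k (snd w))\<^sup>2 / dist (fst w) (snd w) powr (real DIM('a) + 2 * s)) * indicator (U \<times> U) w \<partial>(lborel \<Otimes>\<^sub>M lborel)) \<longlonglongrightarrow> (\<integral>\<^sup>+w. 0 \<partial>((lborel :: 'a measure) \<Otimes>\<^sub>M (lborel :: 'a measure)))"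
    proof (rule nn_integral_dominated_convergence[OF _ _ _ S_bd big(2)])
      show "AE w in lborel \<Otimes>\<^sub>M lborel. (\<lambda>k. ennreal ((d k (fst w) - d k (snd w))\<^sup>2 / dist (fst w) (snd w) powr (real DIM('a) + 2 * s)) * indicator (U \<times> U) w) \<longlonglongrightarrow> 0"
      proof (rule AE_I2)
        fix w :: "'a \<times> 'a"
        let ?t = "dist (fst w) (snd w) powr (real DIM('a) + 2 * s)"
        have "(\<lambda>k. (d k (fst w) - d k (snd w))\<^sup>2 * inverse ?t) \<longlonglongrightarrow> (0 - 0)\<^sup>2 * inverse ?t"
          by (intro tendsto_intros d_lim)
        then have "(\<lambda>k. ennreal ((d k (fst w) - d k (snd w))\<^sup>2 / ?t)) \<longlonglongrightarrow> ennreal 0"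
          unfolding divide_inverse by (intro tendsto_ennrealI) simp
        then show "(\<lambda>k. ennreal ((d k (fst w) - d k (snd w))\<^sup>2 / ?t) * indicator (U \<times> U) w) \<longlonglongrightarrow> 0" by (auto simp: indicator_def)
      qed
    qed measurable
    then have S_lim: "(\<lambda>k. dom_semi U s (\<lambda>x. v k x - single_layer s T x)) \<longlonglongrightarrow> 0" unfolding S_eq by simp
    have mem: "(\<lambda>x. v k x - single_layer s T x) \<in> dom_H U s" for k
    proof -
      have "dom_L2sq U (\<lambda>x. v k x - single_layer s T x) < \<infinity>"
        unfolding L_eq using big(1) dL by (intro le_less_trans[OF nn_integral_mono big(1)]) auto
      moreover have "dom_semi U s (\<lambda>x. v k x - single_layer s T x) < \<infinity>"
        unfolding S_eq using S_bd by (intro le_less_trans[OF nn_integral_mono_AE big(2)]) auto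
      \<comment> \<open>The values of the potential on the boundary are arbitrary, so measurability
        is available only for the completed measure, through agreement with d k off a null
        set.\<close>
      moreover have "(\<lambda>x. v k x - single_layer s T x) \<in> borel_measurable lebesgue"
      proof (rule borel_measurable_AE)
        show "d k \<in> borel_measurable lebesgue" using d[of k] by (intro measurable_completion) simp
        show "AE x in lebesgue. d k x = v k x - single_layer s T x"
          using AE_not_frontier by (intro AE_completion) (auto elim!: AE_mp simp: d_eq)
      qed
      ultimately show ?thesis by (auto simp: dom_H_def intro: measurable_restrict_space1)
    qed
    have lim: "(\<lambda>k. dom_energy U (\<lambda>x. v k x - single_layer s T x)) \<longlonglongrightarrow> 0"
      unfolding dom_energy_def using tendsto_add[OF L_lim S_lim] by simp
    show ?thesis using part1 v_cont mem lim unfolding N_def by blast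
  qed
  show thesis
  proof (rule that[of "2 * ennreal (rc\<^sup>2) * C"])
    show "2 * ennreal (rc\<^sup>2) * C < \<infinity>" using C(1) by (simp add: ennreal_mult_less_top)
  qed (use both in blast)+
qed

text \<open>The approximants in a trace are continuous on some ball only and uncontrolled elsewhere.
  Extension by zero from the closure of the domain makes them Borel on the whole space without
  changing anything the trace inequality sees.\<close>

definition clip :: "('a \<Rightarrow> real) \<Rightarrow> 'a \<Rightarrow> real" where
  "clip v x = indicator (closure \<Omega>) x * v x"

lemma clip_borel: "continuous_on (closure \<Omega>) v \<Longrightarrow> clip v \<in> borel_measurable borel"
  using borel_measurable_continuous_on_indicator[of "closure \<Omega>" v] by (simp add: clip_def[abs_def])

lemma clip_eq: "x \<in> closure \<Omega> \<Longrightarrow> clip v x = v x"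
  by (simp add: clip_def)

lemma \<Omega>_closure: "x \<in> \<Omega> \<Longrightarrow> x \<in> closure \<Omega>" and K_closure: "x \<in> K \<Longrightarrow> x \<in> closure \<Omega>"
  and \<Omega>_K: "x \<in> \<Omega> \<Longrightarrow> x \<notin> K"
  using open_domain closure_subset[of \<Omega>] by (auto simp: frontier_def interior_open)

text \<open>The version for differences makes approximations that are Cauchy in H^s Cauchy on the
  boundary; the version for single functions gives the final norm bound.\<close>

lemma clip_trace:
  obtains C where "0 \<le> C" "\<And>v :: 'a \<Rightarrow> real. continuous_on (closure \<Omega>) v \<Longrightarrow>
     energy \<mu> q (clip v) \<le> ennreal C * dom_energy \<Omega> v"
    "\<And>v w :: 'a \<Rightarrow> real. continuous_on (closure \<Omega>) v \<Longrightarrow> continuous_on (closure \<Omega>) w \<Longrightarrow>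
     energy \<mu> q (\<lambda>x. clip v x - clip w x) \<le> ennreal C * dom_energy \<Omega> (\<lambda>x. v x - w x)"
proof -
  obtain C where C: "0 \<le> C" "\<And>v. v \<in> borel_measurable borel \<Longrightarrow> continuous_on (closure \<Omega>) v \<Longrightarrow>
     energy \<mu> q v \<le> ennreal C * ((\<integral>\<^sup>+x. indicator \<Omega> x * ennreal ((v x)\<^sup>2) \<partial>lborel) + Dsemi v)"
    by (rule trace_inequality) blast
  have cont: "continuous_on (closure \<Omega>) (clip v)" if "continuous_on (closure \<Omega>) v" for v :: "'a \<Rightarrow> real"
    using that by (subst continuous_on_cong[OF refl clip_eq]) auto
  show thesis
  proof (rule that[OF C(1)])
    fix v :: "'a \<Rightarrow> real" assume v: "continuous_on (closure \<Omega>) v"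
    show "energy \<mu> q (clip v) \<le> ennreal C * dom_energy \<Omega> v"
      using C(2)[OF clip_borel[OF v] cont[OF v]] dom_energy_cong[of \<Omega> "clip v" v]
      unfolding dom_energy_\<Omega>[symmetric] by (simp add: clip_eq \<Omega>_closure)
    fix w :: "'a \<Rightarrow> real" assume w: "continuous_on (closure \<Omega>) w"
    have "(\<lambda>x. clip v x - clip w x) \<in> borel_measurable borel"
      by (intro borel_measurable_diff clip_borel v w)
    from C(2)[OF this] show "energy \<mu> q (\<lambda>x. clip v x - clip w x) \<le> ennreal C * dom_energy \<Omega> (\<lambda>x. v x - w x)"
      using cont[OF v] cont[OF w] dom_energy_cong[of \<Omega> "\<lambda>x. clip v x - clip w x" "\<lambda>x. v x - w x"]
      unfolding dom_energy_\<Omega>[symmetric] by (simp add: clip_eq \<Omega>_closure continuous_on_diff)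
  qed
qed

lemma single_layer_borel:
  assumes T: "T \<in> bdry_Hneg \<Omega> (s - 1/2)"
  shows "(\<lambda>x. indicator \<Omega> x * single_layer s T x) \<in> borel_measurable borel"
proof -
  have cW: "continuous_on (- (K \<times> {0})) (\<lambda>X. T (Phi X))"
    by (rule functional_continuous[OF functional_facts[OF T] bdry_Hneg_bound(1)[OF T]])
  have "continuous_on \<Omega> (\<lambda>x. riesz_const DIM('a) s * T (Phi (x, 0)))"
    by (intro continuous_intros continuous_on_compose2[OF cW, of \<Omega> "\<lambda>x. (x, 0)"])
       (auto dest: \<Omega>_K intro!: continuous_intros)
  then have "continuous_on \<Omega> (single_layer s T)"
    by (rule continuous_on_eq) (simp add: single_layer_Phi[OF T] \<Omega>_K)
  then show ?thesis using borel_measurable_continuous_on_indicator[of \<Omega> "single_layer s T"] by simp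
qed

lemma indicator_\<Omega>_borel:
  fixes v :: "'a \<Rightarrow> real"
  shows "continuous_on (closure \<Omega>) v \<Longrightarrow> (\<lambda>x. indicator \<Omega> x * v x) \<in> borel_measurable borel"
  using borel_measurable_continuous_on_indicator[of \<Omega> v] continuous_on_subset[OF _ closure_subset, of \<Omega> v] by simp

lemma dom_energy_\<Omega>_add_le:
  assumes "(\<lambda>x. indicator \<Omega> x * f x) \<in> borel_measurable borel" "(\<lambda>x. indicator \<Omega> x * g x) \<in> borel_measurable borel"
  shows "dom_energy \<Omega> (\<lambda>x. f x + g x) \<le> 2 * dom_energy \<Omega> f + 2 * dom_energy \<Omega> g"
proof -
  have "dom_energy \<Omega> (\<lambda>x. f x + g x) = dom_energy \<Omega> (\<lambda>x. indicator \<Omega> x * f x + indicator \<Omega> x * g x)"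
    by (rule dom_energy_cong) simp
  also have "\<dots> \<le> 2 * dom_energy \<Omega> (\<lambda>x. indicator \<Omega> x * f x) + 2 * dom_energy \<Omega> (\<lambda>x. indicator \<Omega> x * g x)"
    by (rule dom_energy_add_le[OF assms])
  also have "dom_energy \<Omega> (\<lambda>x. indicator \<Omega> x * f x) = dom_energy \<Omega> f" by (rule dom_energy_cong) simp
  also have "dom_energy \<Omega> (\<lambda>x. indicator \<Omega> x * g x) = dom_energy \<Omega> g" by (rule dom_energy_cong) simp
  finally show ?thesis .
qed

lemma dom_energy_uminus: "dom_energy U (\<lambda>x. - f x) = dom_energy U f"
proof -
  have "(- f x - - f y)\<^sup>2 = (f x - f y)\<^sup>2" for x y by (simp add: power2_commute)
  then show ?thesis by (simp add: dom_energy_def dom_L2sq_def dom_semi_def)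
qed

lemma dom_H_norm_energy:
  assumes "u \<in> dom_H U s"
  shows "dom_energy U u < \<infinity>" "dom_H_norm U s u = sqrt (enn2real (dom_energy U u))"
  using assms by (auto simp: dom_H_def dom_energy_def dom_H_norm_def enn2real_plus)

lemma bounded_ball:
  obtains R where "0 < R" "closure \<Omega> \<subseteq> ball 0 R"
  using bounded_domain bounded_subset_ballD[of "closure \<Omega>" 0] by (auto simp: bounded_closure)

text \<open>A fast subsequence of the lifted potentials is Cauchy in the boundary energy by the
  trace inequality, and \<open>energy_complete\<close> supplies the limit.\<close>

lemma trace_exists:
  assumes T: "T \<in> bdry_Hneg \<Omega> (s - 1/2)"
  shows "\<exists>g. is_bdry_trace \<Omega> s (single_layer s T) g"
proof -
  let ?u = "single_layer s T"
  obtain R where R: "0 < R" "closure \<Omega> \<subseteq> ball 0 R" by (rule bounded_ball)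
  define U where "U = ball (0::'a) R"
  have KU: "K \<subseteq> U" and \<Omega>U: "\<Omega> \<subseteq> U" using R K_closure \<Omega>_closure by (auto simp: U_def)
  have dU: "dist x P \<le> 2 * R" if "x \<in> U" "P \<in> U" for x P
    using that dist_triangle[of x P 0] by (auto simp: U_def dist_commute)
  have U_borel: "U \<in> sets borel" by (simp add: U_def)
  have R2: "0 < 2 * R" using R(1) by simp
  obtain v :: "nat \<Rightarrow> 'a \<Rightarrow> real" where v: "\<And>k. continuous_on UNIV (v k)" "\<And>k. (\<lambda>x. v k x - ?u x) \<in> dom_H U s"
    and lim: "(\<lambda>k. dom_energy U (\<lambda>x. v k x - ?u x)) \<longlonglongrightarrow> 0"
  proof (rule single_layer_approximation[OF U_borel KU R2 dU])
    fix C assume C: "C < \<infinity>" "\<And>T. T \<in> bdry_Hneg \<Omega> (s - 1/2) \<Longrightarrow>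
      dom_energy U (single_layer s T) \<le> C * ennreal ((bdry_Hneg_norm \<Omega> (s - 1/2) T)\<^sup>2)"
      "\<And>T. T \<in> bdry_Hneg \<Omega> (s - 1/2) \<Longrightarrow> \<exists>v :: nat \<Rightarrow> 'a \<Rightarrow> real.
        (\<forall>k. continuous_on UNIV (v k) \<and> (\<lambda>x. v k x - single_layer s T x) \<in> dom_H U s) \<and>
        (\<lambda>k. dom_energy U (\<lambda>x. v k x - single_layer s T x)) \<longlonglongrightarrow> 0"
    show thesis using C(3)[OF T] that by blast
  qed
  obtain Ct where Ct: "0 \<le> Ct" "\<And>v w :: 'a \<Rightarrow> real. continuous_on (closure \<Omega>) v \<Longrightarrow> continuous_on (closure \<Omega>) w \<Longrightarrow>
     energy \<mu> q (\<lambda>x. clip v x - clip w x) \<le> ennreal Ct * dom_energy \<Omega> (\<lambda>x. v x - w x)"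
    by (rule clip_trace) blast
  \<comment> \<open>Comparing two approximants through the potential costs a factor 4 and the trace
    inequality a factor \<open>Ct\<close>; this choice brings the product below (1/4)^i. The summand
    1 guards against \<open>Ct = 0\<close>.\<close>
  define \<delta> :: "nat \<Rightarrow> real" where "\<delta> i = (1/4) ^ i / (4 * (Ct + 1))" for i
  have \<delta>: "0 < \<delta> i" "Ct * (4 * \<delta> i) \<le> (1/4) ^ i" for i
  proof -
    show "0 < \<delta> i" using Ct(1) by (simp add: \<delta>_def)
    have "Ct / (Ct + 1) * (1/4) ^ i \<le> 1 * (1/4) ^ i" using Ct(1) by (intro mult_right_mono) auto
    moreover have "Ct * (4 * \<delta> i) = Ct / (Ct + 1) * (1/4) ^ i"
      by (simp only: \<delta>_def times_divide_eq_left times_divide_eq_right mult_divide_mult_cancel_left[of 4] mult.left_commute[of Ct 4])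
    ultimately show "Ct * (4 * \<delta> i) \<le> (1/4) ^ i" by simp
  qed
  have \<delta>_mono: "\<delta> j \<le> \<delta> i" if "i \<le> j" for i j
    unfolding \<delta>_def using that Ct(1) by (intro divide_right_mono power_decreasing) auto
  have "\<exists>k. dom_energy U (\<lambda>x. v k x - ?u x) \<le> ennreal (\<delta> i)" for i
  proof -
    have "eventually (\<lambda>k. dom_energy U (\<lambda>x. v k x - ?u x) < ennreal (\<delta> i)) sequentially"
      using \<delta>(1)[of i] by (intro order_tendstoD[OF lim]) simp
    then show ?thesis by (auto simp: eventually_sequentially intro: less_imp_le)
  qed
  then obtain \<kappa> where \<kappa>: "\<And>i. dom_energy U (\<lambda>x. v (\<kappa> i) x - ?u x) \<le> ennreal (\<delta> i)" by metis
  have vc: "continuous_on S (v k)" for S k using v(1) by (rule continuous_on_subset) simp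
  define F where "F i = clip (v (\<kappa> i))" for i
  have F: "F i \<in> borel_measurable borel" for i unfolding F_def by (intro clip_borel vc)
  have meas: "(\<lambda>x. indicator \<Omega> x * (v k x - ?u x)) \<in> borel_measurable borel" for k
    using borel_measurable_diff[OF indicator_\<Omega>_borel[OF vc] single_layer_borel[OF T]] by (simp add: right_diff_distrib)
  have fast: "energy \<mu> q (\<lambda>x. F i x - F j x) \<le> ennreal ((1/4) ^ i)" if ij: "i \<le> j" for i j
  proof -
    have "energy \<mu> q (\<lambda>x. F i x - F j x) \<le> ennreal Ct * dom_energy \<Omega> (\<lambda>x. v (\<kappa> i) x - v (\<kappa> j) x)"
      unfolding F_def by (intro Ct vc)
    also have "(\<lambda>x. v (\<kappa> i) x - v (\<kappa> j) x) = (\<lambda>x. (v (\<kappa> i) x - ?u x) + - (v (\<kappa> j) x - ?u x))" by simp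
    also have "dom_energy \<Omega> \<dots> \<le> 2 * dom_energy \<Omega> (\<lambda>x. v (\<kappa> i) x - ?u x) + 2 * dom_energy \<Omega> (\<lambda>x. - (v (\<kappa> j) x - ?u x))"
      using borel_measurable_uminus[OF meas[of "\<kappa> j"]] by (intro dom_energy_\<Omega>_add_le meas) (simp only: mult_minus_right)
    also have "\<dots> \<le> 2 * ennreal (\<delta> i) + 2 * ennreal (\<delta> i)"
      unfolding dom_energy_uminus
      using order_trans[OF dom_energy_mono[OF \<Omega>U] \<kappa>[of i]] order_trans[OF dom_energy_mono[OF \<Omega>U] \<kappa>[of j]] ennreal_leI[OF \<delta>_mono[OF ij]]
      by (intro add_mono mult_left_mono) (auto intro: order_trans)
    also have "\<dots> = ennreal (4 * \<delta> i)"
    proof -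
      have "ennreal (4 * \<delta> i) = 4 * ennreal (\<delta> i)" using ennreal_mult[of 4 "\<delta> i"] \<delta>(1)[of i] by simp
      then show ?thesis by (simp add: distrib_right[symmetric])
    qed
    finally have "energy \<mu> q (\<lambda>x. F i x - F j x) \<le> ennreal Ct * ennreal (4 * \<delta> i)" by (simp add: mult_left_mono)
    also have "\<dots> = ennreal (Ct * (4 * \<delta> i))" using Ct(1) \<delta>(1)[of i] by (simp add: ennreal_mult)
    also have "\<dots> \<le> ennreal ((1/4) ^ i)" by (rule ennreal_leI[OF \<delta>(2)])
    finally show ?thesis .
  qed
  obtain f where f: "f \<in> borel_measurable borel" "\<And>i. energy \<mu> q (\<lambda>x. F i x - f x) \<le> ennreal ((1/4) ^ i)"
    using energy_complete[OF sets_bdry_measure fm.sigma_finite_measure_axioms F fast] by blast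
  have pow: "(\<lambda>i. ennreal ((1/4) ^ i)) \<longlonglongrightarrow> 0"
    using tendsto_ennrealI[OF LIMSEQ_power_zero[of "1/4::real"]] by simp
  have "is_trace_on \<Omega> U s ?u f"
    unfolding is_trace_on_def
  proof (intro conjI exI[of _ "\<lambda>i. v (\<kappa> i)"] allI)
    show "f \<in> borel_measurable (surface_measure \<Omega>)" by (rule borel_measurable_surface_measure[OF f(1)])
    show "continuous_on U (v (\<kappa> i))" "(\<lambda>x. v (\<kappa> i) x - ?u x) \<in> dom_H U s" for i by (rule vc, rule v(2))
    have "(\<lambda>i. dom_energy U (\<lambda>x. v (\<kappa> i) x - ?u x)) \<longlonglongrightarrow> 0"
    proof (rule tendsto_sandwich[OF _ _ tendsto_const pow])
      show "\<forall>\<^sub>F i in sequentially. dom_energy U (\<lambda>x. v (\<kappa> i) x - ?u x) \<le> ennreal ((1/4) ^ i)"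
      proof (rule always_eventually, rule allI)
        fix i
        have "\<delta> i \<le> (1/4) ^ i / 1" unfolding \<delta>_def using Ct(1) by (intro divide_left_mono) auto
        then show "dom_energy U (\<lambda>x. v (\<kappa> i) x - ?u x) \<le> ennreal ((1/4) ^ i)"
          using \<kappa>[of i] by (auto intro: order_trans ennreal_leI)
      qed
    qed simp
    then have "(\<lambda>i. enn2real (dom_energy U (\<lambda>x. v (\<kappa> i) x - ?u x))) \<longlonglongrightarrow> 0" by (intro tendsto_enn2real) auto
    then have "(\<lambda>i. sqrt (enn2real (dom_energy U (\<lambda>x. v (\<kappa> i) x - ?u x)))) \<longlonglongrightarrow> sqrt 0" by (rule tendsto_real_sqrt)
    then show "(\<lambda>i. dom_H_norm U s (\<lambda>x. v (\<kappa> i) x - ?u x)) \<longlonglongrightarrow> 0"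
      using dom_H_norm_energy(2)[OF v(2)] by simp
    show "(\<lambda>i. \<integral>\<^sup>+ P. ennreal ((v (\<kappa> i) P - f P)\<^sup>2) \<partial>surface_measure \<Omega>) \<longlonglongrightarrow> 0"
    proof (rule tendsto_sandwich[OF _ _ tendsto_const pow])
      show "\<forall>\<^sub>F i in sequentially. (\<integral>\<^sup>+ P. ennreal ((v (\<kappa> i) P - f P)\<^sup>2) \<partial>surface_measure \<Omega>) \<le> ennreal ((1/4) ^ i)"
      proof (rule always_eventually, rule allI)
        fix i
        have "(\<integral>\<^sup>+ P. ennreal ((v (\<kappa> i) P - f P)\<^sup>2) \<partial>surface_measure \<Omega>) = (\<integral>\<^sup>+ P. ennreal ((F i P - f P)\<^sup>2) \<partial>surface_measure \<Omega>)"
          by (intro nn_integral_cong) (simp add: space_surface_measure F_def clip_eq K_closure)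
        also have "\<dots> = (\<integral>\<^sup>+ P. ennreal ((F i P - f P)\<^sup>2) \<partial>\<mu>)"
          using F[of i] f(1) by (intro nn_integral_bdry_measure[symmetric]) measurable
        also have "\<dots> \<le> energy \<mu> q (\<lambda>x. F i x - f x)" by (simp add: energy_def)
        also have "\<dots> \<le> ennreal ((1/4) ^ i)" by (rule f(2))
        finally show "(\<integral>\<^sup>+ P. ennreal ((v (\<kappa> i) P - f P)\<^sup>2) \<partial>surface_measure \<Omega>) \<le> ennreal ((1/4) ^ i)" .
      qed
    qed auto
  qed
  then show ?thesis using R(2) unfolding is_bdry_trace_def U_def by blast
qed

text \<open>Two balls occur. The fixed ball U yields the bound for the potential, the ball of the
  given trace yields approximants; they are compared only on the domain, which lies in both. This
  keeps the constant free of the second ball.\<close>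

lemma trace_bound:
  obtains C where "\<And>T g. T \<in> bdry_Hneg \<Omega> (s - 1/2) \<Longrightarrow> is_bdry_trace \<Omega> s (single_layer s T) g \<Longrightarrow>
     g \<in> bdry_H \<Omega> (s - 1/2) \<and> bdry_H_norm \<Omega> (s - 1/2) g \<le> C * bdry_Hneg_norm \<Omega> (s - 1/2) T"
proof -
  obtain R where R: "0 < R" "closure \<Omega> \<subseteq> ball 0 R" by (rule bounded_ball)
  define U where "U = ball (0::'a) R"
  have KU: "K \<subseteq> U" and \<Omega>U: "\<Omega> \<subseteq> U" using R K_closure \<Omega>_closure by (auto simp: U_def)
  have dU: "dist x P \<le> 2 * R" if "x \<in> U" "P \<in> U" for x P
    using that dist_triangle[of x P 0] by (auto simp: U_def dist_commute)
  have U_borel: "U \<in> sets borel" by (simp add: U_def)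
  have R2: "0 < 2 * R" using R(1) by simp
  obtain C where C: "C < \<infinity>" "\<And>T. T \<in> bdry_Hneg \<Omega> (s - 1/2) \<Longrightarrow>
      dom_energy U (single_layer s T) \<le> C * ennreal ((bdry_Hneg_norm \<Omega> (s - 1/2) T)\<^sup>2)"
  proof (rule single_layer_approximation[OF U_borel KU R2 dU])
    fix C assume C: "C < \<infinity>" "\<And>T. T \<in> bdry_Hneg \<Omega> (s - 1/2) \<Longrightarrow>
      dom_energy U (single_layer s T) \<le> C * ennreal ((bdry_Hneg_norm \<Omega> (s - 1/2) T)\<^sup>2)"
      "\<And>T. T \<in> bdry_Hneg \<Omega> (s - 1/2) \<Longrightarrow> \<exists>v :: nat \<Rightarrow> 'a \<Rightarrow> real.
        (\<forall>k. continuous_on UNIV (v k) \<and> (\<lambda>x. v k x - single_layer s T x) \<in> dom_H U s) \<and>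
        (\<lambda>k. dom_energy U (\<lambda>x. v k x - single_layer s T x)) \<longlonglongrightarrow> 0"
    show thesis by (rule that[OF C(1,2)])
  qed
  define Cr where "Cr = enn2real C"
  have Cr: "0 \<le> Cr" "C = ennreal Cr" using C(1) by (simp_all add: Cr_def)
  obtain Ct where Ct: "0 \<le> Ct" "\<And>v :: 'a \<Rightarrow> real. continuous_on (closure \<Omega>) v \<Longrightarrow>
     energy \<mu> q (clip v) \<le> ennreal Ct * dom_energy \<Omega> v"
    by (rule clip_trace) blast
  show thesis
  \<comment> \<open>The 2 comes from splitting an approximant into its error, which vanishes in the
    limit, and the potential.\<close>
  proof (rule that[of "sqrt (2 * Ct * Cr)"])
    fix T g assume T: "T \<in> bdry_Hneg \<Omega> (s - 1/2)" and tr: "is_bdry_trace \<Omega> s (single_layer s T) g"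
    let ?u = "single_layer s T"
    define N where "N = bdry_Hneg_norm \<Omega> (s - 1/2) T"
    have N: "0 \<le> N" unfolding N_def by (rule bdry_Hneg_bound(1)[OF T])
    obtain c' r' v where U': "closure \<Omega> \<subseteq> ball c' r'" and g: "g \<in> borel_measurable (surface_measure \<Omega>)"
      and v: "\<And>k::nat. continuous_on (ball c' r') (v k)" "\<And>k. (\<lambda>x. v k x - ?u x) \<in> dom_H (ball c' r') s"
      and lim: "(\<lambda>k. dom_H_norm (ball c' r') s (\<lambda>x. v k x - ?u x)) \<longlonglongrightarrow> 0"
      and lim2: "(\<lambda>k. \<integral>\<^sup>+ P. ennreal ((v k P - g P)\<^sup>2) \<partial>surface_measure \<Omega>) \<longlonglongrightarrow> 0"
      using tr unfolding is_bdry_trace_def is_trace_on_def by blast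
    have vc: "continuous_on (closure \<Omega>) (v k)" for k using v(1) U' by (rule continuous_on_subset)
    have \<Omega>U': "\<Omega> \<subseteq> ball c' r'" using U' \<Omega>_closure by blast
    \<comment> \<open>A trace is measurable on the frontier only; extension by zero gives a Borel
      function with the same boundary integrals.\<close>
    define g0 where "g0 x = indicator K x * g x" for x
    have g0: "g0 \<in> borel_measurable borel"
    proof -
      have "g \<in> borel_measurable (restrict_space borel K)"
        using g unfolding measurable_cong_sets[OF sets_surface_measure refl] .
      then show ?thesis
        by (subst (asm) borel_measurable_restrict_space_iff) (simp_all add: g0_def[abs_def])
    qed
    have g0_eq: "g0 P = g P" if "P \<in> K" for P using that by (simp add: g0_def)
    have near: "\<forall>i. \<exists>k. dom_energy \<Omega> (\<lambda>x. v k x - ?u x) \<le> ennreal ((1/4) ^ i) \<and> (\<integral>\<^sup>+ P. ennreal ((v k P - g P)\<^sup>2) \<partial>surface_measure \<Omega>) \<le> ennreal ((1/4) ^ i)"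
    proof
      fix i
      have "(\<lambda>k. (dom_H_norm (ball c' r') s (\<lambda>x. v k x - ?u x))\<^sup>2) \<longlonglongrightarrow> 0\<^sup>2" by (intro tendsto_power lim)
      then have "eventually (\<lambda>k. (dom_H_norm (ball c' r') s (\<lambda>x. v k x - ?u x))\<^sup>2 < (1/4) ^ i) sequentially"
        by (rule order_tendstoD) simp
      moreover have "eventually (\<lambda>k. (\<integral>\<^sup>+ P. ennreal ((v k P - g P)\<^sup>2) \<partial>surface_measure \<Omega>) < ennreal ((1/4) ^ i)) sequentially"
        by (rule order_tendstoD[OF lim2]) simp
      ultimately have "eventually (\<lambda>k. (dom_H_norm (ball c' r') s (\<lambda>x. v k x - ?u x))\<^sup>2 < (1/4) ^ i \<and>
        (\<integral>\<^sup>+ P. ennreal ((v k P - g P)\<^sup>2) \<partial>surface_measure \<Omega>) < ennreal ((1/4) ^ i)) sequentially"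
        by (rule eventually_conj)
      then obtain k where k: "(dom_H_norm (ball c' r') s (\<lambda>x. v k x - ?u x))\<^sup>2 < (1/4) ^ i"
        "(\<integral>\<^sup>+ P. ennreal ((v k P - g P)\<^sup>2) \<partial>surface_measure \<Omega>) < ennreal ((1/4) ^ i)"
        by (auto simp: eventually_sequentially)
      let ?E = "dom_energy (ball c' r') (\<lambda>x. v k x - ?u x)"
      have "enn2real ?E < (1/4) ^ i" using k(1) unfolding dom_H_norm_energy(2)[OF v(2)] by simp
      then have "?E \<le> ennreal ((1/4) ^ i)"
        using dom_H_norm_energy(1)[OF v(2)[of k]] by (cases ?E) (auto intro: ennreal_leI)
      then have "dom_energy \<Omega> (\<lambda>x. v k x - ?u x) \<le> ennreal ((1/4) ^ i)"
        by (rule order_trans[OF dom_energy_mono[OF \<Omega>U']])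
      then show "\<exists>k. dom_energy \<Omega> (\<lambda>x. v k x - ?u x) \<le> ennreal ((1/4) ^ i) \<and> (\<integral>\<^sup>+ P. ennreal ((v k P - g P)\<^sup>2) \<partial>surface_measure \<Omega>) \<le> ennreal ((1/4) ^ i)" using k(2) by (auto intro: less_imp_le)
    qed
    obtain \<kappa> where \<kappa>: "\<And>i. dom_energy \<Omega> (\<lambda>x. v (\<kappa> i) x - ?u x) \<le> ennreal ((1/4) ^ i)"
      "\<And>i. (\<integral>\<^sup>+ P. ennreal ((v (\<kappa> i) P - g P)\<^sup>2) \<partial>surface_measure \<Omega>) \<le> ennreal ((1/4) ^ i)"
      using choice[OF near] by blast
    define F where "F i = clip (v (\<kappa> i))" for i
    have F: "F i \<in> borel_measurable borel" for i unfolding F_def by (intro clip_borel vc)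
    have "AE x in \<mu>. (\<lambda>i. F i x) \<longlonglongrightarrow> g0 x"
    proof (rule AE_tendsto_of_fast)
      show "F i \<in> borel_measurable \<mu>" for i using F[of i] by (simp cong: measurable_cong_sets)
      show "g0 \<in> borel_measurable \<mu>" using g0 by (simp cong: measurable_cong_sets)
      fix i
      have "(\<integral>\<^sup>+ P. ennreal ((F i P - g0 P)\<^sup>2) \<partial>\<mu>) = (\<integral>\<^sup>+ P. ennreal ((F i P - g0 P)\<^sup>2) \<partial>surface_measure \<Omega>)"
        using F[of i] g0 by (intro nn_integral_bdry_measure) measurable
      also have "\<dots> = (\<integral>\<^sup>+ P. ennreal ((v (\<kappa> i) P - g P)\<^sup>2) \<partial>surface_measure \<Omega>)"
        by (intro nn_integral_cong) (simp add: space_surface_measure F_def clip_eq K_closure g0_eq)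
      also have "\<dots> \<le> ennreal ((1/4) ^ i)" by (rule \<kappa>(2))
      finally show "(\<integral>\<^sup>+ P. ennreal ((F i P - g0 P)\<^sup>2) \<partial>\<mu>) \<le> ennreal ((1/4) ^ i)" .
    qed
    then have fatou: "energy \<mu> q g0 \<le> liminf (\<lambda>i. energy \<mu> q (F i))"
      by (intro energy_fatou sets_bdry_measure fm.sigma_finite_measure_axioms F g0)
    have G: "dom_energy \<Omega> ?u \<le> ennreal (Cr * N\<^sup>2)"
      using order_trans[OF dom_energy_mono[OF \<Omega>U] C(2)[OF T]] unfolding N_def[symmetric] Cr(2) using Cr(1) by (simp add: ennreal_mult)
    have EF: "energy \<mu> q (F i) \<le> ennreal (Ct * (2 * (1/4) ^ i + 2 * (Cr * N\<^sup>2)))" for i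
    proof -
      have meas: "(\<lambda>x. indicator \<Omega> x * (v k x - ?u x)) \<in> borel_measurable borel" for k
        using borel_measurable_diff[OF indicator_\<Omega>_borel[OF vc] single_layer_borel[OF T]] by (simp add: right_diff_distrib)
      have "dom_energy \<Omega> (v (\<kappa> i)) = dom_energy \<Omega> (\<lambda>x. (v (\<kappa> i) x - ?u x) + ?u x)" by simp
      also have "\<dots> \<le> 2 * dom_energy \<Omega> (\<lambda>x. v (\<kappa> i) x - ?u x) + 2 * dom_energy \<Omega> ?u"
        by (intro dom_energy_\<Omega>_add_le meas single_layer_borel[OF T])
      also have "\<dots> \<le> 2 * ennreal ((1/4) ^ i) + 2 * ennreal (Cr * N\<^sup>2)" by (intro add_mono mult_left_mono \<kappa> G) auto
      also have "\<dots> = ennreal (2 * (1/4) ^ i + 2 * (Cr * N\<^sup>2))"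
      proof -
        have *: "2 * ennreal a + 2 * ennreal b = ennreal (2 * a + 2 * b)" if "0 \<le> a" "0 \<le> b" for a b
          using that by (simp add: ennreal_mult)
        show ?thesis by (rule *) (use Cr in auto)
      qed
      finally have d: "dom_energy \<Omega> (v (\<kappa> i)) \<le> ennreal (2 * (1/4) ^ i + 2 * (Cr * N\<^sup>2))" .
      have "energy \<mu> q (F i) \<le> ennreal Ct * dom_energy \<Omega> (v (\<kappa> i))" unfolding F_def by (intro Ct vc)
      also have "\<dots> \<le> ennreal Ct * ennreal (2 * (1/4) ^ i + 2 * (Cr * N\<^sup>2))" by (intro mult_left_mono d) auto
      also have "\<dots> = ennreal (Ct * (2 * (1/4) ^ i + 2 * (Cr * N\<^sup>2)))" using Ct(1) Cr(1) by (intro ennreal_mult[symmetric]) auto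
      finally show ?thesis .
    qed
    have "(\<lambda>i. Ct * (2 * (1/4) ^ i + 2 * (Cr * N\<^sup>2))) \<longlonglongrightarrow> Ct * (2 * 0 + 2 * (Cr * N\<^sup>2))"
      by (intro tendsto_intros LIMSEQ_power_zero) auto
    then have "(\<lambda>i. ennreal (Ct * (2 * (1/4) ^ i + 2 * (Cr * N\<^sup>2)))) \<longlonglongrightarrow> ennreal (2 * Ct * Cr * N\<^sup>2)"
      by (intro tendsto_ennrealI) (simp add: mult_ac)
    then have "liminf (\<lambda>i. ennreal (Ct * (2 * (1/4) ^ i + 2 * (Cr * N\<^sup>2)))) = ennreal (2 * Ct * Cr * N\<^sup>2)"
      by (intro lim_imp_Liminf) auto
    moreover have "liminf (\<lambda>i. energy \<mu> q (F i)) \<le> liminf (\<lambda>i. ennreal (Ct * (2 * (1/4) ^ i + 2 * (Cr * N\<^sup>2))))"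
      by (intro Liminf_mono always_eventually allI EF)
    ultimately have Eg: "energy \<mu> q g0 \<le> ennreal (2 * Ct * Cr * N\<^sup>2)" using fatou by simp
    have fin: "energy \<mu> q g0 < \<infinity>" using Eg by (rule le_less_trans) simp
    note H = bdry_H_norm_energy[OF g0 fin]
    have same: "bdry_L2sq \<Omega> g = bdry_L2sq \<Omega> g0" "bdry_semi \<Omega> (s - 1/2) g = bdry_semi \<Omega> (s - 1/2) g0"
      by (rule bdry_cong; simp add: g0_eq)+
    have "g \<in> bdry_H \<Omega> (s - 1/2)" using H(1) g unfolding bdry_H_def by (simp add: same)
    moreover have "bdry_H_norm \<Omega> (s - 1/2) g \<le> sqrt (2 * Ct * Cr) * N"
    proof -
      have "bdry_H_norm \<Omega> (s - 1/2) g = bdry_H_norm \<Omega> (s - 1/2) g0" by (simp add: bdry_H_norm_def same)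
      also have "\<dots> = sqrt (enn2real (energy \<mu> q g0))" by (rule H(2))
      also have "\<dots> \<le> sqrt (2 * Ct * Cr * N\<^sup>2)"
        using Eg Ct(1) Cr(1) by (intro real_sqrt_le_mono enn2real_leI) auto
      also have "\<dots> = sqrt (2 * Ct * Cr) * N" using N by (simp add: real_sqrt_mult)
      finally show ?thesis .
    qed
    ultimately show "g \<in> bdry_H \<Omega> (s - 1/2) \<and> bdry_H_norm \<Omega> (s - 1/2) g \<le> sqrt (2 * Ct * Cr) * bdry_Hneg_norm \<Omega> (s - 1/2) T"
      by (simp add: N_def)
  qed
qed

end

theorem theorem3p7:
  fixes \<Omega> :: "'a::euclidean_space set" and s :: real
  assumes "DIM('a) \<ge> 2" and "lipschitz_domain \<Omega>" and "1/2 < s" and "s < 1"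
  shows "\<exists>C. \<forall>T \<in> bdry_Hneg \<Omega> (s - 1/2).
           (\<exists>g. is_bdry_trace \<Omega> s (single_layer s T) g) \<and>
           (\<forall>g. is_bdry_trace \<Omega> s (single_layer s T) g \<longrightarrow>
                g \<in> bdry_H \<Omega> (s - 1/2) \<and>
                bdry_H_norm \<Omega> (s - 1/2) g \<le> C * bdry_Hneg_norm \<Omega> (s - 1/2) T)"
proof -
  obtain A where A: "0 \<le> A"
    "\<And>z r. 0 < r \<Longrightarrow> emeasure (bdry_measure \<Omega>) (ball z r) \<le> ennreal (A * r powr (real DIM('a) - 1))"
    by (rule bdry_measure_upper_regular[OF assms(2,1)]) blast
  obtain c where c: "0 < c" "c < 1" "\<And>P \<rho>. P \<in> frontier \<Omega> \<Longrightarrow> 0 < \<rho> \<Longrightarrow> \<rho> \<le> c \<Longrightarrow>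
     ennreal (c * \<rho> ^ DIM('a)) \<le> emeasure lborel (corkscrew \<Omega> c P \<rho>)"
    by (rule corkscrew_condition[OF assms(2)]) blast
  interpret lipschitz_trace \<Omega> s A c
    by unfold_locales (use assms A c in auto)
  obtain C where C: "\<And>T g. T \<in> bdry_Hneg \<Omega> (s - 1/2) \<Longrightarrow> is_bdry_trace \<Omega> s (single_layer s T) g \<Longrightarrow>
     g \<in> bdry_H \<Omega> (s - 1/2) \<and> bdry_H_norm \<Omega> (s - 1/2) g \<le> C * bdry_Hneg_norm \<Omega> (s - 1/2) T"
    by (rule trace_bound) blast
  show ?thesis
    using C trace_exists by (intro exI[of _ C]) blast
qed

end
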